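(* Let $Z$ and $W$ be suspensionlike chain complexes of type SWF. Then $Z$ and $W$ are chain locally equivalent if and only if $Z_{\mathrm{conn}}\cong W_{\mathrm{conn}}$ (isomorphism of $\mathcal{G}$-chain complexes).
   Context: $\mathbb{F}=\mathbb{Z}/2$; $\mathcal{G}=\mathbb{F}[s,j]/(sj=j^3s,s^2=0,j^4=1)$, $\deg s=1$, $\partial s=1+j^2$. A $\mathcal{G}$-chain complex is an $\mathbb{F}$-chain complex that is a $\mathcal{G}$-module with $\partial(az)=a\partial z+(\partial a)z$. A chain complex of type SWF (level $t$) is one isomorphic (up to grading shift) to a complex generated by $c_0,\dots,c_t$ ($\deg c_i=i$) and finitely many $x_i$, with only relations $j^2c_i=c_i$, $sc_i=0$, $jc_0=c_0$, differentials $\partial c_1=c_0$, $\partial c_i=(1+j)c_{i-1}$ ($2\le i\le t-1$), $\partial c_t$ containing $(1+j)c_{t-1}$, and the $x_i$ generating a free submodule; the submodule $R$ generated by the $c_i$ is the fixed-point set. $Z$ is suspensionlike if every nonzero homogeneous element of $R$ has degree less than every nonzero homogeneous element of $Z/R$. A subcomplex $M$ with $M\cap R=0$ is inessential if some $\mathcal{G}$-chain map $Z/M\to Z$ is a chain homotopy equivalence on fixed-point sets; $Z_{\mathrm{conn}}=Z/Z_{\mathrm{iness}}$ for $Z_{\mathrm{iness}}$ a maximal (under inclusion) inessential subcomplex (well defined up to isomorphism). Suspensions: for $V\in\{\tilde{\mathbb{R}},\mathbb{H}\}$ set $\Sigma^VZ=C_V\otimes_{\mathbb{F}}Z$ with product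 differential and $\mathcal{G}$-action $j(a\otimes b)=ja\otimes jb$, $s(a\otimes b)=sa\otimes b+j^2a\otimes sb$, where $C_{\tilde{\mathbb{R}}}$ is generated by $c_0$ (degree 0) and $c_1$ (degree 1) with $jc_0=c_0$, $j^2c_1=c_1$, $sc_0=sc_1=0$, $\partial c_1=c_0$; and $C_{\mathbb{H}}$ is generated by $r_0$ (degree 0, $jr_0=r_0$, $sr_0=0$) and $y_1,y_2,y_3$ (degree $i$, spanning a free $\mathcal{G}$-submodule) with $\partial r_0=0$, $\partial y_1=r_0$, $\partial y_2=(1+j)y_1$, $\partial y_3=sy_1+(1+j)y_2$ (these are the cellular complexes of $\tilde{\mathbb{R}}^+$ and $\mathbb{H}^+$); iterate to define $\Sigma^{N\mathbb{H}}\Sigma^{M\tilde{\mathbb{R}}}$. $Z$ and $W$ are chain locally equivalent if for some nonnegative integers $M,N$ there are $\mathcal{G}$-chain maps $\Sigma^{N\mathbb{H}}\Sigma^{M\tilde{\mathbb{R}}}Z\to\Sigma^{N\mathbb{H}}\Sigma^{M\tilde{\mathbb{R}}}W$ and $\Sigma^{N\mathbb{H}}\Sigma^{M\tilde{\mathbb{R}}}W\to\Sigma^{N\mathbb{H}}\Sigma^{M\tilde{\mathbb{R}}}Z$ which are chain homotopy equivalences on the fixed-point sets. *)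

theory Defs
  imports Main
begin

text \<open>A graded F-vector space (F = Z/2) is an abelian group of exponent 2.
  A G-chain complex is recorded by its carrier, zero, addition, the homogeneous
  subspaces of each degree, the differential gbd, the actions gs (of s) and gj
  (of j), and a distinguished subset gfix (its fixed-point set; used for
  complexes of type SWF, their quotients and their suspensions).\<close>

record 'v gcx =
  gcar :: "'v set"
  gzero :: 'v
  gadd :: "'v \<Rightarrow> 'v \<Rightarrow> 'v"
  ggrade :: "int \<Rightarrow> 'v set"
  gbd :: "'v \<Rightarrow> 'v"
  gs :: "'v \<Rightarrow> 'v"
  gj :: "'v \<Rightarrow> 'v"
  gfix :: "'v set"

definition gsum :: "('v, 'z) gcx_scheme \<Rightarrow> ('a \<Rightarrow> 'v) \<Rightarrow> 'a set \<Rightarrow> 'v" where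
  "gsum C f A = Finite_Set.fold (\<lambda>a acc. gadd C (f a) acc) (gzero C) A"

definition hdecomp :: "'v gcx \<Rightarrow> 'v set \<Rightarrow> (int \<Rightarrow> 'v) \<Rightarrow> 'v \<Rightarrow> bool" where
  "hdecomp C S h x \<longleftrightarrow> (\<forall>n. h n \<in> ggrade C n \<inter> S) \<and> finite {n. h n \<noteq> gzero C}
      \<and> x = gsum C h {n. h n \<noteq> gzero C}"

definition additive_on :: "'v gcx \<Rightarrow> 'w gcx \<Rightarrow> 'v set \<Rightarrow> ('v \<Rightarrow> 'w) \<Rightarrow> bool" where
  "additive_on A B S f \<longleftrightarrow> (\<forall>x\<in>S. \<forall>y\<in>S. f (gadd A x y) = gadd B (f x) (f y))"

definition is_gcx :: "'v gcx \<Rightarrow> bool" where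
  "is_gcx C \<longleftrightarrow>
     \<comment> \<open>F-vector space, F = Z/2\<close>
     gzero C \<in> gcar C \<and>
     (\<forall>x\<in>gcar C. \<forall>y\<in>gcar C. gadd C x y \<in> gcar C) \<and>
     (\<forall>x\<in>gcar C. \<forall>y\<in>gcar C. \<forall>z\<in>gcar C. gadd C (gadd C x y) z = gadd C x (gadd C y z)) \<and>
     (\<forall>x\<in>gcar C. \<forall>y\<in>gcar C. gadd C x y = gadd C y x) \<and>
     (\<forall>x\<in>gcar C. gadd C (gzero C) x = x) \<and>
     (\<forall>x\<in>gcar C. gadd C x x = gzero C) \<and>
     \<comment> \<open>Z-grading: direct sum of the homogeneous subspaces\<close>
     (\<forall>n. ggrade C n \<subseteq> gcar C \<and> gzero C \<in> ggrade C n \<and>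
          (\<forall>x\<in>ggrade C n. \<forall>y\<in>ggrade C n. gadd C x y \<in> ggrade C n)) \<and>
     (\<forall>x\<in>gcar C. \<exists>!h. hdecomp C (gcar C) h x) \<and>
     \<comment> \<open>linear operators of degrees -1, +1, 0\<close>
     (\<forall>x\<in>gcar C. gbd C x \<in> gcar C \<and> gs C x \<in> gcar C \<and> gj C x \<in> gcar C) \<and>
     additive_on C C (gcar C) (gbd C) \<and> additive_on C C (gcar C) (gs C) \<and>
     additive_on C C (gcar C) (gj C) \<and>
     (\<forall>n. \<forall>x\<in>ggrade C n. gbd C x \<in> ggrade C (n - 1) \<and> gs C x \<in> ggrade C (n + 1)
          \<and> gj C x \<in> ggrade C n) \<and>
     \<comment> \<open>G-module: sj = j^3 s, s^2 = 0, j^4 = 1\<close>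
     (\<forall>x\<in>gcar C. gs C (gj C x) = gj C (gj C (gj C (gs C x)))) \<and>
     (\<forall>x\<in>gcar C. gs C (gs C x) = gzero C) \<and>
     (\<forall>x\<in>gcar C. gj C (gj C (gj C (gj C x))) = x) \<and>
     \<comment> \<open>chain complex with Leibniz rule, d j = 0, d s = 1 + j^2\<close>
     (\<forall>x\<in>gcar C. gbd C (gbd C x) = gzero C) \<and>
     (\<forall>x\<in>gcar C. gbd C (gj C x) = gj C (gbd C x)) \<and>
     (\<forall>x\<in>gcar C. gbd C (gs C x) = gadd C (gs C (gbd C x)) (gadd C x (gj C (gj C x))))"

definition gchain_map :: "'v gcx \<Rightarrow> 'w gcx \<Rightarrow> ('v \<Rightarrow> 'w) \<Rightarrow> bool" where
  "gchain_map A B f \<longleftrightarrow>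
     (\<forall>x\<in>gcar A. f x \<in> gcar B) \<and> additive_on A B (gcar A) f \<and>
     (\<forall>n. \<forall>x\<in>ggrade A n. f x \<in> ggrade B n) \<and>
     (\<forall>x\<in>gcar A. f (gbd A x) = gbd B (f x) \<and> f (gs A x) = gs B (f x) \<and> f (gj A x) = gj B (f x))"

definition giso :: "'v gcx \<Rightarrow> 'w gcx \<Rightarrow> bool" where
  "giso A B \<longleftrightarrow> (\<exists>f. gchain_map A B f \<and> bij_betw f (gcar A) (gcar B))"

text \<open>f restricts to the fixed-point sets and is a chain homotopy equivalence
  (of F-chain complexes) between them.  In characteristic 2 no signs occur.\<close>
definition fix_he :: "'v gcx \<Rightarrow> 'w gcx \<Rightarrow> ('v \<Rightarrow> 'w) \<Rightarrow> bool" where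
  "fix_he A B f \<longleftrightarrow>
     (\<forall>x\<in>gfix A. f x \<in> gfix B) \<and>
     (\<exists>g h k.
        (\<forall>y\<in>gfix B. g y \<in> gfix A) \<and> additive_on B A (gfix B) g \<and>
        (\<forall>n. \<forall>y\<in>gfix B \<inter> ggrade B n. g y \<in> ggrade A n) \<and>
        (\<forall>y\<in>gfix B. g (gbd B y) = gbd A (g y)) \<and>
        (\<forall>x\<in>gfix A. h x \<in> gfix A) \<and> additive_on A A (gfix A) h \<and>
        (\<forall>n. \<forall>x\<in>gfix A \<inter> ggrade A n. h x \<in> ggrade A (n + 1)) \<and>
        (\<forall>y\<in>gfix B. k y \<in> gfix B) \<and> additive_on B B (gfix B) k \<and>
        (\<forall>n. \<forall>y\<in>gfix B \<inter> ggrade B n. k y \<in> ggrade B (n + 1)) \<and>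
        (\<forall>x\<in>gfix A. g (f x) = gadd A x (gadd A (gbd A (h x)) (h (gbd A x)))) \<and>
        (\<forall>y\<in>gfix B. f (g y) = gadd B y (gadd B (gbd B (k y)) (k (gbd B y)))))"

definition gsubcx :: "'v gcx \<Rightarrow> 'v set \<Rightarrow> bool" where
  "gsubcx C M \<longleftrightarrow> M \<subseteq> gcar C \<and> gzero C \<in> M \<and>
     (\<forall>x\<in>M. \<forall>y\<in>M. gadd C x y \<in> M) \<and>
     (\<forall>x\<in>M. gbd C x \<in> M \<and> gs C x \<in> M \<and> gj C x \<in> M) \<and>
     (\<forall>x\<in>M. \<exists>h. hdecomp C M h x)"

definition coset :: "'v gcx \<Rightarrow> 'v set \<Rightarrow> 'v \<Rightarrow> 'v set" where
  "coset C M x = {gadd C x m | m. m \<in> M}"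

definition qlift :: "'v gcx \<Rightarrow> 'v set \<Rightarrow> ('v \<Rightarrow> 'v) \<Rightarrow> 'v set \<Rightarrow> 'v set" where
  "qlift C M f X = {gadd C (f x) m | x m. x \<in> X \<and> m \<in> M}"

definition quot :: "'v gcx \<Rightarrow> 'v set \<Rightarrow> 'v set gcx" where
  "quot C M = \<lparr> gcar = coset C M ` gcar C,
                gzero = M,
                gadd = (\<lambda>X Y. {gadd C x y | x y. x \<in> X \<and> y \<in> Y}),
                ggrade = (\<lambda>n. coset C M ` ggrade C n),
                gbd = qlift C M (gbd C),
                gs = qlift C M (gs C),
                gj = qlift C M (gj C),
                gfix = coset C M ` gfix C \<rparr>"

definition swf_gen :: "'v gcx \<Rightarrow> (nat \<Rightarrow> 'v) \<Rightarrow> (nat \<Rightarrow> 'v) \<Rightarrow> (nat \<times> nat) + (nat \<times> nat \<times> nat) \<Rightarrow> 'v" where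
  "swf_gen C c x = case_sum (\<lambda>(i, e). (gj C ^^ e) (c i))
                            (\<lambda>(k, a, b). (gs C ^^ a) ((gj C ^^ b) (x k)))"

definition swf_Ic :: "nat \<Rightarrow> ((nat \<times> nat) + (nat \<times> nat \<times> nat)) set" where
  "swf_Ic t = {Inl (0, 0)} \<union> {Inl (i, e) | i e. 1 \<le> i \<and> i \<le> t \<and> e < 2}"

definition swf_Ix :: "nat \<Rightarrow> ((nat \<times> nat) + (nat \<times> nat \<times> nat)) set" where
  "swf_Ix n = {Inr (k, a, b) | k a b. k < n \<and> a < 2 \<and> b < 4}"

definition gspan :: "'v gcx \<Rightarrow> ('a \<Rightarrow> 'v) \<Rightarrow> 'a set \<Rightarrow> 'v set" where
  "gspan C g I = {gsum C g S | S. S \<subseteq> I}"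

text \<open>Z is (up to isomorphism and a grading shift sigma) generated by c_0..c_t and
  x_0..x_(n-1) subject only to the listed relations, i.e. the elements
  c_0, j^e c_i (1 <= i <= t, e < 2), s^a j^b x_k form an F-basis of Z;
  the fixed-point set gfix is the submodule R generated by the c_i (and,
  being a fixed-point set, a subcomplex).\<close>
definition is_swf :: "'v gcx \<Rightarrow> bool" where
  "is_swf Z \<longleftrightarrow> is_gcx Z \<and>
    (\<exists>(t::nat) (\<sigma>::int) (n::nat) (c::nat \<Rightarrow> 'v) (x::nat \<Rightarrow> 'v) (e::nat \<Rightarrow> int).
      let g = swf_gen Z c x; I = swf_Ic t \<union> swf_Ix n in
      (\<forall>i\<le>t. c i \<in> ggrade Z (int i + \<sigma>)) \<and>
      (\<forall>k<n. x k \<in> ggrade Z (e k)) \<and>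
      (\<forall>i\<le>t. gj Z (gj Z (c i)) = c i \<and> gs Z (c i) = gzero Z) \<and>
      gj Z (c 0) = c 0 \<and>
      \<comment> \<open>F-basis\<close>
      g ` I \<subseteq> gcar Z \<and>
      (\<forall>S\<subseteq>I. gsum Z g S = gzero Z \<longrightarrow> S = {}) \<and>
      gcar Z = gspan Z g I \<and>
      \<comment> \<open>differentials\<close>
      (1 \<le> t \<longrightarrow> gbd Z (c 1) = c 0) \<and>
      (\<forall>i. 2 \<le> i \<and> i \<le> t - 1 \<longrightarrow> gbd Z (c i) = gadd Z (c (i - 1)) (gj Z (c (i - 1)))) \<and>
      (2 \<le> t \<longrightarrow> gadd Z (gbd Z (c t)) (gadd Z (c (t - 1)) (gj Z (c (t - 1))))
                    \<in> gspan Z g (swf_Ix n)) \<and>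
      \<comment> \<open>fixed-point set\<close>
      gfix Z = gspan Z g (swf_Ic t) \<and>
      (\<forall>r\<in>gfix Z. gbd Z r \<in> gfix Z))"

definition suspensionlike :: "'v gcx \<Rightarrow> bool" where
  "suspensionlike Z \<longleftrightarrow>
     (\<forall>n m r X. r \<in> gfix Z \<inter> ggrade Z n \<and> r \<noteq> gzero Z \<and>
        X \<in> ggrade (quot Z (gfix Z)) m \<and> X \<noteq> gzero (quot Z (gfix Z)) \<longrightarrow> n < m)"

definition inessential :: "'v gcx \<Rightarrow> 'v set \<Rightarrow> bool" where
  "inessential Z M \<longleftrightarrow> gsubcx Z M \<and> M \<inter> gfix Z = {gzero Z} \<and>
     (\<exists>f. gchain_map (quot Z M) Z f \<and> fix_he (quot Z M) Z f)"

definition max_inessential :: "'v gcx \<Rightarrow> 'v set \<Rightarrow> bool" where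
  "max_inessential Z M \<longleftrightarrow> inessential Z M \<and>
     (\<forall>M'. inessential Z M' \<and> M \<subseteq> M' \<longrightarrow> M' = M)"

text \<open>A finite model complex C_V given by a basis; mdiff b, ms b, mj b are the
  sets of basis elements occurring (with coefficient 1) in d b, s b, j b.\<close>
record 'b cmodel =
  mbasis :: "'b set"
  mdeg :: "'b \<Rightarrow> int"
  mdiff :: "'b \<Rightarrow> 'b set"
  ms :: "'b \<Rightarrow> 'b set"
  mj :: "'b \<Rightarrow> 'b set"
  mfix :: "'b set"

text \<open>Basis elements: RC0 = c_0, RC1 = c_1, RJC1 = j c_1 of C_R~;
  HR0 = r_0 and HY i a b = s^a j^b y_i (a = True means one factor s) of C_H.\<close>
datatype sbasis = RC0 | RC1 | RJC1 | HR0 | HY nat bool nat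

definition C_Rt :: "sbasis cmodel" where
  "C_Rt = \<lparr> mbasis = {RC0, RC1, RJC1},
            mdeg = (\<lambda>b. if b = RC0 then 0 else 1),
            mdiff = (\<lambda>b. if b = RC1 \<or> b = RJC1 then {RC0} else {}),
            ms = (\<lambda>b. {}),
            mj = (\<lambda>b. if b = RC0 then {RC0} else if b = RC1 then {RJC1}
                      else if b = RJC1 then {RC1} else {}),
            mfix = {RC0, RC1, RJC1} \<rparr>"

text \<open>Using sj = j^3 s (so j s = s j^3) and d s = 1 + j^2:
  d(j^b y1) = r0, d(j^b y2) = j^b y1 + j^(b+1) y1,
  d(j^b y3) = s j^(3b) y1 + j^b y2 + j^(b+1) y2,
  d(s j^b y_i) = s j^b d(y_i) + j^b y_i + j^(b+2) y_i.\<close>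
fun CH_diff :: "sbasis \<Rightarrow> sbasis set" where
  "CH_diff (HY i False b) =
     (if i = 1 then {HR0}
      else if i = 2 then {HY 1 False b, HY 1 False ((b + 1) mod 4)}
      else if i = 3 then {HY 1 True ((3 * b) mod 4), HY 2 False b, HY 2 False ((b + 1) mod 4)}
      else {})"
| "CH_diff (HY i True b) =
     (if i = 1 then {HY 1 False b, HY 1 False ((b + 2) mod 4)}
      else if i = 2 then {HY 1 True b, HY 1 True ((b + 1) mod 4), HY 2 False b, HY 2 False ((b + 2) mod 4)}
      else if i = 3 then {HY 2 True b, HY 2 True ((b + 1) mod 4), HY 3 False b, HY 3 False ((b + 2) mod 4)}
      else {})"
| "CH_diff _ = {}"

fun CH_s :: "sbasis \<Rightarrow> sbasis set" where
  "CH_s (HY i False b) = {HY i True b}"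
| "CH_s _ = {}"

fun CH_j :: "sbasis \<Rightarrow> sbasis set" where
  "CH_j HR0 = {HR0}"
| "CH_j (HY i False b) = {HY i False ((b + 1) mod 4)}"
| "CH_j (HY i True b) = {HY i True ((b + 3) mod 4)}"
| "CH_j _ = {}"

fun CH_deg :: "sbasis \<Rightarrow> int" where
  "CH_deg (HY i a b) = int i + (if a then 1 else 0)"
| "CH_deg _ = 0"

definition C_H :: "sbasis cmodel" where
  "C_H = \<lparr> mbasis = {HR0} \<union> {HY i a b | i a b. 1 \<le> i \<and> i \<le> 3 \<and> b < 4},
           mdeg = CH_deg, mdiff = CH_diff, ms = CH_s, mj = CH_j,
           mfix = {HR0} \<rparr>"

text \<open>Complexes are embedded in functions on words of basis elements so that
  iterated suspensions have a fixed carrier type: an element g of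
  Sigma^V X corresponds to sum_b  b (x) (\<lambda>w. g (b # w)).\<close>
definition gembed :: "'v gcx \<Rightarrow> ('b list \<Rightarrow> 'v) gcx" where
  "gembed C = (let emb = (\<lambda>x w. if w = [] then x else gzero C) in
     \<lparr> gcar = emb ` gcar C,
       gzero = (\<lambda>_. gzero C),
       gadd = (\<lambda>g h. emb (gadd C (g []) (h []))),
       ggrade = (\<lambda>n. emb ` ggrade C n),
       gbd = (\<lambda>g. emb (gbd C (g []))),
       gs = (\<lambda>g. emb (gs C (g []))),
       gj = (\<lambda>g. emb (gj C (g []))),
       gfix = emb ` gfix C \<rparr>)"

definition scomp :: "('b list \<Rightarrow> 'v) \<Rightarrow> 'b \<Rightarrow> ('b list \<Rightarrow> 'v)" where
  "scomp g b = (\<lambda>w. g (b # w))"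

definition smk :: "'b set \<Rightarrow> ('b list \<Rightarrow> 'v) gcx \<Rightarrow> ('b \<Rightarrow> 'b list \<Rightarrow> 'v) \<Rightarrow> ('b list \<Rightarrow> 'v)" where
  "smk B X f = (\<lambda>w. case w of [] \<Rightarrow> gzero X []
                            | b # w' \<Rightarrow> (if b \<in> B then f b w' else gzero X w'))"

text \<open>(T (x) 1) and (1 (x) U)\<close>
definition sT :: "'b cmodel \<Rightarrow> ('b list \<Rightarrow> 'v) gcx \<Rightarrow> ('b \<Rightarrow> 'b set) \<Rightarrow> ('b list \<Rightarrow> 'v) \<Rightarrow> ('b list \<Rightarrow> 'v)" where
  "sT Cm X T g = smk (mbasis Cm) X (\<lambda>b'. gsum X (scomp g) {b \<in> mbasis Cm. b' \<in> T b})"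

definition sU :: "'b cmodel \<Rightarrow> ('b list \<Rightarrow> 'v) gcx \<Rightarrow> (('b list \<Rightarrow> 'v) \<Rightarrow> ('b list \<Rightarrow> 'v)) \<Rightarrow> ('b list \<Rightarrow> 'v) \<Rightarrow> ('b list \<Rightarrow> 'v)" where
  "sU Cm X U g = smk (mbasis Cm) X (\<lambda>b. U (scomp g b))"

definition sadd :: "'b cmodel \<Rightarrow> ('b list \<Rightarrow> 'v) gcx \<Rightarrow> ('b list \<Rightarrow> 'v) \<Rightarrow> ('b list \<Rightarrow> 'v) \<Rightarrow> ('b list \<Rightarrow> 'v)" where
  "sadd Cm X g h = smk (mbasis Cm) X (\<lambda>b. gadd X (scomp g b) (scomp h b))"

text \<open>Sigma^V X = C_V (x) X:  d(a(x)b) = da(x)b + a(x)db,  j(a(x)b) = ja(x)jb,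
  s(a(x)b) = sa(x)b + j^2a(x)sb; fixed-point set C_V^fix (x) X^fix.\<close>
definition susp :: "'b cmodel \<Rightarrow> ('b list \<Rightarrow> 'v) gcx \<Rightarrow> ('b list \<Rightarrow> 'v) gcx" where
  "susp Cm X =
     \<lparr> gcar = {smk (mbasis Cm) X f | f. \<forall>b\<in>mbasis Cm. f b \<in> gcar X},
       gzero = smk (mbasis Cm) X (\<lambda>b. gzero X),
       gadd = sadd Cm X,
       ggrade = (\<lambda>n. {smk (mbasis Cm) X f | f. \<forall>b\<in>mbasis Cm. f b \<in> ggrade X (n - mdeg Cm b)}),
       gbd = (\<lambda>g. sadd Cm X (sT Cm X (mdiff Cm) g) (sU Cm X (gbd X) g)),
       gs = (\<lambda>g. sadd Cm X (sT Cm X (ms Cm) g)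
                    (sT Cm X (mj Cm) (sT Cm X (mj Cm) (sU Cm X (gs X) g)))),
       gj = (\<lambda>g. sT Cm X (mj Cm) (sU Cm X (gj X) g)),
       gfix = {smk (mbasis Cm) X f | f. \<forall>b\<in>mbasis Cm.
                  f b \<in> (if b \<in> mfix Cm then gfix X else {gzero X})} \<rparr>"

definition susp_MN :: "nat \<Rightarrow> nat \<Rightarrow> 'v gcx \<Rightarrow> (sbasis list \<Rightarrow> 'v) gcx" where
  "susp_MN M N Z = (susp C_H ^^ N) ((susp C_Rt ^^ M) (gembed Z))"

definition chain_loc_equiv :: "'v gcx \<Rightarrow> 'w gcx \<Rightarrow> bool" where
  "chain_loc_equiv Z W \<longleftrightarrow> (\<exists>(M::nat) (N::nat) f g.
     gchain_map (susp_MN M N Z) (susp_MN M N W) f \<and> fix_he (susp_MN M N Z) (susp_MN M N W) f \<and>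
     gchain_map (susp_MN M N W) (susp_MN M N Z) g \<and> fix_he (susp_MN M N W) (susp_MN M N Z) g)"

end

theory Submission
  imports Defs
begin

text \<open>Call a chain map local if it maps the fixed-point set injectively into the fixed-point set.
  Kernels of local self-maps are inessential, and every inessential subcomplex lies in such a kernel,
  so the maximal ones are kernels themselves.  Local maps \<open>Z \<rightarrow> W\<close> and \<open>W \<rightarrow> Z\<close> therefore
  induce injections between the finite connected complexes in both directions.  Conversely, an
  isomorphism of connected complexes yields chain maps \<open>Z \<rightarrow> W\<close> and \<open>W \<rightarrow> Z\<close>; as \<open>s\<close>
  vanishes on the fixed-point set and is injective in the lowest free degree, the two fixed-point sets
  have the same top degree and the maps are local.

  It remains to desuspend.  The inclusion of the top cell of the sphere is a quasi-isomorphism from \<open>W\<close>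
  to its suspension, and an algebraic Borsuk--Ulam argument shows that the fixed-point sets of \<open>Z\<close>
  and \<open>W\<close> occupy the same degrees and that a local map of suspensions sends the top class of one to the
  top class of the other.  As \<open>Z\<close> is free above its fixed-point set, a local map can be lifted through
  this quasi-isomorphism.  The suspension by the quaternions only satisfies the relations
  \<open>s\<^sup>2 = 0\<close>, \<open>sj\<^sup>2 = j\<^sup>2s\<close>, \<open>sjsj = jsjs\<close> and \<open>j\<^sup>4 = 1\<close>, hence the lift is
  constructed on a resolution over a larger algebra and then pushed down.\<close>

subsection \<open>Graded complexes\<close>

text \<open>The free part of \<open>Z\<close> meets the fixed-point set only through its top class:
  the boundary of a free generator that lands in degree \<open>d\<close> is a cycle of the
  fixed-point set in its top degree, hence zero or \<open>vtop\<close>. So a map prescribed on the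
  fixed-point set extends over the free generators once the two images of \<open>vtop\<close> in the
  suspended target agree up to a homotopy that respects \<open>s\<close> and \<open>j\<close>. The
  predicate \<open>nul\<close> records such a homotopy together with its first coherence, the amount
  that a resolution of the trivial module asks for. It is trivial on the bottom cell of the
  quaternionic factors, where the two classes are equal, and acyclicity below the top degree carries
  it up one factor at a time. The real factors lie entirely in the fixed-point set, and there
  equality of the top classes comes out of degrees. Equivalences on fixed-point sets are traded for
  injective maps because a fixed-point set is finite with one-dimensional homology: a self-map of it
  that does not kill \<open>vtop\<close> is bijective.\<close>

locale vsp =
  fixes C :: "'v gcx"
  assumes zero_closed [simp]: "gzero C \<in> gcar C"
    and add_closed [simp]: "x \<in> gcar C \<Longrightarrow> y \<in> gcar C \<Longrightarrow> gadd C x y \<in> gcar C"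
    and add_assoc: "x \<in> gcar C \<Longrightarrow> y \<in> gcar C \<Longrightarrow> z \<in> gcar C \<Longrightarrow>
          gadd C (gadd C x y) z = gadd C x (gadd C y z)"
    and add_commute: "x \<in> gcar C \<Longrightarrow> y \<in> gcar C \<Longrightarrow> gadd C x y = gadd C y x"
    and add_0 [simp]: "x \<in> gcar C \<Longrightarrow> gadd C (gzero C) x = x"
    and add_self [simp]: "x \<in> gcar C \<Longrightarrow> gadd C x x = gzero C"
begin

lemma add_0_right [simp]: "x \<in> gcar C \<Longrightarrow> gadd C x (gzero C) = x"
  using add_commute[of x "gzero C"] by simp

lemma add_left_commute:
  "x \<in> gcar C \<Longrightarrow> y \<in> gcar C \<Longrightarrow> z \<in> gcar C \<Longrightarrow>
     gadd C x (gadd C y z) = gadd C y (gadd C x z)"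
  by (metis add_assoc add_commute)

lemma add_self_left [simp]:
  "x \<in> gcar C \<Longrightarrow> y \<in> gcar C \<Longrightarrow> gadd C x (gadd C x y) = y"
  by (simp flip: add_assoc)

lemmas ac = add_assoc add_commute add_left_commute

lemma add_eq_zero: "x \<in> gcar C \<Longrightarrow> y \<in> gcar C \<Longrightarrow> gadd C x y = gzero C \<longleftrightarrow> x = y"
  by (metis add_self add_self_left add_0_right)

lemma gsum_infinite: "infinite A \<Longrightarrow> gsum C f A = gzero C"
  by (simp add: gsum_def)

lemma gsum_empty [simp]: "gsum C f {} = gzero C"
  by (simp add: gsum_def)

text \<open>\<open>Finite_Set.fold\<close> asks for an operation that commutes everywhere, whereas
  \<open>gadd\<close> is controlled on the carrier alone; the replacement skips any step that would
  leave the carrier.\<close>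

lemma gsum_total:
  assumes "f ` A \<subseteq> gcar C"
  shows "gsum C f A = Finite_Set.fold
    (\<lambda>a acc. if f a \<in> gcar C \<and> acc \<in> gcar C then gadd C (f a) acc else acc) (gzero C) A"
  unfolding gsum_def
  by (rule Finite_Set.fold_closed_eq[where B = "gcar C"]) (use assms in auto)

lemma gsum_insert:
  assumes "finite A" "a \<notin> A" "f a \<in> gcar C" "f ` A \<subseteq> gcar C"
  shows "gsum C f (insert a A) = gadd C (f a) (gsum C f A) \<and> gsum C f A \<in> gcar C"
proof -
  interpret comp_fun_commute_on UNIV
    "\<lambda>a acc. if f a \<in> gcar C \<and> acc \<in> gcar C then gadd C (f a) acc else acc"
    by unfold_locales (auto simp: fun_eq_iff add_left_commute)
  have mem: "Finite_Set.fold (\<lambda>a acc. if f a \<in> gcar C \<and> acc \<in> gcar C then gadd C (f a) acc else acc)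
      (gzero C) B \<in> gcar C" if "finite B" for B
    using that by (induction B) (auto simp: fold_insert)
  have "insert a A \<subseteq> UNIV" by simp
  then show ?thesis
    using assms mem[of A] by (simp add: gsum_total fold_insert)
qed

lemma gsum_closed [simp]:
  assumes "\<And>i. i \<in> A \<Longrightarrow> f i \<in> gcar C"
  shows "gsum C f A \<in> gcar C"
proof (cases "finite A")
  case True
  then show ?thesis using assms
  proof (induction A)
    case (insert a A)
    then have "f ` A \<subseteq> gcar C" by auto
    then show ?case using insert gsum_insert[of A a f] by auto
  qed simp
qed (simp add: gsum_infinite)

lemma gsum_insert' [simp]:
  assumes "finite A" "a \<notin> A" "f a \<in> gcar C" "\<And>i. i \<in> A \<Longrightarrow> f i \<in> gcar C"
  shows "gsum C f (insert a A) = gadd C (f a) (gsum C f A)"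
  using gsum_insert[of A a f] assms by auto

lemma gsum_insert_ball [simp]:
  assumes "finite A" "a \<notin> A" "f a \<in> gcar C" "\<forall>i\<in>A. f i \<in> gcar C"
  shows "gsum C f (insert a A) = gadd C (f a) (gsum C f A)"
  using assms by (intro gsum_insert') auto

lemma gsum_single [simp]: "f a \<in> gcar C \<Longrightarrow> gsum C f {a} = f a"
  by (subst gsum_insert') auto

lemma gsum_cong:
  assumes "\<And>i. i \<in> A \<Longrightarrow> f i = g i" "\<And>i. i \<in> A \<Longrightarrow> f i \<in> gcar C"
  shows "gsum C f A = gsum C g A"
proof (cases "finite A")
  case True
  then show ?thesis using assms
    by (induction A) auto
qed (simp add: gsum_infinite)

lemma gsum_Un:
  assumes "finite A" "finite B" "A \<inter> B = {}" "\<And>i. i \<in> A \<union> B \<Longrightarrow> f i \<in> gcar C"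
  shows "gsum C f (A \<union> B) = gadd C (gsum C f A) (gsum C f B)"
  using assms
proof (induction A)
  case (insert a A)
  then have "gsum C f (insert a (A \<union> B)) = gadd C (f a) (gsum C f (A \<union> B))"
    by (intro gsum_insert') auto
  then show ?case using insert by (auto simp: add_assoc)
qed simp

lemma gsum_zero: "(\<And>i. i \<in> A \<Longrightarrow> f i = gzero C) \<Longrightarrow> gsum C f A = gzero C"
proof (cases "finite A")
  case True
  assume "\<And>i. i \<in> A \<Longrightarrow> f i = gzero C"
  with True show ?thesis
    by (induction A) auto
qed (simp add: gsum_infinite)

lemma gsum_add:
  assumes "\<And>i. i \<in> A \<Longrightarrow> f i \<in> gcar C" "\<And>i. i \<in> A \<Longrightarrow> g i \<in> gcar C"
  shows "gsum C (\<lambda>i. gadd C (f i) (g i)) A = gadd C (gsum C f A) (gsum C g A)"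
proof (cases "finite A")
  case True
  then show ?thesis using assms
    by (induction A) (auto simp: ac)
qed (simp add: gsum_infinite)

lemma gsum_mono:
  assumes "finite B" "A \<subseteq> B" "\<And>i. i \<in> B - A \<Longrightarrow> f i = gzero C" "\<And>i. i \<in> A \<Longrightarrow> f i \<in> gcar C"
  shows "gsum C f B = gsum C f A"
proof -
  have fz: "f i \<in> gcar C" if "i \<in> B" for i
    using assms(3)[of i] assms(4)[of i] that by (cases "i \<in> A") auto
  have "B = A \<union> (B - A)" using assms by auto
  moreover have "gsum C f (A \<union> (B - A)) = gadd C (gsum C f A) (gsum C f (B - A))"
    by (rule gsum_Un) (use assms(3,4) rev_finite_subset[OF assms(1,2)] assms(1,2) fz in \<open>auto dest: finite_subset intro: Diff_infinite_finite\<close>)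
  ultimately have "gsum C f B = gadd C (gsum C f A) (gsum C f (B - A))" by metis
  moreover have "gsum C f (B - A) = gzero C" using assms(3) by (rule gsum_zero)
  moreover have "gsum C f A \<in> gcar C" using assms(4) by (rule gsum_closed)
  ultimately show ?thesis by simp
qed

lemma gsum_symdiff:
  assumes "finite A" "finite B" "\<And>i. i \<in> A \<union> B \<Longrightarrow> f i \<in> gcar C"
  shows "gsum C f (sym_diff A B) = gadd C (gsum C f A) (gsum C f B)"
proof -
  have 1: "gsum C f A = gadd C (gsum C f (A - B)) (gsum C f (A \<inter> B))"
    using assms by (subst gsum_Un[symmetric]) (auto intro: arg_cong[where f = "gsum C f"])
  have 2: "gsum C f B = gadd C (gsum C f (B - A)) (gsum C f (A \<inter> B))"
    using assms by (subst gsum_Un[symmetric]) (auto intro: arg_cong[where f = "gsum C f"])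
  have 3: "gsum C f (sym_diff A B) = gadd C (gsum C f (A - B)) (gsum C f (B - A))"
    using assms by (subst gsum_Un[symmetric]) auto
  have m: "gsum C f (A - B) \<in> gcar C" "gsum C f (B - A) \<in> gcar C" "gsum C f (A \<inter> B) \<in> gcar C"
    using assms by (auto intro!: gsum_closed)
  then show ?thesis by (simp add: 1 2 3 ac)
qed

lemma gsum_in:
  assumes "gzero C \<in> P" "\<And>x y. x \<in> P \<Longrightarrow> y \<in> P \<Longrightarrow> gadd C x y \<in> P" "P \<subseteq> gcar C"
    "\<And>i. i \<in> A \<Longrightarrow> f i \<in> P"
  shows "gsum C f A \<in> P"
proof (cases "finite A")
  case True
  then show ?thesis using assms(4)
  proof (induction A)
    case (insert a A)
    then have "gsum C f (insert a A) = gadd C (f a) (gsum C f A)"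
      using assms(3) by (intro gsum_insert') auto
    with insert show ?case using assms by auto
  qed (simp add: assms)
qed (simp add: gsum_infinite assms)

lemma gsum_fibres:
  assumes "finite S" "finite K" "\<And>i. i \<in> S \<Longrightarrow> d i \<in> K" "\<And>i. i \<in> S \<Longrightarrow> f i \<in> gcar C"
  shows "gsum C (\<lambda>n. gsum C f {i \<in> S. d i = n}) K = gsum C f S"
  using assms(2,3,4) assms(1)
proof (induction K arbitrary: S)
  case empty
  then have "S = {}" by auto
  then show ?case by simp
next
  case (insert a K)
  have e: "{i \<in> {i \<in> S. d i \<noteq> a}. d i = n} = {i \<in> S. d i = n}" if "n \<in> K" for n
    using that insert by auto
  have "gsum C (\<lambda>n. gsum C f {i \<in> {i \<in> S. d i \<noteq> a}. d i = n}) K = gsum C f {i \<in> S. d i \<noteq> a}"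
    by (rule insert.IH) (use insert in auto)
  then have "gsum C (\<lambda>n. gsum C f {i \<in> S. d i = n}) K = gsum C f {i \<in> S. d i \<noteq> a}"
    using e by (metis (no_types, lifting) gsum_closed gsum_cong insert.prems(2) mem_Collect_eq)
  then have "gsum C (\<lambda>n. gsum C f {i \<in> S. d i = n}) (insert a K)
      = gadd C (gsum C f {i \<in> S. d i = a}) (gsum C f {i \<in> S. d i \<noteq> a})"
    using insert by (subst gsum_insert') (auto intro!: gsum_closed)
  also have "\<dots> = gsum C f ({i \<in> S. d i = a} \<union> {i \<in> S. d i \<noteq> a})"
    using insert by (intro gsum_Un[symmetric]) auto
  also have "{i \<in> S. d i = a} \<union> {i \<in> S. d i \<noteq> a} = S" by auto
  finally show ?case .
qed

end

definition addf :: "'v gcx \<Rightarrow> 'w gcx \<Rightarrow> ('v \<Rightarrow> 'w) \<Rightarrow> bool" where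
  "addf A B f \<longleftrightarrow> (\<forall>x\<in>gcar A. f x \<in> gcar B) \<and> additive_on A B (gcar A) f"

lemma addfI:
  "(\<And>x. x \<in> gcar A \<Longrightarrow> f x \<in> gcar B) \<Longrightarrow>
   (\<And>x y. x \<in> gcar A \<Longrightarrow> y \<in> gcar A \<Longrightarrow> f (gadd A x y) = gadd B (f x) (f y)) \<Longrightarrow> addf A B f"
  by (auto simp: addf_def additive_on_def)

lemma addf_closed: "addf A B f \<Longrightarrow> x \<in> gcar A \<Longrightarrow> f x \<in> gcar B"
  by (auto simp: addf_def)

lemma addf_add:
  "addf A B f \<Longrightarrow> x \<in> gcar A \<Longrightarrow> y \<in> gcar A \<Longrightarrow> f (gadd A x y) = gadd B (f x) (f y)"
  by (auto simp: addf_def additive_on_def)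

lemma addf_zero:
  assumes "vsp A" "vsp B" "addf A B f"
  shows "f (gzero A) = gzero B"
proof -
  interpret A: vsp A by fact
  interpret B: vsp B by fact
  have "f (gzero A) = f (gadd A (gzero A) (gzero A))" by simp
  also have "\<dots> = gzero B"
    using assms(3) by (subst addf_add[of A B f]) (auto simp: addf_closed)
  finally show ?thesis .
qed

lemma addf_gsum:
  assumes "vsp A" "vsp B" "addf A B f" "\<And>i. i \<in> S \<Longrightarrow> g i \<in> gcar A"
  shows "f (gsum A g S) = gsum B (\<lambda>i. f (g i)) S"
proof -
  interpret A: vsp A by fact
  interpret B: vsp B by fact
  show ?thesis
  proof (cases "finite S")
    case True
    then show ?thesis using assms(4)
    proof (induction S)
      case empty
      then show ?case using addf_zero[OF assms(1-3)] by simp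
    next
      case (insert a S)
      have "f (gsum A g (insert a S)) = f (gadd A (g a) (gsum A g S))"
        using insert by simp
      also have "\<dots> = gadd B (f (g a)) (f (gsum A g S))"
        using insert by (intro addf_add[OF assms(3)]) auto
      finally show ?case using insert addf_closed[OF assms(3)] by simp
    qed
  qed (simp add: A.gsum_infinite B.gsum_infinite addf_zero[OF assms(1-3)])
qed

lemma addf_comp: "addf A B f \<Longrightarrow> addf B D g \<Longrightarrow> addf A D (\<lambda>x. g (f x))"
  by (auto simp: addf_def additive_on_def)

lemma addf_plus:
  assumes "vsp B" "addf A B f" "addf A B g"
  shows "addf A B (\<lambda>x. gadd B (f x) (g x))"
proof -
  interpret B: vsp B by fact
  show ?thesis
    using assms by (intro addfI) (auto simp: addf_closed addf_add B.ac)
qed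

text \<open>The relations of a complex with operators s and j that survive tensoring with the diagonal
  action \<open>s(a \<otimes> b) = sa \<otimes> b + j\<^sup>2a \<otimes> sb\<close>: the relation \<open>sj = j\<^sup>3s\<close> does not.\<close>

locale hcx = vsp C for C :: "'v gcx" +
  assumes grade_sub: "ggrade C n \<subseteq> gcar C"
    and grade_zero [simp]: "gzero C \<in> ggrade C n"
    and grade_add [simp]: "x \<in> ggrade C n \<Longrightarrow> y \<in> ggrade C n \<Longrightarrow> gadd C x y \<in> ggrade C n"
    and bd_closed [simp]: "x \<in> gcar C \<Longrightarrow> gbd C x \<in> gcar C"
    and s_closed [simp]: "x \<in> gcar C \<Longrightarrow> gs C x \<in> gcar C"
    and j_closed [simp]: "x \<in> gcar C \<Longrightarrow> gj C x \<in> gcar C"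
    and bd_add [simp]: "x \<in> gcar C \<Longrightarrow> y \<in> gcar C \<Longrightarrow> gbd C (gadd C x y) = gadd C (gbd C x) (gbd C y)"
    and s_add [simp]: "x \<in> gcar C \<Longrightarrow> y \<in> gcar C \<Longrightarrow> gs C (gadd C x y) = gadd C (gs C x) (gs C y)"
    and j_add [simp]: "x \<in> gcar C \<Longrightarrow> y \<in> gcar C \<Longrightarrow> gj C (gadd C x y) = gadd C (gj C x) (gj C y)"
    and bd_grade: "x \<in> ggrade C n \<Longrightarrow> gbd C x \<in> ggrade C (n - 1)"
    and s_grade: "x \<in> ggrade C n \<Longrightarrow> gs C x \<in> ggrade C (n + 1)"
    and j_grade [simp]: "x \<in> ggrade C n \<Longrightarrow> gj C x \<in> ggrade C n"
    and s_s [simp]: "x \<in> gcar C \<Longrightarrow> gs C (gs C x) = gzero C"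
    and s_j_j: "x \<in> gcar C \<Longrightarrow> gs C (gj C (gj C x)) = gj C (gj C (gs C x))"
    and s_j_s_j: "x \<in> gcar C \<Longrightarrow> gs C (gj C (gs C (gj C x))) = gj C (gs C (gj C (gs C x)))"
    and bd_bd [simp]: "x \<in> gcar C \<Longrightarrow> gbd C (gbd C x) = gzero C"
    and bd_j: "x \<in> gcar C \<Longrightarrow> gbd C (gj C x) = gj C (gbd C x)"
    and bd_s: "x \<in> gcar C \<Longrightarrow> gbd C (gs C x) = gadd C (gs C (gbd C x)) (gadd C x (gj C (gj C x)))"
begin

lemma grade_car [simp, dest]: "x \<in> ggrade C n \<Longrightarrow> x \<in> gcar C"
  using grade_sub by auto

lemma addf_bd: "addf C C (gbd C)" and addf_s: "addf C C (gs C)" and addf_j: "addf C C (gj C)"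
  by (auto intro!: addfI)

lemma bd_zero [simp]: "gbd C (gzero C) = gzero C"
  and s_zero [simp]: "gs C (gzero C) = gzero C"
  and j_zero [simp]: "gj C (gzero C) = gzero C"
  using addf_zero[OF vsp_axioms vsp_axioms] addf_bd addf_s addf_j by auto

lemma bd_grade' [simp]: "x \<in> ggrade C n \<Longrightarrow> m = n - 1 \<Longrightarrow> gbd C x \<in> ggrade C m"
  using bd_grade by blast

lemma s_grade' [simp]: "x \<in> ggrade C n \<Longrightarrow> m = n + 1 \<Longrightarrow> gs C x \<in> ggrade C m"
  using s_grade by blast

lemma grade_gsum: "(\<And>i. i \<in> A \<Longrightarrow> f i \<in> ggrade C n) \<Longrightarrow> gsum C f A \<in> ggrade C n"
  by (rule gsum_in) (auto simp: grade_sub)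

end

text \<open>Kept apart from \<open>hcx\<close> because in the resolution \<open>Vc\<close> below the
  operator \<open>j\<close> has infinite order.\<close>

locale hcx4 = hcx C for C :: "'v gcx" +
  assumes j4 [simp]: "x \<in> gcar C \<Longrightarrow> gj C (gj C (gj C (gj C x))) = x"

definition hmap :: "'v gcx \<Rightarrow> 'w gcx \<Rightarrow> int \<Rightarrow> ('v \<Rightarrow> 'w) \<Rightarrow> bool" where
  "hmap A B D f \<longleftrightarrow> addf A B f \<and> (\<forall>n. \<forall>x\<in>ggrade A n. f x \<in> ggrade B (n + D)) \<and>
     (\<forall>x\<in>gcar A. f (gs A x) = gs B (f x) \<and> f (gj A x) = gj B (f x))"

definition hchain :: "'v gcx \<Rightarrow> 'w gcx \<Rightarrow> int \<Rightarrow> ('v \<Rightarrow> 'w) \<Rightarrow> bool" where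
  "hchain A B D f \<longleftrightarrow> hmap A B D f \<and> (\<forall>x\<in>gcar A. f (gbd A x) = gbd B (f x))"

lemma hmapD:
  assumes "hmap A B D f"
  shows "addf A B f" "x \<in> gcar A \<Longrightarrow> f x \<in> gcar B" "x \<in> ggrade A n \<Longrightarrow> f x \<in> ggrade B (n + D)"
    "x \<in> gcar A \<Longrightarrow> f (gs A x) = gs B (f x)" "x \<in> gcar A \<Longrightarrow> f (gj A x) = gj B (f x)"
    "x \<in> gcar A \<Longrightarrow> y \<in> gcar A \<Longrightarrow> f (gadd A x y) = gadd B (f x) (f y)"
  using assms by (auto simp: hmap_def addf_def additive_on_def)

lemma hchainD:
  assumes "hchain A B D f"
  shows "hmap A B D f" "x \<in> gcar A \<Longrightarrow> f (gbd A x) = gbd B (f x)"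
  using assms by (auto simp: hchain_def)

lemma hchain_simps:
  assumes "hchain A B D f"
  shows "x \<in> gcar A \<Longrightarrow> f x \<in> gcar B"
    "x \<in> gcar A \<Longrightarrow> f (gs A x) = gs B (f x)" "x \<in> gcar A \<Longrightarrow> f (gj A x) = gj B (f x)"
    "x \<in> gcar A \<Longrightarrow> y \<in> gcar A \<Longrightarrow> f (gadd A x y) = gadd B (f x) (f y)"
    "x \<in> gcar A \<Longrightarrow> f (gbd A x) = gbd B (f x)"
  using hmapD[OF hchainD(1)[OF assms]] hchainD(2)[OF assms] by auto

lemma hchain_comp:
  "hchain A B D f \<Longrightarrow> hchain B E D' g \<Longrightarrow> hchain A E (D + D') (\<lambda>x. g (f x))"
  unfolding hchain_def hmap_def addf_def additive_on_def
  by (auto simp: add.assoc[symmetric])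

lemma gchain_map_iff: "gchain_map A B f \<longleftrightarrow> hchain A B 0 f"
  by (auto simp: gchain_map_def hchain_def hmap_def addf_def)

text \<open>Here \<open>sjs = j^3 s^2 = 0\<close>, so both sides of \<open>sjsj = jsjs\<close>
  vanish; in a tensor product with diagonal action they need not.\<close>

lemma is_gcx_hcx4:
  assumes "is_gcx C" shows "hcx4 C"
proof -
  note a = assms[unfolded is_gcx_def additive_on_def]
  have v: "vsp C" by unfold_locales (use a in auto)
  interpret vsp C by fact
  have s0: "gs C (gzero C) = gzero C" "gj C (gzero C) = gzero C"
    by (rule addf_zero[OF v v], rule addfI, use a in auto)+
  have jjs: "gs C (gj C (gj C x)) = gj C (gj C (gs C x))" if "x \<in> gcar C" for x
  proof -
    have "gs C (gj C (gj C x)) = gj C (gj C (gj C (gs C (gj C x))))" using a that by simp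
    also have "\<dots> = gj C (gj C (gj C (gj C (gj C (gj C (gs C x))))))" using a that by simp
    also have "\<dots> = gj C (gj C (gs C x))" using a that by simp
    finally show ?thesis .
  qed
  have sjs: "gs C (gj C (gs C x)) = gzero C" if "x \<in> gcar C" for x
  proof -
    have "gs C (gj C (gs C x)) = gj C (gj C (gj C (gs C (gs C x))))" using a that by simp
    also have "\<dots> = gzero C" using a that s0 by simp
    finally show ?thesis .
  qed
  show ?thesis
    by unfold_locales (use a jjs sjs s0 in auto)
qed

subsection \<open>Suspensions\<close>

locale cmod =
  fixes Cm :: "'b cmodel"
  assumes fin [simp]: "finite (mbasis Cm)"
    and mdiff_sub: "b \<in> mbasis Cm \<Longrightarrow> mdiff Cm b \<subseteq> mbasis Cm"
    and ms_sub: "b \<in> mbasis Cm \<Longrightarrow> ms Cm b \<subseteq> mbasis Cm"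
    and mj_sub: "b \<in> mbasis Cm \<Longrightarrow> mj Cm b \<subseteq> mbasis Cm"

text \<open>The elementary tensor \<open>b \<otimes> x\<close>.\<close>

definition tn :: "'b cmodel \<Rightarrow> ('b list \<Rightarrow> 'v) gcx \<Rightarrow> 'b \<Rightarrow> ('b list \<Rightarrow> 'v) \<Rightarrow> ('b list \<Rightarrow> 'v)" where
  "tn Cm X b x = smk (mbasis Cm) X (\<lambda>b'. if b' = b then x else gzero X)"

locale suspc = cmod Cm + X: hcx X for Cm :: "'b cmodel" and X :: "('b list \<Rightarrow> 'v) gcx"
begin

abbreviation "B \<equiv> mbasis Cm"
abbreviation "S \<equiv> susp Cm X"

lemma scomp_smk [simp]: "b \<in> B \<Longrightarrow> scomp (smk B X f) b = f b"
  by (auto simp: scomp_def smk_def fun_eq_iff)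

lemma smk_cong: "(\<And>b. b \<in> B \<Longrightarrow> f b = g b) \<Longrightarrow> smk B X f = smk B X g"
  by (auto simp: smk_def fun_eq_iff split: list.splits)

lemma smk_eq: "smk B X f = smk B X g \<longleftrightarrow> (\<forall>b\<in>B. f b = g b)"
  by (metis scomp_smk smk_cong)

lemma S_sel:
  "gcar S = {smk B X f | f. \<forall>b\<in>B. f b \<in> gcar X}"
  "gzero S = smk B X (\<lambda>b. gzero X)"
  "gadd S = sadd Cm X"
  "ggrade S n = {smk B X f | f. \<forall>b\<in>B. f b \<in> ggrade X (n - mdeg Cm b)}"
  "gbd S g = sadd Cm X (sT Cm X (mdiff Cm) g) (sU Cm X (gbd X) g)"
  "gs S g = sadd Cm X (sT Cm X (ms Cm) g) (sT Cm X (mj Cm) (sT Cm X (mj Cm) (sU Cm X (gs X) g)))"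
  "gj S g = sT Cm X (mj Cm) (sU Cm X (gj X) g)"
  "gfix S = {smk B X f | f. \<forall>b\<in>B. f b \<in> (if b \<in> mfix Cm then gfix X else {gzero X})}"
  by (simp_all add: susp_def)

lemma smk_car: "smk B X f \<in> gcar S \<longleftrightarrow> (\<forall>b\<in>B. f b \<in> gcar X)"
  unfolding S_sel by (auto simp: smk_eq)

lemma smk_scomp: "g \<in> gcar S \<Longrightarrow> smk B X (scomp g) = g"
  unfolding S_sel by (auto intro: smk_cong)

lemma scomp_car: "g \<in> gcar S \<Longrightarrow> b \<in> B \<Longrightarrow> scomp g b \<in> gcar X"
  unfolding S_sel by auto

lemma S_eqI: "g \<in> gcar S \<Longrightarrow> h \<in> gcar S \<Longrightarrow> (\<And>b. b \<in> B \<Longrightarrow> scomp g b = scomp h b) \<Longrightarrow> g = h"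
  by (metis smk_scomp smk_cong)

lemma add_smk: "gadd S (smk B X f) (smk B X g) = smk B X (\<lambda>b. gadd X (f b) (g b))"
  unfolding S_sel sadd_def by (rule smk_cong) simp

lemma vsp_S: "vsp S"
proof
  fix x y z
  assume "x \<in> gcar S" "y \<in> gcar S" "z \<in> gcar S"
  then obtain f g h where fgh: "x = smk B X f" "y = smk B X g" "z = smk B X h"
    "\<forall>b\<in>B. f b \<in> gcar X" "\<forall>b\<in>B. g b \<in> gcar X" "\<forall>b\<in>B. h b \<in> gcar X"
    unfolding S_sel by blast
  show "gadd S (gadd S x y) z = gadd S x (gadd S y z)"
    using fgh by (simp add: add_smk smk_eq X.ac)
next
  show "gzero S \<in> gcar S" by (auto simp: S_sel)
next
  fix x y
  assume "x \<in> gcar S" "y \<in> gcar S"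
  then obtain f g where fg: "x = smk B X f" "y = smk B X g"
    "\<forall>b\<in>B. f b \<in> gcar X" "\<forall>b\<in>B. g b \<in> gcar X"
    unfolding S_sel by blast
  show "gadd S x y \<in> gcar S"
    using fg by (simp add: add_smk smk_car)
  show "gadd S x y = gadd S y x"
    using fg by (simp add: add_smk smk_eq X.ac)
  show "gadd S (gzero S) x = x"
    using fg by (simp add: add_smk smk_eq S_sel(2))
  show "gadd S x x = gzero S"
    using fg by (simp add: add_smk smk_eq S_sel(2))
qed

end

sublocale suspc \<subseteq> S: vsp "susp Cm X"
  by (rule vsp_S)

context suspc
begin

lemma addf_scomp: "b \<in> B \<Longrightarrow> addf S X (\<lambda>g. scomp g b)"
  by (rule addfI) (auto simp: S_sel(1) add_smk)

lemma tn_car [simp]: "b \<in> B \<Longrightarrow> x \<in> gcar X \<Longrightarrow> tn Cm X b x \<in> gcar S"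
  by (simp add: tn_def smk_car)

lemma scomp_tn: "c \<in> B \<Longrightarrow> scomp (tn Cm X b x) c = (if c = b then x else gzero X)"
  by (simp add: tn_def)

lemma tn_add: "b \<in> B \<Longrightarrow> x \<in> gcar X \<Longrightarrow> y \<in> gcar X \<Longrightarrow>
    tn Cm X b (gadd X x y) = gadd S (tn Cm X b x) (tn Cm X b y)"
  by (simp add: tn_def add_smk smk_eq)

lemma tn_zero [simp]: "tn Cm X b (gzero X) = gzero S"
  by (simp add: tn_def S_sel(2) smk_eq)

lemma tn_inj: "b \<in> B \<Longrightarrow> tn Cm X b x = tn Cm X b y \<longleftrightarrow> x = y"
  by (auto simp: tn_def smk_eq)

lemma addf_tn: "b \<in> B \<Longrightarrow> addf X S (tn Cm X b)"
  by (rule addfI) (auto simp: tn_add)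

lemma tn_grade [simp]: "b \<in> B \<Longrightarrow> x \<in> ggrade X m \<Longrightarrow> n = m + mdeg Cm b \<Longrightarrow> tn Cm X b x \<in> ggrade S n"
  unfolding S_sel tn_def by force

lemma scomp_grade: "g \<in> ggrade S n \<Longrightarrow> b \<in> B \<Longrightarrow> scomp g b \<in> ggrade X (n - mdeg Cm b)"
  unfolding S_sel by auto

lemma grade_S_sub: "ggrade S n \<subseteq> gcar S"
  unfolding S_sel using X.grade_sub by blast

lemma grade_S_zero: "gzero S \<in> ggrade S n"
  unfolding S_sel using X.grade_zero by blast

lemma grade_S_add: "x \<in> ggrade S n \<Longrightarrow> y \<in> ggrade S n \<Longrightarrow> gadd S x y \<in> ggrade S n"
proof -
  assume "x \<in> ggrade S n" "y \<in> ggrade S n"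
  then obtain f g where fg: "x = smk B X f" "y = smk B X g"
    "\<forall>b\<in>B. f b \<in> ggrade X (n - mdeg Cm b)" "\<forall>b\<in>B. g b \<in> ggrade X (n - mdeg Cm b)"
    unfolding S_sel by blast
  then show ?thesis
    by (auto simp: add_smk) (auto simp: S_sel)
qed

lemma expand: "g \<in> gcar S \<Longrightarrow> g = gsum S (\<lambda>b. tn Cm X b (scomp g b)) B"
proof (rule S_eqI)
  assume g: "g \<in> gcar S"
  then show "gsum S (\<lambda>b. tn Cm X b (scomp g b)) B \<in> gcar S"
    by (auto intro!: S.gsum_closed simp: scomp_car)
  fix c assume c: "c \<in> B"
  have "scomp (gsum S (\<lambda>b. tn Cm X b (scomp g b)) B) c
      = gsum X (\<lambda>b. scomp (tn Cm X b (scomp g b)) c) B"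
    by (rule addf_gsum[OF vsp_S X.vsp_axioms addf_scomp[OF c]]) (use g in \<open>auto simp: scomp_car\<close>)
  also have "\<dots> = gsum X (\<lambda>b. scomp (tn Cm X b (scomp g b)) c) {c}"
    by (rule X.gsum_mono) (use g c in \<open>auto simp: scomp_tn scomp_car\<close>)
  also have "\<dots> = scomp g c"
    using g c by (simp add: scomp_tn scomp_car)
  finally show "scomp g c = scomp (gsum S (\<lambda>b. tn Cm X b (scomp g b)) B) c" ..
qed

lemma S_induct [consumes 1, case_names zero tn add]:
  assumes "g \<in> gcar S" "P (gzero S)" "\<And>b x. b \<in> B \<Longrightarrow> x \<in> gcar X \<Longrightarrow> P (tn Cm X b x)"
    "\<And>x y. x \<in> gcar S \<Longrightarrow> y \<in> gcar S \<Longrightarrow> P x \<Longrightarrow> P y \<Longrightarrow> P (gadd S x y)"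
  shows "P g"
proof -
  have "gsum S (\<lambda>b. tn Cm X b (scomp g b)) B \<in> {x \<in> gcar S. P x}"
    by (rule S.gsum_in) (use assms(2-4) scomp_car[OF assms(1)] in auto)
  then show ?thesis by (subst expand[OF assms(1)]) auto
qed

lemma S_grade_induct [consumes 1, case_names zero tn add]:
  assumes "g \<in> ggrade S n" "P (gzero S)"
    "\<And>b x. b \<in> B \<Longrightarrow> x \<in> ggrade X (n - mdeg Cm b) \<Longrightarrow> P (tn Cm X b x)"
    "\<And>x y. x \<in> gcar S \<Longrightarrow> y \<in> gcar S \<Longrightarrow> P x \<Longrightarrow> P y \<Longrightarrow> P (gadd S x y)"
  shows "P g"
proof -
  have "gsum S (\<lambda>b. tn Cm X b (scomp g b)) B \<in> {x \<in> gcar S. P x}"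
    by (rule S.gsum_in) (use assms(2-4) scomp_grade[OF assms(1)] X.grade_car[OF scomp_grade[OF assms(1)]] in auto)
  moreover have "g \<in> gcar S" using assms(1) grade_S_sub by auto
  ultimately show ?thesis by (subst expand) auto
qed

lemma sT_smk:
  assumes "\<forall>b\<in>B. f b \<in> gcar X"
  shows "sT Cm X T (smk B X f) = smk B X (\<lambda>b'. gsum X f {b \<in> B. b' \<in> T b})"
  unfolding sT_def by (rule smk_cong, rule X.gsum_cong) (use assms in auto)

lemma sU_smk: "sU Cm X U (smk B X f) = smk B X (\<lambda>b. U (f b))"
  unfolding sU_def by (rule smk_cong) simp

lemma addf_sT: "addf S S (sT Cm X T)"
proof (rule addfI)
  fix x y
  assume "x \<in> gcar S" "y \<in> gcar S"
  then obtain f g where fg: "x = smk B X f" "y = smk B X g"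
    "\<forall>b\<in>B. f b \<in> gcar X" "\<forall>b\<in>B. g b \<in> gcar X"
    unfolding S_sel by blast
  show "sT Cm X T x \<in> gcar S"
    using fg by (auto simp: sT_smk smk_car intro!: X.gsum_closed)
  show "sT Cm X T (gadd S x y) = gadd S (sT Cm X T x) (sT Cm X T y)"
    using fg by (auto simp: sT_smk add_smk smk_eq intro!: X.gsum_add)
qed

lemma addf_sU:
  assumes "addf X X U"
  shows "addf S S (sU Cm X U)"
proof (rule addfI)
  fix x y
  assume "x \<in> gcar S" "y \<in> gcar S"
  then obtain f g where fg: "x = smk B X f" "y = smk B X g"
    "\<forall>b\<in>B. f b \<in> gcar X" "\<forall>b\<in>B. g b \<in> gcar X"
    unfolding S_sel by blast
  show "sU Cm X U x \<in> gcar S"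
    using fg assms by (auto simp: sU_smk smk_car addf_closed)
  show "sU Cm X U (gadd S x y) = gadd S (sU Cm X U x) (sU Cm X U y)"
    using fg assms by (auto simp: sU_smk add_smk smk_eq addf_add)
qed

lemma sT_tn:
  assumes b: "b \<in> B" and x: "x \<in> gcar X" and T: "T b \<subseteq> B"
  shows "sT Cm X T (tn Cm X b x) = gsum S (\<lambda>b'. tn Cm X b' x) (T b)"
proof (rule S_eqI)
  have fT: "finite (T b)" using T fin finite_subset by blast
  show "sT Cm X T (tn Cm X b x) \<in> gcar S"
    using addf_closed[OF addf_sT] b x by simp
  show "gsum S (\<lambda>b'. tn Cm X b' x) (T b) \<in> gcar S"
    by (rule S.gsum_closed) (use T x in auto)
  fix c assume c: "c \<in> B"
  have "scomp (sT Cm X T (tn Cm X b x)) c = gsum X (\<lambda>b'. if b' = b then x else gzero X) {a \<in> B. c \<in> T a}"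
    using x c unfolding tn_def by (subst sT_smk) auto
  also have "\<dots> = gsum X (\<lambda>b'. if b' = b then x else gzero X) (if c \<in> T b then {b} else {})"
    by (rule X.gsum_mono) (use b x in auto)
  also have "\<dots> = (if c \<in> T b then x else gzero X)"
    using x by auto
  also have "\<dots> = gsum X (\<lambda>b'. if c = b' then x else gzero X) (if c \<in> T b then {c} else {})"
    using x by auto
  also have "\<dots> = gsum X (\<lambda>b'. if c = b' then x else gzero X) (T b)"
    by (rule X.gsum_mono[symmetric]) (use x fT in auto)
  also have "\<dots> = gsum X (\<lambda>b'. scomp (tn Cm X b' x) c) (T b)"
    using c by (simp add: scomp_tn)
  also have "\<dots> = scomp (gsum S (\<lambda>b'. tn Cm X b' x) (T b)) c"
    by (rule addf_gsum[OF vsp_S X.vsp_axioms addf_scomp[OF c], symmetric]) (use T x in auto)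
  finally show "scomp (sT Cm X T (tn Cm X b x)) c = scomp (gsum S (\<lambda>b'. tn Cm X b' x) (T b)) c" .
qed

lemma sU_tn: "b \<in> B \<Longrightarrow> U (gzero X) = gzero X \<Longrightarrow> sU Cm X U (tn Cm X b x) = tn Cm X b (U x)"
  unfolding tn_def by (subst sU_smk, rule smk_cong) auto

lemma addf_ops: "addf S S (gbd S)" "addf S S (gs S)" "addf S S (gj S)"
proof -
  have p: "addf S S (\<lambda>g. sadd Cm X (f g) (h g))" if "addf S S f" "addf S S h" for f h
    using addf_plus[OF vsp_S that] by (simp add: S_sel(3))
  have "addf S S (\<lambda>g. gbd S g)"
    unfolding S_sel(5) by (rule p[OF addf_sT addf_sU[OF X.addf_bd]])
  then show "addf S S (gbd S)" by simp
  have "addf S S (\<lambda>g. gs S g)"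
    unfolding S_sel(6)
    by (rule p[OF addf_sT addf_comp[OF addf_comp[OF addf_sU[OF X.addf_s] addf_sT] addf_sT]])
  then show "addf S S (gs S)" by simp
  have "addf S S (\<lambda>g. gj S g)"
    unfolding S_sel(7) by (rule addf_comp[OF addf_sU[OF X.addf_j] addf_sT])
  then show "addf S S (gj S)" by simp
qed

lemma ops_closed [simp]:
  "x \<in> gcar S \<Longrightarrow> gbd S x \<in> gcar S" "x \<in> gcar S \<Longrightarrow> gs S x \<in> gcar S" "x \<in> gcar S \<Longrightarrow> gj S x \<in> gcar S"
  using addf_closed[OF addf_ops(1)] addf_closed[OF addf_ops(2)] addf_closed[OF addf_ops(3)] by auto

lemma ops_add [simp]:
  "x \<in> gcar S \<Longrightarrow> y \<in> gcar S \<Longrightarrow> gbd S (gadd S x y) = gadd S (gbd S x) (gbd S y)"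
  "x \<in> gcar S \<Longrightarrow> y \<in> gcar S \<Longrightarrow> gs S (gadd S x y) = gadd S (gs S x) (gs S y)"
  "x \<in> gcar S \<Longrightarrow> y \<in> gcar S \<Longrightarrow> gj S (gadd S x y) = gadd S (gj S x) (gj S y)"
  using addf_add[OF addf_ops(1)] addf_add[OF addf_ops(2)] addf_add[OF addf_ops(3)] by auto

lemma ops_zero [simp]:
  "gbd S (gzero S) = gzero S" "gs S (gzero S) = gzero S" "gj S (gzero S) = gzero S"
  using addf_zero[OF vsp_S vsp_S addf_ops(1)] addf_zero[OF vsp_S vsp_S addf_ops(2)]
    addf_zero[OF vsp_S vsp_S addf_ops(3)] by auto

lemma bd_tn:
  assumes "b \<in> B" "x \<in> gcar X"
  shows "gbd S (tn Cm X b x) = gadd S (gsum S (\<lambda>b'. tn Cm X b' x) (mdiff Cm b)) (tn Cm X b (gbd X x))"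
  using assms mdiff_sub by (simp add: S_sel(5) sT_tn sU_tn flip: S_sel(3))

lemma j_tn:
  assumes "b \<in> B" "x \<in> gcar X"
  shows "gj S (tn Cm X b x) = gsum S (\<lambda>b'. tn Cm X b' (gj X x)) (mj Cm b)"
  using assms mj_sub by (simp add: S_sel(7) sT_tn sU_tn flip: S_sel(3))

lemma s_tn:
  assumes "b \<in> B" "x \<in> gcar X"
  shows "gs S (tn Cm X b x) = gadd S (gsum S (\<lambda>b'. tn Cm X b' x) (ms Cm b))
     (gsum S (\<lambda>c. gsum S (\<lambda>b'. tn Cm X b' (gs X x)) (mj Cm c)) (mj Cm b))"
proof -
  have "sT Cm X (mj Cm) (gsum S (\<lambda>b'. tn Cm X b' (gs X x)) (mj Cm b))
      = gsum S (\<lambda>c. sT Cm X (mj Cm) (tn Cm X c (gs X x))) (mj Cm b)"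
    by (rule addf_gsum[OF vsp_S vsp_S addf_sT]) (use assms mj_sub[OF assms(1)] in auto)
  also have "\<dots> = gsum S (\<lambda>c. gsum S (\<lambda>b'. tn Cm X b' (gs X x)) (mj Cm c)) (mj Cm b)"
  proof (rule S.gsum_cong)
    fix c assume "c \<in> mj Cm b"
    then have c: "c \<in> B" using assms mj_sub by auto
    then show *: "sT Cm X (mj Cm) (tn Cm X c (gs X x)) = gsum S (\<lambda>b'. tn Cm X b' (gs X x)) (mj Cm c)"
      using assms mj_sub by (simp add: sT_tn)
    show "sT Cm X (mj Cm) (tn Cm X c (gs X x)) \<in> gcar S"
      using c assms addf_closed[OF addf_sT] by simp
  qed
  finally show ?thesis
    using assms ms_sub mj_sub by (simp add: S_sel(6) sT_tn sU_tn flip: S_sel(3))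
qed

text \<open>The operators are additive and elementary tensors generate, so every relation is reduced
  to a test on \<open>b \<otimes> x\<close>, left to the particular model.\<close>

lemma hcx_S:
  assumes d: "\<And>b c. b \<in> B \<Longrightarrow> c \<in> mdiff Cm b \<Longrightarrow> mdeg Cm c = mdeg Cm b - 1"
    "\<And>b c. b \<in> B \<Longrightarrow> c \<in> ms Cm b \<Longrightarrow> mdeg Cm c = mdeg Cm b + 1"
    "\<And>b c. b \<in> B \<Longrightarrow> c \<in> mj Cm b \<Longrightarrow> mdeg Cm c = mdeg Cm b"
  and r: "\<And>b x. b \<in> B \<Longrightarrow> x \<in> gcar X \<Longrightarrow> gs S (gs S (tn Cm X b x)) = gzero S"
    "\<And>b x. b \<in> B \<Longrightarrow> x \<in> gcar X \<Longrightarrow> gs S (gj S (gj S (tn Cm X b x))) = gj S (gj S (gs S (tn Cm X b x)))"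
    "\<And>b x. b \<in> B \<Longrightarrow> x \<in> gcar X \<Longrightarrow> gs S (gj S (gs S (gj S (tn Cm X b x)))) = gj S (gs S (gj S (gs S (tn Cm X b x))))"
    "\<And>b x. b \<in> B \<Longrightarrow> x \<in> gcar X \<Longrightarrow> gbd S (gbd S (tn Cm X b x)) = gzero S"
    "\<And>b x. b \<in> B \<Longrightarrow> x \<in> gcar X \<Longrightarrow> gbd S (gj S (tn Cm X b x)) = gj S (gbd S (tn Cm X b x))"
    "\<And>b x. b \<in> B \<Longrightarrow> x \<in> gcar X \<Longrightarrow> gbd S (gs S (tn Cm X b x)) =
        gadd S (gs S (gbd S (tn Cm X b x))) (gadd S (tn Cm X b x) (gj S (gj S (tn Cm X b x))))"
  shows "hcx S"
proof -
  have gr: "gsum S (\<lambda>b'. tn Cm X b' x) T \<in> ggrade S n"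
    if "T \<subseteq> B" "x \<in> ggrade X m" "\<And>c. c \<in> T \<Longrightarrow> mdeg Cm c = n - m" for T x n m
    by (rule S.gsum_in) (use that grade_S_zero grade_S_add grade_S_sub in auto)
  show ?thesis
  proof
    fix x n assume "x \<in> ggrade S n"
    then show "gbd S x \<in> ggrade S (n - 1)"
    proof (induction rule: S_grade_induct)
      case (tn b x)
      then show ?case
        using d(1)[OF tn(1)] mdiff_sub[OF tn(1)]
        by (simp add: bd_tn) (intro grade_S_add gr tn_grade[OF _ X.bd_grade], auto)
    qed (auto simp: grade_S_zero grade_S_add)
  next
    fix x n assume "x \<in> ggrade S n"
    then show "gj S x \<in> ggrade S n"
    proof (induction rule: S_grade_induct)
      case (tn b x)
      then show ?case
        using d(3)[OF tn(1)] mj_sub[OF tn(1)]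
        by (simp add: j_tn) (intro gr[where m = "n - mdeg Cm b"] X.j_grade, auto)
    qed (auto simp: grade_S_zero grade_S_add)
  next
    fix x n assume "x \<in> ggrade S n"
    then show "gs S x \<in> ggrade S (n + 1)"
    proof (induction rule: S_grade_induct)
      case (tn b x)
      have 1: "gsum S (\<lambda>b'. tn Cm X b' x) (ms Cm b) \<in> ggrade S (n + 1)"
        by (rule gr[OF ms_sub]) (use tn d(2)[OF tn(1)] in auto)
      have "gsum S (\<lambda>c. gsum S (\<lambda>b'. tn Cm X b' (gs X x)) (mj Cm c)) (mj Cm b) \<in> ggrade S (n + 1)"
      proof (rule S.gsum_in)
        fix c assume c: "c \<in> mj Cm b"
        then have "c \<in> B" using mj_sub tn by auto
        then show "gsum S (\<lambda>b'. tn Cm X b' (gs X x)) (mj Cm c) \<in> ggrade S (n + 1)"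
          using d(3)[OF tn(1) c] d(3)[of c] tn by (intro gr[OF mj_sub X.s_grade[OF tn(2)]]) auto
      qed (auto simp: grade_S_zero grade_S_add grade_S_sub)
      then show ?case using tn 1 by (simp add: s_tn grade_S_add)
    qed (auto simp: grade_S_zero grade_S_add)
  next
    fix x assume "x \<in> gcar S"
    then show "gs S (gs S x) = gzero S" by (induction rule: S_induct) (simp_all add: r)
  next
    fix x assume "x \<in> gcar S"
    then show "gs S (gj S (gj S x)) = gj S (gj S (gs S x))" by (induction rule: S_induct) (simp_all add: r)
  next
    fix x assume "x \<in> gcar S"
    then show "gs S (gj S (gs S (gj S x))) = gj S (gs S (gj S (gs S x)))"
      by (induction rule: S_induct) (simp_all add: r)
  next
    fix x assume "x \<in> gcar S"
    then show "gbd S (gbd S x) = gzero S" by (induction rule: S_induct) (simp_all add: r)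
  next
    fix x assume "x \<in> gcar S"
    then show "gbd S (gj S x) = gj S (gbd S x)" by (induction rule: S_induct) (simp_all add: r)
  next
    fix x assume "x \<in> gcar S"
    then show "gbd S (gs S x) = gadd S (gs S (gbd S x)) (gadd S x (gj S (gj S x)))"
    proof (induction rule: S_induct)
      case (add x y)
      then show ?case by (simp add: S.ac)
    qed (simp_all add: r)
  qed (simp_all add: grade_S_sub grade_S_zero grade_S_add)
qed

end

section \<open>Quasi-isomorphisms and the inclusion of the top cell\<close>

text \<open>Injectivity and surjectivity on homology, elementwise and degree by degree, as a lift
  over cells consumes them. Injectivity is stated for arbitrary \<open>w\<close>, so that being a
  cycle comes as part of the conclusion.\<close>

definition qi :: "'v gcx \<Rightarrow> 'w gcx \<Rightarrow> int \<Rightarrow> ('v \<Rightarrow> 'w) \<Rightarrow> bool" where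
  "qi W X D f \<longleftrightarrow> hchain W X D f \<and>
     (\<forall>m. \<forall>w\<in>ggrade W m. \<forall>q\<in>ggrade X (m + D + 1). f w = gbd X q \<longrightarrow>
        (\<exists>w'\<in>ggrade W (m + 1). w = gbd W w')) \<and>
     (\<forall>m. \<forall>q\<in>ggrade X m. gbd X q = gzero X \<longrightarrow>
        (\<exists>w\<in>ggrade W (m - D). \<exists>a\<in>ggrade X (m + 1). gbd W w = gzero W \<and> q = gadd X (f w) (gbd X a)))"

lemma qi_inj: "qi W X D f \<Longrightarrow> w \<in> ggrade W m \<Longrightarrow> q \<in> ggrade X n \<Longrightarrow> n = m + D + 1 \<Longrightarrow> f w = gbd X q \<Longrightarrow>
    \<exists>w'\<in>ggrade W (m + 1). w = gbd W w'"
  unfolding qi_def by blast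

lemma qi_surj: "qi W X D f \<Longrightarrow> q \<in> ggrade X m \<Longrightarrow> gbd X q = gzero X \<Longrightarrow>
    \<exists>w\<in>ggrade W (m - D). \<exists>a\<in>ggrade X (m + 1). gbd W w = gzero W \<and> q = gadd X (f w) (gbd X a)"
  unfolding qi_def by blast

lemma qi_hchain: "qi W X D f \<Longrightarrow> hchain W X D f"
  unfolding qi_def by blast

lemma qi_comp:
  assumes "hcx A" "hcx B" "hcx E" "qi A B D f" "qi B E D' g"
  shows "qi A E (D + D') (\<lambda>x. g (f x))"
proof -
  interpret A: hcx A by fact
  interpret B: hcx B by fact
  interpret E: hcx E by fact
  note f = hchain_simps[OF qi_hchain[OF assms(4)]] hmapD(3)[OF hchainD(1)[OF qi_hchain[OF assms(4)]]]
  note g = hchain_simps[OF qi_hchain[OF assms(5)]] hmapD(3)[OF hchainD(1)[OF qi_hchain[OF assms(5)]]]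
  show ?thesis unfolding qi_def
  proof (intro conjI allI ballI impI)
    show "hchain A E (D + D') (\<lambda>x. g (f x))"
      by (rule hchain_comp[OF qi_hchain[OF assms(4)] qi_hchain[OF assms(5)]])
  next
    fix m w q assume w: "w \<in> ggrade A m" and q: "q \<in> ggrade E (m + (D + D') + 1)" "g (f w) = gbd E q"
    have "\<exists>b\<in>ggrade B (m + D + 1). f w = gbd B b"
      by (rule qi_inj[OF assms(5) f(6)[OF w] q(1) _ q(2)]) simp
    then obtain b where "b \<in> ggrade B (m + D + 1)" "f w = gbd B b" by blast
    then show "\<exists>w'\<in>ggrade A (m + 1). w = gbd A w'"
      by (intro qi_inj[OF assms(4) w]) auto
  next
    fix m q assume q: "q \<in> ggrade E m" "gbd E q = gzero E"
    obtain b a where b: "b \<in> ggrade B (m - D')" "a \<in> ggrade E (m + 1)" "gbd B b = gzero B"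
      "q = gadd E (g b) (gbd E a)"
      using qi_surj[OF assms(5) q] by blast
    obtain c a' where c: "c \<in> ggrade A (m - D' - D)" "a' \<in> ggrade B (m - D' + 1)" "gbd A c = gzero A"
      "b = gadd B (f c) (gbd B a')"
      using qi_surj[OF assms(4) b(1,3)] by blast
    have car: "c \<in> gcar A" "a' \<in> gcar B" "a \<in> gcar E" "f c \<in> gcar B" using b c f by auto
    have "g a' \<in> ggrade E (m + 1)" using g(6)[OF c(2)] by (simp add: algebra_simps)
    moreover have "q = gadd E (g (f c)) (gbd E (gadd E (g a') a))"
      using b c car g by (simp add: E.ac)
    ultimately show "\<exists>w\<in>ggrade A (m - (D + D')). \<exists>a\<in>ggrade E (m + 1). gbd A w = gzero A \<and>
        q = gadd E (g (f w)) (gbd E a)"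
      using c b by (intro bexI[of _ c] bexI[of _ "gadd E (g a') a"]) (auto simp: algebra_simps)
  qed
qed

context suspc
begin

definition utn :: "'b set \<Rightarrow> ('b list \<Rightarrow> 'v) \<Rightarrow> ('b list \<Rightarrow> 'v)" where
  "utn u x = gsum S (\<lambda>c. tn Cm X c x) u"

text \<open>A contraction \<open>th\<close> of the model onto the class \<open>u\<close> makes \<open>x \<mapsto> u \<otimes> x\<close> a quasi-isomorphism.\<close>

lemma qi_S:
  assumes "hcx S" "u \<subseteq> B" "l \<in> u" "\<And>c. c \<in> u \<Longrightarrow> mdeg Cm c = D"
    and "\<And>b. b \<in> B \<Longrightarrow> th b \<subseteq> B"
    and "\<And>b c. b \<in> B \<Longrightarrow> c \<in> th b \<Longrightarrow> mdeg Cm c = mdeg Cm b + 1"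
    and "\<And>b. b \<in> B \<Longrightarrow> l \<notin> mdiff Cm b"
    and eq: "\<And>x. x \<in> gcar X \<Longrightarrow> gs S (utn u x) = utn u (gs X x)"
      "\<And>x. x \<in> gcar X \<Longrightarrow> gj S (utn u x) = utn u (gj X x)"
      "\<And>x. x \<in> gcar X \<Longrightarrow> gbd S (utn u x) = utn u (gbd X x)"
    and th: "\<And>b x. b \<in> B \<Longrightarrow> x \<in> gcar X \<Longrightarrow>
      gadd S (gbd S (gsum S (\<lambda>c. tn Cm X c x) (th b))) (sT Cm X th (gbd S (tn Cm X b x)))
       = gadd S (tn Cm X b x) (if b = l then utn u x else gzero S)"
  shows "qi X S D (utn u)"
proof -
  interpret SS: hcx S by fact
  have lB: "l \<in> B" and fu: "finite u" using assms(2,3) finite_subset[OF assms(2) fin] by auto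
  have uc: "x \<in> gcar X \<Longrightarrow> utn u x \<in> gcar S" for x
    unfolding utn_def by (rule S.gsum_closed) (use assms in auto)
  have hm: "hmap X S D (utn u)"
    unfolding hmap_def
  proof (intro conjI allI ballI)
    show "addf X S (utn u)"
    proof (rule addfI)
      fix x y assume x: "x \<in> gcar X" "y \<in> gcar X"
      then have "utn u (gadd X x y) = gsum S (\<lambda>c. gadd S (tn Cm X c x) (tn Cm X c y)) u"
        unfolding utn_def by (intro S.gsum_cong) (use assms(2) tn_add in auto)
      also have "\<dots> = gadd S (utn u x) (utn u y)"
        unfolding utn_def by (intro S.gsum_add) (use x assms(2) in auto)
      finally show "utn u (gadd X x y) = gadd S (utn u x) (utn u y)" .
    qed (rule uc)
    fix n x assume "x \<in> ggrade X n"
    then show "utn u x \<in> ggrade S (n + D)"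
      unfolding utn_def by (intro SS.grade_gsum tn_grade) (use assms(2,4) in auto)
  qed (use eq in auto)
  have h: "hchain X S D (utn u)" using hm eq by (auto simp: hchain_def)
  have lu: "scomp (utn u x) l = x" if "x \<in> gcar X" for x
  proof -
    have "scomp (utn u x) l = gsum X (\<lambda>c. scomp (tn Cm X c x) l) u" unfolding utn_def
      by (rule addf_gsum[OF vsp_S X.vsp_axioms addf_scomp[OF lB]]) (use that assms(2) in auto)
    also have "\<dots> = gsum X (\<lambda>c. scomp (tn Cm X c x) l) {l}"
      by (rule X.gsum_mono) (use fu assms(3) lB that in \<open>auto simp: scomp_tn\<close>)
    finally show ?thesis using lB that by (simp add: scomp_tn)
  qed
  \<comment> \<open>As \<open>l\<close> occurs in no boundary of the model, taking the coordinate at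
    \<open>l\<close> is a chain map, and by \<open>lu\<close> it is a left inverse of
    \<open>utn u\<close>: this gives injectivity on homology.\<close>
  have ld: "scomp (gbd S q) l = gbd X (scomp q l)" if "q \<in> gcar S" for q
    using that
  proof (induction rule: S_induct)
    case zero
    then show ?case using addf_zero[OF vsp_S X.vsp_axioms addf_scomp[OF lB]] by simp
  next
    case (tn b x)
    have c: "gsum S (\<lambda>b'. tn Cm X b' x) (mdiff Cm b) \<in> gcar S"
      by (rule S.gsum_closed) (rule tn_car[OF subsetD[OF mdiff_sub[OF tn(1)]] tn(2)])
    have "scomp (gsum S (\<lambda>b'. tn Cm X b' x) (mdiff Cm b)) l
        = gsum X (\<lambda>b'. scomp (tn Cm X b' x) l) (mdiff Cm b)"
      by (rule addf_gsum[OF vsp_S X.vsp_axioms addf_scomp[OF lB]]) (rule tn_car[OF subsetD[OF mdiff_sub[OF tn(1)]] tn(2)])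
    also have "\<dots> = gzero X"
      by (rule X.gsum_zero) (use assms(7)[OF tn(1)] lB in \<open>auto simp: scomp_tn\<close>)
    finally show ?case
      using tn lB c by (auto simp: bd_tn addf_add[OF addf_scomp[OF lB]] scomp_tn)
  next
    case (add x y)
    then show ?case by (simp add: addf_add[OF addf_scomp[OF lB]] scomp_car lB)
  qed
  have Tc: "sT Cm X th q \<in> gcar S" if "q \<in> gcar S" for q using addf_closed[OF addf_sT] that by blast
  have Tg: "sT Cm X th q \<in> ggrade S (m + 1)" if "q \<in> ggrade S m" for q m
    using that
  proof (induction rule: S_grade_induct)
    case zero
    then show ?case using addf_zero[OF vsp_S vsp_S addf_sT] by simp
  next
    case (tn b x)
    have "gsum S (\<lambda>c. tn Cm X c x) (th b) \<in> ggrade S (m + 1)"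
      by (rule SS.grade_gsum, rule tn_grade) (use assms(5,6)[OF tn(1)] tn in auto)
    then show ?case using tn X.grade_car[OF tn(2)] assms(5) by (simp add: sT_tn)
  next
    case (add x y)
    then show ?case by (simp add: addf_add[OF addf_sT])
  qed
  \<comment> \<open>\<open>th\<close> is a homotopy between the identity and the projection sending
    \<open>q\<close> to \<open>u\<close> tensored with the coordinate of \<open>q\<close> at
    \<open>l\<close>: this gives surjectivity on homology.\<close>
  have T: "gadd S (gbd S (sT Cm X th q)) (sT Cm X th (gbd S q)) = gadd S q (utn u (scomp q l))"
    if "q \<in> gcar S" for q
    using that
  proof (induction rule: S_induct)
    case zero
    then show ?case
      using addf_zero[OF vsp_S vsp_S addf_sT] addf_zero[OF vsp_S X.vsp_axioms addf_scomp[OF lB]]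
        addf_zero[OF X.vsp_axioms vsp_S hmapD(1)[OF hm]] by simp
  next
    case (tn b x)
    then show ?case
      using th[OF tn] assms(5) addf_zero[OF X.vsp_axioms vsp_S hmapD(1)[OF hm]] lB
      by (auto simp: sT_tn scomp_tn)
  next
    case (add x y)
    have l: "scomp x l \<in> gcar X" "scomp y l \<in> gcar X" using add scomp_car lB by auto
    have "gadd S (gbd S (sT Cm X th (gadd S x y))) (sT Cm X th (gbd S (gadd S x y)))
       = gadd S (gadd S (gbd S (sT Cm X th x)) (sT Cm X th (gbd S x)))
           (gadd S (gbd S (sT Cm X th y)) (sT Cm X th (gbd S y)))"
      using add.hyps by (simp add: addf_add[OF addf_sT] Tc S.ac)
    also have "\<dots> = gadd S (gadd S x (utn u (scomp x l))) (gadd S y (utn u (scomp y l)))"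
      using add.IH by simp
    also have "\<dots> = gadd S (gadd S x y) (utn u (scomp (gadd S x y) l))"
      using add.hyps l uc by (simp add: addf_add[OF addf_scomp[OF lB]] hmapD(6)[OF hm] S.ac)
    finally show ?case .
  qed
  show ?thesis unfolding qi_def
  proof (intro conjI allI ballI impI)
    show "hchain X S D (utn u)" by fact
  next
    fix m w q assume w: "w \<in> ggrade X m" and q: "q \<in> ggrade S (m + D + 1)" "utn u w = gbd S q"
    have "w = scomp (utn u w) l" using lu w by simp
    also have "\<dots> = gbd X (scomp q l)" using q ld grade_S_sub by auto
    finally show "\<exists>w'\<in>ggrade X (m + 1). w = gbd X w'"
      using scomp_grade[OF q(1) lB] assms(3,4) by auto
  next
    fix m q assume q: "q \<in> ggrade S m" "gbd S q = gzero S"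
    have qc: "q \<in> gcar S" using q by simp
    have lc: "scomp q l \<in> gcar X" using scomp_car qc lB by auto
    have "gbd S (sT Cm X th q) = gadd S q (utn u (scomp q l))"
      using T[OF qc] q(2) addf_zero[OF vsp_S vsp_S addf_sT] Tc[OF qc] by simp
    then have "q = gadd S (utn u (scomp q l)) (gbd S (sT Cm X th q))"
      using qc uc[OF lc] by (simp add: S.ac)
    moreover have "gbd X (scomp q l) = gzero X"
      using ld[OF qc] q(2) addf_zero[OF vsp_S X.vsp_axioms addf_scomp[OF lB]] by simp
    ultimately show "\<exists>w\<in>ggrade X (m - D). \<exists>a\<in>ggrade S (m + 1). gbd X w = gzero X \<and>
        q = gadd S (utn u w) (gbd S a)"
      using scomp_grade[OF q(1) lB] assms(3,4) Tg[OF q(1)] by blast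
  qed
qed

end

section \<open>The model complexes of the two representation spheres\<close>

lemma cmod_Rt: "cmod C_Rt"
  by unfold_locales (auto simp: C_Rt_def)

lemma mbasis_H: "mbasis C_H = {HR0,
   HY 1 False 0, HY 1 False 1, HY 1 False 2, HY 1 False 3,
   HY 1 True 0, HY 1 True 1, HY 1 True 2, HY 1 True 3,
   HY 2 False 0, HY 2 False 1, HY 2 False 2, HY 2 False 3,
   HY 2 True 0, HY 2 True 1, HY 2 True 2, HY 2 True 3,
   HY 3 False 0, HY 3 False 1, HY 3 False 2, HY 3 False 3,
   HY 3 True 0, HY 3 True 1, HY 3 True 2, HY 3 True 3}" (is "_ = ?B")
proof -
  have i: "1 \<le> i \<and> i \<le> 3 \<longleftrightarrow> i = 1 \<or> i = 2 \<or> i = 3" for i :: nat by auto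
  have b: "b < 4 \<longleftrightarrow> b = 0 \<or> b = 1 \<or> b = 2 \<or> b = 3" for b :: nat by auto
  have "mbasis C_H = {HR0} \<union> {HY i a b | i a b. 1 \<le> i \<and> i \<le> 3 \<and> b < 4}" by (simp add: C_H_def)
  also have "\<dots> \<subseteq> ?B"
  proof (rule Un_least)
    show "{HY i a b | i a b. 1 \<le> i \<and> i \<le> 3 \<and> b < 4} \<subseteq> ?B"
    proof
      fix y assume "y \<in> {HY i a b | i a b. 1 \<le> i \<and> i \<le> 3 \<and> b < 4}"
      then obtain k a b where *: "y = HY k a b" "1 \<le> k \<and> k \<le> 3" "b < (4::nat)" by blast
      with i[of k] b[of b] have "(k = 1 \<or> k = 2 \<or> k = 3) \<and> (b = 0 \<or> b = 1 \<or> b = 2 \<or> b = 3)" by blast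
      then show "y \<in> ?B" unfolding * by (cases a) auto
    qed
  qed simp
  finally have "mbasis C_H \<subseteq> ?B" .
  moreover have "?B \<subseteq> mbasis C_H" by (auto simp: C_H_def)
  ultimately show ?thesis by (rule equalityI)
qed

lemma cmod_H: "cmod C_H"
proof
  show "finite (mbasis C_H)" unfolding mbasis_H by simp
  fix b assume b: "b \<in> mbasis C_H"
  from b have "b = HR0 \<or> (\<exists>i a k. b = HY i a k \<and> 1 \<le> i \<and> i \<le> 3 \<and> k < 4)" by (auto simp: C_H_def)
  then have "mdiff C_H b \<subseteq> mbasis C_H \<and> ms C_H b \<subseteq> mbasis C_H \<and> mj C_H b \<subseteq> mbasis C_H"
  proof (elim disjE exE conjE)
    fix i a k assume *: "b = HY i a k" "1 \<le> i" "i \<le> 3" "k < 4"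
    have "mdiff C_H b \<subseteq> mbasis C_H"
      using * by (cases a) (auto simp: C_H_def split: if_splits)
    moreover have "ms C_H b \<subseteq> mbasis C_H"
      using * by (cases a) (auto simp: C_H_def split: if_splits)
    moreover have "mj C_H b \<subseteq> mbasis C_H"
      using * by (cases a) (auto simp: C_H_def split: if_splits)
    ultimately show ?thesis by blast
  next
    assume "b = HR0"
    then show ?thesis by (simp add: C_H_def)
  qed
  then show "mdiff C_H b \<subseteq> mbasis C_H" "ms C_H b \<subseteq> mbasis C_H" "mj C_H b \<subseteq> mbasis C_H"
    by blast+
qed

section \<open>Suspension by the real sign representation\<close>

text \<open>The contraction demanded by \<open>qi_S\<close>, with \<open>j c_1\<close> chosen as the
  cell that bounds \<open>c_0\<close>. It is linear but not equivariant, since \<open>j\<close>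
  fixes \<open>c_0\<close> and moves \<open>j c_1\<close>.\<close>

definition thR :: "sbasis \<Rightarrow> sbasis set" where "thR b = (if b = RC0 then {RJC1} else {})"

lemma Rt_basis: "mbasis C_Rt = {RC0, RC1, RJC1}" by (simp add: C_Rt_def)

lemma C_Rt_sel:
  "mdiff C_Rt b = (if b = RC1 \<or> b = RJC1 then {RC0} else {})"
  "ms C_Rt b = {}"
  "mj C_Rt b = (if b = RC0 then {RC0} else if b = RC1 then {RJC1} else if b = RJC1 then {RC1} else {})"
  by (simp_all add: C_Rt_def)

context
  fixes X :: "(sbasis list \<Rightarrow> 'v) gcx"
  assumes X: "hcx X"
begin

interpretation R: suspc C_Rt X
  by (rule suspc.intro[OF cmod_Rt X])

lemma Rt_bd:
  assumes "x \<in> gcar X"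
  shows "gbd (susp C_Rt X) (tn C_Rt X RC0 x) = tn C_Rt X RC0 (gbd X x)"
    "gbd (susp C_Rt X) (tn C_Rt X RC1 x) = gadd (susp C_Rt X) (tn C_Rt X RC0 x) (tn C_Rt X RC1 (gbd X x))"
    "gbd (susp C_Rt X) (tn C_Rt X RJC1 x) = gadd (susp C_Rt X) (tn C_Rt X RC0 x) (tn C_Rt X RJC1 (gbd X x))"
  using assms by (simp_all add: R.bd_tn Rt_basis C_Rt_sel)

lemma Rt_j:
  assumes "x \<in> gcar X"
  shows "gj (susp C_Rt X) (tn C_Rt X RC0 x) = tn C_Rt X RC0 (gj X x)"
    "gj (susp C_Rt X) (tn C_Rt X RC1 x) = tn C_Rt X RJC1 (gj X x)"
    "gj (susp C_Rt X) (tn C_Rt X RJC1 x) = tn C_Rt X RC1 (gj X x)"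
  using assms by (simp_all add: R.j_tn Rt_basis C_Rt_sel)

lemma Rt_s:
  assumes "x \<in> gcar X"
  shows "gs (susp C_Rt X) (tn C_Rt X RC0 x) = tn C_Rt X RC0 (gs X x)"
    "gs (susp C_Rt X) (tn C_Rt X RC1 x) = tn C_Rt X RC1 (gs X x)"
    "gs (susp C_Rt X) (tn C_Rt X RJC1 x) = tn C_Rt X RJC1 (gs X x)"
  using assms by (simp_all add: R.s_tn Rt_basis C_Rt_sel)

lemma hcx_Rt: "hcx (susp C_Rt X)"
proof (rule R.hcx_S)
  fix b c assume "b \<in> mbasis C_Rt"
  then show "c \<in> mdiff C_Rt b \<Longrightarrow> mdeg C_Rt c = mdeg C_Rt b - 1"
    "c \<in> ms C_Rt b \<Longrightarrow> mdeg C_Rt c = mdeg C_Rt b + 1"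
    "c \<in> mj C_Rt b \<Longrightarrow> mdeg C_Rt c = mdeg C_Rt b"
    by (auto simp: C_Rt_def split: if_splits)
next
  fix b x assume "b \<in> mbasis C_Rt" and x: "x \<in> gcar X"
  then have b: "b = RC0 \<or> b = RC1 \<or> b = RJC1" by (auto simp: Rt_basis)
  note s = Rt_bd Rt_j Rt_s x Rt_basis R.S.ac R.X.bd_j R.X.bd_s R.tn_add R.X.s_j_j R.X.s_j_s_j
  show "gs R.S (gs R.S (tn C_Rt X b x)) = gzero R.S"
    "gs R.S (gj R.S (gj R.S (tn C_Rt X b x))) = gj R.S (gj R.S (gs R.S (tn C_Rt X b x)))"
    "gs R.S (gj R.S (gs R.S (gj R.S (tn C_Rt X b x)))) = gj R.S (gs R.S (gj R.S (gs R.S (tn C_Rt X b x))))"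
    "gbd R.S (gbd R.S (tn C_Rt X b x)) = gzero R.S"
    "gbd R.S (gj R.S (tn C_Rt X b x)) = gj R.S (gbd R.S (tn C_Rt X b x))"
    "gbd R.S (gs R.S (tn C_Rt X b x)) =
        gadd R.S (gs R.S (gbd R.S (tn C_Rt X b x))) (gadd R.S (tn C_Rt X b x) (gj R.S (gj R.S (tn C_Rt X b x))))"
    by (insert b, elim disjE; simp add: s)+
qed

text \<open>\<open>c_1 + j c_1\<close> is the fundamental cycle of the circle; it is read off at
  \<open>RC1\<close> because \<open>thR\<close> has used up the other cell.\<close>

lemma qi_Rt: "qi X (susp C_Rt X) 1 (R.utn {RC1, RJC1})"
proof (rule R.qi_S[where l = RC1 and th = thR, OF hcx_Rt])
  show "mdeg C_Rt c = 1" if "c \<in> {RC1, RJC1}" for c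
    using that by (auto simp: C_Rt_def)
  fix b assume b: "b \<in> mbasis C_Rt"
  show "thR b \<subseteq> mbasis C_Rt" "c \<in> thR b \<Longrightarrow> mdeg C_Rt c = mdeg C_Rt b + 1" "RC1 \<notin> mdiff C_Rt b" for c
    using b by (auto simp: thR_def C_Rt_def split: if_splits)
next
  fix x assume x: "x \<in> gcar X"
  note s = Rt_bd Rt_j Rt_s x Rt_basis R.S.ac R.utn_def
  show "gs R.S (R.utn {RC1, RJC1} x) = R.utn {RC1, RJC1} (gs X x)"
    "gj R.S (R.utn {RC1, RJC1} x) = R.utn {RC1, RJC1} (gj X x)"
    "gbd R.S (R.utn {RC1, RJC1} x) = R.utn {RC1, RJC1} (gbd X x)"
    by (simp_all add: s)
  fix b assume "b \<in> mbasis C_Rt"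
  then have b: "b = RC0 \<or> b = RC1 \<or> b = RJC1" by (auto simp: Rt_basis)
  have sT: "sT C_Rt X thR (tn C_Rt X RC0 y) = tn C_Rt X RJC1 y" "sT C_Rt X thR (tn C_Rt X RC1 y) = gzero R.S"
     "sT C_Rt X thR (tn C_Rt X RJC1 y) = gzero R.S" if "y \<in> gcar X" for y
    using that by (simp_all add: R.sT_tn Rt_basis thR_def)
  show "gadd R.S (gbd R.S (gsum R.S (\<lambda>c. tn C_Rt X c x) (thR b))) (sT C_Rt X thR (gbd R.S (tn C_Rt X b x)))
       = gadd R.S (tn C_Rt X b x) (if b = RC1 then R.utn {RC1, RJC1} x else gzero R.S)"
    using b by (elim disjE; simp add: s thR_def addf_add[OF R.addf_sT] sT)
qed (auto simp: Rt_basis)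

lemma hcx4_Rt: "hcx4 X \<Longrightarrow> hcx4 (susp C_Rt X)"
proof -
  assume X4: "hcx4 X"
  interpret S: hcx "susp C_Rt X" by (rule hcx_Rt)
  interpret X4: hcx4 X by (rule X4)
  show ?thesis
  proof
    fix x assume "x \<in> gcar (susp C_Rt X)"
    then show "gj R.S (gj R.S (gj R.S (gj R.S x))) = x"
    proof (induction rule: R.S_induct)
      case (tn b x)
      then have "b = RC0 \<or> b = RC1 \<or> b = RJC1" by (auto simp: Rt_basis)
      then show ?case using tn(2) by (elim disjE; simp add: Rt_j)
    qed simp_all
  qed
qed

end

section \<open>Suspension by the quaternions\<close>

text \<open>A linear, non-equivariant contraction of the cellular chains of the 4-sphere. Its twelve
  nonzero values cancel twenty-four of the twenty-five basis elements in pairs and leave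
  \<open>HY 3 True 3\<close>, the coordinate at which the fundamental class \<open>uH\<close> is
  read off.\<close>

definition thH :: "sbasis \<Rightarrow> sbasis set" where
  "thH b = (if b = HR0 then {HY 1 False 0}
    else if b = HY 1 False 1 then {HY 2 False 0}
    else if b = HY 1 False 2 then {HY 1 True 0}
    else if b = HY 1 False 3 then {HY 2 False 3}
    else if b = HY 1 True 1 then {HY 3 False 3}
    else if b = HY 1 True 2 then {HY 2 True 0, HY 3 False 2, HY 3 False 3}
    else if b = HY 1 True 3 then {HY 2 True 2, HY 3 False 2}
    else if b = HY 2 False 1 then {HY 3 False 0}
    else if b = HY 2 False 2 then {HY 2 True 0, HY 3 False 3}
    else if b = HY 2 True 1 then {HY 3 True 0}
    else if b = HY 2 True 3 then {HY 3 True 2}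
    else if b = HY 3 False 1 then {HY 3 True 0, HY 3 True 1}
    else {})"

abbreviation uH :: "sbasis set" where
  "uH \<equiv> {HY 3 True 0, HY 3 True 1, HY 3 True 2, HY 3 True 3}"

lemma mem_H: "HR0 \<in> mbasis C_H" "HY i a b \<in> mbasis C_H \<longleftrightarrow> 1 \<le> i \<and> i \<le> 3 \<and> b < 4"
  "RC0 \<notin> mbasis C_H" "RC1 \<notin> mbasis C_H" "RJC1 \<notin> mbasis C_H"
  by (auto simp: C_H_def)

lemma H_cases:
  assumes "b \<in> mbasis C_H"
  obtains "b = HR0"
    | i k where "b = HY i False k" "i = 1 \<or> i = 2 \<or> i = 3" "k = 0 \<or> k = 1 \<or> k = 2 \<or> k = 3"
    | i k where "b = HY i True k" "i = 1 \<or> i = 2 \<or> i = 3" "k = 0 \<or> k = 1 \<or> k = 2 \<or> k = 3"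
proof -
  from assms have "b = HR0 \<or> (\<exists>i a k. b = HY i a k \<and> 1 \<le> i \<and> i \<le> 3 \<and> k < 4)"
    by (auto simp: C_H_def)
  then show ?thesis
  proof (elim disjE exE conjE)
    fix i a k assume *: "b = HY i a k" "1 \<le> i" "i \<le> 3" "k < 4"
    then have "i = 1 \<or> i = 2 \<or> i = 3" "k = 0 \<or> k = 1 \<or> k = 2 \<or> k = 3" by auto
    with * that(2,3) show ?thesis by (cases a) blast+
  qed (use that in blast)
qed

lemma C_H_sel: "mdiff C_H = CH_diff" "ms C_H = CH_s" "mj C_H = CH_j" "mdeg C_H = CH_deg"
  by (simp_all add: C_H_def)

lemma mod4_neq: "(b::nat) < 4 \<Longrightarrow> b \<noteq> Suc b mod 4" "(b::nat) < 4 \<Longrightarrow> b \<noteq> Suc (Suc b) mod 4"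
  "(b::nat) < 4 \<Longrightarrow> Suc b mod 4 \<noteq> b" "(b::nat) < 4 \<Longrightarrow> Suc (Suc b) mod 4 \<noteq> b"
  by presburger+

locale suspH = suspc C_H X for X :: "(sbasis list \<Rightarrow> 'v) gcx"

lemma suspHI: "hcx X \<Longrightarrow> suspH X"
  by (rule suspH.intro, rule suspc.intro[OF cmod_H])

context suspH
begin

lemmas [simp] = mem_H

lemma H_bd:
  assumes "x \<in> gcar X"
  shows "gbd S (tn C_H X HR0 x) = tn C_H X HR0 (gbd X x)"
    "b < 4 \<Longrightarrow> gbd S (tn C_H X (HY 1 False b) x) = gadd S (tn C_H X HR0 x) (tn C_H X (HY 1 False b) (gbd X x))"
    "b < 4 \<Longrightarrow> gbd S (tn C_H X (HY 2 False b) x) =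
       gadd S (gadd S (tn C_H X (HY 1 False b) x) (tn C_H X (HY 1 False (Suc b mod 4)) x))
         (tn C_H X (HY 2 False b) (gbd X x))"
    "b < 4 \<Longrightarrow> gbd S (tn C_H X (HY 3 False b) x) =
       gadd S (gadd S (tn C_H X (HY 1 True (3 * b mod 4)) x)
         (gadd S (tn C_H X (HY 2 False b) x) (tn C_H X (HY 2 False (Suc b mod 4)) x)))
         (tn C_H X (HY 3 False b) (gbd X x))"
    "b < 4 \<Longrightarrow> gbd S (tn C_H X (HY 1 True b) x) =
       gadd S (gadd S (tn C_H X (HY 1 False b) x) (tn C_H X (HY 1 False (Suc (Suc b) mod 4)) x))
         (tn C_H X (HY 1 True b) (gbd X x))"
    "b < 4 \<Longrightarrow> gbd S (tn C_H X (HY 2 True b) x) =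
       gadd S (gadd S (gadd S (tn C_H X (HY 1 True b) x) (tn C_H X (HY 1 True (Suc b mod 4)) x))
           (gadd S (tn C_H X (HY 2 False b) x) (tn C_H X (HY 2 False (Suc (Suc b) mod 4)) x)))
         (tn C_H X (HY 2 True b) (gbd X x))"
    "b < 4 \<Longrightarrow> gbd S (tn C_H X (HY 3 True b) x) =
       gadd S (gadd S (gadd S (tn C_H X (HY 2 True b) x) (tn C_H X (HY 2 True (Suc b mod 4)) x))
           (gadd S (tn C_H X (HY 3 False b) x) (tn C_H X (HY 3 False (Suc (Suc b) mod 4)) x)))
         (tn C_H X (HY 3 True b) (gbd X x))"
  using assms by (simp_all add: bd_tn C_H_sel mod4_neq S.add_assoc)

lemma H_j:
  assumes "x \<in> gcar X"
  shows "gj S (tn C_H X HR0 x) = tn C_H X HR0 (gj X x)"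
    "b < 4 \<Longrightarrow> 1 \<le> i \<Longrightarrow> i \<le> 3 \<Longrightarrow> gj S (tn C_H X (HY i False b) x) = tn C_H X (HY i False (Suc b mod 4)) (gj X x)"
    "b < 4 \<Longrightarrow> 1 \<le> i \<Longrightarrow> i \<le> 3 \<Longrightarrow> gj S (tn C_H X (HY i True b) x) = tn C_H X (HY i True ((b + 3) mod 4)) (gj X x)"
  using assms by (simp_all add: j_tn C_H_sel)

lemma H_s:
  assumes "x \<in> gcar X"
  shows "gs S (tn C_H X HR0 x) = tn C_H X HR0 (gs X x)"
    "b < 4 \<Longrightarrow> 1 \<le> i \<Longrightarrow> i \<le> 3 \<Longrightarrow> gs S (tn C_H X (HY i False b) x) =
       gadd S (tn C_H X (HY i True b) x) (tn C_H X (HY i False (Suc (Suc b) mod 4)) (gs X x))"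
    "b < 4 \<Longrightarrow> 1 \<le> i \<Longrightarrow> i \<le> 3 \<Longrightarrow> gs S (tn C_H X (HY i True b) x) = tn C_H X (HY i True ((b + 6) mod 4)) (gs X x)"
  using assms by (simp_all add: s_tn C_H_sel mod_simps add.commute)

lemma hcx_H: "hcx S"
proof (rule hcx_S)
  fix b c assume "b \<in> mbasis C_H"
  then show "c \<in> mdiff C_H b \<Longrightarrow> mdeg C_H c = mdeg C_H b - 1"
    "c \<in> ms C_H b \<Longrightarrow> mdeg C_H c = mdeg C_H b + 1"
    "c \<in> mj C_H b \<Longrightarrow> mdeg C_H c = mdeg C_H b"
    by (cases b rule: CH_diff.cases; auto simp: C_H_sel split: if_splits)+
next
  fix b x assume b: "b \<in> mbasis C_H" and x: "x \<in> gcar X"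
  note s = H_bd H_j H_s x X.bd_j X.bd_s tn_add X.s_j_j X.s_j_s_j
  show "gs S (gs S (tn C_H X b x)) = gzero S"
    using b by (cases b rule: H_cases; (elim disjE)?; simp add: s S.ac numeral_2_eq_2[symmetric] del: One_nat_def)
  show "gs S (gj S (gj S (tn C_H X b x))) = gj S (gj S (gs S (tn C_H X b x)))"
    using b by (cases b rule: H_cases; (elim disjE)?; simp add: s S.ac numeral_2_eq_2[symmetric] del: One_nat_def)
  show "gs S (gj S (gs S (gj S (tn C_H X b x)))) = gj S (gs S (gj S (gs S (tn C_H X b x))))"
    using b by (cases b rule: H_cases; (elim disjE)?; simp add: s S.ac numeral_2_eq_2[symmetric] del: One_nat_def)
  show "gbd S (gbd S (tn C_H X b x)) = gzero S"
    using b by (cases b rule: H_cases; (elim disjE)?; simp add: s S.ac numeral_2_eq_2[symmetric] del: One_nat_def)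
  show "gbd S (gj S (tn C_H X b x)) = gj S (gbd S (tn C_H X b x))"
    using b by (cases b rule: H_cases; (elim disjE)?; simp add: s S.ac numeral_2_eq_2[symmetric] del: One_nat_def)
  show "gbd S (gs S (tn C_H X b x)) =
        gadd S (gs S (gbd S (tn C_H X b x))) (gadd S (tn C_H X b x) (gj S (gj S (tn C_H X b x))))"
    using b by (cases b rule: H_cases; (elim disjE)?; simp add: s S.ac numeral_2_eq_2[symmetric] del: One_nat_def)
qed

lemma hcx4_H: "hcx4 X \<Longrightarrow> hcx4 S"
proof -
  assume X4: "hcx4 X"
  interpret SS: hcx S by (rule hcx_H)
  interpret X4: hcx4 X by (rule X4)
  show ?thesis
  proof
    fix x assume "x \<in> gcar S"
    then show "gj S (gj S (gj S (gj S x))) = x"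
    proof (induction rule: S_induct)
      case (tn b x)
      from tn(1) show ?case
        by (cases b rule: H_cases; (elim disjE)?; simp add: H_j tn(2) numeral_2_eq_2[symmetric] del: One_nat_def)
    qed simp_all
  qed
qed

lemma qi_H: "qi X S 4 (utn uH)"
proof (rule qi_S[where l = "HY 3 True 3" and th = thH, OF hcx_H])
  show "mdeg C_H c = 4" if "c \<in> uH" for c
    using that by (auto simp: C_H_sel)
  fix b assume b: "b \<in> mbasis C_H"
  show "thH b \<subseteq> mbasis C_H" "c \<in> thH b \<Longrightarrow> mdeg C_H c = mdeg C_H b + 1" for c
    using b by (cases b rule: H_cases; auto simp: thH_def C_H_sel split: if_splits)+
  show "HY 3 True 3 \<notin> mdiff C_H b"
    using b by (cases b rule: CH_diff.cases; auto simp: C_H_sel split: if_splits)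
next
  fix x assume x: "x \<in> gcar X"
  note s = H_bd H_j H_s x S.ac utn_def
  show "gs S (utn uH x) = utn uH (gs X x)"
    by (simp add: s numeral_2_eq_2[symmetric] del: One_nat_def)
  show "gj S (utn uH x) = utn uH (gj X x)"
    by (simp add: s numeral_2_eq_2[symmetric] del: One_nat_def)
  show "gbd S (utn uH x) = utn uH (gbd X x)"
    by (simp add: s numeral_2_eq_2[symmetric] del: One_nat_def)
  fix b assume b: "b \<in> mbasis C_H"
  have sT: "sT C_H X thH (tn C_H X b y) = gsum S (\<lambda>c. tn C_H X c y) (thH b)"
    if "y \<in> gcar X" "b \<in> mbasis C_H" for y b
    using that by (intro sT_tn) (auto simp: thH_def)
  show "gadd S (gbd S (gsum S (\<lambda>c. tn C_H X c x) (thH b))) (sT C_H X thH (gbd S (tn C_H X b x)))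
       = gadd S (tn C_H X b x) (if b = HY 3 True 3 then utn uH x else gzero S)"
    using b by (cases b rule: H_cases; (elim disjE)?;
        simp add: s thH_def addf_add[OF addf_sT] sT numeral_2_eq_2[symmetric] del: One_nat_def)
qed auto

end

section \<open>Null-homologies compatible with \<open>s\<close> and \<open>j\<close>\<close>

definition acyc :: "'v gcx \<Rightarrow> int \<Rightarrow> bool" where
  "acyc T K \<longleftrightarrow> (\<forall>k<K. \<forall>z\<in>ggrade T k. gbd T z = gzero T \<longrightarrow> (\<exists>a\<in>ggrade T (k + 1). z = gbd T a))"

lemma acycD: "acyc T K \<Longrightarrow> z \<in> ggrade T k \<Longrightarrow> k < K \<Longrightarrow> gbd T z = gzero T \<Longrightarrow> k' = k + 1 \<Longrightarrow>
    \<exists>a\<in>ggrade T k'. z = gbd T a"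
  unfolding acyc_def by blast

lemma acyc_qi:
  assumes "hcx W" "hcx X" "qi W X D f" "acyc W d"
  shows "acyc X (d + D)"
  unfolding acyc_def
proof (intro allI impI ballI)
  interpret W: hcx W by fact
  interpret X: hcx X by fact
  note f = hchain_simps[OF qi_hchain[OF assms(3)]] hmapD(3)[OF hchainD(1)[OF qi_hchain[OF assms(3)]]]
  fix k z assume k: "k < d + D" "z \<in> ggrade X k" "gbd X z = gzero X"
  then obtain w a where w: "w \<in> ggrade W (k - D)" "a \<in> ggrade X (k + 1)" "gbd W w = gzero W"
    "z = gadd X (f w) (gbd X a)"
    using qi_surj[OF assms(3)] by blast
  then obtain w' where w': "w' \<in> ggrade W (k - D + 1)" "w = gbd W w'"
    using acycD[OF assms(4) w(1) _ w(3), of "k - D + 1"] k by auto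
  have "f w' \<in> ggrade X (k + 1)" using f(6)[OF w'(1)] by simp
  moreover have "w' \<in> gcar W" "a \<in> gcar X" using w w' by auto
  ultimately show "\<exists>a\<in>ggrade X (k + 1). z = gbd X a"
    using w w' f by (intro bexI[of _ "gadd X (f w') a"]) auto
qed

text \<open>\<open>nul T m q\<close>: the invariant cycle \<open>q\<close> bounds in a homotopy-invariant way.  The pair \<open>b, b'\<close>
  together with \<open>q\<close> is an image of an acyclic complex of which \<open>q\<close> spans the trivial submodule.\<close>

definition nul :: "'v gcx \<Rightarrow> int \<Rightarrow> 'v \<Rightarrow> bool" where
  "nul T m q \<longleftrightarrow> (\<exists>b\<in>ggrade T (m + 1). \<exists>b'\<in>ggrade T (m + 2).
     gbd T b = q \<and> gbd T b' = gadd T b (gj T b) \<and>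
     gs T b = gadd T b' (gj T b') \<and> gs T (gj T b) = gadd T (gj T b') (gj T (gj T b')) \<and>
     gs T b' = gzero T \<and> gs T (gj T b') = gzero T)"

text \<open>The conjugate of \<open>s\<close> by \<open>j\<close>. Because
  \<open>sj^2 = j^2 s\<close>, conjugation by \<open>j\<close> interchanges \<open>s\<close> and
  \<open>sp\<close>, and \<open>sjsj = jsjs\<close> says that the two commute.\<close>

definition sp :: "'v gcx \<Rightarrow> 'v \<Rightarrow> 'v" where
  "sp T x = gj T (gs T (gj T (gj T (gj T x))))"

text \<open>The relations between the classes \<open>r\<^sub>0 \<otimes> p\<close>, \<open>y\<^sub>i \<otimes> p\<close> and \<open>u \<otimes> p\<close> for an invariant cycle \<open>p\<close>,
  where \<open>u\<close> is the top cycle of the model of the quaternionic sphere.\<close>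

definition hpk :: "'v gcx \<Rightarrow> int \<Rightarrow> 'v \<Rightarrow> 'v \<Rightarrow> 'v \<Rightarrow> 'v \<Rightarrow> 'v \<Rightarrow> bool" where
  "hpk T m q0 y1 y2 y3 q4 \<longleftrightarrow> q0 \<in> ggrade T m \<and> y1 \<in> ggrade T (m + 1) \<and> y2 \<in> ggrade T (m + 2) \<and>
     y3 \<in> ggrade T (m + 3) \<and> q4 \<in> ggrade T (m + 4) \<and>
     gbd T y1 = q0 \<and> gbd T y2 = gadd T y1 (gj T y1) \<and>
     gbd T y3 = gadd T (gs T y1) (gadd T y2 (gj T y2)) \<and>
     gs T (sp T y2) = gzero T \<and> gs T (sp T y3) = gzero T \<and>
     gadd T (gs T (gadd T y3 (gj T y3))) (sp T (gadd T y3 (gj T y3))) = q4"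

context hcx4
begin

lemma sp_closed [simp]: "x \<in> gcar C \<Longrightarrow> sp C x \<in> gcar C"
  by (simp add: sp_def)

lemma sp_grade: "x \<in> ggrade C n \<Longrightarrow> m = n + 1 \<Longrightarrow> sp C x \<in> ggrade C m"
  unfolding sp_def by (intro j_grade s_grade')

lemma sp_add [simp]: "x \<in> gcar C \<Longrightarrow> y \<in> gcar C \<Longrightarrow> sp C (gadd C x y) = gadd C (sp C x) (sp C y)"
  by (simp add: sp_def)

lemma sp_zero [simp]: "sp C (gzero C) = gzero C"
  by (simp add: sp_def)

lemma j_s: "x \<in> gcar C \<Longrightarrow> gj C (gs C x) = sp C (gj C x)"
  by (simp add: sp_def)

lemma j_sp: "x \<in> gcar C \<Longrightarrow> gj C (sp C x) = gs C (gj C x)"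
  using s_j_j[of "gj C (gj C (gj C x))"] by (simp add: sp_def)

lemma sp_s: "x \<in> gcar C \<Longrightarrow> sp C (gs C x) = gs C (sp C x)"
  using s_j_s_j[of "gj C (gj C x)"] s_j_j[of x] by (simp add: sp_def)

lemma sp_sp [simp]: "x \<in> gcar C \<Longrightarrow> sp C (sp C x) = gzero C"
  by (simp add: sp_def)

lemma bd_sp: "x \<in> gcar C \<Longrightarrow> gbd C (sp C x) = gadd C (sp C (gbd C x)) (gadd C x (gj C (gj C x)))"
  by (simp add: sp_def bd_j bd_s)

text \<open>Both \<open>y1, y2, y3\<close> and \<open>b, b'\<close> start from a filling of
  \<open>q0\<close>. Acyclicity below \<open>m + 4\<close> fills their differences by
  \<open>a1\<close>, \<open>a2\<close>, \<open>a3\<close> in turn, one degree at a time, so that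
  \<open>y3\<close> becomes a boundary up to terms in the lower fillings; the filling of
  \<open>q4\<close> is built from that.\<close>

lemma hpk_nul:
  assumes h: "hpk C m q0 y1 y2 y3 q4" and n: "nul C m q0" and a: "acyc C (m + 4)"
  shows "nul C (m + 4) q4"
proof -
  obtain b b' where b: "b \<in> ggrade C (m + 1)" "b' \<in> ggrade C (m + 2)"
    "gbd C b = q0" "gbd C b' = gadd C b (gj C b)"
    "gs C b = gadd C b' (gj C b')" "gs C (gj C b) = gadd C (gj C b') (gj C (gj C b'))"
    "gs C b' = gzero C" "gs C (gj C b') = gzero C"
    using n unfolding nul_def by blast
  have y: "q0 \<in> ggrade C m" "y1 \<in> ggrade C (m + 1)" "y2 \<in> ggrade C (m + 2)" "y3 \<in> ggrade C (m + 3)"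
    "gbd C y1 = q0" "gbd C y2 = gadd C y1 (gj C y1)"
    "gbd C y3 = gadd C (gs C y1) (gadd C y2 (gj C y2))"
    "gs C (sp C y2) = gzero C" "gs C (sp C y3) = gzero C"
    "gadd C (gs C (gadd C y3 (gj C y3))) (sp C (gadd C y3 (gj C y3))) = q4"
    using h unfolding hpk_def by auto
  have car [simp]: "b \<in> gcar C" "b' \<in> gcar C" "q0 \<in> gcar C" "y1 \<in> gcar C" "y2 \<in> gcar C" "y3 \<in> gcar C"
    using b(1,2) y(1-4) by auto
  note nf = j_s j_sp sp_s bd_sp bd_s bd_j ac
  have "\<exists>a\<in>ggrade C (m + 2). gadd C y1 b = gbd C a"
    by (rule acycD[OF a, of _ "m + 1"]) (use b y in auto)
  then obtain a1 where a1: "a1 \<in> ggrade C (m + 2)" "gbd C a1 = gadd C y1 b" by metis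
  then have [simp]: "a1 \<in> gcar C" by auto
  have "\<exists>a\<in>ggrade C (m + 3). gadd C y2 (gadd C a1 (gadd C (gj C a1) b')) = gbd C a"
    by (rule acycD[OF a, of _ "m + 2"]) (use b y a1 in \<open>auto simp: nf\<close>)
  then obtain a2 where a2: "a2 \<in> ggrade C (m + 3)" "gbd C a2 = gadd C y2 (gadd C a1 (gadd C (gj C a1) b'))"
    by metis
  then have [simp]: "a2 \<in> gcar C" by auto
  have "\<exists>a\<in>ggrade C (m + 4). gadd C y3 (gadd C (gs C a1) (gadd C a2 (gj C a2))) = gbd C a"
    by (rule acycD[OF a, of _ "m + 3"]) (use b y a1 a2 in \<open>auto simp: nf\<close>)
  then obtain a3 where a3: "a3 \<in> ggrade C (m + 4)"
    "gbd C a3 = gadd C y3 (gadd C (gs C a1) (gadd C a2 (gj C a2)))"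
    by metis
  then have [simp]: "a3 \<in> gcar C" by auto
  \<comment> \<open>\<open>s + sp\<close> commutes with \<open>j\<close> and with the boundary, and
    \<open>q4 = (s + sp)(1 + j) y3\<close>. So the boundary of \<open>(s + sp)(1 + j) a3\<close>
    differs from \<open>q4\<close> by terms in \<open>a1\<close> and \<open>a2\<close>, which the
    boundary of \<open>s sp a2\<close> cancels. The element \<open>d'\<close> is chosen so that
    \<open>s d = (1 + j) d'\<close>.\<close>
  define d where "d = gadd C (gadd C (gs C (gadd C a3 (gj C a3))) (sp C (gadd C a3 (gj C a3)))) (gs C (sp C a2))"
  define d' where "d' = gs C (sp C a3)"
  have spb: "gs C (sp C b') = gzero C" using sp_s[of b'] b by simp
  have q4: "q4 = gadd C (gs C y3) (gadd C (gs C (gj C y3)) (gadd C (sp C y3) (sp C (gj C y3))))"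
    unfolding y(10)[symmetric] by (simp add: ac)
  show ?thesis unfolding nul_def
  proof (rule bexI[of _ d], rule bexI[of _ d'], intro conjI)
    have g3: "gadd C a3 (gj C a3) \<in> ggrade C (m + 4)" by (intro grade_add j_grade a3)
    show "d \<in> ggrade C (m + 4 + 1)"
      unfolding d_def
      by (intro grade_add s_grade'[OF g3] sp_grade[OF g3] s_grade'[OF sp_grade[OF a2(1) refl]]) auto
    show "d' \<in> ggrade C (m + 4 + 2)"
      unfolding d'_def by (intro s_grade'[OF sp_grade[OF a3(1) refl]]) auto
    show "gbd C d = q4" unfolding q4 d_def using y(8,9) a2(2) a3(2) spb by (simp add: nf)
    show "gbd C d' = gadd C d (gj C d)" unfolding d_def d'_def using y(8,9) a2(2) a3(2) spb by (simp add: nf)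
    show "gs C d = gadd C d' (gj C d')" unfolding d_def d'_def by (simp add: nf)
    show "gs C (gj C d) = gadd C (gj C d') (gj C (gj C d'))" unfolding d_def d'_def by (simp add: nf)
    show "gs C d' = gzero C" "gs C (gj C d') = gzero C" unfolding d'_def by (simp_all add: nf)
  qed
qed

end

lemma hpk_push:
  assumes "hcx4 A" "hcx4 T" "hchain A T D f" "hpk A m q0 y1 y2 y3 q4"
  shows "hpk T (m + D) (f q0) (f y1) (f y2) (f y3) (f q4)"
proof -
  interpret A: hcx4 A by fact
  interpret T: hcx4 T by fact
  note f = hchain_simps[OF assms(3)] hmapD(3)[OF hchainD(1)[OF assms(3)]]
  have f0: "f (gzero A) = gzero T"
    by (rule addf_zero[OF A.vsp_axioms T.vsp_axioms hmapD(1)[OF hchainD(1)[OF assms(3)]]])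
  have sp: "x \<in> gcar A \<Longrightarrow> f (sp A x) = sp T (f x)" for x
    unfolding sp_def by (simp add: f)
  have y: "q0 \<in> ggrade A m" "y1 \<in> ggrade A (m + 1)" "y2 \<in> ggrade A (m + 2)" "y3 \<in> ggrade A (m + 3)"
    "q4 \<in> ggrade A (m + 4)" "gbd A y1 = q0" "gbd A y2 = gadd A y1 (gj A y1)"
    "gbd A y3 = gadd A (gs A y1) (gadd A y2 (gj A y2))"
    "gs A (sp A y2) = gzero A" "gs A (sp A y3) = gzero A"
    "gadd A (gs A (gadd A y3 (gj A y3))) (sp A (gadd A y3 (gj A y3))) = q4"
    using assms(4) unfolding hpk_def by auto
  then have c: "q0 \<in> gcar A" "y1 \<in> gcar A" "y2 \<in> gcar A" "y3 \<in> gcar A" by auto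
  have "f (gs A (sp A y2)) = gzero T" "f (gs A (sp A y3)) = gzero T" using y f0 by auto
  then have s0: "gs T (sp T (f y2)) = gzero T" "gs T (sp T (f y3)) = gzero T" using c by (simp_all add: f sp)
  show ?thesis unfolding hpk_def
  proof (intro conjI s0)
    show "f q0 \<in> ggrade T (m + D)" using f(6)[OF y(1)] .
    show "f y1 \<in> ggrade T (m + D + 1)" "f y2 \<in> ggrade T (m + D + 2)" "f y3 \<in> ggrade T (m + D + 3)"
      "f q4 \<in> ggrade T (m + D + 4)"
      using f(6)[OF y(2)] f(6)[OF y(3)] f(6)[OF y(4)] f(6)[OF y(5)] by (simp_all add: algebra_simps)
    show "gbd T (f y1) = f q0" using y(6) c by (simp flip: f(5))
    show "gbd T (f y2) = gadd T (f y1) (gj T (f y1))" using y(7) c by (simp add: f flip: f(5))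
    show "gbd T (f y3) = gadd T (gs T (f y1)) (gadd T (f y2) (gj T (f y2)))"
      using y(8) c by (simp add: f flip: f(5))
    show "gadd T (gs T (gadd T (f y3) (gj T (f y3)))) (sp T (gadd T (f y3) (gj T (f y3)))) = f q4"
      using c y(11)[symmetric] by (simp add: f sp)
  qed
qed

text \<open>Linearity lets \<open>nul_top\<close> treat the difference of two packages as a single
  one.\<close>

lemma hpk_add:
  assumes "hcx4 T" "hpk T m q0 y1 y2 y3 q4" "hpk T m p0 z1 z2 z3 p4"
  shows "hpk T m (gadd T q0 p0) (gadd T y1 z1) (gadd T y2 z2) (gadd T y3 z3) (gadd T q4 p4)"
proof -
  interpret T: hcx4 T by fact
  have y: "q0 \<in> ggrade T m" "y1 \<in> ggrade T (m + 1)" "y2 \<in> ggrade T (m + 2)" "y3 \<in> ggrade T (m + 3)"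
     "q4 \<in> ggrade T (m + 4)" "p0 \<in> ggrade T m" "z1 \<in> ggrade T (m + 1)" "z2 \<in> ggrade T (m + 2)"
     "z3 \<in> ggrade T (m + 3)" "p4 \<in> ggrade T (m + 4)"
    using assms(2,3) unfolding hpk_def by auto
  then have c: "q0 \<in> gcar T" "y1 \<in> gcar T" "y2 \<in> gcar T" "y3 \<in> gcar T" "q4 \<in> gcar T"
     "p0 \<in> gcar T" "z1 \<in> gcar T" "z2 \<in> gcar T" "z3 \<in> gcar T" "p4 \<in> gcar T" by auto
  have e: "q4 = gadd T (gs T (gadd T y3 (gj T y3))) (sp T (gadd T y3 (gj T y3)))"
    "p4 = gadd T (gs T (gadd T z3 (gj T z3))) (sp T (gadd T z3 (gj T z3)))"
    using assms(2,3) unfolding hpk_def by auto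
  show ?thesis
    using assms(2,3) y c unfolding hpk_def
    by (intro conjI T.grade_add) (simp_all add: T.ac e[simplified c])
qed

section \<open>Iterated suspensions with the inclusions of their top and bottom cells\<close>

definition emb :: "'v gcx \<Rightarrow> 'v \<Rightarrow> 'b list \<Rightarrow> 'v" where
  "emb C x = (\<lambda>w. if w = [] then x else gzero C)"

lemma emb_nil [simp]: "emb C x [] = x" by (simp add: emb_def)

lemma emb_inj [simp]: "emb C x = emb C y \<longleftrightarrow> x = y"
  by (metis emb_nil)

lemma gembed_sel:
  "gcar (gembed C) = emb C ` gcar C" "gzero (gembed C) = emb C (gzero C)"
  "gadd (gembed C) g h = emb C (gadd C (g []) (h []))"
  "ggrade (gembed C) n = emb C ` ggrade C n"
  "gbd (gembed C) g = emb C (gbd C (g []))"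
  "gs (gembed C) g = emb C (gs C (g []))"
  "gj (gembed C) g = emb C (gj C (g []))"
  "gfix (gembed C) = emb C ` gfix C"
  by (auto simp: gembed_def emb_def fun_eq_iff image_def)

lemma hcx4_gembed:
  assumes "hcx4 C" shows "hcx4 (gembed C :: ('b list \<Rightarrow> 'v) gcx)"
proof -
  interpret hcx4 C by fact
  show ?thesis
    by unfold_locales
      (auto simp: gembed_sel ac bd_j bd_s s_j_s_j intro: s_j_j)
qed

lemma qi_gembed:
  assumes "hcx4 C" shows "qi C (gembed C :: ('b list \<Rightarrow> 'v) gcx) 0 (emb C)"
proof -
  interpret hcx4 C by fact
  show ?thesis
    unfolding qi_def hchain_def hmap_def addf_def additive_on_def
    by (auto simp: gembed_sel)
      (metis (no_types, lifting) add_0_right bd_zero diff_zero grade_car grade_zero)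
qed

abbreviation Rn :: "nat \<Rightarrow> 'v gcx \<Rightarrow> (sbasis list \<Rightarrow> 'v) gcx" where
  "Rn M Z \<equiv> (susp C_Rt ^^ M) (gembed Z)"

abbreviation Hn :: "nat \<Rightarrow> (sbasis list \<Rightarrow> 'v) gcx \<Rightarrow> (sbasis list \<Rightarrow> 'v) gcx" where
  "Hn N X \<equiv> (susp C_H ^^ N) X"

lemma hcx4_Rn: "hcx4 Z \<Longrightarrow> hcx4 (Rn M Z)"
  by (induction M) (auto intro: hcx4_gembed hcx4_Rt hcx4.axioms)

lemma hcx4_Hn: "hcx4 X \<Longrightarrow> hcx4 (Hn N X)"
  by (induction N) (auto intro: suspH.hcx4_H suspHI hcx4.axioms)

primrec iR :: "'v gcx \<Rightarrow> nat \<Rightarrow> 'v \<Rightarrow> sbasis list \<Rightarrow> 'v" where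
  "iR Z 0 x = emb Z x"
| "iR Z (Suc M) x = suspc.utn C_Rt (Rn M Z) {RC1, RJC1} (iR Z M x)"

primrec iH :: "(sbasis list \<Rightarrow> 'v) gcx \<Rightarrow> nat \<Rightarrow> (sbasis list \<Rightarrow> 'v) \<Rightarrow> (sbasis list \<Rightarrow> 'v)" where
  "iH X 0 x = x"
| "iH X (Suc N) x = suspc.utn C_H (Hn N X) uH (iH X N x)"

lemma qi_iR: "hcx4 Z \<Longrightarrow> qi Z (Rn M Z) (int M) (iR Z M)"
proof (induction M)
  case 0
  have "iR Z 0 = emb Z" by (rule ext) simp
  with 0 show ?case using qi_gembed[of Z] by simp
next
  case (Suc M)
  have e: "iR Z (Suc M) = (\<lambda>x. suspc.utn C_Rt (Rn M Z) {RC1, RJC1} (iR Z M x))" by (rule ext) simp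
  have h: "hcx Z" "hcx (Rn M Z)" "hcx (Rn (Suc M) Z)"
    using Suc hcx4_Rn[of Z M] hcx4_Rn[of Z "Suc M"] hcx4.axioms by auto
  show ?case unfolding e
    using qi_comp[OF h Suc.IH[OF Suc.prems], of 1] qi_Rt[OF h(2)] by (simp add: algebra_simps)
qed

lemma qi_id:
  assumes "hcx X" shows "qi X X 0 (\<lambda>x. x)"
proof -
  interpret hcx X by fact
  show ?thesis
    unfolding qi_def hchain_def hmap_def addf_def additive_on_def
  proof (intro conjI allI ballI impI)
    fix m q assume "q \<in> ggrade X m" "gbd X q = gzero X"
    then show "\<exists>w\<in>ggrade X (m - 0). \<exists>a\<in>ggrade X (m + 1). gbd X w = gzero X \<and> q = gadd X w (gbd X a)"
      by (intro bexI[of _ q] bexI[of _ "gzero X"]) auto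
  qed auto
qed

lemma qi_iH: "hcx4 X \<Longrightarrow> qi X (Hn N X) (4 * int N) (iH X N)"
proof (induction N)
  case 0
  have "iH X 0 = (\<lambda>x. x)" by (rule ext) simp
  with 0 show ?case using qi_id[of X] hcx4.axioms by auto
next
  case (Suc N)
  have e: "iH X (Suc N) = (\<lambda>x. suspc.utn C_H (Hn N X) uH (iH X N x))" by (rule ext) simp
  have h: "hcx X" "hcx (Hn N X)" "hcx (Hn (Suc N) X)"
    using Suc hcx4_Hn[of X N] hcx4_Hn[of X "Suc N"] hcx4.axioms by auto
  show ?case unfolding e
    using qi_comp[OF h Suc.IH[OF Suc.prems], of 4] suspH.qi_H[OF suspHI[OF h(2)]] by (simp add: algebra_simps)
qed

context suspH
begin

lemma hchain_r0: "hchain X S 0 (tn C_H X HR0)"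
  unfolding hchain_def hmap_def
  using addf_tn[of HR0] H_bd H_j H_s by (auto simp: C_H_sel intro!: tn_grade)

lemma hpk_tn:
  assumes p: "p \<in> ggrade X m" "gj X p = p" "gs X p = gzero X" "gbd X p = gzero X"
  shows "hpk S m (tn C_H X HR0 p) (tn C_H X (HY 1 False 0) p) (tn C_H X (HY 2 False 0) p)
     (tn C_H X (HY 3 False 0) p) (utn uH p)"
proof -
  have [simp]: "p \<in> gcar X" using p by auto
  show ?thesis
    unfolding hpk_def
  proof (intro conjI)
    show "utn uH p \<in> ggrade S (m + 4)"
      unfolding utn_def by (rule hcx.grade_gsum[OF hcx_H], rule tn_grade[OF _ p(1)]) (auto simp: C_H_sel)
  qed (simp_all add: p H_bd H_j H_s sp_def utn_def C_H_sel S.ac tn_grade[OF _ p(1)]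
        numeral_2_eq_2[symmetric] del: One_nat_def)
qed

end

text \<open>Tensoring with the bottom cell \<open>r_0\<close> in \<open>k\<close> further
  quaternionic factors; for \<open>n = 0\<close> it carries the fixed-point set onto that of the
  suspension.\<close>

primrec rr :: "(sbasis list \<Rightarrow> 'v) gcx \<Rightarrow> nat \<Rightarrow> nat \<Rightarrow> (sbasis list \<Rightarrow> 'v) \<Rightarrow> (sbasis list \<Rightarrow> 'v)" where
  "rr X n 0 g = g"
| "rr X n (Suc k) g = tn C_H (Hn (n + k) X) HR0 (rr X n k g)"

lemma hchain_id: "hchain X X 0 (\<lambda>x. x)"
  by (auto simp: hchain_def hmap_def addf_def additive_on_def)

lemma hchain_rr: "hcx4 X \<Longrightarrow> hchain (Hn n X) (Hn (n + k) X) 0 (rr X n k)"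
proof (induction k)
  case 0
  have "rr X n 0 = (\<lambda>g. g)" by (rule ext) simp
  then show ?case using hchain_id[of "Hn n X"] by simp
next
  case (Suc k)
  have e: "rr X n (Suc k) = (\<lambda>g. tn C_H (Hn (n + k) X) HR0 (rr X n k g))" by (rule ext) simp
  have h: "hcx (Hn (n + k) X)" using Suc hcx4_Hn hcx4.axioms by blast
  show ?case unfolding e
    using hchain_comp[OF Suc.IH[OF Suc.prems] suspH.hchain_r0[OF suspHI[OF h]]] by simp
qed

text \<open>The bottom cell of factor \<open>n + 1\<close> may be counted with the first factors or
  with the remaining ones, which links consecutive stages of \<open>nul_top\<close>.\<close>

lemma rr_shift: "rr X (Suc n) k (tn C_H (Hn n X) HR0 g) = rr X n (Suc k) g"
  by (induction k) simp_all

lemma rr_inj: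
  assumes "hcx4 X" "rr X n k g = rr X n k h" shows "g = h"
  using assms(2)
proof (induction k)
  case (Suc k)
  interpret H: suspH "Hn (n + k) X"
    using assms(1) hcx4_Hn hcx4.axioms by (intro suspHI) blast
  show ?case using Suc by (simp add: H.tn_inj)
qed simp

lemma iH_inv:
  assumes "hcx4 X" "p \<in> ggrade X m" "gj X p = p" "gs X p = gzero X" "gbd X p = gzero X"
  shows "iH X n p \<in> ggrade (Hn n X) (m + 4 * int n)" "gj (Hn n X) (iH X n p) = iH X n p"
    "gs (Hn n X) (iH X n p) = gzero (Hn n X)" "gbd (Hn n X) (iH X n p) = gzero (Hn n X)"
proof -
  interpret hcx4 X by fact
  have q: "hchain X (Hn n X) (4 * int n) (iH X n)" using qi_hchain qi_iH assms(1) by blast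
  interpret H: hcx4 "Hn n X" using hcx4_Hn assms(1) by blast
  have z: "iH X n (gzero X) = gzero (Hn n X)"
    by (rule addf_zero[OF vsp_axioms H.vsp_axioms hmapD(1)[OF hchainD(1)[OF q]]])
  have p: "p \<in> gcar X" using assms by auto
  show "iH X n p \<in> ggrade (Hn n X) (m + 4 * int n)"
    using hmapD(3)[OF hchainD(1)[OF q] assms(2)] .
  show "gj (Hn n X) (iH X n p) = iH X n p" "gs (Hn n X) (iH X n p) = gzero (Hn n X)"
    "gbd (Hn n X) (iH X n p) = gzero (Hn n X)"
    using p z assms by (simp_all flip: hchain_simps[OF q])
qed

text \<open>The class \<open>p\<close> is moved from \<open>r\<^sub>0 \<otimes> \<dots> \<otimes> r\<^sub>0 \<otimes> p\<close>, which \<open>F\<close> sends to its counterpart, to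
  \<open>u \<otimes> \<dots> \<otimes> u \<otimes> p\<close> one factor at a time.\<close>

lemma nul_top:
  assumes X: "hcx4 X" "hcx4 X'" and F: "hchain (Hn N X) (Hn N X') 0 F"
    and p: "p \<in> ggrade X m" "gj X p = p" "gs X p = gzero X" "gbd X p = gzero X"
    and p': "p' \<in> ggrade X' m" "gj X' p' = p'" "gs X' p' = gzero X'" "gbd X' p' = gzero X'"
    and Fp: "F (rr X 0 N p) = rr X' 0 N p'"
    and ac: "acyc (Hn N X') (m + 4 * int N)"
  shows "nul (Hn N X') (m + 4 * int N) (gadd (Hn N X') (F (iH X N p)) (iH X' N p'))"
proof -
  interpret Q: hcx4 "Hn N X'" using X hcx4_Hn by blast
  have "nul (Hn N X') (m + 4 * int n)
     (gadd (Hn N X') (F (rr X n (N - n) (iH X n p))) (rr X' n (N - n) (iH X' n p')))" if "n \<le> N" for n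
    using that
  proof (induction n)
    case 0
    have "rr X' 0 N p' \<in> ggrade (Hn N X') m"
      using hmapD(3)[OF hchainD(1)[OF hchain_rr[OF X(2), of 0 N]], of p' m] p' by simp
    then have e: "gadd (Hn N X') (F (rr X 0 N p)) (rr X' 0 N p') = gzero (Hn N X')"
      using Fp by auto
    show ?case
      using e unfolding nul_def
      by (auto intro!: bexI[of _ "gzero (Hn N X')"])
  next
    case (Suc n)
    define k where "k = N - Suc n"
    have k: "N - n = Suc k" "N = Suc n + k" using Suc by (auto simp: k_def)
    have pk: "hpk (Hn (Suc n) Y) (m + 4 * int n) (tn C_H (Hn n Y) HR0 (iH Y n q))
        (tn C_H (Hn n Y) (HY 1 False 0) (iH Y n q)) (tn C_H (Hn n Y) (HY 2 False 0) (iH Y n q))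
        (tn C_H (Hn n Y) (HY 3 False 0) (iH Y n q)) (iH Y (Suc n) q)"
      if "hcx4 Y" "q \<in> ggrade Y m" "gj Y q = q" "gs Y q = gzero Y" "gbd Y q = gzero Y"
      for Y :: "(sbasis list \<Rightarrow> 'c) gcx" and q
    proof -
      interpret H: suspH "Hn n Y" using that hcx4_Hn hcx4.axioms by (intro suspHI) blast
      show ?thesis using H.hpk_tn[OF iH_inv[OF that, of n]] by simp
    qed
    have h: "hchain (Hn (Suc n) X) (Hn N X') 0 (\<lambda>g. F (rr X (Suc n) k g))"
      using hchain_comp[OF hchain_rr[OF X(1), of "Suc n" k] F[unfolded k(2)]] unfolding k(2) by simp
    have h': "hchain (Hn (Suc n) X') (Hn N X') 0 (rr X' (Suc n) k)"
      using hchain_rr[OF X(2), of "Suc n" k] unfolding k(2) .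
    \<comment> \<open>The package of factor \<open>n + 1\<close> lives in the first
      \<open>Suc n\<close> factors; \<open>F\<close> after \<open>rr\<close> transports it to the
      full suspension. Its first entry is then the class of stage \<open>n\<close> and its last
      entry the class of stage \<open>Suc n\<close>.\<close>
    have 1: "hpk (Hn N X') (m + 4 * int n) (F (rr X n (Suc k) (iH X n p)))
        (F (rr X (Suc n) k (tn C_H (Hn n X) (HY 1 False 0) (iH X n p))))
        (F (rr X (Suc n) k (tn C_H (Hn n X) (HY 2 False 0) (iH X n p))))
        (F (rr X (Suc n) k (tn C_H (Hn n X) (HY 3 False 0) (iH X n p))))
        (F (rr X (Suc n) k (iH X (Suc n) p)))"
      using hpk_push[OF hcx4_Hn[OF X(1)] hcx4_Hn[OF X(2)] h pk[OF X(1) p]] unfolding rr_shift by simp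
    have 2: "hpk (Hn N X') (m + 4 * int n) (rr X' n (Suc k) (iH X' n p'))
        (rr X' (Suc n) k (tn C_H (Hn n X') (HY 1 False 0) (iH X' n p')))
        (rr X' (Suc n) k (tn C_H (Hn n X') (HY 2 False 0) (iH X' n p')))
        (rr X' (Suc n) k (tn C_H (Hn n X') (HY 3 False 0) (iH X' n p')))
        (rr X' (Suc n) k (iH X' (Suc n) p'))"
      using hpk_push[OF hcx4_Hn[OF X(2)] hcx4_Hn[OF X(2)] h' pk[OF X(2) p']] unfolding rr_shift by simp
    have n: "nul (Hn N X') (m + 4 * int n)
        (gadd (Hn N X') (F (rr X n (Suc k) (iH X n p))) (rr X' n (Suc k) (iH X' n p')))"
      using Suc k by simp
    have ac': "acyc (Hn N X') (m + 4 * int n + 4)"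
      using ac Suc.prems unfolding acyc_def by auto
    show ?case
      using Q.hpk_nul[OF hpk_add[OF Q.hcx4_axioms 1 2] n ac'] k_def by (simp add: algebra_simps)
  qed
  from this[of N] show ?thesis by simp
qed

subsection \<open>Fixed-point sets\<close>

text \<open>The fixed-point set as a complex of its own, so that the results on suspensions and
  quasi-isomorphisms apply to it.\<close>

definition fixc :: "'v gcx \<Rightarrow> 'v gcx" where
  "fixc X = X\<lparr>gcar := gfix X, ggrade := (\<lambda>n. ggrade X n \<inter> gfix X)\<rparr>"

lemma fixc_sel [simp]:
  "gcar (fixc X) = gfix X" "gzero (fixc X) = gzero X" "gadd (fixc X) = gadd X"
  "ggrade (fixc X) n = ggrade X n \<inter> gfix X" "gbd (fixc X) = gbd X" "gs (fixc X) = gs X"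
  "gj (fixc X) = gj X" "gfix (fixc X) = gfix X"
  by (simp_all add: fixc_def)

lemma gsum_fixc [simp]: "gsum (fixc X) = gsum X"
  by (intro ext) (simp add: gsum_def)

definition fixok :: "'v gcx \<Rightarrow> bool" where
  "fixok X \<longleftrightarrow> gfix X \<subseteq> gcar X \<and> gzero X \<in> gfix X \<and>
     (\<forall>x\<in>gfix X. \<forall>y\<in>gfix X. gadd X x y \<in> gfix X) \<and>
     (\<forall>x\<in>gfix X. gbd X x \<in> gfix X \<and> gj X x \<in> gfix X \<and> gs X x = gzero X \<and> gj X (gj X x) = x)"

lemma hcx4_fixc:
  assumes "hcx4 X" "fixok X" shows "hcx4 (fixc X)"
proof -
  interpret hcx4 X by fact
  have a: "x \<in> gfix X \<Longrightarrow> x \<in> gcar X" for x using assms(2) by (auto simp: fixok_def)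
  show ?thesis
    using assms(2) unfolding fixok_def
    by unfold_locales (auto simp: a ac bd_j bd_s)
qed

lemma emb_fixc [simp]: "emb (fixc Z) = emb Z"
  by (simp add: emb_def fun_eq_iff)

lemma gembed_fixc: "gembed (fixc Z) = fixc (gembed Z)"
  by (intro gcx.equality ext) (auto simp: gembed_sel)

lemma tn_fixc [simp]: "tn Cm (fixc X) = tn Cm X"
  by (intro ext) (simp add: tn_def smk_def split: list.split)

text \<open>Every cell of \<open>C_Rt\<close> is fixed, so passing to fixed points commutes with
  this suspension; of \<open>C_H\<close> only \<open>r_0\<close> survives, see
  \<open>gfix_H\<close>.\<close>

lemma susp_Rt_fixc:
  assumes "hcx X"
  shows "susp C_Rt (fixc X) = fixc (susp C_Rt X)"
proof -
  interpret R: suspc C_Rt X by (rule suspc.intro[OF cmod_Rt assms])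
  have s: "smk A (fixc X) = smk A X" for A :: "sbasis set"
    by (intro ext) (simp add: smk_def split: list.split)
  have o: "sadd C_Rt (fixc X) = sadd C_Rt X" "sT C_Rt (fixc X) = sT C_Rt X" "sU C_Rt (fixc X) = sU C_Rt X"
    by (intro ext, simp add: sadd_def sT_def sU_def s)+
  have f: "b \<in> mbasis C_Rt \<Longrightarrow> b \<in> mfix C_Rt" for b by (auto simp: C_Rt_def)
  have fx: "gfix (susp C_Rt X) = {smk R.B X f | f. \<forall>b\<in>R.B. f b \<in> gfix X}"
    unfolding R.S_sel using f by auto
  have "ggrade (susp C_Rt (fixc X)) n = ggrade (fixc (susp C_Rt X)) n" for n
    unfolding fixc_sel fx unfolding R.S_sel
    by (auto simp: susp_def s R.smk_eq)
  moreover have "gcar (susp C_Rt (fixc X)) = gfix (susp C_Rt X)"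
    unfolding fx by (auto simp: susp_def s)
  moreover have "gfix (susp C_Rt (fixc X)) = gfix (susp C_Rt X)"
    unfolding fx using f by (auto simp: susp_def s)
  ultimately show ?thesis
    by (intro gcx.equality ext) (auto simp: susp_def s o)
qed

lemma Rn_fixc: "hcx4 Z \<Longrightarrow> Rn M (fixc Z) = fixc (Rn M Z)"
proof (induction M)
  case (Suc M)
  then show ?case using susp_Rt_fixc[of "Rn M Z"] hcx4_Rn[of Z M] hcx4.axioms by auto
qed (simp add: gembed_fixc)

lemma iR_fixc:
  assumes "hcx4 Z" "hcx4 (fixc Z)" shows "iR (fixc Z) M x = iR Z M x"
proof (induction M)
  case 0
  show ?case by (simp add: emb_def fun_eq_iff)
next
  case (Suc M)
  have h: "hcx (Rn M Z)" "hcx (Rn M (fixc Z))" using assms hcx4_Rn hcx4.axioms by blast+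
  interpret R: suspc C_Rt "Rn M Z" by (rule suspc.intro[OF cmod_Rt h(1)])
  interpret R': suspc C_Rt "Rn M (fixc Z)" by (rule suspc.intro[OF cmod_Rt h(2)])
  show ?case
    unfolding iR.simps Suc R.utn_def R'.utn_def
    by (simp add: Rn_fixc[OF assms(1)] susp_Rt_fixc[OF h(1)])
qed

lemma gfix_H:
  assumes "hcx X" shows "gfix (susp C_H X) = tn C_H X HR0 ` gfix X"
proof -
  interpret H: suspH X by (rule suspHI[OF assms])
  have m: "b \<in> mfix C_H \<longleftrightarrow> b = HR0" for b by (simp add: C_H_def)
  show ?thesis
  proof (intro equalityI subsetI)
    fix y assume "y \<in> gfix (susp C_H X)"
    then obtain f where f: "y = smk H.B X f" "\<forall>b\<in>H.B. f b \<in> (if b = HR0 then gfix X else {gzero X})"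
      unfolding H.S_sel m by auto
    have "y = tn C_H X HR0 (f HR0)"
      unfolding f(1) tn_def by (rule H.smk_cong) (use f(2) in auto)
    then show "y \<in> tn C_H X HR0 ` gfix X" using f(2)[rule_format, of HR0] by auto
  next
    fix y assume "y \<in> tn C_H X HR0 ` gfix X"
    then show "y \<in> gfix (susp C_H X)" unfolding H.S_sel m tn_def by force
  qed
qed

lemma gfix_Hn: "hcx4 X \<Longrightarrow> gfix (Hn N X) = rr X 0 N ` gfix X"
proof (induction N)
  case (Suc N)
  then show ?case using gfix_H[of "Hn N X"] hcx4_Hn[of X N] hcx4.axioms by (auto simp: image_image)
qed simp

lemma rr_grade_iff:
  assumes "hcx4 X" "g \<in> gcar X" "rr X 0 N g \<in> ggrade (Hn N X) m"
  shows "g \<in> ggrade X m"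
  using assms(3)
proof (induction N)
  case (Suc N)
  interpret H: suspH "Hn N X"
    using assms(1) hcx4_Hn hcx4.axioms by (intro suspHI) blast
  have "scomp (tn C_H (Hn N X) HR0 (rr X 0 N g)) HR0 \<in> ggrade (Hn N X) (m - mdeg C_H HR0)"
    using Suc.prems by (intro H.scomp_grade) auto
  then show ?case using Suc.IH by (simp add: H.scomp_tn C_H_sel)
qed simp

definition hinj :: "'v gcx \<Rightarrow> 'w gcx \<Rightarrow> ('v \<Rightarrow> 'w) \<Rightarrow> bool" where
  "hinj A B f \<longleftrightarrow> (\<forall>m. \<forall>r\<in>ggrade A m. \<forall>y\<in>ggrade B (m + 1). gbd A r = gzero A \<and> f r = gbd B y \<longrightarrow>
      (\<exists>x\<in>ggrade A (m + 1). r = gbd A x))"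

text \<open>For a cycle \<open>r\<close> with \<open>f r = \<partial>y\<close>, the homotopy gives
  \<open>g (\<partial>y) = r + \<partial>(h r)\<close>, hence
  \<open>r = \<partial>(g y + h r)\<close>.\<close>

lemma fix_he_hinj:
  assumes "hcx A" "fixok A" "fix_he A B f"
  shows "hinj (fixc A) (fixc B) f"
proof -
  interpret A: hcx A by fact
  obtain g h where g: "\<forall>y\<in>gfix B. g y \<in> gfix A" "\<forall>n. \<forall>y\<in>gfix B \<inter> ggrade B n. g y \<in> ggrade A n"
     "\<forall>y\<in>gfix B. g (gbd B y) = gbd A (g y)"
    and h: "\<forall>x\<in>gfix A. h x \<in> gfix A" "additive_on A A (gfix A) h"
      "\<forall>n. \<forall>x\<in>gfix A \<inter> ggrade A n. h x \<in> ggrade A (n + 1)"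
    and gf: "\<forall>x\<in>gfix A. g (f x) = gadd A x (gadd A (gbd A (h x)) (h (gbd A x)))"
    using assms(3) unfolding fix_he_def by blast
  have fa: "gfix A \<subseteq> gcar A" "gzero A \<in> gfix A" "\<And>x y. x \<in> gfix A \<Longrightarrow> y \<in> gfix A \<Longrightarrow> gadd A x y \<in> gfix A"
    "\<And>x. x \<in> gfix A \<Longrightarrow> gbd A x \<in> gfix A"
    using assms(2) by (auto simp: fixok_def)
  have "h (gzero A) = h (gadd A (gzero A) (gzero A))" by simp
  also have "\<dots> = gadd A (h (gzero A)) (h (gzero A))" using h(2)[unfolded additive_on_def, rule_format, OF fa(2) fa(2)] .
  also have "\<dots> = gzero A" using h fa by auto
  finally have h0: "h (gzero A) = gzero A" .
  show ?thesis unfolding hinj_def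
  proof (intro allI ballI impI)
    fix m r y
    assume r: "r \<in> ggrade (fixc A) m" and y: "y \<in> ggrade (fixc B) (m + 1)"
      and e: "gbd (fixc A) r = gzero (fixc A) \<and> f r = gbd (fixc B) y"
    have rf: "r \<in> gfix A" "y \<in> gfix B" using r y by auto
    have hr: "h r \<in> gfix A" "g y \<in> gfix A" "h r \<in> ggrade A (m + 1)" "g y \<in> ggrade A (m + 1)"
      using h g r y by auto
    have c: "r \<in> gcar A" "gbd A (h r) \<in> gcar A" "gbd A (g y) \<in> gcar A" "g y \<in> gcar A" "h r \<in> gcar A"
      using rf hr fa by blast+
    have "gbd A (g y) = gadd A r (gadd A (gbd A (h r)) (gzero A))"
      using gf rf e g(3) h0 by auto
    then have "r = gadd A (gbd A (g y)) (gbd A (h r))"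
      using c by (simp add: A.ac)
    then have "r = gbd A (gadd A (g y) (h r))" using c by simp
    then show "\<exists>x\<in>ggrade (fixc A) (m + 1). r = gbd (fixc A) x"
      using hr fa by (intro bexI[of _ "gadd A (g y) (h r)"]) auto
  qed
qed

section \<open>The algebraic Borsuk--Ulam argument\<close>

text \<open>For every cycle \<open>z\<close>, the element \<open>(1 + j)z\<close> bounds inside the
  image of \<open>1 + j\<close>. Fixed-point sets have this property because their homology is
  generated by an invariant class.\<close>

definition cyc :: "'v gcx \<Rightarrow> bool" where
  "cyc T \<longleftrightarrow> (\<forall>m. \<forall>z\<in>ggrade T m. gbd T z = gzero T \<longrightarrow>
     (\<exists>a\<in>ggrade T (m + 1). gadd T z (gj T z) = gbd T (gadd T a (gj T a))))"

lemma cyc_qi: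
  assumes "hcx W" "hcx X" "qi W X D f" "cyc W"
  shows "cyc X"
  unfolding cyc_def
proof (intro allI impI ballI)
  interpret W: hcx W by fact
  interpret X: hcx X by fact
  note f = hchain_simps[OF qi_hchain[OF assms(3)]] hmapD(3)[OF hchainD(1)[OF qi_hchain[OF assms(3)]]]
  fix m z assume z: "z \<in> ggrade X m" "gbd X z = gzero X"
  then obtain w a where w: "w \<in> ggrade W (m - D)" "a \<in> ggrade X (m + 1)" "gbd W w = gzero W"
    "z = gadd X (f w) (gbd X a)"
    using qi_surj[OF assms(3)] by blast
  obtain w' where w': "w' \<in> ggrade W (m - D + 1)" "gadd W w (gj W w) = gbd W (gadd W w' (gj W w'))"
    using assms(4) w unfolding cyc_def by blast
  have c: "w \<in> gcar W" "w' \<in> gcar W" "a \<in> gcar X" using w w' by auto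
  have "gadd X (f w) (gj X (f w)) = f (gadd W w (gj W w))" using c by (simp add: f)
  also have "\<dots> = gadd X (gbd X (f w')) (gbd X (gj X (f w')))"
    unfolding w' using c by (simp add: f W.bd_j X.bd_j)
  finally have e: "gadd X (f w) (gj X (f w)) = gadd X (gbd X (f w')) (gbd X (gj X (f w')))" .
  have "gadd X z (gj X z) = gadd X (gadd X (f w) (gj X (f w))) (gadd X (gbd X a) (gj X (gbd X a)))"
    unfolding w(4) using c f(1) by (simp add: X.ac)
  also have "\<dots> = gbd X (gadd X (gadd X (f w') a) (gj X (gadd X (f w') a)))"
    unfolding e using c f(1) by (simp add: X.bd_j X.ac)
  finally have "gadd X z (gj X z) = gbd X (gadd X (gadd X (f w') a) (gj X (gadd X (f w') a)))" .
  moreover have "gadd X (f w') a \<in> ggrade X (m + 1)"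
    using f(6)[OF w'(1)] w by simp
  ultimately show "\<exists>a\<in>ggrade X (m + 1). gadd X z (gj X z) = gbd X (gadd X a (gj X a))" by blast
qed

text \<open>The algebraic Borsuk--Ulam argument: \<open>nbd T F m g\<close> is passed along a chain
  \<open>g = \<partial>e, (1 + j)e = \<partial>e', \<dots>\<close> from the bottom to the top of the fixed-point set.\<close>

definition nbd :: "'w gcx \<Rightarrow> ('v \<Rightarrow> 'w) \<Rightarrow> int \<Rightarrow> 'v \<Rightarrow> bool" where
  "nbd T F m g \<longleftrightarrow> (\<exists>a\<in>ggrade T (m + 1). F g = gbd T (gadd T a (gj T a)))"

text \<open>If \<open>F (\<partial>e) = \<partial>(1 + j)a\<close>, then
  \<open>F e + (1 + j)a\<close> is a cycle, and \<open>1 + j\<close> maps it to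
  \<open>(1 + j) F e\<close> because \<open>(1 + j)^2 = 1 + j^2 = 0\<close>; now \<open>cyc\<close>
  applies.\<close>

lemma nbd_step:
  assumes "hcx A" "hcx T" "\<And>y. y \<in> gcar T \<Longrightarrow> gj T (gj T y) = y" "cyc T" "hchain A T D F"
    and e: "e \<in> ggrade A k" "nbd T F m (gbd A e)" "m = k + D - 1"
  shows "nbd T F (m + 1) (gadd A e (gj A e))"
proof -
  interpret A: hcx A by fact
  interpret T: hcx T by fact
  note f = hchain_simps[OF assms(5)] hmapD(3)[OF hchainD(1)[OF assms(5)]]
  obtain a where a: "a \<in> ggrade T (m + 1)" "F (gbd A e) = gbd T (gadd T a (gj T a))"
    using e by (auto simp: nbd_def)
  have c: "e \<in> gcar A" "a \<in> gcar T" "F e \<in> gcar T" using a e f by auto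
  have "F e \<in> ggrade T (m + 1)" using f(6)[OF e(1)] e(3) by simp
  then have "gadd T (F e) (gadd T a (gj T a)) \<in> ggrade T (m + 1)" using a by simp
  moreover have "gbd T (gadd T (F e) (gadd T a (gj T a))) = gzero T"
    using a(2) c by (simp add: f)
  ultimately obtain a' where a': "a' \<in> ggrade T (m + 1 + 1)"
    "gadd T (gadd T (F e) (gadd T a (gj T a))) (gj T (gadd T (F e) (gadd T a (gj T a))))
        = gbd T (gadd T a' (gj T a'))"
    using assms(4) unfolding cyc_def by blast
  have "gadd T (gadd T (F e) (gadd T a (gj T a))) (gj T (gadd T (F e) (gadd T a (gj T a))))
     = F (gadd A e (gj A e))"
    using c assms(3) by (simp add: f T.ac)
  then show ?thesis unfolding nbd_def a'(2)[symmetric] using a' by metis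
qed

lemma C_Rt_deg: "mdeg C_Rt b = (if b = RC0 then 0 else 1)"
  by (simp add: C_Rt_def)

primrec cc :: "'v gcx \<Rightarrow> nat \<Rightarrow> 'v \<Rightarrow> sbasis list \<Rightarrow> 'v" where
  "cc Z 0 x = emb Z x"
| "cc Z (Suc M) x = tn C_Rt (Rn M Z) RC0 (cc Z M x)"

lemma cc_grade: "hcx4 Z \<Longrightarrow> x \<in> ggrade Z m \<Longrightarrow> cc Z M x \<in> ggrade (Rn M Z) m"
proof (induction M)
  case (Suc M)
  interpret R: suspc C_Rt "Rn M Z"
    using Suc hcx4_Rn hcx4.axioms by (intro suspc.intro[OF cmod_Rt]) blast
  show ?case using Suc by (auto intro!: R.tn_grade simp: C_Rt_deg Rt_basis)
qed (simp add: gembed_sel)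

lemma hchain_RC0: "hcx X \<Longrightarrow> hchain X (susp C_Rt X) 0 (tn C_Rt X RC0)"
proof -
  assume X: "hcx X"
  interpret R: suspc C_Rt X by (rule suspc.intro[OF cmod_Rt X])
  show ?thesis
    unfolding hchain_def hmap_def
    using R.addf_tn[of RC0] Rt_bd[OF X] Rt_j[OF X] Rt_s[OF X]
    by (auto simp: C_Rt_deg Rt_basis intro!: R.tn_grade)
qed

text \<open>Each real factor contributes one step with \<open>e = c_1 \<otimes> y\<close>: for an
  invariant cycle \<open>y\<close> its boundary is \<open>c_0 \<otimes> y\<close>, and
  \<open>(1 + j)e\<close> is \<open>(c_1 + j c_1) \<otimes> y\<close>, the class of the next
  stage.\<close>

lemma nbd_iR:
  assumes "hcx4 Z" "hcx T" "\<And>y. y \<in> gcar T \<Longrightarrow> gj T (gj T y) = y" "cyc T" "hchain (Rn M Z) T 0 F"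
    and x: "x \<in> ggrade Z m" "gbd Z x = gzero Z" "gj Z x = x" "F (cc Z M x) = gzero T"
  shows "nbd T F (m + int M) (iR Z M x)"
  using assms(5) x(4)
proof (induction M arbitrary: F)
  case 0
  interpret T: hcx T by fact
  show ?case using 0 unfolding nbd_def by (auto intro!: bexI[of _ "gzero T"])
next
  case (Suc M)
  let ?Y = "Rn M Z"
  interpret Z: hcx4 Z by fact
  interpret Y: hcx4 ?Y using assms hcx4_Rn by blast
  interpret R: suspc C_Rt ?Y by (rule suspc.intro[OF cmod_Rt Y.hcx_axioms])
  let ?y = "iR Z M x"
  have q: "hchain Z ?Y (int M) (iR Z M)" using qi_hchain qi_iR assms(1) by blast
  have z: "iR Z M (gzero Z) = gzero ?Y"
    by (rule addf_zero[OF Z.vsp_axioms Y.vsp_axioms hmapD(1)[OF hchainD(1)[OF q]]])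
  have y: "?y \<in> ggrade ?Y (m + int M)" using hmapD(3)[OF hchainD(1)[OF q] x(1)] .
  have yc: "?y \<in> gcar ?Y" "x \<in> gcar Z" using y x by auto
  have yj: "gj ?Y ?y = ?y" "gbd ?Y ?y = gzero ?Y"
    using yc x z by (simp_all flip: hchain_simps[OF q])
  have h: "hchain ?Y T 0 (\<lambda>g. F (tn C_Rt ?Y RC0 g))"
    using hchain_comp[OF hchain_RC0[OF Y.hcx_axioms], of T 0 F] Suc.prems(1) by simp
  have "nbd T (\<lambda>g. F (tn C_Rt ?Y RC0 g)) (m + int M) ?y"
    using Suc.IH[OF h] Suc.prems(2) by simp
  then have 1: "nbd T F (m + int M) (gbd (Rn (Suc M) Z) (tn C_Rt ?Y RC1 ?y))"
    using yc yj by (simp add: nbd_def Rt_bd[OF Y.hcx_axioms] Rt_basis)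
  have g: "tn C_Rt ?Y RC1 ?y \<in> ggrade (Rn (Suc M) Z) (m + int (Suc M))"
    using y by (auto intro!: R.tn_grade simp: C_Rt_deg Rt_basis)
  have S: "hcx (Rn (Suc M) Z)" using assms hcx4_Rn hcx4.axioms by blast
  have "nbd T F (m + int M + 1) (gadd (Rn (Suc M) Z) (tn C_Rt ?Y RC1 ?y) (gj (Rn (Suc M) Z) (tn C_Rt ?Y RC1 ?y)))"
    by (rule nbd_step[OF S assms(2-4) Suc.prems(1) g 1]) auto
  then show ?case
    using yc yj by (simp add: R.utn_def Rt_j[OF Y.hcx_axioms] Rt_basis algebra_simps)
qed

definition conc :: "'v gcx \<Rightarrow> int \<Rightarrow> int \<Rightarrow> bool" where
  "conc X lo hi \<longleftrightarrow> (\<forall>k. k < lo \<or> hi < k \<longrightarrow> ggrade X k \<subseteq> {gzero X})"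

lemma conc_Rn: "hcx4 Z \<Longrightarrow> conc Z lo hi \<Longrightarrow> conc (Rn M Z) lo (hi + int M)"
proof (induction M)
  case 0
  have "emb Z ` ggrade Z k \<subseteq> {emb Z (gzero Z)}" if "ggrade Z k \<subseteq> {gzero Z}" for k
    using image_mono[OF that, of "emb Z"] by simp
  with 0 show ?case unfolding conc_def by (simp add: gembed_sel) blast
next
  case (Suc M)
  interpret R: suspc C_Rt "Rn M Z"
    using Suc hcx4_Rn hcx4.axioms by (intro suspc.intro[OF cmod_Rt]) blast
  have IH: "conc (Rn M Z) lo (hi + int M)" using Suc by blast
  show ?case unfolding conc_def
  proof (intro allI impI subsetI)
    fix k g assume k: "k < lo \<or> hi + int (Suc M) < k" and g: "g \<in> ggrade (Rn (Suc M) Z) k"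
    have gc: "g \<in> gcar R.S" using g R.grade_S_sub by auto
    have "g = gzero R.S"
    proof (rule R.S_eqI[OF gc])
      fix b assume b: "b \<in> R.B"
      have "mdeg C_Rt b = 0 \<or> mdeg C_Rt b = 1" by (simp add: C_Rt_deg)
      moreover have "scomp g b \<in> ggrade (Rn M Z) (k - mdeg C_Rt b)"
        using R.scomp_grade[of g k b] g b by simp
      moreover have "k - mdeg C_Rt b < lo \<or> hi + int M < k - mdeg C_Rt b"
        using k calculation(1) by auto
      then have "ggrade (Rn M Z) (k - mdeg C_Rt b) \<subseteq> {gzero (Rn M Z)}"
        using IH unfolding conc_def by blast
      ultimately have "scomp g b = gzero (Rn M Z)" by blast
      then show "scomp g b = scomp (gzero R.S) b"
        using b by (simp add: R.S_sel)
    qed simp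
    then show "g \<in> {gzero (Rn (Suc M) Z)}" by simp
  qed
qed

subsection \<open>Complexes of type SWF\<close>

lemma (in vsp) gsum_reindex:
  assumes "inj_on h A" "\<And>i. i \<in> A \<Longrightarrow> f (h i) \<in> gcar C"
  shows "gsum C f (h ` A) = gsum C (\<lambda>i. f (h i)) A"
proof (cases "finite A")
  case True
  then show ?thesis using assms
  proof (induction A)
    case (insert a A)
    then have "gsum C f (insert (h a) (h ` A)) = gadd C (f (h a)) (gsum C f (h ` A))"
      by (intro gsum_insert') auto
    moreover have "gsum C (\<lambda>i. f (h i)) (insert a A) = gadd C (f (h a)) (gsum C (\<lambda>i. f (h i)) A)"
      using insert by (intro gsum_insert') auto
    ultimately show ?case using insert by auto
  qed simp
next
  case False
  then have "infinite (h ` A)" using finite_imageD[OF _ assms(1)] by blast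
  with False show ?thesis by (simp add: gsum_infinite)
qed

locale gcx =
  fixes Z :: "'v gcx"
  assumes gcx: "is_gcx Z"

sublocale gcx \<subseteq> hcx4 Z
  by (rule is_gcx_hcx4[OF gcx])

context gcx
begin

lemma s_j: "x \<in> gcar Z \<Longrightarrow> gs Z (gj Z x) = gj Z (gj Z (gj Z (gs Z x)))"
  using gcx by (auto simp: is_gcx_def)

lemma j_s': "x \<in> gcar Z \<Longrightarrow> gj Z (gs Z x) = gs Z (gj Z (gj Z (gj Z x)))"
  by (simp add: s_j)

lemma hdecomp_ex1: "x \<in> gcar Z \<Longrightarrow> \<exists>!h. hdecomp Z (gcar Z) h x"
  using gcx by (auto simp: is_gcx_def)

lemma hdecompI:
  assumes "finite S" "\<And>i. i \<in> S \<Longrightarrow> f i \<in> ggrade Z (d i)"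
  shows "hdecomp Z (gcar Z) (\<lambda>n. gsum Z f {i \<in> S. d i = n}) (gsum Z f S)"
  unfolding hdecomp_def
proof (intro conjI allI)
  let ?h = "\<lambda>n. gsum Z f {i \<in> S. d i = n}"
  have hc: "?h n \<in> ggrade Z n" for n by (rule grade_gsum) (use assms in auto)
  then show "?h n \<in> ggrade Z n \<inter> gcar Z" for n by auto
  have sub: "{n. ?h n \<noteq> gzero Z} \<subseteq> d ` S"
  proof
    fix n assume n: "n \<in> {n. ?h n \<noteq> gzero Z}"
    show "n \<in> d ` S"
    proof (rule ccontr)
      assume "n \<notin> d ` S"
      then have "{i \<in> S. d i = n} = {}" by auto
      with n show False by simp
    qed
  qed
  then show "finite {n. ?h n \<noteq> gzero Z}" using assms finite_subset by blast
  have "gsum Z f S = gsum Z ?h (d ` S)"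
    by (rule gsum_fibres[symmetric]) (use assms in auto)
  also have "\<dots> = gsum Z ?h {n. ?h n \<noteq> gzero Z}"
    by (rule gsum_mono) (use assms sub hc in auto)
  finally show "gsum Z f S = gsum Z ?h {n. ?h n \<noteq> gzero Z}" .
qed

lemma hdecomp_single:
  assumes "z \<in> ggrade Z m"
  shows "hdecomp Z (gcar Z) (\<lambda>n. if n = m then z else gzero Z) z"
proof -
  have "hdecomp Z (gcar Z) (\<lambda>n. gsum Z (\<lambda>_. z) {i \<in> {0::nat}. m = n}) (gsum Z (\<lambda>_. z) {0::nat})"
    by (rule hdecompI) (use assms in auto)
  moreover have "(\<lambda>n. gsum Z (\<lambda>_. z) {i \<in> {0::nat}. m = n}) = (\<lambda>n. if n = m then z else gzero Z)"
    using assms by (auto simp: fun_eq_iff)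
  moreover have "gsum Z (\<lambda>_. z) {0::nat} = z" using grade_car[OF assms] by simp
  ultimately show ?thesis by simp
qed

text \<open>Grouping the sum by degree is a homogeneous decomposition, and so is the whole sum
  placed in degree \<open>m\<close>; uniqueness identifies the two.\<close>

lemma homog_sum:
  assumes "finite S" "\<And>i. i \<in> S \<Longrightarrow> f i \<in> ggrade Z (d i)" "gsum Z f S \<in> ggrade Z m"
  shows "gsum Z f S = gsum Z f {i \<in> S. d i = m}"
proof -
  have "gsum Z f S \<in> gcar Z" using assms by auto
  then have "(\<lambda>n. gsum Z f {i \<in> S. d i = n}) = (\<lambda>n. if n = m then gsum Z f S else gzero Z)"
    using hdecomp_ex1 hdecompI[of S f d] hdecomp_single[OF assms(3)] assms by blast
  then show ?thesis by (metis (mono_tags, lifting))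
qed

end

text \<open>The generators and the degree shift hidden in \<open>is_swf\<close> become parameters.
  The abbreviation \<open>d\<close> below is the top degree of the fixed-point set.\<close>

locale swf = gcx Z for Z :: "'v gcx" +
  fixes t :: nat and \<sigma> :: int and n :: nat and c x :: "nat \<Rightarrow> 'v" and e :: "nat \<Rightarrow> int"
  assumes c_grade: "i \<le> t \<Longrightarrow> c i \<in> ggrade Z (int i + \<sigma>)"
    and x_grade: "k < n \<Longrightarrow> x k \<in> ggrade Z (e k)"
    and j_j_c: "i \<le> t \<Longrightarrow> gj Z (gj Z (c i)) = c i"
    and s_c: "i \<le> t \<Longrightarrow> gs Z (c i) = gzero Z"
    and j_c0: "gj Z (c 0) = c 0"
    and indep: "S \<subseteq> swf_Ic t \<union> swf_Ix n \<Longrightarrow> gsum Z (swf_gen Z c x) S = gzero Z \<Longrightarrow> S = {}"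
    and car: "gcar Z = gspan Z (swf_gen Z c x) (swf_Ic t \<union> swf_Ix n)"
    and bd_c1: "1 \<le> t \<Longrightarrow> gbd Z (c 1) = c 0"
    and bd_c_raw: "2 \<le> i \<Longrightarrow> i \<le> t - 1 \<Longrightarrow> gbd Z (c i) = gadd Z (c (i - 1)) (gj Z (c (i - 1)))"
    and bd_ct_raw: "2 \<le> t \<Longrightarrow> gadd Z (gbd Z (c t)) (gadd Z (c (t - 1)) (gj Z (c (t - 1))))
                    \<in> gspan Z (swf_gen Z c x) (swf_Ix n)"
    and fix_eq: "gfix Z = gspan Z (swf_gen Z c x) (swf_Ic t)"
    and fix_bd: "r \<in> gfix Z \<Longrightarrow> gbd Z r \<in> gfix Z"
    and susplike: "suspensionlike Z"
begin

abbreviation "g \<equiv> swf_gen Z c x"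
abbreviation "I \<equiv> swf_Ic t \<union> swf_Ix n"
abbreviation "d \<equiv> \<sigma> + int t"

definition bdeg :: "(nat \<times> nat) + (nat \<times> nat \<times> nat) \<Rightarrow> int" where
  "bdeg = case_sum (\<lambda>(i, _). int i + \<sigma>) (\<lambda>(k, a, _). e k + int a)"

lemma bdeg_simps [simp]: "bdeg (Inl (i, l)) = int i + \<sigma>" "bdeg (Inr (k, a, b)) = e k + int a"
  by (simp_all add: bdeg_def)

lemma g_simps: "g (Inl (i, l)) = (gj Z ^^ l) (c i)" "g (Inr (k, a, b)) = (gs Z ^^ a) ((gj Z ^^ b) (x k))"
  by (simp_all add: swf_gen_def)

lemma fin_I: "finite (swf_Ic t)" "finite (swf_Ix n)" "finite I"
proof -
  have "swf_Ic t \<subseteq> Inl ` ({..t} \<times> {..<2})" by (auto simp: swf_Ic_def)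
  then show 1: "finite (swf_Ic t)" by (rule finite_subset) auto
  have "swf_Ix n \<subseteq> Inr ` ({..<n} \<times> {..<2} \<times> {..<4})" by (auto simp: swf_Ix_def)
  then show 2: "finite (swf_Ix n)" by (rule finite_subset) auto
  with 1 show "finite I" by simp
qed

lemma Ic_cases:
  assumes "i \<in> swf_Ic t"
  obtains "i = Inl (0, 0)" | k where "i = Inl (k, 0)" "1 \<le> k" "k \<le> t" | k where "i = Inl (k, 1)" "1 \<le> k" "k \<le> t"
  using assms by (auto simp: swf_Ic_def less_2_cases_iff)

lemma Ix_cases:
  assumes "i \<in> swf_Ix n"
  obtains k b where "i = Inr (k, 0, b)" "k < n" "b < 4" | k b where "i = Inr (k, 1, b)" "k < n" "b < 4"
  using assms by (auto simp: swf_Ix_def less_2_cases_iff)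

lemma j_pow_grade: "z \<in> ggrade Z m \<Longrightarrow> (gj Z ^^ b) z \<in> ggrade Z m"
  by (induction b) auto

lemma g_grade: "i \<in> I \<Longrightarrow> g i \<in> ggrade Z (bdeg i)"
proof (elim UnE)
  assume "i \<in> swf_Ic t"
  then show ?thesis by (cases i rule: Ic_cases) (use c_grade[of 0] in \<open>auto simp: g_simps c_grade\<close>)
next
  assume "i \<in> swf_Ix n"
  then show ?thesis
    by (cases i rule: Ix_cases) (auto simp: g_simps intro!: j_pow_grade s_grade x_grade)
qed

lemma g_car [simp]: "i \<in> I \<Longrightarrow> g i \<in> gcar Z"
  using g_grade by blast

lemma gsum_g_car [simp]: "S \<subseteq> I \<Longrightarrow> gsum Z g S \<in> gcar Z"
  by (rule gsum_closed) auto

lemma sum_eq: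
  assumes "S \<subseteq> I" "S' \<subseteq> I" "gsum Z g S = gsum Z g S'" shows "S = S'"
proof -
  have f: "finite S" "finite S'" using finite_subset[OF assms(1) fin_I(3)] finite_subset[OF assms(2) fin_I(3)] .
  have "gsum Z g (sym_diff S S') = gadd Z (gsum Z g S) (gsum Z g S')"
    by (rule gsum_symdiff[OF f]) (use assms in auto)
  also have "\<dots> = gzero Z" using assms by simp
  finally have "sym_diff S S' = {}" by (rule indep[rotated]) (use assms in auto)
  then show ?thesis by auto
qed

lemma car_ex: "z \<in> gcar Z \<Longrightarrow> \<exists>S\<subseteq>I. z = gsum Z g S"
  unfolding car gspan_def by blast

lemma fix_ex: "z \<in> gfix Z \<longleftrightarrow> (\<exists>S\<subseteq>swf_Ic t. z = gsum Z g S)"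
  unfolding fix_eq gspan_def by blast

lemma finite_car: "finite (gcar Z)"
proof -
  have "gcar Z \<subseteq> gsum Z g ` Pow I" using car_ex by blast
  moreover have "finite (gsum Z g ` Pow I)" using fin_I by simp
  ultimately show ?thesis by (rule finite_subset)
qed

lemma homog:
  assumes "z \<in> ggrade Z m"
  shows "\<exists>S\<subseteq>{i \<in> I. bdeg i = m}. z = gsum Z g S"
proof -
  have "z \<in> gcar Z" using assms by auto
  then obtain S where S: "S \<subseteq> I" "z = gsum Z g S" using car_ex by metis
  have "finite S" by (rule finite_subset[OF S(1) fin_I(3)])
  then have sm: "gsum Z g S = gsum Z g {i \<in> S. bdeg i = m}"
  proof (rule homog_sum)
    show "gsum Z g S \<in> ggrade Z m" using assms S(2) by simp
  qed (use S(1) g_grade in blast)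
  show ?thesis
  proof (intro exI conjI)
    show "{i \<in> S. bdeg i = m} \<subseteq> {i \<in> I. bdeg i = m}" using S(1) by blast
    show "z = gsum Z g {i \<in> S. bdeg i = m}" using S(2) sm by simp
  qed
qed

lemma g_single: "i \<in> I \<Longrightarrow> gsum Z g {i} = g i"
  by simp

lemma g_nonzero: "i \<in> I \<Longrightarrow> g i \<noteq> gzero Z"
  using indep[of "{i}"] by auto

lemma fix_g: "i \<in> swf_Ic t \<Longrightarrow> g i \<in> gfix Z"
  unfolding fix_ex using g_single[of i] by (intro exI[of _ "{i}"]) auto

lemma fix_sub: "gfix Z \<subseteq> gcar Z"
proof
  fix z assume "z \<in> gfix Z"
  then obtain S where "S \<subseteq> swf_Ic t" "z = gsum Z g S" unfolding fix_ex by blast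
  moreover from this have "S \<subseteq> I" by blast
  ultimately show "z \<in> gcar Z" using gsum_g_car by simp
qed

lemma fix_zero: "gzero Z \<in> gfix Z"
  unfolding fix_ex by (intro exI[of _ "{}"]) auto

lemma fix_add: "y \<in> gfix Z \<Longrightarrow> z \<in> gfix Z \<Longrightarrow> gadd Z y z \<in> gfix Z"
proof -
  assume "y \<in> gfix Z" "z \<in> gfix Z"
  then obtain S S' where S: "S \<subseteq> swf_Ic t" "y = gsum Z g S" "S' \<subseteq> swf_Ic t" "z = gsum Z g S'"
    unfolding fix_ex by blast
  have f: "finite S" "finite S'" using finite_subset[OF S(1) fin_I(1)] finite_subset[OF S(3) fin_I(1)] .
  have "gsum Z g (sym_diff S S') = gadd Z y z"
    unfolding S by (rule gsum_symdiff[OF f]) (use S in auto)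
  then show ?thesis unfolding fix_ex using S by (intro exI[of _ "sym_diff S S'"]) auto
qed

lemma fix_induct [consumes 1, case_names zero g add]:
  assumes r: "r \<in> gfix Z" and P: "P (gzero Z)" "\<And>i. i \<in> swf_Ic t \<Longrightarrow> P (g i)"
    "\<And>y z. y \<in> gfix Z \<Longrightarrow> z \<in> gfix Z \<Longrightarrow> P y \<Longrightarrow> P z \<Longrightarrow> P (gadd Z y z)"
  shows "P r"
proof -
  obtain S where S: "S \<subseteq> swf_Ic t" "r = gsum Z g S" using r fix_ex by blast
  have "gsum Z g S \<in> {y \<in> gfix Z. P y}"
    by (rule gsum_in) (use P S fix_g fix_zero fix_add fix_sub in auto)
  then show ?thesis using S by simp
qed

lemma c_in: "i \<le> t \<Longrightarrow> c i = g (Inl (i, 0))" "i \<le> t \<Longrightarrow> Inl (i, 0) \<in> swf_Ic t"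
  "1 \<le> i \<Longrightarrow> i \<le> t \<Longrightarrow> gj Z (c i) = g (Inl (i, 1))" "1 \<le> i \<Longrightarrow> i \<le> t \<Longrightarrow> Inl (i, 1) \<in> swf_Ic t"
  by (auto simp: g_simps swf_Ic_def)

lemma x_in: "k < n \<Longrightarrow> x k = g (Inr (k, 0, 0))" "k < n \<Longrightarrow> a < 2 \<Longrightarrow> b < 4 \<Longrightarrow> Inr (k, a, b) \<in> swf_Ix n"
  by (auto simp: g_simps swf_Ix_def)

lemma x_car [simp]: "k < n \<Longrightarrow> x k \<in> gcar Z"
  using x_grade by blast

lemma c_car [simp]: "i \<le> t \<Longrightarrow> c i \<in> gcar Z"
  using c_grade by blast

lemma c_fix: "i \<le> t \<Longrightarrow> c i \<in> gfix Z" "i \<le> t \<Longrightarrow> gj Z (c i) \<in> gfix Z"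
proof -
  assume i: "i \<le> t"
  then show 1: "c i \<in> gfix Z" using fix_g c_in(1,2) by metis
  show "gj Z (c i) \<in> gfix Z"
  proof (cases "i = 0")
    case True
    then show ?thesis using 1 j_c0 by simp
  next
    case False
    then show ?thesis using fix_g c_in(3,4)[of i] i by simp
  qed
qed

lemma fix_j: "r \<in> gfix Z \<Longrightarrow> gj Z r \<in> gfix Z \<and> gs Z r = gzero Z \<and> gj Z (gj Z r) = r"
proof (induction rule: fix_induct)
  case zero
  then show ?case using fix_zero by simp
next
  case (g i)
  then show ?case
    by (cases i rule: Ic_cases) (auto simp: g_simps j_c0 s_c j_j_c s_j c_fix)
next
  case (add y z)
  then show ?case using fix_sub fix_add by (auto simp: subset_iff)
qed

lemma fixok: "fixok Z"
  unfolding fixok_def using fix_sub fix_zero fix_add fix_bd fix_j by blast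

text \<open>\<open>c t\<close> is a nonzero fixed element of degree \<open>d\<close>, and
  \<open>x k\<close> is nonzero modulo the fixed-point set by independence; being suspensionlike
  compares their degrees.\<close>

lemma e_gt: "k < n \<Longrightarrow> d < e k"
proof -
  assume k: "k < n"
  have "coset Z (gfix Z) (x k) \<noteq> gfix Z"
  proof
    assume *: "coset Z (gfix Z) (x k) = gfix Z"
    have "gadd Z (x k) (gzero Z) \<in> coset Z (gfix Z) (x k)"
      unfolding coset_def using fix_zero by blast
    then have "x k \<in> gfix Z" using * k by simp
    then obtain S where S: "S \<subseteq> swf_Ic t" "x k = gsum Z g S" unfolding fix_ex by blast
    have "S = {Inr (k, 0, 0)}"
      by (rule sum_eq) (use S x_in(2)[OF k, of 0 0] x_in(1)[OF k] g_single[of "Inr (k, 0, 0)"] in auto)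
    then show False using S by (auto simp: swf_Ic_def)
  qed
  moreover have "coset Z (gfix Z) (x k) \<in> ggrade (quot Z (gfix Z)) (e k)"
    using x_grade[OF k] by (auto simp: quot_def)
  moreover have "c t \<in> gfix Z \<inter> ggrade Z d" using c_fix[of t] c_grade[of t] by (simp add: add.commute)
  moreover have "c t \<noteq> gzero Z" using g_nonzero[of "Inl (t, 0)"] c_in[of t] by simp
  moreover have "gzero (quot Z (gfix Z)) = gfix Z" by (simp add: quot_def)
  ultimately show ?thesis using susplike unfolding suspensionlike_def by metis
qed

lemma homog_low: "z \<in> ggrade Z m \<Longrightarrow> m \<le> d \<Longrightarrow> z \<in> gfix Z"
proof -
  assume z: "z \<in> ggrade Z m" "m \<le> d"
  obtain S where S: "S \<subseteq> {i \<in> I. bdeg i = m}" "z = gsum Z g S" using homog[OF z(1)] by blast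
  have "S \<subseteq> swf_Ic t"
  proof
    fix i assume i: "i \<in> S"
    then have *: "i \<in> I" "bdeg i = m" using S(1) by auto
    have "i \<notin> swf_Ix n"
    proof
      assume "i \<in> swf_Ix n"
      then show False using *(2) z(2) e_gt by (cases i rule: Ix_cases) force+
    qed
    then show "i \<in> swf_Ic t" using *(1) by blast
  qed
  then show ?thesis unfolding fix_ex using S by blast
qed

lemma homog_high: "z \<in> ggrade Z m \<Longrightarrow> d < m \<Longrightarrow> \<exists>S\<subseteq>{i \<in> swf_Ix n. bdeg i = m}. z = gsum Z g S"
proof -
  assume z: "z \<in> ggrade Z m" "d < m"
  obtain S where S: "S \<subseteq> {i \<in> I. bdeg i = m}" "z = gsum Z g S" using homog[OF z(1)] by blast
  have "S \<subseteq> {i \<in> swf_Ix n. bdeg i = m}"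
  proof
    fix i assume i: "i \<in> S"
    then have *: "i \<in> I" "bdeg i = m" using S by auto
    have "i \<notin> swf_Ic t"
      using *(2) z(2) by (auto elim!: Ic_cases)
    then show "i \<in> {i \<in> swf_Ix n. bdeg i = m}" using * by auto
  qed
  then show ?thesis using S by blast
qed

lemma fix_homog: "z \<in> gfix Z \<Longrightarrow> z \<in> ggrade Z m \<Longrightarrow> \<exists>S\<subseteq>{i \<in> swf_Ic t. bdeg i = m}. z = gsum Z g S"
proof -
  assume z: "z \<in> gfix Z" "z \<in> ggrade Z m"
  obtain S where S: "S \<subseteq> {i \<in> I. bdeg i = m}" "z = gsum Z g S" using homog[OF z(2)] by blast
  obtain S' where S': "S' \<subseteq> swf_Ic t" "z = gsum Z g S'" using z(1) fix_ex by blast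
  have "S = S'" by (rule sum_eq) (use S S' in auto)
  then show ?thesis using S S' by blast
qed

lemma fix_cases:
  assumes z: "z \<in> gfix Z" "z \<in> ggrade Z m"
  obtains "z = gzero Z" | "m = \<sigma>" "z = c 0"
    | i where "1 \<le> i" "i \<le> t" "m = int i + \<sigma>" "z = c i \<or> z = gj Z (c i) \<or> z = gadd Z (c i) (gj Z (c i))"
proof -
  obtain S where S: "S \<subseteq> {i \<in> swf_Ic t. bdeg i = m}" "z = gsum Z g S"
    using fix_homog[OF z] by blast
  consider "S = {}" | i0 where "i0 \<in> S" by blast
  then show ?thesis
  proof cases
    case 1
    then show ?thesis using S that by simp
  next
    case 2
    then have i0: "i0 \<in> swf_Ic t" "bdeg i0 = m" using S by auto
    from i0(1) have "\<exists>i\<le>t. m = int i + \<sigma>"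
      using i0(2) by (cases i0 rule: Ic_cases) auto
    then obtain i where i: "i \<le> t" "m = int i + \<sigma>" by blast
    have sub: "S \<subseteq> (if i = 0 then {Inl (0, 0)} else {Inl (i, 0), Inl (i, 1)})"
    proof
      fix l assume "l \<in> S"
      then have l: "l \<in> swf_Ic t" "bdeg l = m" using S by auto
      from l(1) show "l \<in> (if i = 0 then {Inl (0, 0)} else {Inl (i, 0), Inl (i, 1)})"
        using l(2) i by (cases l rule: Ic_cases) auto
    qed
    show ?thesis
    proof (cases "i = 0")
      case True
      then have "S = {Inl (0, 0)}" using sub 2 by auto
      then have "z = c 0" using S(2) c_in[of 0] by simp
      then show ?thesis using that(2) i True by simp
    next
      case False
      then have "S = {Inl (i, 0)} \<or> S = {Inl (i, 1)} \<or> S = {Inl (i, 0), Inl (i, 1)}"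
        using sub 2 by auto
      then have "z = c i \<or> z = gj Z (c i) \<or> z = gadd Z (c i) (gj Z (c i))"
        using S(2) c_in[of i] i False by auto
      then show ?thesis using that(3)[of i] i False by simp
    qed
  qed
qed

text \<open>For \<open>i = t\<close> the differential is prescribed only modulo the free span. The
  difference lies in that span, but also in the fixed-point set, which is a subcomplex; by
  independence the two meet in zero.\<close>

lemma bd_c: "2 \<le> i \<Longrightarrow> i \<le> t \<Longrightarrow> gbd Z (c i) = gadd Z (c (i - 1)) (gj Z (c (i - 1)))"
proof (cases "i = t")
  case True
  assume i: "2 \<le> i"
  let ?z = "gadd Z (gbd Z (c t)) (gadd Z (c (t - 1)) (gj Z (c (t - 1))))"
  have c: "c t \<in> gcar Z" "c (t - 1) \<in> gcar Z" by auto
  have "?z \<in> gfix Z" using c_fix[of t] c_fix[of "t - 1"] fix_bd fix_add by auto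
  then obtain S where S: "S \<subseteq> swf_Ic t" "?z = gsum Z g S" unfolding fix_ex by blast
  obtain S' where S': "S' \<subseteq> swf_Ix n" "?z = gsum Z g S'"
    using bd_ct_raw i True unfolding gspan_def by blast
  have "S = S'" by (rule sum_eq) (use S S' in auto)
  moreover have "swf_Ic t \<inter> swf_Ix n = {}" by (auto simp: swf_Ic_def swf_Ix_def)
  ultimately have "S = {}" using S S' by blast
  then have "?z = gzero Z" using S by simp
  then show ?thesis using c True add_eq_zero by simp
qed (use bd_c_raw in auto)

lemma cj_nonzero: "1 \<le> i \<Longrightarrow> i \<le> t \<Longrightarrow> gadd Z (c i) (gj Z (c i)) \<noteq> gzero Z"
proof
  assume i: "1 \<le> i" "i \<le> t" "gadd Z (c i) (gj Z (c i)) = gzero Z"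
  have "gsum Z g {Inl (i, 0), Inl (i, 1)} = gzero Z"
    using i c_in[of i] by auto
  then show False using indep[of "{Inl (i, 0), Inl (i, 1)}"] c_in[of i] i by auto
qed

lemma c0_nonzero: "c 0 \<noteq> gzero Z"
  using g_nonzero[of "Inl (0, 0)"] c_in[of 0] by simp

lemma bd_c0: "gbd Z (c 0) = gzero Z"
proof -
  have "gbd Z (c 0) \<in> ggrade Z (\<sigma> - 1)" "gbd Z (c 0) \<in> gfix Z"
    using c_grade[of 0] bd_grade[of "c 0" \<sigma>] fix_bd c_fix[of 0] by auto
  then show ?thesis by (cases rule: fix_cases[rotated]) auto
qed

lemma bd_c_nonzero: "1 \<le> i \<Longrightarrow> i \<le> t \<Longrightarrow> gbd Z (c i) \<noteq> gzero Z"
  using bd_c1 c0_nonzero bd_c[of i] cj_nonzero[of "i - 1"] by (cases "i = 1") auto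

lemma bd_c_inv: "i \<le> t \<Longrightarrow> gj Z (gbd Z (c i)) = gbd Z (c i)"
proof -
  assume i: "i \<le> t"
  consider "i = 0" | "i = 1" | "2 \<le> i" by linarith
  then show ?thesis
  proof cases
    case 3
    then show ?thesis using bd_c[of i] i j_j_c[of "i - 1"] by (simp add: ac)
  qed (use bd_c0 bd_c1 j_c0 i in auto)
qed

text \<open>The fundamental class of the fixed-point sphere. For \<open>t = 0\<close> the only cell
  is \<open>c 0\<close>, which \<open>1 + j\<close> would kill.\<close>

definition vtop :: 'v where
  "vtop = (if t = 0 then c 0 else gadd Z (c t) (gj Z (c t)))"

lemma vtop: "vtop \<in> gfix Z" "vtop \<in> ggrade Z d" "vtop \<noteq> gzero Z" "gbd Z vtop = gzero Z"
  "gj Z vtop = vtop" "gs Z vtop = gzero Z"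
proof -
  show "vtop \<in> gfix Z" unfolding vtop_def using c_fix[of 0] c_fix[of t] fix_add by auto
  then show "gs Z vtop = gzero Z" using fix_j by blast
  show "vtop \<in> ggrade Z d" unfolding vtop_def using c_grade[of t] by (auto simp: add.commute)
  show "vtop \<noteq> gzero Z" unfolding vtop_def using c0_nonzero cj_nonzero by auto
  show "gj Z vtop = vtop" unfolding vtop_def using j_c0 j_j_c[of t] by (auto simp: ac)
  show "gbd Z vtop = gzero Z" unfolding vtop_def using bd_c0 bd_c_inv[of t] by (auto simp: bd_j)
qed

text \<open>The fixed-point set is the reduced cellular complex of a \<open>t\<close>-sphere with
  two cells in each positive dimension. Its nonzero homogeneous cycles are \<open>c 0\<close> and
  the \<open>(1 + j)(c i)\<close>, and each but the last is the boundary of the next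
  generator.\<close>

lemma fix_cycle:
  assumes z: "z \<in> gfix Z" "z \<in> ggrade Z m" "gbd Z z = gzero Z"
  obtains w where "w \<in> gfix Z" "w \<in> ggrade Z (m + 1)" "z = gbd Z w" | "m = d" "z = vtop"
  using z(1,2)
proof (cases rule: fix_cases)
  case 1
  then show ?thesis using that(1)[of "gzero Z"] fix_zero by simp
next
  case 2
  show ?thesis
  proof (cases "t = 0")
    case True
    have "z = vtop" "m = d" using 2 True unfolding vtop_def by simp_all
    then show ?thesis using that(2) by blast
  next
    case False
    then show ?thesis using that(1)[of "c 1"] 2 c_fix[of 1] c_grade[of 1] bd_c1 by (simp add: add.commute)
  qed
next
  case (3 i)
  have "gbd Z (c i) \<noteq> gzero Z" "gbd Z (gj Z (c i)) \<noteq> gzero Z"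
    using bd_c_nonzero[of i] bd_c_inv[of i] 3 by (simp_all add: bd_j)
  then have z': "z = gadd Z (c i) (gj Z (c i))" using 3 z(3) by auto
  show ?thesis
  proof (cases "i = t")
    case True
    have "z = vtop" "m = d" using 3 True z' unfolding vtop_def by simp_all
    then show ?thesis using that(2) by blast
  next
    case False
    then have "c (Suc i) \<in> ggrade Z (m + 1)" using 3 c_grade[of "Suc i"] by (simp add: algebra_simps)
    then show ?thesis
      using that(1)[of "c (Suc i)"] bd_c[of "Suc i"] 3 z' False c_fix[of "Suc i"] by simp
  qed
qed

lemma conc_fix: "conc (fixc Z) \<sigma> d"
  unfolding conc_def
proof (intro allI impI subsetI)
  fix k z assume k: "k < \<sigma> \<or> d < k" and z: "z \<in> ggrade (fixc Z) k"
  then have "z \<in> gfix Z" "z \<in> ggrade Z k" by auto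
  then show "z \<in> {gzero (fixc Z)}" by (cases rule: fix_cases) (use k in auto)
qed

lemma vtop_not_bd: "w \<in> ggrade (fixc Z) (d + 1) \<Longrightarrow> vtop \<noteq> gbd Z w"
  using conc_fix vtop(3) unfolding conc_def by force

text \<open>Up to degree \<open>d\<close> the complex coincides with its fixed-point set, whose
  homology sits in degree \<open>d\<close>.\<close>

lemma acyc: "acyc Z d"
  unfolding acyc_def
proof (intro allI impI ballI)
  fix k z assume z: "k < d" "z \<in> ggrade Z k" "gbd Z z = gzero Z"
  have "z \<in> gfix Z" using homog_low z by simp
  then show "\<exists>a\<in>ggrade Z (k + 1). z = gbd Z a"
    by (cases rule: fix_cycle[OF _ z(2,3)]) (use z in auto)
qed

lemma hcx4_fix: "hcx4 (fixc Z)"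
  by (rule hcx4_fixc[OF hcx4_axioms fixok])

lemma cyc_fix: "cyc (fixc Z)"
  unfolding cyc_def
proof (intro allI impI ballI)
  interpret F: hcx4 "fixc Z" by (rule hcx4_fix)
  fix m z assume z: "z \<in> ggrade (fixc Z) m" "gbd (fixc Z) z = gzero (fixc Z)"
  then have "z \<in> gfix Z" "z \<in> ggrade Z m" "gbd Z z = gzero Z" by auto
  then show "\<exists>a\<in>ggrade (fixc Z) (m + 1). gadd (fixc Z) z (gj (fixc Z) z) =
      gbd (fixc Z) (gadd (fixc Z) a (gj (fixc Z) a))"
  proof (cases rule: fix_cycle)
    case (1 w)
    then have "w \<in> gcar Z" by auto
    with 1 show ?thesis by (intro bexI[of _ w]) (auto simp: bd_j)
  next
    case 2
    then show ?thesis
      using vtop(5,1) fix_sub fix_zero by (intro bexI[of _ "gzero Z"]) auto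
  qed
qed

text \<open>The steps are \<open>e = c (Suc i)\<close>, whose boundary is the element reached at
  stage \<open>i\<close>.\<close>

lemma nbd_top:
  assumes "hcx T" "\<And>y. y \<in> gcar T \<Longrightarrow> gj T (gj T y) = y" "cyc T" "hchain (fixc Z) T D F"
    and "nbd T F (\<sigma> + D) (c 0)"
  shows "nbd T F (d + D) vtop"
proof -
  interpret F: hcx4 "fixc Z" by (rule hcx4_fix)
  have g: "c i \<in> ggrade (fixc Z) (int i + \<sigma>)" if "i \<le> t" for i using c_grade[OF that] c_fix[OF that] by simp
  have "i \<le> t \<Longrightarrow> nbd T F (\<sigma> + int i + D) (if i = 0 then c 0 else gadd Z (c i) (gj Z (c i)))" for i
  proof (induction i)
    case 0
    then show ?case using assms(5) by simp
  next
    case (Suc i)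
    have "gbd Z (c (Suc i)) = (if i = 0 then c 0 else gadd Z (c i) (gj Z (c i)))"
      using bd_c[of "Suc i"] bd_c1 Suc.prems by auto
    then have "nbd T F (\<sigma> + int i + D) (gbd (fixc Z) (c (Suc i)))" using Suc by simp
    then have "nbd T F (\<sigma> + int i + D + 1) (gadd (fixc Z) (c (Suc i)) (gj (fixc Z) (c (Suc i))))"
      by (intro nbd_step[OF F.hcx_axioms assms(1-4) g[OF Suc.prems]]) auto
    then show ?case by (simp add: algebra_simps)
  qed
  from this[of t] show ?thesis by (simp add: vtop_def)
qed

text \<open>Free generators have degree at least \<open>d + 1\<close>, so in that degree only basis
  elements \<open>j^b x_k\<close> without a factor \<open>s\<close> occur, and \<open>s\<close>
  sends them to distinct basis elements. On the fixed-point set \<open>s\<close> vanishes;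
  \<open>conn_deg\<close> plays the two facts against each other.\<close>

lemma s_inj:
  assumes z: "z \<in> ggrade Z (d + 1)" "gs Z z = gzero Z"
  shows "z = gzero Z"
proof -
  obtain S where S: "S \<subseteq> {i \<in> swf_Ix n. bdeg i = d + 1}" "z = gsum Z g S"
    using homog_high[OF z(1)] by auto
  define h :: "(nat \<times> nat) + (nat \<times> nat \<times> nat) \<Rightarrow> (nat \<times> nat) + (nat \<times> nat \<times> nat)"
    where "h = map_sum id (\<lambda>(k, a, b). (k, Suc a, b))"
  have el: "\<exists>k b. i = Inr (k, 0, b) \<and> k < n \<and> b < 4" if "i \<in> S" for i
  proof -
    have "i \<in> swf_Ix n" "bdeg i = d + 1" using that S by auto
    then show ?thesis using e_gt by (cases i rule: Ix_cases) force+
  qed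
  have inj: "inj_on h S"
  proof (rule inj_onI)
    fix i l assume "i \<in> S" "l \<in> S" "h i = h l"
    then show "i = l" using el[of i] el[of l] by (auto simp: h_def)
  qed
  have hS: "h ` S \<subseteq> swf_Ix n" using el by (force simp: h_def swf_Ix_def)
  have gh: "gs Z (g i) = g (h i)" if "i \<in> S" for i
    using el[OF that] by (auto simp: h_def g_simps)
  have "gzero Z = gs Z (gsum Z g S)" using z S by simp
  also have "\<dots> = gsum Z (\<lambda>i. gs Z (g i)) S"
    by (rule addf_gsum[OF vsp_axioms vsp_axioms addf_s]) (use S in auto)
  also have "\<dots> = gsum Z (\<lambda>i. g (h i)) S"
    by (rule gsum_cong) (use gh g_car[of "h _"] hS in force)+
  also have "\<dots> = gsum Z g (h ` S)"
    by (rule gsum_reindex[symmetric, OF inj]) (use hS in auto)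
  finally have "h ` S = {}" using indep[of "h ` S"] hS by auto
  then show ?thesis using S by simp
qed

lemma gen_induct [consumes 1, case_names zero cgen xgen add s j]:
  assumes "z \<in> gcar Z" "P (gzero Z)" "\<And>i. i \<le> t \<Longrightarrow> P (c i)" "\<And>k. k < n \<Longrightarrow> P (x k)"
    and add: "\<And>y z. y \<in> gcar Z \<Longrightarrow> z \<in> gcar Z \<Longrightarrow> P y \<Longrightarrow> P z \<Longrightarrow> P (gadd Z y z)"
    and sj: "\<And>y. y \<in> gcar Z \<Longrightarrow> P y \<Longrightarrow> P (gs Z y)" "\<And>y. y \<in> gcar Z \<Longrightarrow> P y \<Longrightarrow> P (gj Z y)"
  shows "P z"
proof -
  obtain S where S: "S \<subseteq> I" "z = gsum Z g S" using car_ex assms(1) by blast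
  have jp: "(gj Z ^^ b) y \<in> gcar Z \<and> P ((gj Z ^^ b) y)" if "y \<in> gcar Z" "P y" for y b
    using that sj by (induction b) auto
  have "P (g i)" if "i \<in> I" for i
    using that
  proof (elim UnE)
    assume "i \<in> swf_Ic t"
    then show ?thesis using assms(3) sj by (cases i rule: Ic_cases) (auto simp: g_simps)
  next
    assume "i \<in> swf_Ix n"
    then show ?thesis using assms(4) sj jp by (cases i rule: Ix_cases) (auto simp: g_simps)
  qed
  then have "gsum Z g S \<in> {y \<in> gcar Z. P y}"
    by (intro gsum_in) (use assms S in auto)
  then show ?thesis using S by simp
qed

text \<open>As a module, without differential, \<open>Z\<close> is presented by its generators. The
  target must satisfy \<open>sj = j^3 s\<close>, so maps into quaternionic suspensions cannot be
  obtained in this way.\<close>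

lemma univ:
  fixes T :: "'w gcx"
  assumes "is_gcx T"
    and c': "\<And>i. i \<le> t \<Longrightarrow> c' i \<in> ggrade T (int i + \<sigma>)" "\<And>i. i \<le> t \<Longrightarrow> gj T (gj T (c' i)) = c' i"
      "\<And>i. i \<le> t \<Longrightarrow> gs T (c' i) = gzero T" "gj T (c' 0) = c' 0"
    and x': "\<And>k. k < n \<Longrightarrow> x' k \<in> ggrade T (e k)"
  shows "\<exists>f. hmap Z T 0 f \<and> (\<forall>i\<le>t. f (c i) = c' i) \<and> (\<forall>k<n. f (x k) = x' k)"
proof -
  interpret T: gcx T by unfold_locales fact
  define g' where "g' = swf_gen T c' x'"
  have g'_simps: "g' (Inl (i, l)) = (gj T ^^ l) (c' i)"
     "g' (Inr (k, a, b)) = (gs T ^^ a) ((gj T ^^ b) (x' k))" for i l k a b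
    by (simp_all add: swf_gen_def g'_def)
  have jp: "y \<in> ggrade T m \<Longrightarrow> (gj T ^^ b) y \<in> ggrade T m" for y m b by (induction b) auto
  have c'c [simp]: "i \<le> t \<Longrightarrow> c' i \<in> gcar T" for i using c' by blast
  have x'c [simp]: "k < n \<Longrightarrow> x' k \<in> gcar T" for k using x' by blast
  have g'g: "g' i \<in> ggrade T (bdeg i)" if "i \<in> I" for i
    using that
  proof (elim UnE)
    assume "i \<in> swf_Ic t"
    then show ?thesis by (cases i rule: Ic_cases) (use c'(1)[of 0] in \<open>auto simp: g'_simps c'(1)\<close>)
  next
    assume "i \<in> swf_Ix n"
    then show ?thesis
      by (cases i rule: Ix_cases) (auto simp: g'_simps intro!: jp T.s_grade x')
  qed
  then have g'c [simp]: "i \<in> I \<Longrightarrow> g' i \<in> gcar T" for i by blast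
  \<comment> \<open>Independence makes the set \<open>S\<close> representing \<open>z\<close>
    unique; \<open>f\<close> replaces each basis element by its counterpart.\<close>
  define f where "f z = gsum T g' (THE S. S \<subseteq> I \<and> z = gsum Z g S)" for z
  have f: "f (gsum Z g S) = gsum T g' S" if "S \<subseteq> I" for S
  proof -
    have "(THE S'. S' \<subseteq> I \<and> gsum Z g S = gsum Z g S') = S"
      by (rule the_equality) (use that sum_eq in metis)+
    then show ?thesis by (simp add: f_def)
  qed
  have fg: "f (g i) = g' i" if "i \<in> I" for i
    using f[of "{i}"] that by simp
  have addf: "addf Z T f"
  proof (rule addfI)
    fix y z assume "y \<in> gcar Z" "z \<in> gcar Z"
    then obtain S S' where S: "S \<subseteq> I" "y = gsum Z g S" "S' \<subseteq> I" "z = gsum Z g S'" using car_ex by metis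
    have fin: "finite S" "finite S'" using finite_subset[OF S(1) fin_I(3)] finite_subset[OF S(3) fin_I(3)] .
    have "gsum T g' S \<in> gcar T" by (rule T.gsum_closed) (use S(1) in auto)
    then show "f y \<in> gcar T" using S f by simp
    have "gadd Z y z = gsum Z g (sym_diff S S')"
      unfolding S by (rule gsum_symdiff[OF fin, symmetric]) (use S in auto)
    moreover have "gsum T g' (sym_diff S S') = gadd T (gsum T g' S) (gsum T g' S')"
      by (rule T.gsum_symdiff[OF fin]) (use S in auto)
    moreover have "sym_diff S S' \<subseteq> I" using S by auto
    ultimately show "f (gadd Z y z) = gadd T (f y) (f z)" using f S by simp
  qed
  have f0 [simp]: "f (gzero Z) = gzero T" using f[of "{}"] by simp
  have fc [simp]: "i \<le> t \<Longrightarrow> f (c i) = c' i" for i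
    using fg[of "Inl (i, 0)"] c_in[of i] by (simp add: g'_simps)
  have fjc [simp]: "f (gj Z (c i)) = gj T (c' i)" if i: "i \<le> t" for i
  proof (cases "i = 0")
    case True
    then show ?thesis using j_c0 c'(4) fc[of 0] by simp
  next
    case False
    have "f (g (Inl (i, 1))) = g' (Inl (i, 1))" using fg c_in(4)[of i] i False by simp
    then show ?thesis by (simp add: g'_simps g_simps)
  qed
  have fx: "f ((gs Z ^^ a) ((gj Z ^^ b) (x k))) = (gs T ^^ a) ((gj T ^^ b) (x' k))"
    if "k < n" "a < 2" "b < 4" for k a b
    using fg[of "Inr (k, a, b)"] x_in(2)[OF that] by (simp add: g'_simps g_simps)
  have fx0: "f (x k) = x' k" "f (gj Z (x k)) = gj T (x' k)" "f (gj Z (gj Z (x k))) = gj T (gj T (x' k))"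
    "f (gj Z (gj Z (gj Z (x k)))) = gj T (gj T (gj T (x' k)))" if "k < n" for k
    using fx[OF that, of 0 0] fx[OF that, of 0 1] fx[OF that, of 0 2] fx[OF that, of 0 3] that
    by (simp_all add: numeral_2_eq_2 numeral_3_eq_3)
  have fx1: "f (gs Z (x k)) = gs T (x' k)" "f (gs Z (gj Z (x k))) = gs T (gj T (x' k))"
    "f (gs Z (gj Z (gj Z (x k)))) = gs T (gj T (gj T (x' k)))"
    "f (gs Z (gj Z (gj Z (gj Z (x k))))) = gs T (gj T (gj T (gj T (x' k))))" if "k < n" for k
    using fx[OF that, of 1 0] fx[OF that, of 1 1] fx[OF that, of 1 2] fx[OF that, of 1 3] that
    by (simp_all add: numeral_2_eq_2 numeral_3_eq_3)
  have eqv: "f (gs Z (g i)) = gs T (g' i) \<and> f (gj Z (g i)) = gj T (g' i)" if "i \<in> I" for i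
    using that
  proof (elim UnE)
    assume "i \<in> swf_Ic t"
    then show ?thesis
      by (cases i rule: Ic_cases)
        (auto simp: g_simps g'_simps s_c c'(2,3) j_c0 c'(4) j_j_c s_j T.s_j)
  next
    assume "i \<in> swf_Ix n"
    then obtain k b where kb: "i = Inr (k, 0, b) \<or> i = Inr (k, 1, b)" "k < n"
      "b = 0 \<or> b = 1 \<or> b = 2 \<or> b = 3"
      by (cases i rule: Ix_cases) force+
    show ?thesis
      using kb(1,3)
      by (elim disjE)
        (use kb(2) in \<open>simp_all add: g_simps g'_simps numeral_2_eq_2 numeral_3_eq_3 fx0 fx1 j_s' T.j_s'\<close>)
  qed
  define A where "A = {z \<in> gcar Z. f (gs Z z) = gs T (f z) \<and> f (gj Z z) = gj T (f z)}"
  have A: "g i \<in> A" if "i \<in> I" for i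
    using eqv[OF that] fg[OF that] g_car[OF that] unfolding A_def by simp
  have P: "z \<in> A" if z: "z \<in> gcar Z" for z
  proof -
    obtain S where S: "S \<subseteq> I" "z = gsum Z g S" using car_ex[OF z] by blast
    have "gsum Z g S \<in> A"
    proof (rule gsum_in)
      show "gzero Z \<in> A" by (simp add: A_def)
      fix y z assume "y \<in> A" "z \<in> A"
      then show "gadd Z y z \<in> A"
        by (simp add: A_def addf_add[OF addf] addf_closed[OF addf])
    next
      show "A \<subseteq> gcar Z" unfolding A_def by blast
      fix i assume "i \<in> S"
      then show "g i \<in> A" using A S(1) by blast
    qed
    then show ?thesis unfolding S(2) .
  qed
  have deg: "f z \<in> ggrade T m" if z: "z \<in> ggrade Z m" for z m
  proof -
    obtain S where S: "S \<subseteq> {i \<in> I. bdeg i = m}" "z = gsum Z g S" using homog[OF z] by blast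
    have "S \<subseteq> I" using S(1) by blast
    then have e: "f z = gsum T g' S" unfolding S(2) by (rule f)
    show ?thesis unfolding e by (rule T.grade_gsum) (use S(1) g'g in auto)
  qed
  have "hmap Z T 0 f" unfolding hmap_def using addf P deg by (simp add: A_def)
  then show ?thesis using fc fx0(1) by blast
qed

end

lemma is_swf_swf:
  assumes "is_swf Z" "suspensionlike Z"
  shows "\<exists>t \<sigma> n c x e. swf Z t \<sigma> n c x e"
proof -
  have g: "is_gcx Z" using assms(1) by (simp add: is_swf_def)
  from assms(1)[unfolded is_swf_def Let_def, THEN conjunct2] show ?thesis
  proof (elim exE conjE, goal_cases)
    case (1 t \<sigma> n c x e)
    have "swf Z t \<sigma> n c x e"
    proof (intro swf.intro gcx.intro g swf_axioms.intro)
      fix i assume "i \<le> t"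
      then show "c i \<in> ggrade Z (int i + \<sigma>)" "gj Z (gj Z (c i)) = c i" "gs Z (c i) = gzero Z"
        using 1(1) 1(3) by blast+
    next
      fix S assume "S \<subseteq> swf_Ic t \<union> swf_Ix n" "gsum Z (swf_gen Z c x) S = gzero Z"
      then show "S = {}" using 1(6) by blast
    next
      show "gj Z (c 0) = c 0" "gcar Z = gspan Z (swf_gen Z c x) (swf_Ic t \<union> swf_Ix n)"
        "gfix Z = gspan Z (swf_gen Z c x) (swf_Ic t)" "suspensionlike Z"
        by (fact 1 assms)+
    next
      fix k assume "k < n"
      then show "x k \<in> ggrade Z (e k)" using 1(2) by blast
    next
      assume "1 \<le> t"
      then show "gbd Z (c 1) = c 0" using 1(8) by blast
    next
      assume "2 \<le> t"
      then show "gadd Z (gbd Z (c t)) (gadd Z (c (t - 1)) (gj Z (c (t - 1))))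
                    \<in> gspan Z (swf_gen Z c x) (swf_Ix n)" using 1(10) by blast
    next
      fix i assume "2 \<le> i" "i \<le> t - 1"
      then show "gbd Z (c i) = gadd Z (c (i - 1)) (gj Z (c (i - 1)))" using 1(9) by blast
    next
      fix r assume "r \<in> gfix Z"
      then show "gbd Z r \<in> gfix Z" using 1(12) by blast
    qed
    then show ?thesis by blast
  qed
qed

subsection \<open>A resolution over the larger algebra\<close>

text \<open>Basis of a free resolution: \<open>Cell k p q m\<close> stands for \<open>s\<^sup>p (js)\<^sup>q j\<^sup>m x\<^sub>k\<close>, and \<open>Bt m\<close>, \<open>Bs m\<close> for
  \<open>j\<^sup>m \<beta>\<close>, \<open>j\<^sup>m \<beta>'\<close>, where \<open>\<partial>\<beta>' = (1 + j)\<beta>\<close> and \<open>s\<beta> = (1 + j)\<beta>'\<close> resolve the trivial module.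
  A chain is the finite set of basis elements with coefficient 1.\<close>

datatype vsym = Cell nat bool bool nat | Bt nat | Bs nat

fun vdeg :: "(nat \<Rightarrow> int) \<Rightarrow> int \<Rightarrow> vsym \<Rightarrow> int" where
  "vdeg e d0 (Cell k p q m) = e k + of_bool p + of_bool q"
| "vdeg e d0 (Bt m) = d0"
| "vdeg e d0 (Bs m) = d0 + 1"

definition pl :: "vsym set \<Rightarrow> vsym set \<Rightarrow> vsym set" where
  "pl A B = sym_diff A B"

lemma pl_ac: "pl (pl A B) C = pl A (pl B C)" "pl A B = pl B A" "pl A (pl B C) = pl B (pl A C)"
  by (auto simp: pl_def)

lemma pl_simps [simp]: "pl A A = {}" "pl A (pl A B) = B" "pl {} A = A" "pl A {} = A"
  "finite A \<Longrightarrow> finite B \<Longrightarrow> finite (pl A B)"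
  by (auto simp: pl_def)

text \<open>Carries the vector-space structure alone, so that finite sums of chains can be taken
  from \<open>vsp\<close>; grading and operators are supplied by \<open>Vc\<close>.\<close>

definition V0 :: "vsym set gcx" where
  "V0 = \<lparr> gcar = {S. finite S}, gzero = {}, gadd = pl, ggrade = (\<lambda>n. {}),
     gbd = id, gs = id, gj = id, gfix = {} \<rparr>"

definition lin :: "(vsym \<Rightarrow> vsym set) \<Rightarrow> vsym set \<Rightarrow> vsym set" where
  "lin T S = gsum V0 T S"

lemma V0_sel [simp]: "gcar V0 = {S. finite S}" "gzero V0 = {}" "gadd V0 = pl"
  by (simp_all add: V0_def)

interpretation V0: vsp V0
  by unfold_locales (auto simp: pl_ac)

fun sb :: "vsym \<Rightarrow> vsym set" where
  "sb (Cell k p q m) = (if p then {} else {Cell k True q m})"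
| "sb (Bt m) = pl {Bs m} {Bs (Suc m)}"
| "sb (Bs m) = {}"

text \<open>Left multiplication by \<open>j\<close>, brought back to the form
  \<open>s^p (js)^q j^m\<close>: \<open>j (js) j^m = s j^(m+2)\<close> comes from
  \<open>sj^2 = j^2 s\<close>, and \<open>j s (js) j^m = s (js) j^(m+1)\<close> from
  \<open>sjsj = jsjs\<close>.\<close>

fun jb :: "vsym \<Rightarrow> vsym set" where
  "jb (Cell k p q m) = {Cell k q p (if p = q then Suc m else if q then Suc (Suc m) else m)}"
| "jb (Bt m) = {Bt (Suc m)}"
| "jb (Bs m) = {Bs (Suc m)}"

definition sV :: "vsym set \<Rightarrow> vsym set" where "sV = lin sb"
definition jV :: "vsym set \<Rightarrow> vsym set" where "jV = lin jb"

definition act :: "bool \<Rightarrow> bool \<Rightarrow> nat \<Rightarrow> vsym set \<Rightarrow> vsym set" where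
  "act p q m S = (sV ^^ of_bool p) (((\<lambda>y. jV (sV y)) ^^ of_bool q) ((jV ^^ m) S))"

text \<open>The Leibniz rule for \<open>s^p (js)^q j^m\<close> applied to a generator with boundary
  \<open>d k\<close>. The correction terms come from \<open>\<partial>s = 1 + j^2\<close>, once for
  the outer \<open>s\<close> and once for the one inside \<open>js\<close>.\<close>

fun db :: "(nat \<Rightarrow> vsym set) \<Rightarrow> vsym \<Rightarrow> vsym set" where
  "db d (Cell k p q m) = pl (act p q m (d k))
     (pl (if p then pl {Cell k False q m} {Cell k False q (Suc (Suc m))} else {})
        (if q then pl {Cell k p False (Suc m)} {Cell k p False (Suc (Suc (Suc m)))} else {}))"
| "db d (Bt m) = {}"
| "db d (Bs m) = pl {Bt m} {Bt (Suc m)}"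

definition Vc :: "(nat \<Rightarrow> int) \<Rightarrow> int \<Rightarrow> (nat \<Rightarrow> vsym set) \<Rightarrow> vsym set gcx" where
  "Vc e d0 d = \<lparr> gcar = {S. finite S}, gzero = {}, gadd = pl,
     ggrade = (\<lambda>n. {S. finite S \<and> (\<forall>y\<in>S. vdeg e d0 y = n)}),
     gbd = lin (db d), gs = sV, gj = jV, gfix = {} \<rparr>"

lemma Vc_sel [simp]: "gcar (Vc e d0 d) = {S. finite S}" "gzero (Vc e d0 d) = {}"
  "gadd (Vc e d0 d) = pl" "ggrade (Vc e d0 d) n = {S. finite S \<and> (\<forall>y\<in>S. vdeg e d0 y = n)}"
  "gbd (Vc e d0 d) = lin (db d)" "gs (Vc e d0 d) = sV" "gj (Vc e d0 d) = jV"
  by (simp_all add: Vc_def)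

lemma finite_sb [simp]: "finite (sb y)" "finite (jb y)"
  by (cases y; simp)+

lemma finite_lin [simp]: "(\<And>y. finite (T y)) \<Longrightarrow> finite (lin T S)"
  using V0.gsum_closed[of S T] by (simp add: lin_def)

lemma lin_empty [simp]: "lin T {} = {}"
  by (simp add: lin_def V0.gsum_empty[simplified])

lemma lin_single: "finite (T y) \<Longrightarrow> lin T {y} = T y"
  using V0.gsum_single[of T y] by (simp add: lin_def)

lemma lin_pl:
  assumes "finite A" "finite B" "\<And>y. finite (T y)"
  shows "lin T (pl A B) = pl (lin T A) (lin T B)"
  unfolding lin_def using V0.gsum_symdiff[of A B T] assms by (simp add: pl_def)

lemma finite_sV [simp]: "finite (sV S)" "finite (jV S)"
  by (simp_all add: sV_def jV_def)

lemma finite_jpow [simp]: "finite S \<Longrightarrow> finite ((jV ^^ m) S)"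
  by (induction m) auto

lemma finite_act [simp]: "finite S \<Longrightarrow> finite (act p q m S)"
  unfolding act_def by (cases p; cases q; simp)

lemma finite_db [simp]: "(\<And>k. finite (d k)) \<Longrightarrow> finite (db d y)"
  by (cases y) auto

lemma sV_simps [simp]: "sV {} = {}" "jV {} = {}" "sV {y} = sb y" "jV {y} = jb y"
  "finite A \<Longrightarrow> finite B \<Longrightarrow> sV (pl A B) = pl (sV A) (sV B)"
  "finite A \<Longrightarrow> finite B \<Longrightarrow> jV (pl A B) = pl (jV A) (jV B)"
  by (simp_all add: sV_def jV_def lin_single lin_pl)

lemma V_induct [consumes 1, case_names empty single add]:
  assumes "finite S" "P {}" "\<And>y. y \<in> S \<Longrightarrow> P {y}"
    "\<And>A B. finite A \<Longrightarrow> finite B \<Longrightarrow> P A \<Longrightarrow> P B \<Longrightarrow> P (pl A B)"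
  shows "P S"
  using assms(1,3)
proof (induction S)
  case (insert y A)
  have "P (pl {y} A)" by (rule assms(4)) (use insert in auto)
  moreover have "pl {y} A = insert y A" using insert by (auto simp: pl_def)
  ultimately show ?case by simp
qed (rule assms(2))

lemma V_rel:
  assumes "finite S"
  shows "sV (sV S) = {}" "sV (jV (jV S)) = jV (jV (sV S))" "sV (jV (sV (jV S))) = jV (sV (jV (sV S)))"
proof -
  show "sV (sV S) = {}"
    using assms
  proof (induction S rule: V_induct)
    case (single y)
    then show ?case by (cases y) auto
  qed (simp_all add: pl_ac)
  show "sV (jV (jV S)) = jV (jV (sV S))"
    using assms
  proof (induction S rule: V_induct)
    case (single y)
    then show ?case by (cases y) auto
  qed (simp_all add: pl_ac)
  show "sV (jV (sV (jV S))) = jV (sV (jV (sV S)))"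
    using assms
  proof (induction S rule: V_induct)
    case (single y)
    then show ?case by (cases y) auto
  qed (simp_all add: pl_ac)
qed

lemma act_simps: "act False False m S = (jV ^^ m) S" "act True False m S = sV ((jV ^^ m) S)"
  "act False True m S = jV (sV ((jV ^^ m) S))" "act True True m S = sV (jV (sV ((jV ^^ m) S)))"
  by (simp_all add: act_def)

lemma vdeg_sb: "z \<in> sb y \<Longrightarrow> vdeg e d0 z = vdeg e d0 y + 1"
  by (cases y) (auto simp: pl_def split: if_splits)

lemma vdeg_jb: "z \<in> jb y \<Longrightarrow> vdeg e d0 z = vdeg e d0 y"
  by (cases y) (auto simp: pl_def split: if_splits)

lemma lin_mem: "finite S \<Longrightarrow> (\<And>y. finite (T y)) \<Longrightarrow> z \<in> lin T S \<Longrightarrow> \<exists>y\<in>S. z \<in> T y"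
proof -
  assume S: "finite S" "\<And>y. finite (T y)" "z \<in> lin T S"
  have "gsum V0 T S \<in> {A. finite A \<and> A \<subseteq> (\<Union>y\<in>S. T y)}"
    by (rule V0.gsum_in) (use S in \<open>auto simp: pl_def\<close>)
  then show ?thesis using S(3) by (auto simp: lin_def)
qed

locale vcx =
  fixes e :: "nat \<Rightarrow> int" and d0 :: int and d :: "nat \<Rightarrow> vsym set"
  assumes fin_d [simp]: "finite (d k)"
    and deg_d: "y \<in> d k \<Longrightarrow> vdeg e d0 y = e k - 1"
    and bd_d: "lin (db d) (d k) = {}"
begin

abbreviation "D \<equiv> lin (db d)"

lemma D_simps [simp]: "D {y} = db d y"
  "finite A \<Longrightarrow> finite B \<Longrightarrow> D (pl A B) = pl (D A) (D B)"
  by (simp_all add: lin_single lin_pl)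

lemma finite_D [simp]: "finite (D S)" by simp

lemma D_j: "finite S \<Longrightarrow> D (jV S) = jV (D S)"
proof (induction S rule: V_induct)
  case (single y)
  have j: "sV (jV (jV ((jV ^^ m) S))) = jV (jV (sV ((jV ^^ m) S)))"
    "sV (jV (sV (jV ((jV ^^ m) S)))) = jV (sV (jV (sV ((jV ^^ m) S))))" if "finite S" for m S
    using V_rel that by auto
  show ?case
  proof (cases y)
    case (Cell k p q m)
    show ?thesis unfolding Cell
      by (cases p; cases q) (simp_all add: act_simps j pl_ac)
  qed (simp_all add: pl_ac)
next
  case (add A B)
  then show ?case by (simp add: pl_ac)
qed simp

lemma D_s: "finite S \<Longrightarrow> D (sV S) = pl (sV (D S)) (pl S (jV (jV S)))"
proof (induction S rule: V_induct)
  case (single y)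
  have j: "sV (sV ((jV ^^ m) S)) = {}" "sV (sV (jV (sV ((jV ^^ m) S)))) = {}" if "finite S" for m S
    using V_rel that by auto
  show ?case
  proof (cases y)
    case (Cell k p q m)
    show ?thesis unfolding Cell
      by (cases p; cases q) (simp_all add: act_simps j pl_ac)
  qed (simp_all add: pl_ac)
next
  case (add A B)
  then show ?case by (simp add: pl_ac)
qed simp

text \<open>On the translates of a generator by powers of \<open>j\<close> the claim is
  \<open>bd_d\<close>. It is inherited under \<open>s\<close> and \<open>j\<close>, and the other
  three kinds of cells arise by applying \<open>s\<close>, \<open>j\<close>, \<open>s\<close> in
  succession.\<close>

lemma D_D: "finite S \<Longrightarrow> D (D S) = {}"
proof (induction S rule: V_induct)
  case (single y)
  have s: "D (D (sV S)) = {}" if "D (D S) = {}" "finite S" for S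
    using that by (simp add: D_s D_j pl_ac)
  have j: "D (D (jV S)) = {}" if "D (D S) = {}" "finite S" for S
    using that by (simp add: D_j)
  have jp: "D (D ((jV ^^ m) S)) = {}" if "D (D S) = {}" "finite S" for S m
    using that by (induction m) (auto simp: j)
  have dd: "D ((jV ^^ m) (d k)) = {}" for m k
    by (induction m) (auto simp: bd_d D_j)
  have 0: "D (D {Cell k False False m}) = {}" for k m
    by (simp add: act_simps dd)
  have 1: "D (D {Cell k True False m}) = {}" for k m
    using s[OF 0[of k m]] by simp
  have 2: "D (D {Cell k False True m}) = {}" for k m
    using j[OF 1[of k m]] by simp
  have 3: "D (D {Cell k True True m}) = {}" for k m
    using s[OF 2[of k m]] by simp
  show ?case
  proof (cases y)
    case (Cell k p q m)
    then show ?thesis using 0 1 2 3 by (cases p; cases q) (simp_all del: D_simps(1))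
  qed (simp_all add: pl_ac)
next
  case (add A B)
  then show ?case by (simp add: pl_ac)
qed simp

lemma deg_act:
  assumes "finite S" "\<forall>y\<in>S. vdeg e d0 y = m" "z \<in> act p q l S"
  shows "vdeg e d0 z = m + of_bool p + of_bool q"
proof -
  have j: "\<forall>z\<in>jV S. vdeg e d0 z = m" if fS: "finite S" "\<forall>y\<in>S. vdeg e d0 y = m" for S m
  proof
    fix z assume "z \<in> jV S"
    then obtain y where "y \<in> S" "z \<in> jb y" using lin_mem[OF fS(1), of jb z] by (auto simp: jV_def)
    then show "vdeg e d0 z = m" using vdeg_jb[of z _ e d0] fS(2) by simp
  qed
  have s: "\<forall>z\<in>sV S. vdeg e d0 z = m + 1" if fS: "finite S" "\<forall>y\<in>S. vdeg e d0 y = m" for S m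
  proof
    fix z assume "z \<in> sV S"
    then obtain y where "y \<in> S" "z \<in> sb y" using lin_mem[OF fS(1), of sb z] by (auto simp: sV_def)
    then show "vdeg e d0 z = m + 1" using vdeg_sb[of z _ e d0] fS(2) by simp
  qed
  have jp: "\<forall>z\<in>(jV ^^ l) S. vdeg e d0 z = m" for l
  proof (induction l)
    case (Suc l)
    have "\<forall>z\<in>jV ((jV ^^ l) S). vdeg e d0 z = m" by (rule j[OF _ Suc]) (use assms(1) in simp)
    then show ?case by simp
  qed (use assms(2) in simp)
  have f: "finite ((jV ^^ l) S)" using assms(1) by simp
  have 1: "\<forall>z\<in>sV ((jV ^^ l) S). vdeg e d0 z = m + 1" by (rule s[OF f jp])
  have 2: "\<forall>z\<in>jV (sV ((jV ^^ l) S)). vdeg e d0 z = m + 1" by (rule j[OF _ 1]) simp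
  have 3: "\<forall>z\<in>sV (jV (sV ((jV ^^ l) S))). vdeg e d0 z = m + 1 + 1" by (rule s[OF _ 2]) simp
  show ?thesis
    using assms(3) jp[of l] 1 2 3 by (cases p; cases q) (simp_all add: act_simps)
qed

lemma hcx_V: "hcx (Vc e d0 d)"
proof
  fix x m assume x: "x \<in> ggrade (Vc e d0 d) m"
  then have f: "finite x" "\<And>y. y \<in> x \<Longrightarrow> vdeg e d0 y = m" by auto
  show "gj (Vc e d0 d) x \<in> ggrade (Vc e d0 d) m"
  proof -
    have "vdeg e d0 z = m" if "z \<in> jV x" for z
    proof -
      obtain y where "y \<in> x" "z \<in> jb y" using lin_mem[OF f(1), of jb z] \<open>z \<in> jV x\<close> by (auto simp: jV_def)
      then show ?thesis using vdeg_jb[of z _ e d0] f(2) by simp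
    qed
    then show ?thesis by simp
  qed
  show "gs (Vc e d0 d) x \<in> ggrade (Vc e d0 d) (m + 1)"
  proof -
    have "vdeg e d0 z = m + 1" if "z \<in> sV x" for z
    proof -
      obtain y where "y \<in> x" "z \<in> sb y" using lin_mem[OF f(1), of sb z] \<open>z \<in> sV x\<close> by (auto simp: sV_def)
      then show ?thesis using vdeg_sb[of z _ e d0] f(2) by simp
    qed
    then show ?thesis by simp
  qed
  have vd: "vdeg e d0 z = vdeg e d0 y - 1" if "z \<in> db d y" for y z
  proof (cases y)
    case (Cell k p q l)
    have a: "z \<in> act p q l (d k) \<Longrightarrow> vdeg e d0 z = e k - 1 + of_bool p + of_bool q"
      by (rule deg_act[OF fin_d]) (use deg_d in auto)
    have "z \<in> act p q l (d k) \<or> (p \<and> z \<in> {Cell k False q l, Cell k False q (Suc (Suc l))}) \<or>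
       (q \<and> z \<in> {Cell k p False (Suc l), Cell k p False (Suc (Suc (Suc l)))})"
      using that unfolding Cell by (auto simp: pl_def split: if_splits)
    then show ?thesis unfolding Cell using a by auto
  qed (use that in \<open>auto simp: pl_def split: if_splits\<close>)
  have "vdeg e d0 z = m - 1" if "z \<in> D x" for z
  proof -
    obtain y where "y \<in> x" "z \<in> db d y" using lin_mem[OF f(1), of "db d" z] \<open>z \<in> D x\<close> by auto
    then show ?thesis using vd f(2) by metis
  qed
  then show "gbd (Vc e d0 d) x \<in> ggrade (Vc e d0 d) (m - 1)" by simp
next
  fix x assume "x \<in> gcar (Vc e d0 d)"
  then show "gbd (Vc e d0 d) (gs (Vc e d0 d) x) = gadd (Vc e d0 d) (gs (Vc e d0 d) (gbd (Vc e d0 d) x))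
      (gadd (Vc e d0 d) x (gj (Vc e d0 d) (gj (Vc e d0 d) x)))"
    using D_s by simp
qed (auto simp: V_rel D_D D_j D_s pl_ac, auto simp: pl_def)

end

section \<open>Evaluation of chains of the resolution in a complex\<close>

fun vev :: "'w gcx \<Rightarrow> (nat \<Rightarrow> 'w) \<Rightarrow> 'w \<Rightarrow> 'w \<Rightarrow> vsym \<Rightarrow> 'w" where
  "vev T a b b' (Cell k p q m) =
     (gs T ^^ of_bool p) (((\<lambda>y. gj T (gs T y)) ^^ of_bool q) ((gj T ^^ m) (a k)))"
| "vev T a b b' (Bt m) = (gj T ^^ m) b"
| "vev T a b b' (Bs m) = (gj T ^^ m) b'"

definition hv :: "'w gcx \<Rightarrow> (nat \<Rightarrow> 'w) \<Rightarrow> 'w \<Rightarrow> 'w \<Rightarrow> vsym set \<Rightarrow> 'w" where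
  "hv T a b b' S = gsum T (vev T a b b') S"

lemma (in hcx) jpow_grade: "y \<in> ggrade C m \<Longrightarrow> (gj C ^^ l) y \<in> ggrade C m"
  by (induction l) auto

lemma (in hcx) jpow_car [simp]: "y \<in> gcar C \<Longrightarrow> (gj C ^^ l) y \<in> gcar C"
  by (induction l) auto

text \<open>The conditions on \<open>b\<close> and \<open>b'\<close> are those that
  \<open>nul\<close> supplies. They are imposed on these elements and their first
  \<open>j\<close>-translates; \<open>sj^2 = j^2 s\<close> spreads them to all translates.\<close>

locale vmap = hcx T for T :: "'w gcx" +
  fixes e :: "nat \<Rightarrow> int" and d0 N :: int and a :: "nat \<Rightarrow> 'w" and b b' :: 'w
  assumes a_grade: "\<And>k. a k \<in> ggrade T (e k + N)"
    and b_grade: "b \<in> ggrade T (d0 + N)" "b' \<in> ggrade T (d0 + 1 + N)"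
    and s_b: "gs T b = gadd T b' (gj T b')" "gs T (gj T b) = gadd T (gj T b') (gj T (gj T b'))"
    and s_b': "gs T b' = gzero T" "gs T (gj T b') = gzero T"
begin

abbreviation "f \<equiv> hv T a b b'"

lemma car [simp]: "a k \<in> gcar T" "b \<in> gcar T" "b' \<in> gcar T"
  using a_grade b_grade by blast+

lemma vev_grade: "vev T a b b' y \<in> ggrade T (vdeg e d0 y + N)"
proof (cases y)
  case (Cell k p q m)
  have 0: "(gj T ^^ m) (a k) \<in> ggrade T (e k + N)" by (rule jpow_grade[OF a_grade])
  have 1: "gs T ((gj T ^^ m) (a k)) \<in> ggrade T (e k + N + 1)" by (rule s_grade[OF 0])
  have 2: "gs T (gj T (gs T ((gj T ^^ m) (a k)))) \<in> ggrade T (e k + N + 1 + 1)"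
    by (rule s_grade[OF j_grade[OF 1]])
  show ?thesis unfolding Cell using 0 1 2 by (cases p; cases q) (simp_all add: algebra_simps)
qed (use jpow_grade[OF b_grade(1)] jpow_grade[OF b_grade(2)] in auto)

lemma vev_car [simp]: "vev T a b b' y \<in> gcar T"
  using vev_grade by blast

lemma f_empty [simp]: "f {} = gzero T" by (simp add: hv_def)

lemma f_single [simp]: "f {y} = vev T a b b' y" by (simp add: hv_def)

lemma f_car [simp]: "f S \<in> gcar T" by (simp add: hv_def)

lemma f_pl [simp]: "finite A \<Longrightarrow> finite B \<Longrightarrow> f (pl A B) = gadd T (f A) (f B)"
  unfolding hv_def pl_def by (rule gsum_symdiff) auto

lemma s_jb: "gs T ((gj T ^^ m) b) = gadd T ((gj T ^^ m) b') (gj T ((gj T ^^ m) b')) \<and>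
    gs T (gj T ((gj T ^^ m) b)) = gadd T (gj T ((gj T ^^ m) b')) (gj T (gj T ((gj T ^^ m) b')))"
proof (induction m)
  case 0
  show ?case using s_b by simp
next
  case (Suc m)
  then show ?case by (simp add: s_j_j)
qed

lemma s_jb': "gs T ((gj T ^^ m) b') = gzero T \<and> gs T (gj T ((gj T ^^ m) b')) = gzero T"
  by (induction m) (use s_b' in \<open>simp_all add: s_j_j\<close>)

lemma f_s: "finite S \<Longrightarrow> f (sV S) = gs T (f S)"
proof (induction S rule: V_induct)
  case (single y)
  show ?case
  proof (cases y)
    case (Cell k p q m)
    show ?thesis unfolding Cell by (cases p; cases q) simp_all
  qed (simp_all add: s_jb s_jb')
qed simp_all

lemma f_j: "finite S \<Longrightarrow> f (jV S) = gj T (f S)"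
proof (induction S rule: V_induct)
  case (single y)
  show ?case
  proof (cases y)
    case (Cell k p q m)
    show ?thesis unfolding Cell by (cases p; cases q) (simp_all add: s_j_j s_j_s_j)
  qed simp_all
qed simp_all

lemma f_grade: "finite S \<Longrightarrow> (\<And>y. y \<in> S \<Longrightarrow> vdeg e d0 y = m) \<Longrightarrow> f S \<in> ggrade T (m + N)"
  unfolding hv_def by (rule grade_gsum) (use vev_grade in auto)

end

definition inK :: "nat set \<Rightarrow> vsym set \<Rightarrow> bool" where
  "inK K S \<longleftrightarrow> (\<forall>k p q m. Cell k p q m \<in> S \<longrightarrow> k \<in> K)"

lemma inK_pl: "inK K A \<Longrightarrow> inK K B \<Longrightarrow> inK K (pl A B)"
  unfolding inK_def pl_def by blast

lemma inK_lin:
  assumes "finite S" "\<And>y. finite (T y)" "\<And>y. y \<in> S \<Longrightarrow> inK K (T y)"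
  shows "inK K (lin T S)"
  unfolding inK_def using lin_mem[OF assms(1), of T] assms(2,3) by (metis inK_def)

lemma inK_sV: "finite S \<Longrightarrow> inK K S \<Longrightarrow> inK K (sV S)"
proof (unfold sV_def, rule inK_lin)
  fix y assume "inK K S" "y \<in> S"
  then show "inK K (sb y)" by (cases y) (auto simp: inK_def pl_def split: if_splits)
qed auto

lemma inK_jV: "finite S \<Longrightarrow> inK K S \<Longrightarrow> inK K (jV S)"
proof (unfold jV_def, rule inK_lin)
  fix y assume "inK K S" "y \<in> S"
  then show "inK K (jb y)" by (cases y) (auto simp: inK_def pl_def split: if_splits)
qed auto

lemma inK_act: "finite S \<Longrightarrow> inK K S \<Longrightarrow> inK K (act p q m S)"
proof -
  assume S: "finite S" "inK K S"
  have "inK K ((jV ^^ m) S)" using S by (induction m) (auto intro: inK_jV)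
  then show ?thesis using S by (cases p; cases q) (auto simp: act_simps intro!: inK_jV inK_sV)
qed

lemma gen_Cell:
  "{Cell k p q m} = act p q m {Cell k False False 0}"
proof -
  have "(jV ^^ m) {Cell k False False 0} = {Cell k False False m}" by (induction m) simp_all
  then show ?thesis by (cases p; cases q) (simp_all add: act_simps)
qed

lemma Vgen [consumes 2, case_names empty cell bt bs add s j]:
  assumes "finite S" "inK K S" "P {}" "\<And>k. k \<in> K \<Longrightarrow> P {Cell k False False 0}" "P {Bt 0}" "P {Bs 0}"
    and add: "\<And>A B. finite A \<Longrightarrow> finite B \<Longrightarrow> inK K A \<Longrightarrow> inK K B \<Longrightarrow> P A \<Longrightarrow> P B \<Longrightarrow> P (pl A B)"
    and s: "\<And>A. finite A \<Longrightarrow> inK K A \<Longrightarrow> P A \<Longrightarrow> P (sV A)"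
    and j: "\<And>A. finite A \<Longrightarrow> inK K A \<Longrightarrow> P A \<Longrightarrow> P (jV A)"
  shows "P S"
proof -
  have jp: "P ((jV ^^ m) A) \<and> inK K ((jV ^^ m) A)" if "finite A" "inK K A" "P A" for A m
    by (induction m) (use that j inK_jV in auto)
  have "P S \<and> inK K S" using assms(1)
  proof (induction S rule: V_induct)
    case empty
    show ?case using assms(3) by (simp add: inK_def)
  next
    case (single y)
    show ?case
    proof (cases y)
      case (Cell k p q m)
      then have k: "k \<in> K" using assms(2) single by (auto simp: inK_def)
      then have i: "inK K {Cell k False False 0}" by (auto simp: inK_def)
      have 0: "P ((jV ^^ m) {Cell k False False 0})" "inK K ((jV ^^ m) {Cell k False False 0})"
        using jp[OF _ i assms(4)[OF k]] by auto
      have 1: "P (sV ((jV ^^ m) {Cell k False False 0}))" "inK K (sV ((jV ^^ m) {Cell k False False 0}))"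
        using s[OF _ 0(2,1)] inK_sV[OF _ 0(2)] by auto
      have 2: "P (jV (sV ((jV ^^ m) {Cell k False False 0})))" "inK K (jV (sV ((jV ^^ m) {Cell k False False 0})))"
        using j[OF _ 1(2,1)] inK_jV[OF _ 1(2)] by auto
      have 3: "P (sV (jV (sV ((jV ^^ m) {Cell k False False 0}))))" using s[OF _ 2(2,1)] by auto
      have "P {Cell k p q m}"
        unfolding gen_Cell[of k p q m] using 0 1 2 3 by (cases p; cases q) (simp_all add: act_simps)
      then show ?thesis unfolding Cell using k by (auto simp: inK_def)
    next
      case (Bt m)
      have "(jV ^^ m) {Bt 0} = {Bt m}" for m by (induction m) simp_all
      then show ?thesis using jp[of "{Bt 0}" m] assms(5) Bt by (auto simp: inK_def)
    next
      case (Bs m)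
      have "(jV ^^ m) {Bs 0} = {Bs m}" for m by (induction m) simp_all
      then show ?thesis using jp[of "{Bs 0}" m] assms(6) Bs by (auto simp: inK_def)
    qed
  next
    case (add A B)
    then show ?case using assms(7) inK_pl by blast
  qed
  then show ?thesis by blast
qed

text \<open>\<open>tau\<close> and \<open>lam = [\<partial>, tau]\<close> generate the kernel of the projection onto complexes in which
  \<open>sj = j\<^sup>3s\<close> and \<open>j\<^sup>4 = 1\<close>.\<close>

definition tau :: "vsym set \<Rightarrow> vsym set" where "tau S = pl (sV S) (jV (sV (jV S)))"
definition lam :: "vsym set \<Rightarrow> vsym set" where "lam S = pl S (jV (jV (jV (jV S))))"

lemma tau_simps [simp]: "finite (tau S)" "finite S \<Longrightarrow> finite (lam S)" "tau {} = {}" "lam {} = {}"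
  "finite A \<Longrightarrow> finite B \<Longrightarrow> tau (pl A B) = pl (tau A) (tau B)"
  "finite A \<Longrightarrow> finite B \<Longrightarrow> lam (pl A B) = pl (lam A) (lam B)"
  by (simp_all add: tau_def lam_def pl_ac)

lemma tau_tau: "finite S \<Longrightarrow> tau (tau S) = {}"
  by (simp add: tau_def V_rel pl_ac)

lemma tau_lam: "finite S \<Longrightarrow> tau (lam S) = lam (tau S)"
  by (simp add: tau_def lam_def V_rel pl_ac)

lemma (in vcx) D_tau: "finite S \<Longrightarrow> D (tau S) = pl (lam S) (tau (D S))"
  by (simp add: tau_def lam_def D_s D_j pl_ac)

primrec vidx :: "vsym \<Rightarrow> nat" where
  "vidx (Cell k p q m) = m" | "vidx (Bt m) = m" | "vidx (Bs m) = m"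

primrec vsh :: "vsym \<Rightarrow> vsym" where
  "vsh (Cell k p q m) = Cell k p q (m + 4)" | "vsh (Bt m) = Bt (m + 4)" | "vsh (Bs m) = Bs (m + 4)"

lemma vsh_inj: "vsh y = vsh z \<Longrightarrow> y = z"
  by (cases y; cases z) auto

lemma jV4: "finite S \<Longrightarrow> jV (jV (jV (jV S))) = vsh ` S"
proof (induction S rule: V_induct)
  case (single y)
  then show ?case by (cases y) auto
next
  case (add A B)
  have "vsh ` pl A B = pl (vsh ` A) (vsh ` B)" by (auto simp: pl_def dest: vsh_inj)
  with add show ?case by simp
qed simp

text \<open>\<open>j^4\<close> raises the index of every basis element by four, so
  \<open>S = j^4 S\<close> contradicts the presence of an element of largest index.\<close>

lemma lam_inj:
  assumes "finite S" "lam S = {}" shows "S = {}"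
proof (rule ccontr)
  assume ne: "S \<noteq> {}"
  have "pl S (vsh ` S) = {}" using assms by (simp add: lam_def jV4)
  then have e: "S = vsh ` S" unfolding pl_def by blast
  have "Max (vidx ` S) \<in> vidx ` S" by (rule Max_in) (use assms(1) ne in auto)
  then obtain y where y: "y \<in> S" "vidx y = Max (vidx ` S)" by (metis imageE)
  have "vsh y \<in> vsh ` S" using y(1) by (rule imageI)
  then have "vsh y \<in> S" unfolding e[symmetric] .
  then have "vidx (vsh y) \<le> Max (vidx ` S)" using assms(1) by simp
  then show False using y(2) by (cases y) auto
qed

primrec isC :: "vsym \<Rightarrow> bool" where
  "isC (Cell k p q m) = True" | "isC (Bt m) = False" | "isC (Bs m) = False"

definition prC :: "vsym set \<Rightarrow> vsym set" where "prC S = {y \<in> S. isC y}"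

lemma prC_simps [simp]: "prC {} = {}" "prC (pl A B) = pl (prC A) (prC B)" "finite S \<Longrightarrow> finite (prC S)"
  by (auto simp: prC_def pl_def)

lemma prC_single: "prC {y} = (if isC y then {y} else {})"
  by (auto simp: prC_def)

lemma prC_sj: "finite S \<Longrightarrow> prC (sV S) = sV (prC S)" "finite S \<Longrightarrow> prC (jV S) = jV (prC S)"
proof -
  show "finite S \<Longrightarrow> prC (sV S) = sV (prC S)"
  proof (induction S rule: V_induct)
    case (single y)
    then show ?case by (cases y) (simp_all add: prC_single)
  qed simp_all
  show "finite S \<Longrightarrow> prC (jV S) = jV (prC S)"
  proof (induction S rule: V_induct)
    case (single y)
    then show ?case by (cases y) (simp_all add: prC_single)
  qed simp_all
qed

lemma prC_tl: "finite S \<Longrightarrow> prC (tau S) = tau (prC S)" "finite S \<Longrightarrow> prC (lam S) = lam (prC S)"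
  by (simp_all add: tau_def lam_def prC_sj)

lemma prC_split: "finite S \<Longrightarrow> \<exists>w. finite w \<and> prC w = {} \<and> S = pl (prC S) w \<and> w \<subseteq> S"
  by (rule exI[of _ "{y \<in> S. \<not> isC y}"]) (auto simp: prC_def pl_def)

definition good :: "(nat \<Rightarrow> int) \<Rightarrow> int \<Rightarrow> nat set \<Rightarrow> int \<Rightarrow> vsym set \<Rightarrow> bool" where
  "good e d0 K m S \<longleftrightarrow> finite S \<and> inK K S \<and> (\<forall>y\<in>S. vdeg e d0 y = m)"

lemma good_empty [simp]: "good e d0 K m {}" by (simp add: good_def inK_def)

lemma good_pl: "good e d0 K m A \<Longrightarrow> good e d0 K m B \<Longrightarrow> good e d0 K m (pl A B)"
  unfolding good_def by (auto simp: inK_pl) (auto simp: pl_def)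

lemma good_single: "good e d0 K m {y} \<longleftrightarrow> vdeg e d0 y = m \<and> inK K {y}"
  by (auto simp: good_def)

lemma good_sj: "good e d0 K m S \<Longrightarrow> good e d0 K (m + 1) (sV S)" "good e d0 K m S \<Longrightarrow> good e d0 K m (jV S)"
proof -
  assume S: "good e d0 K m S"
  then have f: "finite S" "inK K S" "\<And>y. y \<in> S \<Longrightarrow> vdeg e d0 y = m" by (auto simp: good_def)
  have "vdeg e d0 z = m + 1" if z: "z \<in> sV S" for z
    using lin_mem[OF f(1), of sb z] z f(3) vdeg_sb[of z _ e d0] by (auto simp: sV_def)
  then show "good e d0 K (m + 1) (sV S)" using f inK_sV by (auto simp: good_def)
  have "vdeg e d0 z = m" if z: "z \<in> jV S" for z
    using lin_mem[OF f(1), of jb z] z f(3) vdeg_jb[of z _ e d0] by (auto simp: jV_def)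
  then show "good e d0 K m (jV S)" using f inK_jV by (auto simp: good_def)
qed

lemma good_tl: "good e d0 K m S \<Longrightarrow> good e d0 K (m + 1) (tau S)" "good e d0 K m S \<Longrightarrow> good e d0 K m (lam S)"
  unfolding tau_def lam_def by (intro good_pl good_sj; simp)+

section \<open>Normal forms modulo \<open>sj = j^3 s\<close> and \<open>j^4 = 1\<close>\<close>

definition nf :: "vsym set" where "nf = {Cell k p False m | k p m. m < 4}"

text \<open>\<open>N\<close> collects cells that survive the reduction, \<open>tau p + lam q\<close>
  lies in its kernel, and \<open>w\<close> involves only the resolved trivial module.\<close>

definition dec :: "(nat \<Rightarrow> int) \<Rightarrow> int \<Rightarrow> nat set \<Rightarrow> int \<Rightarrow> vsym set \<Rightarrow>
    vsym set \<Rightarrow> vsym set \<Rightarrow> vsym set \<Rightarrow> vsym set \<Rightarrow> bool" where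
  "dec e d0 K m S N p q w \<longleftrightarrow> S = pl N (pl (tau p) (pl (lam q) w)) \<and> N \<subseteq> nf \<and> prC p = p \<and> prC w = {} \<and>
     good e d0 K m N \<and> good e d0 K (m - 1) p \<and> good e d0 K m q \<and> good e d0 K m w"

lemma dec_pl:
  assumes A: "dec e d0 K m A N p q w" and B: "dec e d0 K m B N' p' q' w'"
  shows "dec e d0 K m (pl A B) (pl N N') (pl p p') (pl q q') (pl w w')"
proof -
  have a: "A = pl N (pl (tau p) (pl (lam q) w))" "N \<subseteq> nf" "prC p = p" "prC w = {}"
      "good e d0 K m N" "good e d0 K (m - 1) p" "good e d0 K m q" "good e d0 K m w"
    using A unfolding dec_def by blast+
  have b: "B = pl N' (pl (tau p') (pl (lam q') w'))" "N' \<subseteq> nf" "prC p' = p'" "prC w' = {}"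
      "good e d0 K m N'" "good e d0 K (m - 1) p'" "good e d0 K m q'" "good e d0 K m w'"
    using B unfolding dec_def by blast+
  have fin: "finite p" "finite q" "finite p'" "finite q'" using a b unfolding good_def by blast+
  have n: "pl N N' \<subseteq> nf" using a(2) b(2) unfolding pl_def by blast
  have e: "pl A B = pl (pl N N') (pl (tau (pl p p')) (pl (lam (pl q q')) (pl w w')))"
    unfolding a(1) b(1) using fin by (simp add: pl_ac)
  have c: "prC (pl p p') = pl p p'" "prC (pl w w') = {}" using a(3,4) b(3,4) by simp_all
  show ?thesis unfolding dec_def
    by (intro conjI e n c good_pl a b)
qed

lemma dec_nf:
  assumes "k \<in> K" "e k + of_bool p = m"
  shows "\<exists>N P q w. dec e d0 K m {Cell k p False l} N P q w"
proof (induction l rule: less_induct)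
  case (less l)
  have g: "good e d0 K m {Cell k p False l}" for l using assms by (auto simp: good_single inK_def)
  show ?case
  proof (cases "l < 4")
    case True
    have "dec e d0 K m {Cell k p False l} {Cell k p False l} {} {} {}"
      unfolding dec_def using True g by (auto simp: nf_def)
    then show ?thesis by blast
  next
    case False
    have "l - 4 < l" using False by simp
    then obtain N P q w where 1: "dec e d0 K m {Cell k p False (l - 4)} N P q w" using less by blast
    have 2: "dec e d0 K m (lam {Cell k p False (l - 4)}) {} {} {Cell k p False (l - 4)} {}"
      unfolding dec_def using g by simp
    have l: "Suc (Suc (Suc (Suc (l - 4)))) = l" using False by simp
    have "lam {Cell k p False (l - 4)} = pl {Cell k p False (l - 4)} {Cell k p False l}"
      unfolding lam_def by (cases p) (simp_all add: l)
    then have "pl {Cell k p False (l - 4)} (lam {Cell k p False (l - 4)}) = {Cell k p False l}"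
      by simp
    then show ?thesis using dec_pl[OF 1 2] by metis
  qed
qed

lemma decomp:
  assumes "good e d0 K m S"
  shows "\<exists>N p q w. dec e d0 K m S N p q w"
proof -
  have "finite S" using assms by (simp add: good_def)
  then show ?thesis
  proof (induction S rule: V_induct)
    case empty
    have "dec e d0 K m {} {} {} {} {}" by (simp add: dec_def)
    then show ?case by blast
  next
    case (add A B)
    then show ?case using dec_pl by metis
  next
    case (single y)
    then have y: "vdeg e d0 y = m" "inK K {y}" using assms by (auto simp: good_def inK_def)
    show ?case
    proof (cases "isC y")
      case False
      have "dec e d0 K m {y} {} {} {} {y}"
        unfolding dec_def using False y by (auto simp: prC_single good_single)
      then show ?thesis by blast
    next
      case True
      then obtain k p q l where C: "y = Cell k p q l" by (cases y) auto
      have k: "k \<in> K" using y C by (auto simp: inK_def)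
      have i: "inK K {Cell k p q l}" for p q l using k by (auto simp: inK_def)
      show ?thesis
      proof (cases q)
        case False
        then show ?thesis using dec_nf[OF k, of e p m d0 l] y(1) C by simp
      next
        case q: True
        show ?thesis
        proof (cases p)
          case False
          have "e k + of_bool True = m" using y C q False by simp
          then obtain N P R w where 1: "dec e d0 K m {Cell k True False (l + 3)} N P R w"
            using dec_nf[OF k, of e True m d0 "l + 3"] by metis
          \<comment> \<open>\<open>js j^l\<close> reduces to \<open>s j^(l+3)\<close>:
            \<open>tau\<close> of \<open>j^(l+3)\<close> is \<open>s j^(l+3) + js j^(l+4)\<close>,
            and \<open>lam\<close> of \<open>js j^l\<close> trades \<open>js j^(l+4)\<close> for
            \<open>js j^l\<close>.\<close>
          have 2: "dec e d0 K m (pl (tau {Cell k False False (l + 3)}) (lam {Cell k False True l}))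
              {} {Cell k False False (l + 3)} {Cell k False True l} {}"
            unfolding dec_def using y C q False i by (auto simp: prC_single good_single)
          have "pl {Cell k True False (l + 3)}
             (pl (tau {Cell k False False (l + 3)}) (lam {Cell k False True l})) = {y}"
            unfolding C using q False by (simp add: tau_def lam_def pl_ac numeral_3_eq_3)
          then show ?thesis using dec_pl[OF 1 2] by metis
        next
          case p: True
          \<comment> \<open>\<open>sjs\<close> reduces to zero: as \<open>s^2 = 0\<close>,
            \<open>tau\<close> of \<open>s j^(l+3)\<close> is \<open>s js j^(l+4)\<close> alone, and
            \<open>lam\<close> brings the index back to \<open>l\<close>.\<close>
          have "pl (tau {Cell k True False (l + 3)}) (lam {Cell k True True l}) = {y}"
            unfolding C using q p by (simp add: tau_def lam_def pl_ac numeral_3_eq_3)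
          moreover have "dec e d0 K m (pl (tau {Cell k True False (l + 3)}) (lam {Cell k True True l}))
              {} {Cell k True False (l + 3)} {Cell k True True l} {}"
            unfolding dec_def using y C q p i by (auto simp: prC_single good_single)
          ultimately show ?thesis by metis
        qed
      qed
    qed
  qed
qed

text \<open>The differential from the \<open>Bs\<close> to the \<open>Bt\<close> is multiplication
  by \<open>1 + j\<close> on \<open>F[j]\<close>, with cokernel \<open>F\<close> spanned by
  \<open>Bt 0\<close>; that it is injective is \<open>Bs_inj\<close>.\<close>

lemma (in vcx) Bt_mod:
  assumes "finite S" "S \<subseteq> range Bt"
  shows "\<exists>h. finite h \<and> h \<subseteq> range Bs \<and> (S = D h \<or> S = pl (D h) {Bt 0})"
  using assms
proof (induction S)
  case empty
  show ?case by (rule exI[of _ "{}"]) simp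
next
  case (insert y S)
  have s: "\<exists>h. finite h \<and> h \<subseteq> range Bs \<and> {Bt a} = pl (D h) {Bt 0}" for a
  proof (induction a)
    case 0
    show ?case by (rule exI[of _ "{}"]) simp
  next
    case (Suc a)
    then obtain h where h: "finite h" "h \<subseteq> range Bs" "{Bt a} = pl (D h) {Bt 0}" by blast
    have "{Bt (Suc a)} = pl {Bt a} (D {Bs a})" by (simp add: pl_ac)
    also have "\<dots> = pl (D (pl h {Bs a})) {Bt 0}"
      unfolding h(3) using h(1) by (simp add: pl_ac)
    finally show ?case using h(1,2) by (intro exI[of _ "pl h {Bs a}"]) (auto simp: pl_def)
  qed
  obtain a where y: "y = Bt a" using insert by auto
  obtain h where h: "finite h" "h \<subseteq> range Bs" "{Bt a} = pl (D h) {Bt 0}" using s by blast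
  obtain h' where h': "finite h'" "h' \<subseteq> range Bs" "S = D h' \<or> S = pl (D h') {Bt 0}" using insert by blast
  have e: "insert y S = pl {Bt a} S" using insert y by (auto simp: pl_def)
  have "insert y S = D (pl h h') \<or> insert y S = pl (D (pl h h')) {Bt 0}"
    unfolding e h(3) using h' h(1) by (auto simp: pl_ac)
  moreover have "pl h h' \<subseteq> range Bs" using h h' by (auto simp: pl_def)
  ultimately show ?case using h(1) h'(1) by (intro exI[of _ "pl h h'"]) auto
qed

lemma (in vcx) Bs_inj:
  assumes "finite S" "S \<subseteq> range Bs" "D S = {}" shows "S = {}"
proof (rule ccontr)
  assume ne: "S \<noteq> {}"
  define A where "A = {m. Bs m \<in> S}"
  have SA: "S = Bs ` A" using assms(2) by (auto simp: A_def)
  have fA: "finite A" using assms(1) unfolding SA by (rule finite_imageD) (auto simp: inj_on_def)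
  have "D (Bs ` A) = pl (Bt ` A) (Bt ` Suc ` A)" using fA
  proof (induction A)
    case (insert a A)
    have "Bs ` insert a A = pl {Bs a} (Bs ` A)" "Bt ` insert a A = pl {Bt a} (Bt ` A)"
      "Bt ` Suc ` insert a A = pl {Bt (Suc a)} (Bt ` Suc ` A)"
      using insert by (auto simp: pl_def)
    then show ?case using insert by (simp add: pl_ac)
  qed simp
  then have "Bt ` A = Bt ` Suc ` A" using assms(3) SA by (auto simp: pl_def)
  then have e: "A = Suc ` A" by (simp add: inj_image_eq_iff inj_def)
  have "A \<noteq> {}" using ne SA by auto
  then have "Max A \<in> A" using fA by simp
  then have "Suc (Max A) \<in> A" using e by blast
  then have "Suc (Max A) \<le> Max A" by (rule Max_ge[OF fA])
  then show False by simp
qed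

text \<open>Recursion over the finitely many degrees of the generators. By \<open>cong\<close> a
  choice for \<open>k\<close> depends on the choices in smaller degrees alone, so later choices
  leave it valid.\<close>

lemma degree_choice:
  fixes e :: "nat \<Rightarrow> int" and u0 :: "nat \<Rightarrow> 'y"
  assumes cong: "\<And>k u u' y. k < n \<Longrightarrow> (\<And>l. l < n \<Longrightarrow> e l < e k \<Longrightarrow> u l = u' l) \<Longrightarrow> \<Phi> k u y \<Longrightarrow> \<Phi> k u' y"
    and ex: "\<And>k u. k < n \<Longrightarrow> (\<And>l. l < n \<Longrightarrow> e l < e k \<Longrightarrow> \<Phi> l u (u l)) \<Longrightarrow> \<exists>y. \<Phi> k u y"
  shows "\<exists>u. \<forall>k<n. \<Phi> k u (u k)"
proof -
  define lo where "lo = Min (insert 0 (e ` {..<n}))"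
  define hi where "hi = Max (insert 0 (e ` {..<n}))"
  have lo: "lo \<le> e k" "e k \<le> hi" if "k < n" for k
    unfolding lo_def hi_def using that by auto
  have "\<exists>u. \<forall>k<n. e k < lo + int i \<longrightarrow> \<Phi> k u (u k)" for i
  proof (induction i)
    case 0
    then show ?case using lo by force
  next
    case (Suc i)
    then obtain u where u: "\<And>k. k < n \<Longrightarrow> e k < lo + int i \<Longrightarrow> \<Phi> k u (u k)" by blast
    define u' where "u' k = (if e k < lo + int i then u k else SOME y. \<Phi> k u y)" for k
    have "\<Phi> k u' (u' k)" if k: "k < n" "e k < lo + int (Suc i)" for k
    proof (rule cong[OF k(1)])
      show "l < n \<Longrightarrow> e l < e k \<Longrightarrow> u l = u' l" for l using k(2) by (simp add: u'_def)
      show "\<Phi> k u (u' k)"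
      proof (cases "e k < lo + int i")
        case True
        then show ?thesis using u k by (simp add: u'_def)
      next
        case False
        have "\<exists>y. \<Phi> k u y" by (rule ex[OF k(1)]) (use u k in auto)
        then show ?thesis using someI_ex[of "\<Phi> k u"] False by (simp add: u'_def)
      qed
    qed
    then show ?case by blast
  qed
  from this[of "nat (hi - lo + 1)"] obtain u where
    "\<forall>k<n. e k < lo + int (nat (hi - lo + 1)) \<longrightarrow> \<Phi> k u (u k)" by blast
  then show ?thesis using lo by (intro exI[of _ u]) force
qed

lemma inK_db:
  assumes "\<And>k. k \<in> K \<Longrightarrow> finite (dd k) \<and> inK K (dd k)" "inK K {y}"
  shows "inK K (db dd y)"
proof (cases y)
  case (Cell k p q m)
  then have k: "k \<in> K" using assms(2) by (auto simp: inK_def)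
  have "inK K (act p q m (dd k))" using assms(1)[OF k] inK_act by blast
  moreover have "inK K (pl (if p then pl {Cell k False q m} {Cell k False q (Suc (Suc m))} else {})
        (if q then pl {Cell k p False (Suc m)} {Cell k p False (Suc (Suc (Suc m)))} else {}))"
    using k by (auto simp: inK_def pl_def)
  ultimately show ?thesis unfolding Cell by (simp add: inK_pl)
qed (auto simp: inK_def pl_def)

lemma lin_cong:
  assumes "finite S" "\<And>y. finite (T y)" "\<And>y. y \<in> S \<Longrightarrow> T y = T' y"
  shows "lin T S = lin T' S"
  unfolding lin_def by (rule V0.gsum_cong) (use assms(3) in blast, simp add: assms(2))

section \<open>The projection of the resolution onto \<open>Z\<close> and its kernel\<close>

context swf
begin

text \<open>Cells of arbitrary index occur in \<open>vsym\<close>; those beyond the last generator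
  are evaluated as zero.\<close>

definition xz :: "nat \<Rightarrow> 'v" where "xz k = (if k < n then x k else gzero Z)"

abbreviation "\<pi> \<equiv> hv Z xz vtop (gzero Z)"

text \<open>The projection sends \<open>Bt 0\<close> to \<open>vtop\<close> and \<open>Bs 0\<close>
  to zero, which is consistent because \<open>vtop\<close> is invariant and killed by
  \<open>s\<close>.\<close>

lemma vmap_pi: "vmap Z e d 0 xz vtop (gzero Z)"
  by unfold_locales (use x_grade vtop in \<open>auto simp: xz_def\<close>)

sublocale pi: vmap Z e d 0 xz vtop "gzero Z"
  by (rule vmap_pi)

lemma pi_tau: "finite S \<Longrightarrow> \<pi> (tau S) = gzero Z" and pi_lam: "finite S \<Longrightarrow> \<pi> (lam S) = gzero Z"
  by (simp_all add: tau_def lam_def pi.f_s pi.f_j s_j)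

lemma pi_Bs: "finite S \<Longrightarrow> S \<subseteq> range Bs \<Longrightarrow> \<pi> S = gzero Z"
  unfolding hv_def
proof (rule gsum_zero)
  fix i assume "S \<subseteq> range Bs" "i \<in> S"
  then obtain m where "i = Bs m" by blast
  moreover have "(gj Z ^^ m) (gzero Z) = gzero Z" by (induction m) auto
  ultimately show "vev Z xz vtop (gzero Z) i = gzero Z" by simp
qed

definition kap :: "vsym \<Rightarrow> (nat \<times> nat) + (nat \<times> nat \<times> nat)" where
  "kap y = (case y of Cell k p q m \<Rightarrow> Inr (k, of_bool p, m) | _ \<Rightarrow> Inl (0, 0))"

lemma pi_nf:
  assumes "N \<subseteq> nf" "inK {..<n} N" "finite N"
  shows "inj_on kap N" "kap ` N \<subseteq> swf_Ix n" "\<pi> N = gsum Z g (kap ` N)"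
proof -
  have el: "\<exists>k p m. y = Cell k p False m \<and> m < 4 \<and> k < n" if "y \<in> N" for y
    using assms(1,2) that unfolding nf_def inK_def by blast
  show inj: "inj_on kap N"
  proof (rule inj_onI)
    fix y z assume "y \<in> N" "z \<in> N" "kap y = kap z"
    then show "y = z" using el[of y] el[of z] by (auto simp: kap_def of_bool_def split: if_splits)
  qed
  show sub: "kap ` N \<subseteq> swf_Ix n"
    using el by (auto simp: kap_def swf_Ix_def) force
  have "\<pi> N = gsum Z (\<lambda>y. g (kap y)) N" unfolding hv_def
  proof (rule gsum_cong)
    fix y assume "y \<in> N"
    then obtain k p m where "y = Cell k p False m" "k < n" using el by blast
    then show "vev Z xz vtop (gzero Z) y = g (kap y)"
      by (cases p) (simp_all add: kap_def g_simps xz_def)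
  qed (rule pi.vev_car)
  also have "\<dots> = gsum Z g (kap ` N)"
    by (rule gsum_reindex[symmetric, OF inj]) (use sub in auto)
  finally show "\<pi> N = gsum Z g (kap ` N)" .
qed

lemma pi_chain:
  assumes "vcx e d dd" "K \<subseteq> {..<n}" and k: "\<And>k. k \<in> K \<Longrightarrow> \<pi> (dd k) = gbd Z (x k)"
    and S: "finite S" "inK K S"
  shows "\<pi> (lin (db dd) S) = gbd Z (\<pi> S)"
proof -
  interpret V: vcx e d dd by fact
  show ?thesis using S
  proof (induction rule: Vgen[where P = "\<lambda>S. \<pi> (lin (db dd) S) = gbd Z (\<pi> S)"])
    case (cell k)
    then show ?case using assms(2) k[OF cell] by (auto simp: act_simps xz_def)
  next
    case bt
    show ?case using vtop(4) by simp
  next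
    case bs
    show ?case using vtop by simp
  next
    case (s A)
    then show ?case by (simp add: V.D_s pi.f_s pi.f_j bd_s)
  next
    case (j A)
    then show ?case by (simp add: V.D_j pi.f_j bd_j)
  qed simp_all
qed

text \<open>The kernel of \<open>\<pi>\<close> is acyclic: a cycle \<open>tau p + lam q\<close> is the boundary of \<open>tau q\<close>.\<close>

lemma kernel_acyclic:
  assumes V: "vcx e d dd" and K: "K \<subseteq> {..<n}"
    and k: "\<And>k. k \<in> K \<Longrightarrow> \<pi> (dd k) = gbd Z (x k) \<and> inK K (dd k)"
    and S: "good e d K m S" "lin (db dd) S = {}" "\<pi> S = gzero Z"
  shows "\<exists>u. good e d K (m + 1) u \<and> lin (db dd) u = S \<and> \<pi> u = gzero Z"
proof -
  interpret V: vcx e d dd by (rule V)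
  interpret VV: hcx "Vc e d dd" by (rule V.hcx_V)
  obtain N p q w where "dec e d K m S N p q w" using decomp[OF S(1)] by blast
  then have D: "S = pl N (pl (tau p) (pl (lam q) w))" "N \<subseteq> nf" "prC p = p" "prC w = {}"
     "good e d K m N" "good e d K (m - 1) p" "good e d K m q" "good e d K m w"
    unfolding dec_def by blast+
  have f [simp]: "finite N" "finite p" "finite q" "finite w" using D unfolding good_def by blast+
  have NK: "inK {..<n} N" using D(5) K unfolding good_def inK_def by blast
  have piw: "\<pi> w \<in> gfix Z"
    unfolding hv_def
  proof (rule gsum_in)
    fix i assume "i \<in> w"
    then have "\<not> isC i" using D(4) unfolding prC_def by blast
    moreover have "(gj Z ^^ l) vtop = vtop" "(gj Z ^^ l) (gzero Z) = gzero Z" for l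
      using vtop(5) by (induction l) auto
    ultimately show "vev Z xz vtop (gzero Z) i \<in> gfix Z" using vtop(1) fix_zero by (cases i) auto
  qed (use fix_zero fix_add fix_sub in auto)
  \<comment> \<open>\<open>\<pi> N\<close> lies in the free span and \<open>\<pi> w\<close> in the
    fixed-point set, so equality makes both zero. Normal forms go to distinct basis elements, whence
    \<open>N\<close> is empty.\<close>
  have "gadd Z (\<pi> N) (\<pi> w) = gzero Z"
    using S(3) unfolding D(1) by (simp add: pi_tau pi_lam)
  then have pN: "\<pi> N = \<pi> w" by (simp add: add_eq_zero)
  obtain S' where S': "S' \<subseteq> swf_Ic t" "\<pi> w = gsum Z g S'" using piw fix_ex by metis
  have "kap ` N = S'"
    by (rule sum_eq) (use S' pi_nf[OF D(2) NK f(1)] pN in auto)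
  moreover have "swf_Ic t \<inter> swf_Ix n = {}" by (auto simp: swf_Ic_def swf_Ix_def)
  ultimately have "kap ` N = {}" using S'(1) pi_nf(2)[OF D(2) NK f(1)] by blast
  then have N0: "N = {}" by simp
  have S1: "S = pl (tau p) (pl (lam q) w)" using D(1) N0 by simp
  define Dq where "Dq = lin (db dd) q"
  \<comment> \<open>Subtracting the boundary \<open>lam q + tau (\<partial>q)\<close> of
    \<open>tau q\<close> removes \<open>lam q\<close> from \<open>S\<close>. What is left is
    \<open>tau r\<close>, with the free part of \<open>\<partial>q\<close> absorbed in
    \<open>r\<close>, plus chains over the trivial module.\<close>
  define r where "r = pl p (prC Dq)"
  obtain wq where wq: "finite wq" "prC wq = {}" "Dq = pl (prC Dq) wq"
    using prC_split[of Dq] unfolding Dq_def by (metis V.finite_D)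
  have fD [simp]: "finite Dq" unfolding Dq_def by simp
  define n1 where "n1 = pl S (lin (db dd) (tau q))"
  define w1 where "w1 = pl w (tau wq)"
  have fw1 [simp]: "finite w1" "finite r" using wq unfolding w1_def r_def by simp_all
  have tDq: "tau Dq = pl (tau (prC Dq)) (tau wq)"
    using wq by (metis fD prC_simps(3) tau_simps(5))
  have n1: "n1 = pl (tau r) w1"
    unfolding n1_def S1 w1_def r_def by (simp add: V.D_tau Dq_def[symmetric] tDq pl_ac)
  have prw1: "prC w1 = {}" unfolding w1_def using D(4) wq prC_tl(1)[of wq] by simp
  have prr: "prC r = r" unfolding r_def using D(3) by (auto simp: prC_def pl_def)
  have n1c: "lin (db dd) n1 = {}"
    unfolding n1_def using S(1,2) by (simp add: V.D_D good_def)
  have "pl (lam r) (pl (tau (lin (db dd) r)) (lin (db dd) w1)) = {}"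
    using n1c unfolding n1 by (simp add: V.D_tau pl_ac)
  then have "prC (pl (lam r) (pl (tau (lin (db dd) r)) (lin (db dd) w1))) = {}" by simp
  moreover have "prC (lin (db dd) w1) = {}"
  proof -
    have "\<not> isC y" if "y \<in> lin (db dd) w1" for y
    proof -
      obtain z where "z \<in> w1" "y \<in> db dd z" using lin_mem[of w1 "db dd" y] \<open>y \<in> lin (db dd) w1\<close> by auto
      moreover have "\<not> isC z" using \<open>z \<in> w1\<close> prw1 unfolding prC_def by blast
      ultimately show ?thesis by (cases z) (auto simp: pl_def split: if_splits)
    qed
    then show ?thesis unfolding prC_def by blast
  qed
  ultimately have "pl (lam r) (tau (prC (lin (db dd) r))) = {}"
    using prr by (simp add: prC_tl)
  \<comment> \<open>Applying \<open>tau\<close> kills the second term, as \<open>tau^2 = 0\<close>,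
    and turns the first into \<open>lam (tau r)\<close>; since \<open>lam\<close> is injective,
    \<open>tau r\<close> vanishes.\<close>
  then have "tau (pl (lam r) (tau (prC (lin (db dd) r)))) = tau {}" by (rule arg_cong)
  then have "lam (tau r) = {}" by (simp add: tau_tau tau_lam)
  then have "tau r = {}" by (rule lam_inj[rotated]) simp
  then have n1w: "n1 = w1" using n1 by simp
  have gn1: "good e d K m n1"
  proof -
    have g1: "good e d K (m + 1) (tau q)" using D(7) good_tl by blast
    have "lin (db dd) (tau q) \<in> ggrade (Vc e d dd) m"
      using VV.bd_grade[of "tau q" "m + 1"] g1 unfolding good_def by simp
    moreover have "inK K (lin (db dd) (tau q))"
    proof (rule inK_lin)
      fix y assume "y \<in> tau q"
      then have "inK K {y}" using g1 unfolding good_def inK_def by blast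
      then show "inK K (db dd y)" by (intro inK_db) (use k in auto)
    qed auto
    ultimately have "good e d K m (lin (db dd) (tau q))" unfolding good_def by simp
    then show ?thesis unfolding n1_def using S(1) good_pl by blast
  qed
  have pn1: "\<pi> n1 = gzero Z"
  proof -
    have "\<pi> (lin (db dd) (tau q)) = gbd Z (\<pi> (tau q))"
      by (rule pi_chain[OF V K]) (use k good_tl(1)[OF D(7)] in \<open>auto simp: good_def\<close>)
    then show ?thesis unfolding n1_def using S by (simp add: good_def pi_tau)
  qed
  have nC: "\<not> isC y" if "y \<in> n1" for y using that prw1 unfolding n1w prC_def by blast
  have dy: "vdeg e d y = m" if "y \<in> n1" for y using that gn1 unfolding good_def by blast
  have fn1: "finite n1" using gn1 unfolding good_def by blast
  have "\<exists>h. good e d K (m + 1) h \<and> lin (db dd) h = n1 \<and> \<pi> h = gzero Z"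
  proof (cases "m = d")
    case True
    have "n1 \<subseteq> range Bt"
    proof
      fix y assume y: "y \<in> n1"
      show "y \<in> range Bt" using nC[OF y] dy[OF y] True by (cases y) auto
    qed
    then obtain h where h: "finite h" "h \<subseteq> range Bs" "n1 = lin (db dd) h \<or> n1 = pl (lin (db dd) h) {Bt 0}"
      using V.Bt_mod[OF fn1] by blast
    have iK: "inK K h" using h(2) unfolding inK_def by blast
    have ph: "\<pi> h = gzero Z" using pi_Bs h by blast
    have pDh: "\<pi> (lin (db dd) h) = gzero Z"
      using pi_chain[OF V K _ h(1) iK] k ph by simp
    have "n1 \<noteq> pl (lin (db dd) h) {Bt 0}"
    proof
      assume "n1 = pl (lin (db dd) h) {Bt 0}"
      then have "\<pi> n1 = vtop" using h(1) pDh vtop(2) by simp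
      then show False using pn1 vtop(3) by simp
    qed
    moreover have "good e d K (m + 1) h"
      using h iK True unfolding good_def by auto
    ultimately show ?thesis using h(3) ph by blast
  next
    case False
    have "n1 \<subseteq> range Bs"
    proof
      fix y assume y: "y \<in> n1"
      show "y \<in> range Bs" using nC[OF y] dy[OF y] False by (cases y) auto
    qed
    then have "n1 = {}" using V.Bs_inj[OF fn1] n1c by blast
    then show ?thesis by (intro exI[of _ "{}"]) simp
  qed
  then obtain h where h: "good e d K (m + 1) h" "lin (db dd) h = n1" "\<pi> h = gzero Z" by blast
  have fh: "finite h" using h(1) unfolding good_def by blast
  show ?thesis
  proof (intro exI conjI)
    show "good e d K (m + 1) (pl h (tau q))" using h(1) D(7) good_tl(1) good_pl by blast
    show "lin (db dd) (pl h (tau q)) = S" using fh h(2) unfolding n1_def by (simp add: pl_ac)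
    show "\<pi> (pl h (tau q)) = gzero Z" using fh h(3) by (simp add: pi_tau)
  qed
qed

end

subsection \<open>Lifting chain maps\<close>

lemma (in vmap) f_cong:
  assumes "inK K S" "\<And>k. k \<in> K \<Longrightarrow> a k = a' k"
  shows "f S = hv T a' b b' S"
  unfolding hv_def
proof (rule gsum_cong)
  fix i assume "i \<in> S"
  show "vev T a b b' i = vev T a' b b' i"
  proof (cases i)
    case (Cell k p q m)
    then have "a k = a' k" using \<open>i \<in> S\<close> assms unfolding inK_def by blast
    then show ?thesis unfolding Cell by simp
  qed simp_all
qed simp

lemma (in vmap) f_push:
  assumes "hcx B" "hmap T B N' h"
  shows "h (f S) = hv B (\<lambda>k. h (a k)) (h b) (h b') S"
proof -
  interpret B: hcx B by fact
  note h = hmapD[OF assms(2)]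
  have jp: "h ((gj T ^^ m) y) = (gj B ^^ m) (h y)" if "y \<in> gcar T" for m y
    using that by (induction m) (auto simp: h)
  have "h (f S) = gsum B (\<lambda>i. h (vev T a b b' i)) S" unfolding hv_def
    by (rule addf_gsum[OF vsp_axioms B.vsp_axioms h(1)]) simp
  also have "\<dots> = gsum B (vev B (\<lambda>k. h (a k)) (h b) (h b')) S"
  proof (rule B.gsum_cong)
    fix i
    show "h (vev T a b b' i) = vev B (\<lambda>k. h (a k)) (h b) (h b') i"
    proof (cases i)
      case (Cell k p q m)
      show ?thesis unfolding Cell by (cases p; cases q) (simp_all add: h jp)
    qed (simp_all add: jp)
    show "h (vev T a b b' i) \<in> gcar B" by (simp add: h)
  qed
  finally show ?thesis by (simp add: hv_def)
qed

context swf
begin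

abbreviation "below k \<equiv> {l. l < n \<and> e l < e k}"

text \<open>In degree \<open>d\<close> the boundary of \<open>x k\<close> is a cycle of the
  fixed-point set, hence zero or \<open>vtop\<close>, the image of \<open>Bt 0\<close>. Above
  \<open>d\<close> it is a sum of free basis elements, whose generators have smaller degree than
  \<open>x k\<close>.\<close>

lemma cover:
  assumes "k < n"
  shows "\<exists>y. good e d (below k) (e k - 1) y \<and> \<pi> y = gbd Z (x k)"
proof -
  let ?z = "gbd Z (x k)"
  have z: "?z \<in> ggrade Z (e k - 1)" "gbd Z ?z = gzero Z"
    using bd_grade[OF x_grade[OF assms]] bd_bd[OF x_car[OF assms]] by blast+
  show ?thesis
  proof (cases "e k - 1 = d")
    case True
    have zf: "?z \<in> gfix Z" by (rule homog_low[OF z(1)]) (use True in simp)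
    show ?thesis
    proof (cases rule: fix_cycle[OF zf z])
      case (1 w)
      have "w \<in> ggrade (fixc Z) (d + 1)" using 1(1,2) unfolding True by simp
      moreover have "ggrade (fixc Z) (d + 1) \<subseteq> {gzero (fixc Z)}"
        by (rule conc_fix[unfolded conc_def, rule_format]) simp
      ultimately have w: "w = gzero Z" by auto
      have "?z = gzero Z" unfolding 1(3) w by (rule bd_zero)
      then have "\<pi> {} = ?z" by (simp only: pi.f_empty)
      then show ?thesis by (intro exI[of _ "{}"] conjI good_empty)
    next
      case 2
      have "\<pi> {Bt 0} = ?z" unfolding 2(2) by simp
      moreover have "good e d (below k) (e k - 1) {Bt 0}"
        unfolding True good_single by (simp add: inK_def)
      ultimately show ?thesis by (intro exI[of _ "{Bt 0}"] conjI)
    qed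
  next
    case False
    then have lt: "d < e k - 1" using e_gt[OF assms] by linarith
    obtain S where S: "S \<subseteq> {i \<in> swf_Ix n. bdeg i = e k - 1}" "?z = gsum Z g S"
      using homog_high[OF z(1) lt] by (elim exE conjE) (rule that)
    define h :: "(nat \<times> nat) + (nat \<times> nat \<times> nat) \<Rightarrow> vsym" where
      "h = case_sum (\<lambda>_. Bt 0) (\<lambda>(l, a, b). Cell l (a = 1) False b)"
    have el: "\<exists>l a b. i = Inr (l, a, b) \<and> h i = Cell l (a = 1) False b \<and> l \<in> below k \<and> a < 2 \<and> b < 4 \<and>
        e l + int a = e k - 1" if i: "i \<in> S" for i
    proof -
      have "i \<in> swf_Ix n" "bdeg i = e k - 1" using i S(1) by auto
      then obtain l a b where *: "i = Inr (l, a, b)" "l < n" "a < 2" "b < 4" "bdeg i = e k - 1"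
        unfolding swf_Ix_def by blast
      have ea: "e l + int a = e k - 1" using *(1,5) by simp
      have lb: "l \<in> below k" using ea *(2) by simp
      have "h i = Cell l (a = 1) False b" unfolding h_def *(1) by simp
      then show ?thesis using *(1,3,4) ea lb by blast
    qed
    have kap: "kap (h i) = i" if i: "i \<in> S" for i
    proof -
      obtain l a b where el: "i = Inr (l, a, b)" "h i = Cell l (a = 1) False b" "l \<in> below k" "a < 2" "b < 4" "e l + int a = e k - 1" using el[OF i] by (elim exE conjE) (rule that)
      have "a = 0 \<or> a = 1" using el(4) by linarith
      then show ?thesis unfolding el(2) using el(1) by (auto simp: kap_def)
    qed
    have "S \<subseteq> swf_Ix n" using S(1) by blast
    then have fS: "finite (h ` S)" by (intro finite_imageI finite_subset[OF _ fin_I(2)])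
    have hn: "h ` S \<subseteq> nf"
    proof (rule image_subsetI)
      fix i assume i: "i \<in> S"
      obtain l a b where el: "i = Inr (l, a, b)" "h i = Cell l (a = 1) False b" "l \<in> below k" "a < 2" "b < 4" "e l + int a = e k - 1" using el[OF i] by (elim exE conjE) (rule that)
      show "h i \<in> nf" unfolding el(2) nf_def using el(5) by simp
    qed
    have hK: "inK (below k) (h ` S)" unfolding inK_def
    proof (intro allI impI)
      fix l p q m assume "Cell l p q m \<in> h ` S"
      then obtain i where i: "i \<in> S" "Cell l p q m = h i" by blast
      obtain l' a b where el: "i = Inr (l', a, b)" "h i = Cell l' (a = 1) False b" "l' \<in> below k" "a < 2" "b < 4" "e l' + int a = e k - 1" using el[OF i(1)] by (elim exE conjE) (rule that)
      show "l \<in> below k" using i(2) el(2,3) by simp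
    qed
    then have hK': "inK {..<n} (h ` S)" unfolding inK_def by blast
    have "kap ` h ` S = S" unfolding image_image using kap by simp
    then have "\<pi> (h ` S) = ?z" using pi_nf(3)[OF hn hK' fS] S(2) by simp
    moreover have "vdeg e d y = e k - 1" if y: "y \<in> h ` S" for y
    proof -
      obtain i where i: "i \<in> S" "y = h i" using y by blast
      obtain l a b where el: "i = Inr (l, a, b)" "h i = Cell l (a = 1) False b" "l \<in> below k" "a < 2" "b < 4" "e l + int a = e k - 1" using el[OF i(1)] by (elim exE conjE) (rule that)
      have "a = 0 \<or> a = 1" using el(4) by linarith
      then show ?thesis unfolding i(2) el(2) using el(6) by auto
    qed
    ultimately have "\<pi> (h ` S) = ?z \<and> good e d (below k) (e k - 1) (h ` S)"
      unfolding good_def using fS hK by blast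
    then show ?thesis by blast
  qed
qed

lemma vcx_I:
  assumes "\<And>k. k \<in> K \<Longrightarrow> good e d (below k) (e k - 1) (dd k)" "\<And>k. k \<notin> K \<Longrightarrow> dd k = {}"
    "\<And>k. k \<in> K \<Longrightarrow> lin (db dd) (dd k) = {}"
  shows "vcx e d dd"
proof
  fix k
  show "finite (dd k)" using assms(1,2)[of k] by (cases "k \<in> K") (auto simp: good_def)
  show "y \<in> dd k \<Longrightarrow> vdeg e d y = e k - 1" for y
    using assms(1,2)[of k] by (cases "k \<in> K") (auto simp: good_def)
  show "lin (db dd) (dd k) = {}" using assms(2,3)[of k] by (cases "k \<in> K") auto
qed

lemma lin_db_cong:
  assumes "finite S" "inK K S" "\<And>l. l \<in> K \<Longrightarrow> dd l = dd' l" "\<And>l. finite (dd l)"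
  shows "lin (db dd) S = lin (db dd') S"
proof (rule lin_cong[OF assms(1)])
  fix y assume "y \<in> S"
  show "db dd y = db dd' y"
  proof (cases y)
    case (Cell k p q m)
    then have "dd k = dd' k" using \<open>y \<in> S\<close> assms(2,3) unfolding inK_def by blast
    then show ?thesis unfolding Cell by simp
  qed simp_all
qed (use assms(4) in auto)

text \<open>A chain covering \<open>gbd Z (x k)\<close> need not be a cycle of the resolution, but
  its boundary is a cycle in the kernel of \<open>\<pi>\<close>, and \<open>kernel_acyclic\<close>
  supplies a correction inside that kernel.\<close>

lemma resolution:
  "\<exists>dd. vcx e d dd \<and> (\<forall>k<n. \<pi> (dd k) = gbd Z (x k) \<and> good e d (below k) (e k - 1) (dd k))"
proof -
  \<comment> \<open>Attaching data of the part of the resolution built so far: \<open>u\<close> is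
    cut off outside \<open>below k\<close>, so that \<open>\<Phi>\<close> depends on smaller degrees
    as \<open>degree_choice\<close> demands.\<close>
  define rs :: "nat \<Rightarrow> (nat \<Rightarrow> vsym set) \<Rightarrow> nat \<Rightarrow> vsym set"
    where "rs k u l = (if l \<in> below k then u l else {})" for k u l
  define \<Phi> where "\<Phi> k u y \<longleftrightarrow> good e d (below k) (e k - 1) y \<and> \<pi> y = gbd Z (x k) \<and>
    lin (db (rs k u)) y = {}" for k u y
  have agree: "lin (db dd) (u l) = {}"
    if "\<Phi> l u (u l)" "\<And>l'. l' \<in> below l \<Longrightarrow> dd l' = u l'" "\<And>l. finite (dd l)" for dd u l
  proof -
    have "lin (db dd) (u l) = lin (db (rs l u)) (u l)"
      by (rule lin_db_cong[where K = "below l"]) (use that in \<open>auto simp: \<Phi>_def good_def rs_def\<close>)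
    then show ?thesis using that(1) unfolding \<Phi>_def by blast
  qed
  have "\<exists>u. \<forall>k<n. \<Phi> k u (u k)"
  proof (rule degree_choice[where e = e])
    fix k u u' y assume *: "k < n" "\<And>l. l < n \<Longrightarrow> e l < e k \<Longrightarrow> u l = u' l" "\<Phi> k u y"
    then have "rs k u = rs k u'" by (auto simp: rs_def fun_eq_iff)
    then show "\<Phi> k u' y" using *(3) unfolding \<Phi>_def by simp
  next
    fix k u assume k: "k < n" and IH: "\<And>l. l < n \<Longrightarrow> e l < e k \<Longrightarrow> \<Phi> l u (u l)"
    define dd where "dd = rs k u"
    have ddK: "dd l = u l" "\<Phi> l u (u l)" if "l \<in> below k" for l
      using that IH by (auto simp: dd_def rs_def)
    have ddN: "dd l = {}" if "l \<notin> below k" for l using that by (auto simp: dd_def rs_def)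
    have fdd: "finite (dd l)" for l
      using ddK[of l] ddN[of l] by (cases "l \<in> below k") (auto simp: \<Phi>_def good_def)
    have V: "vcx e d dd"
    proof (rule vcx_I[where K = "below k"])
      fix l assume l: "l \<in> below k"
      then show "good e d (below l) (e l - 1) (dd l)" using ddK unfolding \<Phi>_def by simp
      have "lin (db dd) (u l) = {}"
        by (rule agree[OF ddK(2)[OF l] _ fdd]) (use l in \<open>auto simp: dd_def rs_def\<close>)
      then show "lin (db dd) (dd l) = {}" using ddK(1)[OF l] by simp
    qed (rule ddN)
    interpret V: vcx e d dd by (rule V)
    interpret VV: hcx "Vc e d dd" by (rule V.hcx_V)
    have K: "below k \<subseteq> {..<n}" by auto
    have dk: "\<pi> (dd l) = gbd Z (x l) \<and> inK (below k) (dd l)" if l: "l \<in> below k" for l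
    proof -
      have "inK (below l) (u l)" "\<pi> (u l) = gbd Z (x l)" using ddK(2)[OF l] by (auto simp: \<Phi>_def good_def)
      moreover have "below l \<subseteq> below k" using l by auto
      ultimately show ?thesis using ddK(1)[OF l] unfolding inK_def by auto
    qed
    obtain y0 where y0: "good e d (below k) (e k - 1) y0" "\<pi> y0 = gbd Z (x k)"
      using cover[OF k] by blast
    have f0: "finite y0" "inK (below k) y0" using y0(1) by (auto simp: good_def)
    have g: "good e d (below k) (e k - 2) (lin (db dd) y0)"
    proof -
      have "lin (db dd) y0 \<in> ggrade (Vc e d dd) (e k - 1 - 1)"
        by (rule VV.bd_grade[of y0 "e k - 1", simplified Vc_sel(5)]) (use y0(1) in \<open>simp add: good_def\<close>)
      moreover have "inK (below k) (lin (db dd) y0)"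
      proof (rule inK_lin[OF f0(1)])
        fix y assume "y \<in> y0"
        then have "inK (below k) {y}" using f0(2) unfolding inK_def by blast
        then show "inK (below k) (db dd y)" by (intro inK_db) (use dk in auto)
      qed auto
      ultimately show ?thesis unfolding good_def by simp
    qed
    have "\<pi> (lin (db dd) y0) = gzero Z"
      using pi_chain[OF V K _ f0] dk y0(2) k by simp
    then obtain y1 where y1: "good e d (below k) (e k - 2 + 1) y1" "lin (db dd) y1 = lin (db dd) y0" "\<pi> y1 = gzero Z"
      using kernel_acyclic[OF V K dk g] V.D_D[OF f0(1)] by blast
    have f1: "finite y1" using y1(1) by (simp add: good_def)
    have "\<Phi> k u (pl y0 y1)"
      unfolding \<Phi>_def dd_def[symmetric]
      using good_pl[OF y0(1), of y1] y1 f0 f1 y0(2) k by simp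
    then show "\<exists>y. \<Phi> k u y" by blast
  qed
  then obtain u where u: "\<And>k. k < n \<Longrightarrow> \<Phi> k u (u k)" by blast
  define dd where "dd k = (if k < n then u k else {})" for k
  have fdd: "finite (dd l)" for l using u[of l] by (auto simp: dd_def \<Phi>_def good_def)
  have "vcx e d dd"
  proof (rule vcx_I[where K = "{..<n}"])
    fix k assume "k \<in> {..<n}"
    then have k: "k < n" by simp
    then show "good e d (below k) (e k - 1) (dd k)" using u by (simp add: dd_def \<Phi>_def)
    have "lin (db dd) (u k) = {}"
      by (rule agree[OF u[OF k] _ fdd]) (simp add: dd_def)
    then show "lin (db dd) (dd k) = {}" using k by (simp add: dd_def)
  qed (simp add: dd_def)
  then show ?thesis using u by (intro exI[of _ dd]) (simp add: dd_def \<Phi>_def)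
qed

definition vt :: "'w gcx \<Rightarrow> (nat \<Rightarrow> 'w) \<Rightarrow> 'w" where
  "vt W c' = (if t = 0 then c' 0 else gadd W (c' t) (gj W (c' t)))"

text \<open>Lifting of \<open>P\<close> through the quasi-isomorphism \<open>h\<close>, prescribed on the fixed-point set, cell by cell
  over the resolution.\<close>

lemma lift:
  fixes W :: "'w gcx" and Q :: "'q gcx"
  assumes W: "is_gcx W" and Q: "hcx4 Q" and q: "qi W Q N h" and P: "hchain Z Q N P"
    and c': "\<And>i. i \<le> t \<Longrightarrow> c' i \<in> ggrade W (int i + \<sigma>)" "\<And>i. i \<le> t \<Longrightarrow> gj W (gj W (c' i)) = c' i"
      "\<And>i. i \<le> t \<Longrightarrow> gs W (c' i) = gzero W" "gj W (c' 0) = c' 0"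
      "gbd W (c' 0) = gzero W" "1 \<le> t \<Longrightarrow> gbd W (c' 1) = c' 0"
      "\<And>i. 2 \<le> i \<Longrightarrow> i \<le> t \<Longrightarrow> gbd W (c' i) = gadd W (c' (i - 1)) (gj W (c' (i - 1)))"
    and nul: "nul Q (d + N) (gadd Q (P vtop) (h (vt W c')))"
  shows "\<exists>f. gchain_map Z W f \<and> (\<forall>i\<le>t. f (c i) = c' i)"
proof -
  interpret W: gcx W by unfold_locales fact
  interpret Q: hcx4 Q by fact
  note hh = hchain_simps[OF qi_hchain[OF q]] hmapD(3)[OF hchainD(1)[OF qi_hchain[OF q]]]
  note PP = hchain_simps[OF P] hmapD(3)[OF hchainD(1)[OF P]]
  have h0: "h (gzero W) = gzero Q"
    by (rule addf_zero[OF W.vsp_axioms Q.vsp_axioms hmapD(1)[OF hchainD(1)[OF qi_hchain[OF q]]]])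
  have P0: "P (gzero Z) = gzero Q"
    by (rule addf_zero[OF vsp_axioms Q.vsp_axioms hmapD(1)[OF hchainD(1)[OF P]]])
  define v' where "v' = vt W c'"
  have c'car: "i \<le> t \<Longrightarrow> c' i \<in> gcar W" for i using c'(1) by blast
  have v'g: "v' \<in> ggrade W d" unfolding v'_def vt_def using c'(1)[of t] by (auto simp: add.commute)
  have v'car: "v' \<in> gcar W" using v'g by blast
  have v'j: "gj W v' = v'" unfolding v'_def vt_def using c'(2,4) c'car[of t] by (auto simp: W.ac)
  have v's: "gs W v' = gzero W" unfolding v'_def vt_def using c'(3) c'car[of t] c'(3)[of 0] c'(3)[of t]
    by (auto simp: W.s_j)
  have v'bd: "gbd W v' = gzero W"
  proof -
    consider "t = 0" | "t = 1" | "2 \<le> t" by linarith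
    then show ?thesis
    proof cases
      case 3
      have "c' t \<in> gcar W" "c' (t - 1) \<in> gcar W" using c'car by auto
      then show ?thesis using 3 c'(2)[of "t - 1"] c'(7)[of t] unfolding v'_def vt_def
        by (simp add: W.bd_j W.ac)
    next
      case 1
      then have "v' = c' 0" unfolding v'_def vt_def by simp
      then show ?thesis using c'(5) by simp
    next
      case 2
      then have "v' = gadd W (c' 1) (gj W (c' 1))" unfolding v'_def vt_def by simp
      then show ?thesis using 2 c'(4,6) c'car[of 1] c'car[of 0] by (simp add: W.bd_j)
    qed
  qed
  \<comment> \<open>These become the values of the homotopy on \<open>Bt 0\<close> and
    \<open>Bs 0\<close>.\<close>
  obtain b b' where b: "b \<in> ggrade Q (d + N + 1)" "b' \<in> ggrade Q (d + N + 2)"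
    "gbd Q b = gadd Q (P vtop) (h v')" "gbd Q b' = gadd Q b (gj Q b)"
    "gs Q b = gadd Q b' (gj Q b')" "gs Q (gj Q b) = gadd Q (gj Q b') (gj Q (gj Q b'))"
    "gs Q b' = gzero Q" "gs Q (gj Q b') = gzero Q"
    using nul unfolding nul_def v'_def by blast
  have bcar [simp]: "b \<in> gcar Q" "b' \<in> gcar Q" using b by auto
  obtain dd where V: "vcx e d dd"
    and dd: "\<And>k. k < n \<Longrightarrow> \<pi> (dd k) = gbd Z (x k) \<and> good e d (below k) (e k - 1) (dd k)"
    using resolution by blast
  interpret V: vcx e d dd by (rule V)
  define wk :: "nat \<Rightarrow> (nat \<Rightarrow> 'w \<times> 'q) \<Rightarrow> nat \<Rightarrow> 'w"
    where "wk k u l = (if l \<in> below k then fst (u l) else gzero W)" for k u l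
  define ak :: "nat \<Rightarrow> (nat \<Rightarrow> 'w \<times> 'q) \<Rightarrow> nat \<Rightarrow> 'q"
    where "ak k u l = (if l \<in> below k then snd (u l) else gzero Q)" for k u l
  \<comment> \<open>A choice for \<open>k\<close> is a pair: the image of \<open>x k\<close> in
    \<open>W\<close>, and the value in \<open>Q\<close> of a homotopy, of degree
    \<open>N + 1\<close>, between \<open>P\<close> and the lifted map followed by \<open>h\<close>.
    Both are extended over the resolution, where the relation \<open>sj = j^3 s\<close> is not
    demanded of \<open>Q\<close>.\<close>
  define \<Phi> where "\<Phi> k u y \<longleftrightarrow> fst y \<in> ggrade W (e k) \<and> snd y \<in> ggrade Q (e k + N + 1) \<and>
    gbd W (fst y) = hv W (wk k u) v' (gzero W) (dd k) \<and>
    gbd Q (snd y) = gadd Q (gadd Q (hv Q (ak k u) b b' (dd k)) (P (x k))) (h (fst y))" for k u y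
  have "\<exists>u. \<forall>k<n. \<Phi> k u (u k)"
  proof (rule degree_choice[where e = e])
    fix k u u' y assume *: "k < n" "\<And>l. l < n \<Longrightarrow> e l < e k \<Longrightarrow> u l = u' l" "\<Phi> k u y"
    then have "wk k u = wk k u'" "ak k u = ak k u'" by (auto simp: wk_def ak_def fun_eq_iff)
    then show "\<Phi> k u' y" using *(3) unfolding \<Phi>_def by simp
  next
    fix k u assume k: "k < n" and IH: "\<And>l. l < n \<Longrightarrow> e l < e k \<Longrightarrow> \<Phi> l u (u l)"
    have vW: "vmap W e d 0 (wk l u) v' (gzero W)" if "l = k \<or> l \<in> below k" for l
      by unfold_locales (use IH that v'g v'j v's in \<open>auto simp: wk_def \<Phi>_def\<close>)
    have vQ: "vmap Q e d (N + 1) (ak l u) b b'" if "l = k \<or> l \<in> below k" for l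
      by unfold_locales (use IH that b in \<open>auto simp: ak_def \<Phi>_def algebra_simps\<close>)
    interpret fW: vmap W e d 0 "wk k u" v' "gzero W" by (rule vW) simp
    interpret fQ: vmap Q e d "N + 1" "ak k u" b b' by (rule vQ) simp
    have gens: "gbd W (fst (u l)) = fW.f (dd l)"
      "gbd Q (snd (u l)) = gadd Q (gadd Q (fQ.f (dd l)) (P (x l))) (h (fst (u l)))"
      if l: "l \<in> below k" for l
    proof -
      have i: "inK (below l) (dd l)" using dd[of l] l by (auto simp: good_def)
      have "hv W (wk l u) v' (gzero W) (dd l) = fW.f (dd l)"
        by (rule vmap.f_cong[OF vW i]) (use l in \<open>auto simp: wk_def\<close>)
      moreover have "hv Q (ak l u) b b' (dd l) = fQ.f (dd l)"
        by (rule vmap.f_cong[OF vQ i]) (use l in \<open>auto simp: ak_def\<close>)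
      moreover have "\<Phi> l u (u l)" using IH l by blast
      ultimately show "gbd W (fst (u l)) = fW.f (dd l)"
        "gbd Q (snd (u l)) = gadd Q (gadd Q (fQ.f (dd l)) (P (x l))) (h (fst (u l)))"
        unfolding \<Phi>_def by simp_all
    qed
    have ucar: "fst (u l) \<in> gcar W" "snd (u l) \<in> gcar Q" if "l \<in> below k" for l
      using IH that unfolding \<Phi>_def by blast+
    have 1: "fW.f (V.D S) = gbd W (fW.f S)" if "finite S" "inK (below k) S" for S
      using that
    proof (induction rule: Vgen[where P = "\<lambda>S. fW.f (V.D S) = gbd W (fW.f S)"])
      case (cell l)
      then show ?case using gens(1)[OF cell] by (simp add: act_simps wk_def)
    next
      case bt
      show ?case using v'bd by simp
    next
      case bs
      show ?case using v'j v'car by simp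
    next
      case (s A)
      then show ?case by (simp add: V.D_s fW.f_s fW.f_j W.bd_s)
    next
      case (j A)
      then show ?case by (simp add: V.D_j fW.f_j W.bd_j)
    qed simp_all
    \<comment> \<open>The homotopy formula \<open>\<partial>H + H\<partial> = P \<pi> + h f\<close>
      on chains over the generators already treated.\<close>
    have 2: "gadd Q (gbd Q (fQ.f S)) (fQ.f (V.D S)) = gadd Q (P (\<pi> S)) (h (fW.f S))"
      if "finite S" "inK (below k) S" for S
      using that
    proof (induction rule: Vgen[where P = "\<lambda>S. gadd Q (gbd Q (fQ.f S)) (fQ.f (V.D S)) = gadd Q (P (\<pi> S)) (h (fW.f S))"])
      case empty
      show ?case by (simp add: P0 h0)
    next
      case (cell l)
      then have l: "l < n" by simp
      show ?case using gens(2)[OF cell] ucar[OF cell] l cell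
        by (simp add: act_simps wk_def ak_def xz_def Q.ac PP hh)
    next
      case bt
      show ?case using b(3) by (simp add: PP hh v'car)
    next
      case bs
      show ?case using b(4) by (simp add: P0 h0)
    next
      case (add A B)
      have "gadd Q (gbd Q (fQ.f (pl A B))) (fQ.f (V.D (pl A B)))
        = gadd Q (gadd Q (gbd Q (fQ.f A)) (fQ.f (V.D A))) (gadd Q (gbd Q (fQ.f B)) (fQ.f (V.D B)))"
        using add.hyps(1,2) by (simp add: Q.ac)
      also have "\<dots> = gadd Q (P (\<pi> (pl A B))) (h (fW.f (pl A B)))"
        unfolding add.IH using add.hyps(1,2) by (simp add: Q.ac PP hh)
      finally show ?case .
    next
      case (s A)
      have "gadd Q (gbd Q (fQ.f (sV A))) (fQ.f (V.D (sV A))) = gs Q (gadd Q (gbd Q (fQ.f A)) (fQ.f (V.D A)))"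
        using s.hyps(1) by (simp add: V.D_s fQ.f_s fQ.f_j Q.bd_s Q.ac)
      also have "\<dots> = gadd Q (P (\<pi> (sV A))) (h (fW.f (sV A)))"
        unfolding s.IH using s.hyps(1) by (simp add: PP hh pi.f_s fW.f_s)
      finally show ?case .
    next
      case (j A)
      have "gadd Q (gbd Q (fQ.f (jV A))) (fQ.f (V.D (jV A))) = gj Q (gadd Q (gbd Q (fQ.f A)) (fQ.f (V.D A)))"
        using j.hyps(1) by (simp add: V.D_j fQ.f_j Q.bd_j)
      also have "\<dots> = gadd Q (P (\<pi> (jV A))) (h (fW.f (jV A)))"
        unfolding j.IH using j.hyps(1) by (simp add: PP hh pi.f_j fW.f_j)
      finally show ?case .
    qed
    have dk: "finite (dd k)" "inK (below k) (dd k)" "\<And>y. y \<in> dd k \<Longrightarrow> vdeg e d y = e k - 1"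
      "\<pi> (dd k) = gbd Z (x k)"
      using dd[OF k] by (auto simp: good_def)
    define q0 where "q0 = gadd Q (fQ.f (dd k)) (P (x k))"
    have "fQ.f (dd k) \<in> ggrade Q (e k - 1 + (N + 1))" using fQ.f_grade[OF dk(1,3)] .
    then have q0g: "q0 \<in> ggrade Q (e k + N)"
      unfolding q0_def using PP(6)[OF x_grade[OF k]] by simp
    have yg: "fW.f (dd k) \<in> ggrade W (e k - 1)" using fW.f_grade[OF dk(1,3)] by simp
    have "gbd Q (fQ.f (dd k)) = gadd Q (P (gbd Z (x k))) (h (fW.f (dd k)))"
      using 2[OF dk(1,2)] V.bd_d dk(4) by simp
    then have q0b: "gbd Q q0 = h (fW.f (dd k))"
      unfolding q0_def using k by (simp add: PP hh Q.ac)
    \<comment> \<open>Injectivity of \<open>h\<close> on homology yields a first image of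
      \<open>x k\<close>. Surjectivity then corrects it by a cycle \<open>w1\<close> so that the
      homotopy extends.\<close>
    obtain w0 where w0: "w0 \<in> ggrade W (e k)" "fW.f (dd k) = gbd W w0"
      using qi_inj[OF q yg q0g _ q0b[symmetric]] by auto
    have w0c: "w0 \<in> gcar W" "q0 \<in> gcar Q" using w0 q0g by auto
    have "gadd Q q0 (h w0) \<in> ggrade Q (e k + N)" using q0g hh(6)[OF w0(1)] by simp
    moreover have "gbd Q (gadd Q q0 (h w0)) = gzero Q" using w0c q0b w0(2) by (simp add: hh)
    ultimately obtain w1 a where w1: "w1 \<in> ggrade W (e k + N - N)" "a \<in> ggrade Q (e k + N + 1)"
      "gbd W w1 = gzero W" "gadd Q q0 (h w0) = gadd Q (h w1) (gbd Q a)"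
      using qi_surj[OF q] by blast
    have w1c: "w1 \<in> gcar W" "a \<in> gcar Q" using w1 by auto
    have "gbd Q a = gadd Q (h w1) (gadd Q q0 (h w0))"
      unfolding w1(4) using w1c by (simp add: hh)
    also have "\<dots> = gadd Q q0 (h (gadd W w0 w1))"
      using w0c w1c by (simp add: hh Q.ac)
    finally have "gbd Q a = gadd Q q0 (h (gadd W w0 w1))" .
    then have "\<Phi> k u (gadd W w0 w1, a)"
      unfolding \<Phi>_def q0_def using w0 w1 w0c w1c by simp
    then show "\<exists>y. \<Phi> k u y" by blast
  qed
  then obtain u where u: "\<And>k. k < n \<Longrightarrow> \<Phi> k u (u k)" by blast
  have xg: "\<And>k. k < n \<Longrightarrow> fst (u k) \<in> ggrade W (e k)" using u unfolding \<Phi>_def by blast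
  \<comment> \<open>The images in \<open>W\<close> found over the resolution descend to
    \<open>Z\<close>, because \<open>W\<close> satisfies all the relations.\<close>
  obtain f where f: "hmap Z W 0 f" "\<And>i. i \<le> t \<Longrightarrow> f (c i) = c' i" "\<And>k. k < n \<Longrightarrow> f (x k) = fst (u k)"
    using univ[OF W c'(1-4) xg] by blast
  note ff = hmapD[OF f(1)]
  have f0: "f (gzero Z) = gzero W" by (rule addf_zero[OF vsp_axioms W.vsp_axioms ff(1)])
  have fv: "f vtop = v'"
    unfolding vtop_def v'_def vt_def using f(2)[of 0] f(2)[of t] by (auto simp: ff)
  have ch: "f (gbd Z z) = gbd W (f z)" if "z \<in> gcar Z" for z
    using that
  proof (induction rule: gen_induct)
    case zero
    show ?case by (simp add: f0)
  next
    case (cgen i)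
    consider "i = 0" | "i = 1" | "2 \<le> i" by linarith
    then show ?case
    proof cases
      case 1
      then show ?thesis using f(2)[of 0] bd_c0 c'(5) by (simp add: f0)
    next
      case 2
      then show ?thesis using f(2)[of 0] f(2)[of 1] bd_c1 c'(6) \<open>i \<le> t\<close> by simp
    next
      case 3
      then show ?thesis
        using f(2)[of i] f(2)[of "i - 1"] bd_c[of i] c'(7)[of i] \<open>i \<le> t\<close> by (simp add: ff)
    qed
  next
    case (xgen k)
    have "f (gbd Z (x k)) = f (\<pi> (dd k))" using dd[OF xgen] by simp
    also have "\<dots> = hv W (\<lambda>l. f (xz l)) (f vtop) (f (gzero Z)) (dd k)"
      by (rule pi.f_push[OF W.hcx_axioms f(1)])
    also have "\<dots> = hv W (\<lambda>l. f (xz l)) v' (gzero W) (dd k)" by (simp add: fv f0)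
    also have "\<dots> = hv W (wk k u) v' (gzero W) (dd k)"
    proof (rule vmap.f_cong[where K = "below k"])
      show "vmap W e d 0 (\<lambda>l. f (xz l)) v' (gzero W)"
        by unfold_locales (use v'g v'j v's f(3) xg f0 in \<open>auto simp: xz_def\<close>)
      show "inK (below k) (dd k)" using dd[OF xgen] by (simp add: good_def)
      show "f (xz l) = wk k u l" if "l \<in> below k" for l
        using that f(3) by (auto simp: xz_def wk_def)
    qed
    also have "\<dots> = gbd W (f (x k))" using u[OF xgen] f(3)[OF xgen] unfolding \<Phi>_def by simp
    finally show ?case .
  qed (simp_all add: ff bd_s bd_j W.bd_s W.bd_j)
  have "hchain Z W 0 f" using f(1) ch by (simp add: hchain_def)
  then show ?thesis using f(2) by (auto simp: gchain_map_iff)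
qed

end

subsection \<open>Local maps and quotients\<close>

definition lmap :: "'v gcx \<Rightarrow> 'w gcx \<Rightarrow> ('v \<Rightarrow> 'w) \<Rightarrow> bool" where
  "lmap A B f \<longleftrightarrow> gchain_map A B f \<and> f ` gfix A \<subseteq> gfix B \<and> inj_on f (gfix A)"

text \<open>Injections both ways between finite sets, on the whole fixed-point sets and in each
  degree separately, make \<open>f\<close> an isomorphism there; its inverse and zero homotopies
  serve as witnesses.\<close>

lemma fix_he_lmap:
  assumes A: "hcx A" "fixok A" "finite (gfix A)" and B: "hcx B" "fixok B" "finite (gfix B)"
    and f: "lmap A B f" and g: "lmap B A g"
  shows "fix_he A B f"
proof -
  interpret A: hcx A by fact
  interpret B: hcx B by fact
  have f1: "\<And>x. x \<in> gfix A \<Longrightarrow> f x \<in> gfix B" "inj_on f (gfix A)" "hchain A B 0 f"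
    using f unfolding lmap_def gchain_map_iff by blast+
  have g1: "\<And>x. x \<in> gfix B \<Longrightarrow> g x \<in> gfix A" "inj_on g (gfix B)" "hchain B A 0 g"
    using g unfolding lmap_def gchain_map_iff by blast+
  have fA: "\<And>x. x \<in> gfix A \<Longrightarrow> x \<in> gcar A" "gzero A \<in> gfix A"
    "\<And>x y. x \<in> gfix A \<Longrightarrow> y \<in> gfix A \<Longrightarrow> gadd A x y \<in> gfix A"
    "\<And>x. x \<in> gfix A \<Longrightarrow> gbd A x \<in> gfix A"
    using A(2) unfolding fixok_def by blast+
  have fB: "\<And>x. x \<in> gfix B \<Longrightarrow> x \<in> gcar B" "gzero B \<in> gfix B"
    "\<And>x. x \<in> gfix B \<Longrightarrow> gbd B x \<in> gfix B"
    using B(2) unfolding fixok_def by blast+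
  have onto: "f ` S = T" if "S \<subseteq> gfix A" "T \<subseteq> gfix B" "f ` S \<subseteq> T" "g ` T \<subseteq> S" for S T
  proof (rule card_seteq)
    have "finite S" using A(3) that(1) finite_subset by blast
    moreover show "finite T" using B(3) that(2) finite_subset by blast
    ultimately have "card T \<le> card S"
      using card_inj_on_le[OF inj_on_subset[OF g1(2) that(2)] that(4)] by blast
    then show "card T \<le> card (f ` S)" using card_image[OF inj_on_subset[OF f1(2) that(1)]] by simp
  qed fact
  define r where "r = inv_into (gfix A) f"
  have im: "f ` gfix A = gfix B" by (rule onto) (use f1(1) g1(1) in auto)
  have r: "\<And>y. y \<in> gfix B \<Longrightarrow> r y \<in> gfix A" "\<And>y. y \<in> gfix B \<Longrightarrow> f (r y) = y"
    using im unfolding r_def by (auto intro: inv_into_into f_inv_into_f)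
  have rf: "\<And>x. x \<in> gfix A \<Longrightarrow> r (f x) = x"
    unfolding r_def using f1(2) by (rule inv_into_f_f)
  have r_gr: "r y \<in> ggrade A m" if y: "y \<in> gfix B" "y \<in> ggrade B m" for y m
  proof -
    have "f ` (gfix A \<inter> ggrade A m) = gfix B \<inter> ggrade B m"
      by (rule onto)
        (use f1(1) g1(1) hmapD(3)[OF hchainD(1)[OF f1(3)]] hmapD(3)[OF hchainD(1)[OF g1(3)]] in fastforce)+
    then obtain x where x: "x \<in> gfix A" "x \<in> ggrade A m" "y = f x" using y by blast
    then show ?thesis using rf[OF x(1)] by simp
  qed
  have r_add: "r (gadd B y z) = gadd A (r y) (r z)" if "y \<in> gfix B" "z \<in> gfix B" for y z
  proof -
    have "gadd B y z = f (gadd A (r y) (r z))"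
      using hchain_simps(4)[OF f1(3), of "r y" "r z"] r that fA(1) by simp
    then show ?thesis using rf fA(3) r(1) that by simp
  qed
  have r_bd: "r (gbd B y) = gbd A (r y)" if "y \<in> gfix B" for y
  proof -
    have "gbd B y = f (gbd A (r y))"
      using hchain_simps(5)[OF f1(3), of "r y"] r that fA(1) by simp
    then show ?thesis using rf fA(4) r(1) that by simp
  qed
  show ?thesis
    unfolding fix_he_def
  proof (intro conjI)
    show "\<forall>x\<in>gfix A. f x \<in> gfix B" using f1(1) by blast
    show "\<exists>g h k.
        (\<forall>y\<in>gfix B. g y \<in> gfix A) \<and> additive_on B A (gfix B) g \<and>
        (\<forall>n. \<forall>y\<in>gfix B \<inter> ggrade B n. g y \<in> ggrade A n) \<and>
        (\<forall>y\<in>gfix B. g (gbd B y) = gbd A (g y)) \<and>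
        (\<forall>x\<in>gfix A. h x \<in> gfix A) \<and> additive_on A A (gfix A) h \<and>
        (\<forall>n. \<forall>x\<in>gfix A \<inter> ggrade A n. h x \<in> ggrade A (n + 1)) \<and>
        (\<forall>y\<in>gfix B. k y \<in> gfix B) \<and> additive_on B B (gfix B) k \<and>
        (\<forall>n. \<forall>y\<in>gfix B \<inter> ggrade B n. k y \<in> ggrade B (n + 1)) \<and>
        (\<forall>x\<in>gfix A. g (f x) = gadd A x (gadd A (gbd A (h x)) (h (gbd A x)))) \<and>
        (\<forall>y\<in>gfix B. f (g y) = gadd B y (gadd B (gbd B (k y)) (k (gbd B y))))"
      by (rule exI[of _ r], rule exI[of _ "\<lambda>_. gzero A"], rule exI[of _ "\<lambda>_. gzero B"])
        (simp add: additive_on_def r rf r_gr r_add r_bd fA fB)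
  qed
qed

lemma lmap_comp: "lmap A B f \<Longrightarrow> lmap B C g \<Longrightarrow> lmap A C (\<lambda>x. g (f x))"
  unfolding lmap_def gchain_map_iff
  using hchain_comp[of A B 0 f C 0 g] comp_inj_on[of f "gfix A" g]
  by (auto simp: comp_def intro: inj_on_subset)

lemma hdecomp_map:
  assumes "is_gcx Z" "is_gcx W" "hchain Z W 0 F" and h: "hdecomp Z (gcar Z) h z"
  shows "hdecomp W (gcar W) (\<lambda>m. F (h m)) (F z)"
proof -
  interpret Z: gcx Z by unfold_locales fact
  interpret W: gcx W by unfold_locales fact
  note FF = hchain_simps[OF assms(3)] hmapD(3)[OF hchainD(1)[OF assms(3)]]
  note add = hmapD(1)[OF hchainD(1)[OF assms(3)]]
  have F0: "F (gzero Z) = gzero W" by (rule addf_zero[OF Z.vsp_axioms W.vsp_axioms add])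
  let ?S = "{m. h m \<noteq> gzero Z}" let ?T = "{m. F (h m) \<noteq> gzero W}"
  have h1: "\<And>m. h m \<in> ggrade Z m" "finite ?S" "z = gsum Z h ?S" using h unfolding hdecomp_def by blast+
  have g: "F (h m) \<in> ggrade W m" for m using FF(6)[OF h1(1), of m] by simp
  have sub: "?T \<subseteq> ?S" using F0 by auto
  have "F z = gsum W (\<lambda>m. F (h m)) ?S"
    unfolding h1(3) by (rule addf_gsum[OF Z.vsp_axioms W.vsp_axioms add]) (use h1(1) in blast)
  also have "\<dots> = gsum W (\<lambda>m. F (h m)) ?T"
    by (rule W.gsum_mono[OF h1(2) sub]) (use g in auto)
  finally show ?thesis
    unfolding hdecomp_def using g finite_subset[OF sub h1(2)] by blast
qed

text \<open>The components of \<open>z\<close> map to the homogeneous decomposition of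
  \<open>F z\<close>, so the component of degree \<open>m\<close> already has image
  \<open>F z\<close>.\<close>

lemma grade_lift:
  assumes "is_gcx Z" "is_gcx W" "hchain Z W 0 F" "z \<in> gcar Z" "F z \<in> ggrade W m"
  shows "\<exists>z'\<in>ggrade Z m. F z' = F z"
proof -
  interpret Z: gcx Z by unfold_locales fact
  interpret W: gcx W by unfold_locales fact
  obtain h where h: "hdecomp Z (gcar Z) h z" using Z.hdecomp_ex1[OF assms(4)] by blast
  have "(\<lambda>k. F (h k)) = (\<lambda>k. if k = m then F z else gzero W)"
    using W.hdecomp_ex1[of "F z"] hdecomp_map[OF assms(1-3) h] W.hdecomp_single[OF assms(5)]
      W.grade_car[OF assms(5)] by blast
  from fun_cong[OF this, of m] have "F (h m) = F z" by simp
  moreover have "h m \<in> ggrade Z m" using h unfolding hdecomp_def by blast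
  ultimately show ?thesis by blast
qed

section \<open>Kernels and quotient complexes\<close>

definition ker :: "'v gcx \<Rightarrow> 'w gcx \<Rightarrow> ('v \<Rightarrow> 'w) \<Rightarrow> 'v set" where
  "ker Z W F = {z \<in> gcar Z. F z = gzero W}"

lemma gsubcx_ker:
  assumes "is_gcx Z" "is_gcx W" "hchain Z W 0 F"
  shows "gsubcx Z (ker Z W F)"
proof -
  interpret Z: gcx Z by unfold_locales fact
  interpret W: gcx W by unfold_locales fact
  note FF = hchain_simps[OF assms(3)]
  have F0: "F (gzero Z) = gzero W"
    by (rule addf_zero[OF Z.vsp_axioms W.vsp_axioms hmapD(1)[OF hchainD(1)[OF assms(3)]]])
  have "\<exists>h. hdecomp Z (ker Z W F) h z" if z: "z \<in> ker Z W F" for z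
  proof -
    have z1: "z \<in> gcar Z" "F z = gzero W" using z unfolding ker_def by auto
    obtain h where h: "hdecomp Z (gcar Z) h z" using Z.hdecomp_ex1[OF z1(1)] by blast
    have "hdecomp W (gcar W) (\<lambda>k. F (h k)) (gzero W)" using hdecomp_map[OF assms h] z1(2) by simp
    moreover have "hdecomp W (gcar W) (\<lambda>k. gzero W) (gzero W)"
      using W.hdecomp_single[OF W.grade_zero, of 0] by simp
    ultimately have "(\<lambda>k. F (h k)) = (\<lambda>k. gzero W)" using W.hdecomp_ex1[OF W.zero_closed] by blast
    then have "h k \<in> ker Z W F" for k
      using h fun_cong[of "\<lambda>k. F (h k)" "\<lambda>k. gzero W" k] unfolding hdecomp_def ker_def by simp
    then have "hdecomp Z (ker Z W F) h z" using h unfolding hdecomp_def by blast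
    then show ?thesis by blast
  qed
  then show ?thesis
    unfolding gsubcx_def by (auto simp: ker_def FF F0)
qed

locale subcx = gcx Z for Z :: "'v gcx" +
  fixes M assumes sub: "gsubcx Z M"
begin

lemma M_car [simp]: "m \<in> M \<Longrightarrow> m \<in> gcar Z"
  and M_zero [simp]: "gzero Z \<in> M"
  and M_add: "m \<in> M \<Longrightarrow> m' \<in> M \<Longrightarrow> gadd Z m m' \<in> M"
  and M_op: "m \<in> M \<Longrightarrow> gbd Z m \<in> M" "m \<in> M \<Longrightarrow> gs Z m \<in> M" "m \<in> M \<Longrightarrow> gj Z m \<in> M"
  using sub by (auto simp: gsubcx_def)

abbreviation "\<pi> \<equiv> coset Z M"
abbreviation "Q \<equiv> quot Z M"

lemma mem_coset: "x \<in> gcar Z \<Longrightarrow> y \<in> \<pi> x \<longleftrightarrow> y \<in> gcar Z \<and> gadd Z x y \<in> M"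
proof
  assume x: "x \<in> gcar Z" and "y \<in> \<pi> x"
  then obtain m where "m \<in> M" "y = gadd Z x m" unfolding coset_def by blast
  then show "y \<in> gcar Z \<and> gadd Z x y \<in> M" using x by simp
next
  assume x: "x \<in> gcar Z" and "y \<in> gcar Z \<and> gadd Z x y \<in> M"
  moreover from this have "y = gadd Z x (gadd Z x y)" by simp
  ultimately show "y \<in> \<pi> x" unfolding coset_def by blast
qed

lemma coset_self: "x \<in> gcar Z \<Longrightarrow> x \<in> \<pi> x"
  by (simp add: mem_coset)

lemma coset_eq: "x \<in> gcar Z \<Longrightarrow> y \<in> gcar Z \<Longrightarrow> \<pi> x = \<pi> y \<longleftrightarrow> gadd Z x y \<in> M"
proof
  assume "x \<in> gcar Z" "y \<in> gcar Z" "\<pi> x = \<pi> y"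
  then show "gadd Z x y \<in> M" using coset_self[of y] mem_coset[of x y] by simp
next
  assume x: "x \<in> gcar Z" "y \<in> gcar Z" and m: "gadd Z x y \<in> M"
  have "gadd Z x z \<in> M \<longleftrightarrow> gadd Z y z \<in> M" if z: "z \<in> gcar Z" for z
  proof -
    have "gadd Z y z = gadd Z (gadd Z x y) (gadd Z x z)" "gadd Z x z = gadd Z (gadd Z x y) (gadd Z y z)"
      using x z by (simp_all add: ac)
    then show ?thesis using M_add[OF m] by metis
  qed
  then show "\<pi> x = \<pi> y" using x by (auto simp: mem_coset)
qed

lemma coset_zero: "\<pi> (gzero Z) = M"
proof (rule set_eqI)
  show "y \<in> \<pi> (gzero Z) \<longleftrightarrow> y \<in> M" for y
    unfolding mem_coset[OF zero_closed] by (cases "y \<in> gcar Z") (use M_car in auto)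
qed

lemma coset_M: "m \<in> M \<Longrightarrow> \<pi> m = M"
  using coset_eq[OF M_car zero_closed, of m] unfolding coset_zero by simp

lemma quot_sel:
  "gcar Q = \<pi> ` gcar Z" "gzero Q = \<pi> (gzero Z)" "ggrade Q k = \<pi> ` ggrade Z k" "gfix Q = \<pi> ` gfix Z"
  by (simp_all add: quot_def coset_zero)

lemma quot_add: "x \<in> gcar Z \<Longrightarrow> y \<in> gcar Z \<Longrightarrow> gadd Q (\<pi> x) (\<pi> y) = \<pi> (gadd Z x y)"
proof -
  assume xy: "x \<in> gcar Z" "y \<in> gcar Z"
  have "{gadd Z a b | a b. a \<in> \<pi> x \<and> b \<in> \<pi> y} = \<pi> (gadd Z x y)"
  proof (intro equalityI subsetI)
    fix z assume "z \<in> {gadd Z a b | a b. a \<in> \<pi> x \<and> b \<in> \<pi> y}"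
    then obtain a b where ab: "z = gadd Z a b" "a \<in> \<pi> x" "b \<in> \<pi> y" by blast
    have m: "a \<in> gcar Z" "b \<in> gcar Z" "gadd Z x a \<in> M" "gadd Z y b \<in> M"
      using ab(2,3) mem_coset[OF xy(1)] mem_coset[OF xy(2)] by simp_all
    have "gadd Z (gadd Z x a) (gadd Z y b) = gadd Z (gadd Z x y) z"
      unfolding ab(1) using m(1,2) xy by (simp add: ac)
    then show "z \<in> \<pi> (gadd Z x y)"
      using M_add[OF m(3,4)] mem_coset[OF add_closed[OF xy]] add_closed[OF m(1,2)] unfolding ab(1) by simp
  next
    fix z assume "z \<in> \<pi> (gadd Z x y)"
    then have z: "z \<in> gcar Z" "gadd Z (gadd Z x y) z \<in> M" using mem_coset[OF add_closed[OF xy]] by simp_all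
    have "z = gadd Z x (gadd Z x z)" using add_self_left[OF xy(1) z(1)] by (rule sym)
    moreover have "gadd Z y (gadd Z x z) = gadd Z (gadd Z x y) z" using xy z(1) by (simp add: ac)
    then have "gadd Z x z \<in> \<pi> y" using mem_coset[OF xy(2)] add_closed[OF xy(1) z(1)] z(2) by simp
    ultimately show "z \<in> {gadd Z a b | a b. a \<in> \<pi> x \<and> b \<in> \<pi> y}" using coset_self[OF xy(1)] by blast
  qed
  then show ?thesis by (simp add: quot_def)
qed

lemma qlift_coset:
  assumes f: "addf Z Z f" "\<And>m. m \<in> M \<Longrightarrow> f m \<in> M" and x: "x \<in> gcar Z"
  shows "qlift Z M f (\<pi> x) = \<pi> (f x)"
proof (intro equalityI subsetI)
  fix z assume "z \<in> qlift Z M f (\<pi> x)"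
  then obtain a m where am: "z = gadd Z (f a) m" "a \<in> \<pi> x" "m \<in> M" unfolding qlift_def by blast
  have a: "a \<in> gcar Z" "gadd Z x a \<in> M" using am(2) mem_coset[OF x] by simp_all
  have "gadd Z (f x) (f a) \<in> M" using f(2)[OF a(2)] addf_add[OF f(1) x a(1)] by simp
  moreover have fc: "f x \<in> gcar Z" "f a \<in> gcar Z" using addf_closed[OF f(1)] x a(1) by blast+
  moreover have "gadd Z (f x) z = gadd Z (gadd Z (f x) (f a)) m"
    unfolding am(1) using fc M_car[OF am(3)] by (simp add: ac)
  ultimately show "z \<in> \<pi> (f x)"
    using M_add[OF _ am(3)] mem_coset[OF fc(1)] M_car[OF am(3)] unfolding am(1) by simp
next
  fix z assume "z \<in> \<pi> (f x)"
  then obtain m where "m \<in> M" "z = gadd Z (f x) m" unfolding coset_def by blast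
  then show "z \<in> qlift Z M f (\<pi> x)" unfolding qlift_def using coset_self[OF x] by blast
qed

lemma quot_op: "x \<in> gcar Z \<Longrightarrow> gbd Q (\<pi> x) = \<pi> (gbd Z x)" "x \<in> gcar Z \<Longrightarrow> gs Q (\<pi> x) = \<pi> (gs Z x)"
  "x \<in> gcar Z \<Longrightarrow> gj Q (\<pi> x) = \<pi> (gj Z x)"
  using qlift_coset[OF addf_bd] qlift_coset[OF addf_s] qlift_coset[OF addf_j] M_op
  by (simp_all add: quot_def)

lemma coset_in_grade: "x \<in> ggrade Z k \<Longrightarrow> \<pi> x \<in> \<pi> ` ggrade Z k" by (rule imageI)

lemma hcx4_quot: "hcx4 Q"
  by unfold_locales
    (auto simp: quot_sel quot_add quot_op ac bd_j bd_s s_j_j s_j_s_j intro!: coset_in_grade bd_grade s_grade)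

lemma hchain_coset: "hchain Z Q 0 \<pi>"
  unfolding hchain_def hmap_def addf_def additive_on_def by (auto simp: quot_sel quot_add quot_op)

lemma fixok_quot: "fixok Z \<Longrightarrow> fixok Q"
  unfolding fixok_def by (auto simp: quot_sel quot_add quot_op subset_iff)

text \<open>The induced map on cosets, evaluated at an arbitrary representative; independent of it
  once \<open>F\<close> vanishes on \<open>M\<close>.\<close>

definition ind :: "('v \<Rightarrow> 'w) \<Rightarrow> 'v set \<Rightarrow> 'w" where
  "ind F X = F (SOME z. z \<in> X)"

lemma ind_coset:
  assumes "hcx B" "hchain Z B 0 F" "\<And>m. m \<in> M \<Longrightarrow> F m = gzero B" "x \<in> gcar Z"
  shows "ind F (\<pi> x) = F x"
proof -
  interpret B: hcx B by fact
  note FF = hchain_simps[OF assms(2)]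
  define y where "y = (SOME z. z \<in> \<pi> x)"
  have "y \<in> \<pi> x" unfolding y_def using coset_self[OF assms(4)] by (rule someI)
  then have y: "y \<in> gcar Z" "gadd Z x y \<in> M" using mem_coset[OF assms(4)] by simp_all
  have "gadd B (F x) (F y) = gzero B" using assms(3)[OF y(2)] FF(4)[OF assms(4) y(1)] by simp
  then have "F x = F y" using B.add_eq_zero FF(1) assms(4) y(1) by simp
  then show ?thesis unfolding ind_def y_def by simp
qed

lemma hchain_ind:
  assumes "hcx B" "hchain Z B 0 F" "\<And>m. m \<in> M \<Longrightarrow> F m = gzero B"
  shows "hchain Q B 0 (ind F)"
proof -
  note FF = hchain_simps[OF assms(2)] hmapD(3)[OF hchainD(1)[OF assms(2)]]
  note i = ind_coset[OF assms]
  show ?thesis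
    unfolding hchain_def hmap_def addf_def additive_on_def
    using FF by (auto simp: quot_sel quot_add quot_op i)
qed

lemma ind_inj:
  assumes "hcx B" "hchain Z B 0 F" "M = ker Z B F"
  shows "inj_on (ind F) (gcar Q)"
proof (rule inj_onI)
  interpret B: hcx B by fact
  note FF = hchain_simps[OF assms(2)]
  have z: "\<And>m. m \<in> M \<Longrightarrow> F m = gzero B" unfolding assms(3) ker_def by simp
  note i = ind_coset[OF assms(1,2) z]
  fix X Y assume "X \<in> gcar Q" "Y \<in> gcar Q" and e: "ind F X = ind F Y"
  then obtain x y where xy: "x \<in> gcar Z" "X = \<pi> x" "y \<in> gcar Z" "Y = \<pi> y" unfolding quot_sel by blast
  then have "F x = F y" using e i by simp
  then have "gadd Z x y \<in> ker Z B F" unfolding ker_def using xy FF by simp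
  then have "gadd Z x y \<in> M" unfolding assms(3) .
  then show "X = Y" using coset_eq[OF xy(1,3)] unfolding xy(2,4) by simp
qed

end

subsection \<open>Desuspension\<close>

definition triv :: "'v gcx \<Rightarrow> bool" where
  "triv A \<longleftrightarrow> (\<forall>x\<in>gcar A. gs A x = gzero A \<and> gj A (gj A x) = x)"

lemma triv_Rn: "hcx4 A \<Longrightarrow> triv A \<Longrightarrow> triv (Rn M A)"
proof (induction M)
  case 0
  then show ?case by (auto simp: triv_def gembed_sel)
next
  case (Suc M)
  have h: "hcx (Rn M A)" using Suc.prems(1) hcx4_Rn hcx4.axioms by blast
  interpret R: suspc C_Rt "Rn M A" by (rule suspc.intro[OF cmod_Rt h])
  have IH: "gs (Rn M A) y = gzero (Rn M A)" "gj (Rn M A) (gj (Rn M A) y) = y" if "y \<in> gcar (Rn M A)" for y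
    using Suc that by (auto simp: triv_def)
  have "gs R.S y = gzero R.S \<and> gj R.S (gj R.S y) = y" if "y \<in> gcar R.S" for y
    using that
  proof (induction rule: R.S_induct)
    case (tn b x)
    then have "b = RC0 \<or> b = RC1 \<or> b = RJC1" by (auto simp: Rt_basis)
    then show ?case using tn(2) IH by (elim disjE) (simp_all add: Rt_s[OF h] Rt_j[OF h])
  qed simp_all
  then show ?case by (simp add: triv_def)
qed

lemma gfix_Rn: "hcx4 Z \<Longrightarrow> gfix Z \<subseteq> gcar Z \<Longrightarrow> gfix (Rn M Z) \<subseteq> gcar (Rn M Z)"
proof (induction M)
  case 0
  then show ?case by (auto simp: gembed_sel)
next
  case (Suc M)
  have h: "hcx (Rn M Z)" using Suc.prems(1) hcx4_Rn hcx4.axioms by blast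
  interpret R: suspc C_Rt "Rn M Z" by (rule suspc.intro[OF cmod_Rt h])
  have "gfix R.S \<subseteq> gcar R.S"
    unfolding R.S_sel using Suc by (auto simp: C_Rt_def)
  then show ?case by simp
qed

lemma fixok_triv:
  assumes "hcx4 (fixc X)" "triv (fixc X)" "gfix X \<subseteq> gcar X"
  shows "fixok X"
proof -
  interpret F: hcx4 "fixc X" by fact
  show ?thesis
    using assms(2,3) F.zero_closed F.add_closed F.bd_closed F.j_closed
    unfolding fixok_def triv_def by simp
qed

lemma fixok_Rn:
  assumes "hcx4 Z" "fixok Z" shows "fixok (Rn M Z)"
proof (rule fixok_triv)
  have t: "triv (fixc Z)" using assms(2) by (auto simp: triv_def fixok_def)
  note h = hcx4_fixc[OF assms]
  show "hcx4 (fixc (Rn M Z))" using hcx4_Rn[OF h, of M] Rn_fixc[OF assms(1), of M] by simp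
  show "triv (fixc (Rn M Z))" using triv_Rn[OF h t, of M] Rn_fixc[OF assms(1), of M] by simp
  show "gfix (Rn M Z) \<subseteq> gcar (Rn M Z)" by (rule gfix_Rn) (use assms in \<open>auto simp: fixok_def\<close>)
qed

lemma rr_simps:
  assumes "hcx4 X"
  shows "x \<in> gcar X \<Longrightarrow> rr X 0 N x \<in> gcar (Hn N X)"
    "x \<in> gcar X \<Longrightarrow> gs (Hn N X) (rr X 0 N x) = rr X 0 N (gs X x)"
    "x \<in> gcar X \<Longrightarrow> gj (Hn N X) (rr X 0 N x) = rr X 0 N (gj X x)"
    "x \<in> gcar X \<Longrightarrow> gbd (Hn N X) (rr X 0 N x) = rr X 0 N (gbd X x)"
    "x \<in> gcar X \<Longrightarrow> y \<in> gcar X \<Longrightarrow> gadd (Hn N X) (rr X 0 N x) (rr X 0 N y) = rr X 0 N (gadd X x y)"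
    "x \<in> ggrade X m \<Longrightarrow> rr X 0 N x \<in> ggrade (Hn N X) m"
    "rr X 0 N (gzero X) = gzero (Hn N X)"
proof -
  have h: "hchain X (Hn N X) 0 (rr X 0 N)" using hchain_rr[OF assms, of 0 N] by simp
  interpret X: hcx4 X by fact
  interpret H: hcx4 "Hn N X" using hcx4_Hn assms by blast
  note hh = hchain_simps[OF h] hmapD(3)[OF hchainD(1)[OF h]]
  show "x \<in> gcar X \<Longrightarrow> rr X 0 N x \<in> gcar (Hn N X)"
    "x \<in> gcar X \<Longrightarrow> gs (Hn N X) (rr X 0 N x) = rr X 0 N (gs X x)"
    "x \<in> gcar X \<Longrightarrow> gj (Hn N X) (rr X 0 N x) = rr X 0 N (gj X x)"
    "x \<in> gcar X \<Longrightarrow> gbd (Hn N X) (rr X 0 N x) = rr X 0 N (gbd X x)"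
    "x \<in> gcar X \<Longrightarrow> y \<in> gcar X \<Longrightarrow> gadd (Hn N X) (rr X 0 N x) (rr X 0 N y) = rr X 0 N (gadd X x y)"
    using hh by simp_all
  show "x \<in> ggrade X m \<Longrightarrow> rr X 0 N x \<in> ggrade (Hn N X) m" using hh(6)[of x m] by simp
  show "rr X 0 N (gzero X) = gzero (Hn N X)"
    by (rule addf_zero[OF X.vsp_axioms H.vsp_axioms hmapD(1)[OF hchainD(1)[OF h]]])
qed

lemma fixok_Hn:
  assumes "hcx4 X" "fixok X" shows "fixok (Hn N X)"
proof -
  note r = rr_simps[OF assms(1), where N = N]
  have a: "gfix X \<subseteq> gcar X" "gzero X \<in> gfix X" "\<And>x y. x \<in> gfix X \<Longrightarrow> y \<in> gfix X \<Longrightarrow> gadd X x y \<in> gfix X"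
    "\<And>x. x \<in> gfix X \<Longrightarrow> gbd X x \<in> gfix X \<and> gj X x \<in> gfix X \<and> gs X x = gzero X \<and> gj X (gj X x) = x"
    using assms(2) unfolding fixok_def by blast+
  have c: "x \<in> gfix X \<Longrightarrow> x \<in> gcar X" for x using a(1) by blast
  have z: "gzero (Hn N X) \<in> rr X 0 N ` gfix X" using a(2) rr_simps(7)[OF assms(1), where N = N] by (metis imageI)
  show ?thesis unfolding fixok_def gfix_Hn[OF assms(1)]
    using a(3,4) c z by (auto simp: r rr_simps(7)[OF assms(1)])
qed

text \<open>Quaternionic suspension changes the fixed-point set only by the embedding
  \<open>rr\<close>, so \<open>F\<close> restricts to a map between the fixed-point sets before
  these suspensions, still injective on homology.\<close>

lemma fix_restrict:
  assumes X: "hcx4 X" "fixok X" and X': "hcx4 X'" "fixok X'"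
    and F: "gchain_map (Hn N X) (Hn N X') F" "fix_he (Hn N X) (Hn N X') F"
  shows "\<exists>F0. hchain (fixc X) (fixc X') 0 F0 \<and> hinj (fixc X) (fixc X') F0 \<and>
     (\<forall>y\<in>gfix X. rr X' 0 N (F0 y) = F (rr X 0 N y))"
proof -
  interpret X: hcx4 X by fact
  interpret X': hcx4 X' by fact
  interpret A: hcx4 "Hn N X" using hcx4_Hn X by blast
  note r = rr_simps[OF X(1), where N = N] note r' = rr_simps[OF X'(1), where N = N]
  have h: "hchain (Hn N X) (Hn N X') 0 F" using F(1) by (simp add: gchain_map_iff)
  note FF = hchain_simps[OF h] hmapD(3)[OF hchainD(1)[OF h]]
  have c: "x \<in> gfix X \<Longrightarrow> x \<in> gcar X" for x using X(2) unfolding fixok_def by blast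
  have c': "x \<in> gfix X' \<Longrightarrow> x \<in> gcar X'" for x using X'(2) unfolding fixok_def by blast
  have fX: "\<And>x y. x \<in> gfix X \<Longrightarrow> y \<in> gfix X \<Longrightarrow> gadd X x y \<in> gfix X"
    "\<And>x. x \<in> gfix X \<Longrightarrow> gbd X x \<in> gfix X" "\<And>x. x \<in> gfix X \<Longrightarrow> gj X x \<in> gfix X" 
    "\<And>x. x \<in> gfix X \<Longrightarrow> gs X x \<in> gfix X"
    using X(2) unfolding fixok_def by simp_all
  have hi: "hinj (fixc (Hn N X)) (fixc (Hn N X')) F"
    by (rule fix_he_hinj[OF A.hcx_axioms fixok_Hn[OF X] F(2)])
  have "\<forall>y\<in>gfix X. \<exists>y'. y' \<in> gfix X' \<and> rr X' 0 N y' = F (rr X 0 N y)"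
  proof
    fix y assume "y \<in> gfix X"
    then have "rr X 0 N y \<in> gfix (Hn N X)" using gfix_Hn[OF X(1)] by blast
    then have "F (rr X 0 N y) \<in> gfix (Hn N X')" using F(2) unfolding fix_he_def by blast
    then show "\<exists>y'. y' \<in> gfix X' \<and> rr X' 0 N y' = F (rr X 0 N y)"
      unfolding gfix_Hn[OF X'(1)] by auto
  qed
  then obtain F0 where F0: "\<And>y. y \<in> gfix X \<Longrightarrow> F0 y \<in> gfix X'" "\<And>y. y \<in> gfix X \<Longrightarrow> rr X' 0 N (F0 y) = F (rr X 0 N y)"
    by metis
  have F0c: "y \<in> gfix X \<Longrightarrow> F0 y \<in> gcar X'" for y using F0(1) c' by blast
  note inj = rr_inj[OF X'(1), of 0 N]
  have hF0: "hchain (fixc X) (fixc X') 0 F0"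
    unfolding hchain_def hmap_def
  proof (intro conjI ballI allI addfI)
    fix x y assume xy: "x \<in> gcar (fixc X)" "y \<in> gcar (fixc X)"
    show "F0 (gadd (fixc X) x y) = gadd (fixc X') (F0 x) (F0 y)"
      by (rule inj) (use xy in \<open>simp add: F0 fX F0c c r(1) FF flip: r'(5) r(5)\<close>)
  next
    fix x assume x: "x \<in> gcar (fixc X)"
    show "F0 (gs (fixc X) x) = gs (fixc X') (F0 x)"
      by (rule inj) (use x in \<open>simp add: F0 fX F0c c r(1) FF flip: r'(2) r(2)\<close>)
    show "F0 (gj (fixc X) x) = gj (fixc X') (F0 x)"
      by (rule inj) (use x in \<open>simp add: F0 fX F0c c r(1) FF flip: r'(3) r(3)\<close>)
    show "F0 (gbd (fixc X) x) = gbd (fixc X') (F0 x)"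
      by (rule inj) (use x in \<open>simp add: F0 fX F0c c r(1) FF flip: r'(4) r(4)\<close>)
    show "F0 x \<in> gcar (fixc X')" using x F0 by simp
  next
    fix m x assume x: "x \<in> ggrade (fixc X) m"
    then have "F (rr X 0 N x) \<in> ggrade (Hn N X') (m + 0)" by (intro FF(6) r(6)) simp
    then have "rr X' 0 N (F0 x) \<in> ggrade (Hn N X') (m + 0)" using F0(2) x by simp
    then have "F0 x \<in> ggrade X' (m + 0)" by (rule rr_grade_iff[OF X'(1), rotated]) (use x F0c in simp)
    then show "F0 x \<in> ggrade (fixc X') (m + 0)" using F0(1) x by simp
  qed
  have "hinj (fixc X) (fixc X') F0"
    unfolding hinj_def
  proof (intro allI ballI impI)
    fix m p y assume p: "p \<in> ggrade (fixc X) m" and y: "y \<in> ggrade (fixc X') (m + 1)"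
      and e: "gbd (fixc X) p = gzero (fixc X) \<and> F0 p = gbd (fixc X') y"
    have p1: "p \<in> gfix X" "p \<in> ggrade X m" "y \<in> gfix X'" "y \<in> ggrade X' (m + 1)" using p y by auto
    have 1: "rr X 0 N p \<in> ggrade (fixc (Hn N X)) m" using p1 r(6) gfix_Hn[OF X(1)] by auto
    have 2: "rr X' 0 N y \<in> ggrade (fixc (Hn N X')) (m + 1)" using p1 r'(6) gfix_Hn[OF X'(1)] by auto
    have 3: "gbd (fixc (Hn N X)) (rr X 0 N p) = gzero (fixc (Hn N X))"
      using e p1(1) c r(4) rr_simps(7)[OF X(1)] by simp
    have 4: "F (rr X 0 N p) = gbd (fixc (Hn N X')) (rr X' 0 N y)"
      using e p1 F0(2)[OF p1(1)] c' r'(4) by simp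
    obtain w where w: "w \<in> ggrade (fixc (Hn N X)) (m + 1)" "rr X 0 N p = gbd (fixc (Hn N X)) w"
      using hi[unfolded hinj_def, rule_format, OF 1 2 conjI[OF 3 4]] by blast
    then obtain w' where w': "w' \<in> gfix X" "w = rr X 0 N w'" using gfix_Hn[OF X(1)] by auto
    have g: "w' \<in> ggrade X (m + 1)"
      by (rule rr_grade_iff[OF X(1)]) (use w w' c in auto)
    have "rr X 0 N p = rr X 0 N (gbd X w')" using w(2) w' c r(4) by simp
    then have "p = gbd X w'" by (rule rr_inj[OF X(1)])
    then show "\<exists>x\<in>ggrade (fixc X) (m + 1). p = gbd (fixc X) x" using w' g by auto
  qed
  then show ?thesis using hF0 F0(2) by blast
qed

context swf
begin

lemma hcx_RnF: "hcx4 (Rn M (fixc Z))" by (rule hcx4_Rn[OF hcx4_fix])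

lemma iR_vtop:
  "iR (fixc Z) M vtop \<in> ggrade (Rn M (fixc Z)) (d + int M)"
  "gbd (Rn M (fixc Z)) (iR (fixc Z) M vtop) = gzero (Rn M (fixc Z))"
  "w \<in> ggrade (Rn M (fixc Z)) (d + int M + 1) \<Longrightarrow> iR (fixc Z) M vtop \<noteq> gbd (Rn M (fixc Z)) w"
proof -
  interpret F: hcx4 "fixc Z" by (rule hcx4_fix)
  interpret R: hcx4 "Rn M (fixc Z)" by (rule hcx_RnF)
  note q = qi_iR[OF hcx4_fix, of M]
  note h = qi_hchain[OF q]
  have v: "vtop \<in> ggrade (fixc Z) d" using vtop by simp
  show "iR (fixc Z) M vtop \<in> ggrade (Rn M (fixc Z)) (d + int M)"
    using hmapD(3)[OF hchainD(1)[OF h] v] .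
  have "iR (fixc Z) M (gzero (fixc Z)) = gzero (Rn M (fixc Z))"
    by (rule addf_zero[OF F.vsp_axioms R.vsp_axioms hmapD(1)[OF hchainD(1)[OF h]]])
  then show "gbd (Rn M (fixc Z)) (iR (fixc Z) M vtop) = gzero (Rn M (fixc Z))"
    using hchain_simps(5)[OF h, of vtop] vtop by simp
  show "w \<in> ggrade (Rn M (fixc Z)) (d + int M + 1) \<Longrightarrow> iR (fixc Z) M vtop \<noteq> gbd (Rn M (fixc Z)) w"
    using qi_inj[OF q v, of w "d + int M + 1"] vtop_not_bd by auto
qed

end

text \<open>If the target began in a higher degree, \<open>F\<close> would kill the bottom class,
  and the chain of \<open>nbd\<close> steps would make the image of the top class bound, against
  injectivity on homology. The top degrees agree because that image is a non-bounding cycle and the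
  target has homology in its own top degree alone.\<close>

lemma fix_compare:
  assumes Z: "swf Z t \<sigma> n c x e" and W: "swf W t' \<sigma>' n' c' x' e'"
    and F: "hchain (Rn M (fixc Z)) (Rn M (fixc W)) 0 F" "hinj (Rn M (fixc Z)) (Rn M (fixc W)) F"
  shows "\<sigma>' \<le> \<sigma>" "\<sigma> + int t = \<sigma>' + int t'"
    "F (iR (fixc Z) M (swf.vtop Z t c)) = iR (fixc W) M (swf.vtop W t' c')"
proof -
  interpret Z: swf Z t \<sigma> n c x e by fact
  interpret W: swf W t' \<sigma>' n' c' x' e' by fact
  let ?A = "Rn M (fixc Z)" let ?T = "Rn M (fixc W)"
  interpret FZ: hcx4 "fixc Z" by (rule Z.hcx4_fix)
  interpret FW: hcx4 "fixc W" by (rule W.hcx4_fix)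
  interpret A: hcx4 ?A by (rule Z.hcx_RnF)
  interpret T: hcx4 ?T by (rule W.hcx_RnF)
  note FF = hchain_simps[OF F(1)] hmapD(3)[OF hchainD(1)[OF F(1)]]
  note qW = qi_iR[OF W.hcx4_fix, of M] and qZ = qi_iR[OF Z.hcx4_fix, of M]
  note hW = hchain_simps[OF qi_hchain[OF qW]] hmapD(3)[OF hchainD(1)[OF qi_hchain[OF qW]]]
  have F0: "F (gzero ?A) = gzero ?T"
    by (rule addf_zero[OF A.vsp_axioms T.vsp_axioms hmapD(1)[OF hchainD(1)[OF F(1)]]])
  have "triv (fixc W)" using W.fixok by (auto simp: triv_def fixok_def)
  then have tT: "gj ?T (gj ?T y) = y" if "y \<in> gcar ?T" for y
    using triv_Rn[OF W.hcx4_fix, of M] that unfolding triv_def by blast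
  have cT: "cyc ?T" by (rule cyc_qi[OF FW.hcx_axioms T.hcx_axioms qW W.cyc_fix])
  have conT: "conc ?T \<sigma>' (\<sigma>' + int t' + int M)" by (rule conc_Rn[OF W.hcx4_fix W.conc_fix])
  define p where "p = iR (fixc Z) M Z.vtop"
  have p: "p \<in> ggrade ?A (\<sigma> + int t + int M)" "gbd ?A p = gzero ?A"
    "\<And>w. w \<in> ggrade ?A (\<sigma> + int t + int M + 1) \<Longrightarrow> p \<noteq> gbd ?A w"
    unfolding p_def using Z.iR_vtop by blast+
  have pc: "p \<in> gcar ?A" using p(1) by blast
  have nb: "F p \<noteq> gbd ?T y" if "y \<in> ggrade ?T (\<sigma> + int t + int M + 1)" for y
    using F(2)[unfolded hinj_def, rule_format, OF p(1) that] p(2,3) by blast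
  show "\<sigma>' \<le> \<sigma>"
  proof (rule ccontr)
    assume "\<not> \<sigma>' \<le> \<sigma>"
    then have e: "ggrade ?T \<sigma> \<subseteq> {gzero ?T}" using conT unfolding conc_def by simp
    have c0: "c 0 \<in> ggrade (fixc Z) \<sigma>" using Z.c_grade[of 0] Z.c_fix[of 0] by simp
    have "F (cc (fixc Z) M (c 0)) \<in> ggrade ?T (\<sigma> + 0)"
      by (rule FF(6)[OF cc_grade[OF Z.hcx4_fix c0]])
    then have "F (cc (fixc Z) M (c 0)) = gzero ?T" using e by auto
    then have "nbd ?T F (\<sigma> + int M) (iR (fixc Z) M (c 0))"
      by (intro nbd_iR[OF Z.hcx4_fix T.hcx_axioms tT cT F(1) c0]) (use Z.bd_c0 Z.j_c0 in simp_all)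
    then have n0: "nbd ?T (\<lambda>z. F (iR (fixc Z) M z)) (\<sigma> + int M) (c 0)" unfolding nbd_def .
    have "hchain (fixc Z) ?T (int M) (\<lambda>z. F (iR (fixc Z) M z))"
      using hchain_comp[OF qi_hchain[OF qZ] F(1)] by simp
    from Z.nbd_top[OF T.hcx_axioms tT cT this n0]
    obtain a where a: "a \<in> ggrade ?T (\<sigma> + int t + int M + 1)" "F p = gbd ?T (gadd ?T a (gj ?T a))"
      unfolding nbd_def p_def by blast
    have "gadd ?T a (gj ?T a) \<in> ggrade ?T (\<sigma> + int t + int M + 1)"
      by (intro T.grade_add T.j_grade a(1))
    then show False using nb a(2) by blast
  qed
  have q: "F p \<in> ggrade ?T (\<sigma> + int t + int M)" using FF(6)[OF p(1)] by simp
  have qc: "gbd ?T (F p) = gzero ?T" using p(2) pc F0 by (simp flip: FF(5))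
  obtain w a where w: "w \<in> ggrade (fixc W) (\<sigma> + int t + int M - int M)"
    "a \<in> ggrade ?T (\<sigma> + int t + int M + 1)" "gbd (fixc W) w = gzero (fixc W)"
    "F p = gadd ?T (iR (fixc W) M w) (gbd ?T a)"
    using qi_surj[OF qW q qc] by blast
  have ac: "a \<in> gcar ?T" using w(2) by blast
  have w1: "w \<in> gfix W" "w \<in> ggrade W (\<sigma> + int t)" "gbd W w = gzero W" using w by auto
  have "\<sigma> + int t = \<sigma>' + int t' \<and> w = W.vtop"
  proof (cases rule: W.fix_cycle[OF w1])
    case (1 w')
    have w'g: "w' \<in> ggrade (fixc W) (\<sigma> + int t + 1)" using 1 by simp
    have "iR (fixc W) M w' \<in> ggrade ?T (\<sigma> + int t + 1 + int M)" by (rule hW(6)[OF w'g])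
    then have g: "gadd ?T (iR (fixc W) M w') a \<in> ggrade ?T (\<sigma> + int t + int M + 1)"
      using w(2) by (intro T.grade_add) (simp_all add: algebra_simps)
    have "F p = gbd ?T (gadd ?T (iR (fixc W) M w') a)"
      using w(4) 1 ac hW(1,5)[of w'] by simp
    then show ?thesis using nb[OF g] by blast
  qed simp
  then show e: "\<sigma> + int t = \<sigma>' + int t'" and "F (iR (fixc Z) M Z.vtop) = iR (fixc W) M W.vtop"
  proof -
    assume *: "\<sigma> + int t = \<sigma>' + int t' \<and> w = W.vtop"
    then show "\<sigma> + int t = \<sigma>' + int t'" by blast
    \<comment> \<open>Above the top degree the suspended fixed-point set is zero, so homologous top
      classes are equal.\<close>
    have "ggrade ?T (\<sigma> + int t + int M + 1) \<subseteq> {gzero ?T}"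
      using * conT unfolding conc_def by simp
    then have "a = gzero ?T" using w(2) by blast
    then show "F (iR (fixc Z) M Z.vtop) = iR (fixc W) M W.vtop"
      using w(4) * hW(1)[of W.vtop] W.vtop unfolding p_def by simp
  qed
qed

text \<open>Comparison in both directions matches the degrees of \<open>c i\<close> and
  \<open>c' i\<close>, so the assignment of \<open>c' i\<close> to \<open>c i\<close> can be
  prescribed for the lift. It carries the basis of one fixed-point set to that of the other and is
  therefore injective there.\<close>

lemma desuspend:
  assumes Z: "swf Z t \<sigma> n c x e" and W: "swf W t' \<sigma>' n' c' x' e'"
    and F: "gchain_map (susp_MN M N Z) (susp_MN M N W) F" "fix_he (susp_MN M N Z) (susp_MN M N W) F"
    and G: "gchain_map (susp_MN M N W) (susp_MN M N Z) G" "fix_he (susp_MN M N W) (susp_MN M N Z) G"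
  shows "\<exists>f. lmap Z W f"
proof -
  interpret Z: swf Z t \<sigma> n c x e by fact
  interpret W: swf W t' \<sigma>' n' c' x' e' by fact
  let ?X = "Rn M Z" let ?Y = "Rn M W"
  have X: "hcx4 ?X" "fixok ?X" using hcx4_Rn fixok_Rn Z.hcx4_axioms Z.fixok by blast+
  have Y: "hcx4 ?Y" "fixok ?Y" using hcx4_Rn fixok_Rn W.hcx4_axioms W.fixok by blast+
  note F = F[unfolded susp_MN_def] and G = G[unfolded susp_MN_def]
  note eZ = Rn_fixc[OF Z.hcx4_axioms, of M] and eW = Rn_fixc[OF W.hcx4_axioms, of M]
  obtain F0 where F0: "hchain (fixc ?X) (fixc ?Y) 0 F0" "hinj (fixc ?X) (fixc ?Y) F0"
     "\<forall>y\<in>gfix ?X. rr ?Y 0 N (F0 y) = F (rr ?X 0 N y)"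
    using fix_restrict[OF X Y F] by blast
  obtain G0 where G0: "hchain (fixc ?Y) (fixc ?X) 0 G0" "hinj (fixc ?Y) (fixc ?X) G0"
    using fix_restrict[OF Y X G] by blast
  note FC = fix_compare[OF Z W, of M F0, unfolded eZ eW, OF F0(1,2)]
  note GC = fix_compare[OF W Z, of M G0, unfolded eZ eW, OF G0(1,2)]
  have s: "\<sigma>' = \<sigma>" "t' = t" using FC(1,2) GC(1) by auto
  let ?p = "iR Z M Z.vtop" let ?p' = "iR W M W.vtop"
  have iR: "iR (fixc Z) M y = iR Z M y" "iR (fixc W) M z = iR W M z" for y z
    by (rule iR_fixc[OF Z.hcx4_axioms Z.hcx4_fix], rule iR_fixc[OF W.hcx4_axioms W.hcx4_fix])
  interpret X: hcx4 ?X by (rule X)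
  interpret Y: hcx4 ?Y by (rule Y)
  interpret Q: hcx4 "Hn N ?Y" by (rule hcx4_Hn[OF Y(1)])
  have inv: "iR U M v \<in> ggrade (Rn M U) (m + int M)" "gj (Rn M U) (iR U M v) = iR U M v"
     "gs (Rn M U) (iR U M v) = gzero (Rn M U)" "gbd (Rn M U) (iR U M v) = gzero (Rn M U)"
    if "hcx4 U" "v \<in> ggrade U m" "gj U v = v" "gs U v = gzero U" "gbd U v = gzero U" for U :: "'z gcx" and v m
  proof -
    interpret U: hcx4 U by fact
    interpret R: hcx4 "Rn M U" by (rule hcx4_Rn[OF that(1)])
    note h = qi_hchain[OF qi_iR[OF that(1), of M]]
    have z: "iR U M (gzero U) = gzero (Rn M U)"
      by (rule addf_zero[OF U.vsp_axioms R.vsp_axioms hmapD(1)[OF hchainD(1)[OF h]]])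
    have v: "v \<in> gcar U" using that by blast
    show "iR U M v \<in> ggrade (Rn M U) (m + int M)" using hmapD(3)[OF hchainD(1)[OF h] that(2)] .
    show "gj (Rn M U) (iR U M v) = iR U M v" "gs (Rn M U) (iR U M v) = gzero (Rn M U)"
      "gbd (Rn M U) (iR U M v) = gzero (Rn M U)"
      using hchain_simps(2,3,5)[OF h v] that z by simp_all
  qed
  note ip = inv[OF Z.hcx4_axioms Z.vtop(2,5,6,4)]
  have v'd: "W.vtop \<in> ggrade W (\<sigma> + int t)" using W.vtop(2) s by simp
  note ip' = inv[OF W.hcx4_axioms v'd W.vtop(5,6,4)]
  have pfix: "?p \<in> gfix ?X"
  proof -
    have "iR (fixc Z) M Z.vtop \<in> gcar (Rn M (fixc Z))" using Z.iR_vtop(1)[of M] Z.hcx_RnF[of M]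
      by (meson hcx.grade_car hcx4.axioms(1))
    then show ?thesis unfolding iR eZ by simp
  qed
  have Fp: "F (rr ?X 0 N ?p) = rr ?Y 0 N ?p'"
    using F0(3) pfix FC(3) unfolding iR by metis
  define D where "D = int M + 4 * int N"
  let ?h = "\<lambda>w. iH ?Y N (iR W M w)"
  have q: "qi W (Hn N ?Y) D ?h"
    unfolding D_def by (rule qi_comp[OF W.hcx_axioms Y.hcx_axioms Q.hcx_axioms qi_iR[OF W.hcx4_axioms] qi_iH[OF Y(1)]])
  have "acyc (Hn N ?Y) (\<sigma>' + int t' + D)" by (rule acyc_qi[OF W.hcx_axioms Q.hcx_axioms q W.acyc])
  then have ac: "acyc (Hn N ?Y) (\<sigma> + int t + int M + 4 * int N)" unfolding D_def s by (simp add: algebra_simps)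
  have hF: "hchain (Hn N ?X) (Hn N ?Y) 0 F" using F(1) by (simp add: gchain_map_iff)
  have nul: "nul (Hn N ?Y) (\<sigma> + int t + int M + 4 * int N)
      (gadd (Hn N ?Y) (F (iH ?X N ?p)) (iH ?Y N ?p'))"
    by (rule nul_top[OF X(1) Y(1) hF ip ip' Fp ac])
  have P: "hchain Z (Hn N ?Y) D (\<lambda>z. F (iH ?X N (iR Z M z)))"
    using hchain_comp[OF hchain_comp[OF qi_hchain[OF qi_iR[OF Z.hcx4_axioms]] qi_hchain[OF qi_iH[OF X(1)]]] hF]
    unfolding D_def by simp
  have vt: "Z.vt W c' = W.vtop" unfolding Z.vt_def W.vtop_def using s by simp
  have "\<exists>f. gchain_map Z W f \<and> (\<forall>i\<le>t. f (c i) = c' i)"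
  proof (rule Z.lift[OF W.gcx Q.hcx4_axioms q P])
    show "nul (Hn N ?Y) (\<sigma> + int t + D) (gadd (Hn N ?Y) (F (iH ?X N ?p)) (?h (Z.vt W c')))"
      using nul unfolding vt D_def by (simp add: algebra_simps)
  qed (use W.c_grade W.j_j_c W.s_c W.j_c0 W.bd_c0 W.bd_c1 W.bd_c s in auto)
  then obtain f where f: "gchain_map Z W f" "\<And>i. i \<le> t \<Longrightarrow> f (c i) = c' i" by blast
  have hf: "hchain Z W 0 f" using f(1) by (simp add: gchain_map_iff)
  note ff = hchain_simps[OF hf]
  have fg: "f (Z.g i) = W.g i" if "i \<in> swf_Ic t" for i
    using that f(2) by (cases i rule: Z.Ic_cases) (simp_all add: Z.g_simps W.g_simps ff)
  have fs: "f (gsum Z Z.g S) = gsum W W.g S" if S: "S \<subseteq> swf_Ic t" for S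
  proof -
    have "f (gsum Z Z.g S) = gsum W (\<lambda>i. f (Z.g i)) S"
      by (rule addf_gsum[OF Z.vsp_axioms W.vsp_axioms hmapD(1)[OF hchainD(1)[OF hf]]]) (use S in auto)
    also have "\<dots> = gsum W W.g S"
      by (rule W.gsum_cong) (use S fg s in auto)
    finally show ?thesis .
  qed
  have "f ` gfix Z \<subseteq> gfix W"
  proof (rule image_subsetI)
    fix z assume "z \<in> gfix Z"
    then obtain S where S: "S \<subseteq> swf_Ic t" "z = gsum Z Z.g S" unfolding Z.fix_ex by blast
    show "f z \<in> gfix W" unfolding W.fix_ex S(2) fs[OF S(1)] using S(1) s by blast
  qed
  moreover have "inj_on f (gfix Z)"
  proof (rule inj_onI)
    fix y z assume yz: "y \<in> gfix Z" "z \<in> gfix Z" "f y = f z"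
    obtain S where S: "S \<subseteq> swf_Ic t" "y = gsum Z Z.g S" using yz(1) unfolding Z.fix_ex by blast
    obtain S' where S': "S' \<subseteq> swf_Ic t" "z = gsum Z Z.g S'" using yz(2) unfolding Z.fix_ex by blast
    have "gsum W W.g S = gsum W W.g S'" using yz(3) unfolding S(2) S'(2) fs[OF S(1)] fs[OF S'(1)] .
    then have "S = S'" by (rule W.sum_eq[rotated 2]) (use S(1) S'(1) s in auto)
    then show "y = z" using S(2) S'(2) by simp
  qed
  ultimately show ?thesis using f(1) unfolding lmap_def by blast
qed

subsection \<open>Connected complexes\<close>

lemma lmapD:
  assumes "lmap A B f"
  shows "gchain_map A B f" "hchain A B 0 f" "f ` gfix A \<subseteq> gfix B" "inj_on f (gfix A)"
  using assms by (simp_all add: lmap_def flip: gchain_map_iff)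

context subcx
begin

lemma lmap_coset:
  assumes "gfix Z \<subseteq> gcar Z" "\<And>y z. y \<in> gfix Z \<Longrightarrow> z \<in> gfix Z \<Longrightarrow> gadd Z y z \<in> gfix Z" "M \<inter> gfix Z = {gzero Z}"
  shows "lmap Z Q \<pi>"
  unfolding lmap_def gchain_map_iff
proof (intro conjI hchain_coset inj_onI)
  show "\<pi> ` gfix Z \<subseteq> gfix Q" by (simp add: quot_sel)
  fix y z assume yz: "y \<in> gfix Z" "z \<in> gfix Z" "\<pi> y = \<pi> z"
  have c: "y \<in> gcar Z" "z \<in> gcar Z" using yz assms(1) by blast+
  have "gadd Z y z \<in> M" using coset_eq[OF c] yz(3) by simp
  then have "gadd Z y z = gzero Z" using assms(2)[OF yz(1,2)] assms(3) by blast
  then show "y = z" using add_eq_zero[OF c] by simp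
qed

lemma lmap_ind:
  assumes "hcx B" "lmap Z B F" "\<And>m. m \<in> M \<Longrightarrow> F m = gzero B" "gfix Z \<subseteq> gcar Z"
  shows "lmap Q B (ind F)"
proof -
  note h = lmapD(2-4)[OF assms(2)]
  note i = ind_coset[OF assms(1) h(1) assms(3)]
  have e: "ind F (\<pi> x) = F x" if "x \<in> gfix Z" for x using i that assms(4) by blast
  show ?thesis
    unfolding lmap_def gchain_map_iff quot_sel
  proof (intro conjI inj_onI)
    show "hchain Q B 0 (ind F)" by (rule hchain_ind[OF assms(1) h(1) assms(3)])
    show "ind F ` \<pi> ` gfix Z \<subseteq> gfix B" using e h(2) by auto
    fix X Y assume "X \<in> \<pi> ` gfix Z" "Y \<in> \<pi> ` gfix Z" and XY: "ind F X = ind F Y"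
    then obtain x y where xy: "x \<in> gfix Z" "X = \<pi> x" "y \<in> gfix Z" "Y = \<pi> y" by blast
    then have "F x = F y" using XY e by simp
    then have "x = y" using h(3) xy(1,3) by (simp add: inj_on_eq_iff)
    then show "X = Y" using xy by simp
  qed
qed

end

context swf
begin

lemma finite_fix: "finite (gfix Z)"
  using finite_subset[OF fix_sub finite_car] .

text \<open>Here \<open>w\<close> may be inhomogeneous; only basis elements of degree
  \<open>d + 1\<close> could contribute to degree \<open>d\<close>, and the fixed-point set has
  none.\<close>

lemma fix_bd_ne_vtop:
  assumes "w \<in> gfix Z" shows "gbd Z w \<noteq> vtop"
proof
  assume w: "gbd Z w = vtop"
  obtain S where S: "S \<subseteq> swf_Ic t" "w = gsum Z g S" using assms fix_ex by blast
  have fin: "finite S" using finite_subset[OF S(1) fin_I(1)] .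
  have gr: "gbd Z (g i) \<in> ggrade Z (bdeg i - 1)" if "i \<in> S" for i
    using bd_grade[OF g_grade[of i]] that S(1) by blast
  have e: "gbd Z w = gsum Z (\<lambda>i. gbd Z (g i)) S"
    unfolding S(2) by (rule addf_gsum[OF vsp_axioms vsp_axioms addf_bd]) (use S(1) in auto)
  then have "gsum Z (\<lambda>i. gbd Z (g i)) S \<in> ggrade Z d" using w vtop(2) by simp
  from homog_sum[OF fin gr this]
  have "gbd Z w = gsum Z (\<lambda>i. gbd Z (g i)) {i \<in> S. bdeg i - 1 = d}" using e by simp
  moreover have "{i \<in> S. bdeg i - 1 = d} = {}"
  proof -
    have "bdeg i - 1 \<noteq> d" if "i \<in> S" for i
    proof -
      have "i \<in> swf_Ic t" using that S(1) by blast
      then show ?thesis by (cases i rule: Ic_cases) auto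
    qed
    then show ?thesis by blast
  qed
  ultimately show False using w vtop(3) by simp
qed

text \<open>A self-map of the fixed-point set that does not kill the top class is an involution:
  descending from the top, every \<open>c i\<close> is sent to itself or to its \<open>j\<close>-translate.\<close>

lemma fix_self_inj:
  assumes p: "hchain Z Z 0 p" "p ` gfix Z \<subseteq> gfix Z" "p vtop \<noteq> gzero Z"
  shows "inj_on p (gfix Z)"
proof -
  note P = hchain_simps[OF p(1)] hmapD(3)[OF hchainD(1)[OF p(1)]]
  have pc: "p (c i) \<in> gfix Z" "p (c i) \<in> ggrade Z (int i + \<sigma>)" if "i \<le> t" for i
    using p(2) c_fix[OF that] P(6)[OF c_grade[OF that]] by auto
  have key: "p (c i) = c i \<or> p (c i) = gj Z (c i)"
    if i: "i \<le> t" and nz: "p (if i = 0 then c 0 else gadd Z (c i) (gj Z (c i))) \<noteq> gzero Z" for i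
    using pc[OF i]
  proof (cases rule: fix_cases)
    case 1
    then show ?thesis using nz i by (auto simp: P split: if_splits)
  next
    case 2
    then show ?thesis by simp
  next
    case (3 l)
    then have l: "l = i" "i \<noteq> 0" by auto
    have "p (c i) \<noteq> gadd Z (c i) (gj Z (c i))"
    proof
      assume "p (c i) = gadd Z (c i) (gj Z (c i))"
      then have "p (gadd Z (c i) (gj Z (c i))) = gzero Z"
        using i j_j_c[OF i] by (simp add: P ac)
      then show False using nz l by simp
    qed
    then show ?thesis using 3 l by blast
  qed
  have all: "p (c i) = c i \<or> p (c i) = gj Z (c i)" if "i \<le> t" for i
    using that
  proof (induction rule: inc_induct)
    case base
    show ?case by (rule key) (use p(3) in \<open>auto simp: vtop_def\<close>)
  next
    case (step k)
    have S: "Suc k \<le> t" using step by simp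
    let ?b = "if k = 0 then c 0 else gadd Z (c k) (gj Z (c k))"
    have b: "gbd Z (c (Suc k)) = ?b" using bd_c[of "Suc k"] bd_c1 S by auto
    have "p ?b = gbd Z (p (c (Suc k)))" unfolding b[symmetric] using P(5)[OF c_car[OF S]] .
    also have "\<dots> = gbd Z (c (Suc k))"
      using step.IH bd_j[OF c_car[OF S]] bd_c_inv[OF S] by (elim disjE) simp_all
    also have "\<dots> \<noteq> gzero Z" by (rule bd_c_nonzero) (use S in auto)
    finally show ?case by (intro key) (use S in auto)
  qed
  have pp: "p (p (c i)) = c i" if "i \<le> t" for i
    using all[OF that] P(3)[OF c_car[OF that]] j_j_c[OF that] by (elim disjE) simp_all
  have inv: "p (p z) = z" if "z \<in> gfix Z" for z
    using that
  proof (induction rule: fix_induct)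
    case zero
    have "p (gzero Z) = gzero Z"
      by (rule addf_zero[OF vsp_axioms vsp_axioms hmapD(1)[OF hchainD(1)[OF p(1)]]])
    then show ?case by simp
  next
    case (g i)
    then show ?case
      by (cases i rule: Ic_cases) (simp_all add: g_simps pp P)
  next
    case (add y z)
    then have "y \<in> gcar Z" "z \<in> gcar Z" using fix_sub by blast+
    then show ?case using add by (simp add: P)
  qed
  show ?thesis by (rule inj_on_inverseI[of _ p]) (rule inv)
qed

lemma lmap_ker_fix:
  assumes "vsp B" "lmap Z B F" shows "ker Z B F \<inter> gfix Z = {gzero Z}"
proof -
  interpret B: vsp B by fact
  note h = lmapD(2,4)[OF assms(2)]
  have F0: "F (gzero Z) = gzero B"
    by (rule addf_zero[OF vsp_axioms B.vsp_axioms hmapD(1)[OF hchainD(1)[OF h(1)]]])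
  have "z = gzero Z" if "z \<in> gfix Z" "F z = gzero B" for z
    by (rule inj_onD[OF h(2) _ that(1) fix_zero]) (use F0 that in simp)
  then have "ker Z B F \<inter> gfix Z \<subseteq> {gzero Z}" unfolding ker_def by blast
  moreover have "gzero Z \<in> ker Z B F" unfolding ker_def using F0 by simp
  ultimately show ?thesis using fix_zero by blast
qed

text \<open>The map induced by \<open>p\<close> on the quotient and the quotient map itself are
  local maps in opposite directions, so \<open>fix_he_lmap\<close> applies.\<close>

lemma ker_inessential:
  assumes p: "lmap Z Z p" shows "inessential Z (ker Z Z p)"
proof -
  note h = lmapD(2)[OF p]
  interpret K: subcx Z "ker Z Z p" by unfold_locales (rule gsubcx_ker[OF gcx gcx h])
  note kf = lmap_ker_fix[OF vsp_axioms p]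
  have z: "\<And>m. m \<in> ker Z Z p \<Longrightarrow> p m = gzero Z" unfolding ker_def by simp
  interpret Q: hcx4 K.Q by (rule K.hcx4_quot)
  have l: "lmap K.Q Z (K.ind p)" by (rule K.lmap_ind[OF hcx_axioms p z fix_sub])
  have "finite (gfix K.Q)" using finite_fix by (simp add: K.quot_sel)
  then have "fix_he K.Q Z (K.ind p)"
    by (rule fix_he_lmap[OF Q.hcx_axioms K.fixok_quot[OF fixok] _ hcx_axioms fixok finite_fix l
          K.lmap_coset[OF fix_sub fix_add kf]])
  moreover have "gchain_map K.Q Z (K.ind p)" using l unfolding lmap_def by (rule conjunct1)
  ultimately have "\<exists>f. gchain_map K.Q Z f \<and> fix_he K.Q Z f" by (intro exI conjI)
  then show ?thesis unfolding inessential_def using K.sub kf by (intro conjI)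
qed

text \<open>The witness composed with the quotient map is a self-map vanishing on \<open>M\<close>.
  As \<open>M\<close> meets the fixed-point set in zero, \<open>vtop\<close> still does not bound in
  the quotient, so a homotopy equivalence cannot kill it, and \<open>fix_self_inj\<close> makes the
  self-map local.\<close>

lemma inessential_ker:
  assumes "inessential Z M" shows "\<exists>p. lmap Z Z p \<and> M \<subseteq> ker Z Z p"
proof -
  obtain f where M: "gsubcx Z M" "M \<inter> gfix Z = {gzero Z}" and f: "gchain_map (quot Z M) Z f" "fix_he (quot Z M) Z f"
    using assms unfolding inessential_def by blast
  interpret K: subcx Z M by unfold_locales (rule M(1))
  interpret Q: hcx4 K.Q by (rule K.hcx4_quot)
  have hf: "hchain K.Q Z 0 f" using f(1) by (simp add: gchain_map_iff)
  define p where "p = (\<lambda>z. f (K.\<pi> z))"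
  have h: "hchain Z Z 0 p" unfolding p_def using hchain_comp[OF K.hchain_coset hf] by simp
  have fx: "p ` gfix Z \<subseteq> gfix Z" using f(2) unfolding fix_he_def p_def K.quot_sel by auto
  have f0: "f (gzero K.Q) = gzero Z"
    by (rule addf_zero[OF Q.vsp_axioms vsp_axioms hmapD(1)[OF hchainD(1)[OF hf]]])
  have "p vtop \<noteq> gzero Z"
  proof
    assume pv: "p vtop = gzero Z"
    have hi: "hinj (fixc K.Q) (fixc Z) f"
      by (rule fix_he_hinj[OF Q.hcx_axioms K.fixok_quot[OF fixok] f(2)])
    have vc: "vtop \<in> gcar Z" using vtop(1) fix_sub by blast
    have 1: "K.\<pi> vtop \<in> ggrade (fixc K.Q) d" using vtop(1,2) by (simp add: K.quot_sel)
    have 2: "gzero Z \<in> ggrade (fixc Z) (d + 1)" using fix_zero by simp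
    have 3: "gbd (fixc K.Q) (K.\<pi> vtop) = gzero (fixc K.Q)"
      using vtop(4) K.quot_op(1)[OF vc] by (simp add: K.quot_sel)
    have 4: "f (K.\<pi> vtop) = gbd (fixc Z) (gzero Z)" using pv unfolding p_def by simp
    obtain X where X: "X \<in> ggrade (fixc K.Q) (d + 1)" "K.\<pi> vtop = gbd (fixc K.Q) X"
      using hi[unfolded hinj_def, rule_format, OF 1 2 conjI[OF 3 4]] by blast
    from X(1) have "X \<in> K.\<pi> ` gfix Z" by (simp add: K.quot_sel)
    then obtain w where w: "w \<in> gfix Z" "X = K.\<pi> w" by blast
    have wc: "w \<in> gcar Z" using w fix_sub by blast
    have "K.\<pi> vtop = K.\<pi> (gbd Z w)" using X(2) w(2) K.quot_op(1)[OF wc] by simp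
    then have "gadd Z vtop (gbd Z w) \<in> M" using K.coset_eq[OF vc bd_closed[OF wc]] by simp
    then have "gadd Z vtop (gbd Z w) = gzero Z" using fix_add[OF vtop(1) fix_bd[OF w(1)]] M(2) by blast
    then have "vtop = gbd Z w" using add_eq_zero[OF vc bd_closed[OF wc]] by simp
    then show False using fix_bd_ne_vtop[OF w(1)] by simp
  qed
  then have "lmap Z Z p" unfolding lmap_def gchain_map_iff using h fx fix_self_inj by blast
  moreover have "M \<subseteq> ker Z Z p"
  proof
    fix m assume m: "m \<in> M"
    then have "p m = gzero Z" unfolding p_def using K.coset_M[OF m] f0 K.coset_zero by (simp add: K.quot_sel)
    then show "m \<in> ker Z Z p" unfolding ker_def using m by simp
  qed
  ultimately show ?thesis by blast
qed

lemma max_inessential_ex: "\<exists>M. max_inessential Z M"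
proof -
  have "lmap Z Z (\<lambda>z. z)" unfolding lmap_def gchain_map_iff using hchain_id by auto
  then have ne: "{M. inessential Z M} \<noteq> {}" using ker_inessential by blast
  have "{M. inessential Z M} \<subseteq> Pow (gcar Z)" unfolding inessential_def gsubcx_def by blast
  then have "finite {M. inessential Z M}" using finite_subset finite_car finite_Pow_iff by blast
  from finite_has_maximal[OF this ne] show ?thesis unfolding max_inessential_def by auto
qed

lemma max_inessential_ker:
  assumes "max_inessential Z M" "lmap Z Z p" "M \<subseteq> ker Z Z p" shows "M = ker Z Z p"
  using assms(1)[unfolded max_inessential_def] ker_inessential[OF assms(2)] assms(3) by blast

lemma max_inessential_ker_ex:
  assumes "max_inessential Z M" obtains p where "lmap Z Z p" "M = ker Z Z p"
proof -
  have "inessential Z M" using assms unfolding max_inessential_def by blast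
  then obtain p where p: "lmap Z Z p" "M \<subseteq> ker Z Z p" using inessential_ker by blast
  show ?thesis by (rule that[OF p(1) max_inessential_ker[OF assms p]])
qed

end

section \<open>Between local maps and isomorphisms of connected complexes\<close>

text \<open>Composing \<open>f p\<close> with the projection modulo \<open>N\<close> gives a map
  whose kernel lies in that of the local self-map \<open>g q f p\<close>, which equals
  \<open>M\<close> by maximality. Putting \<open>p\<close> first ensures that the kernel also
  contains \<open>M\<close>.\<close>

lemma conn_inj:
  assumes Z: "swf Z t \<sigma> n c x e" and W: "swf W t' \<sigma>' n' c' x' e'"
    and M: "max_inessential Z M" and N: "max_inessential W N"
    and f: "lmap Z W f" and g: "lmap W Z g"
  shows "\<exists>\<Phi>. gchain_map (quot Z M) (quot W N) \<Phi> \<and> inj_on \<Phi> (gcar (quot Z M))"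
proof -
  interpret Z: swf Z t \<sigma> n c x e by fact
  interpret W: swf W t' \<sigma>' n' c' x' e' by fact
  obtain p where p: "lmap Z Z p" "M = ker Z Z p" using Z.max_inessential_ker_ex[OF M] .
  obtain q where q: "lmap W W q" "N = ker W W q" using W.max_inessential_ker_ex[OF N] .
  note h = lmapD(2)[OF p(1)] lmapD(2)[OF q(1)] lmapD(2)[OF f] lmapD(2)[OF g]
  interpret K: subcx Z M by unfold_locales (simp add: p(2) gsubcx_ker[OF Z.gcx Z.gcx h(1)])
  interpret L: subcx W N by unfold_locales (simp add: q(2) gsubcx_ker[OF W.gcx W.gcx h(2)])
  interpret LQ: hcx4 L.Q by (rule L.hcx4_quot)
  have fp: "hchain Z W 0 (\<lambda>z. f (p z))" using hchain_comp[OF h(1,3)] by simp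
  define F where "F = (\<lambda>z. L.\<pi> (f (p z)))"
  have F: "hchain Z L.Q 0 F" unfolding F_def using hchain_comp[OF fp L.hchain_coset] by simp
  note fpc = hchain_simps(1)[OF fp]
  have q0: "q (gzero W) = gzero W"
    by (rule addf_zero[OF W.vsp_axioms W.vsp_axioms hmapD(1)[OF hchainD(1)[OF h(2)]]])
  have f0: "f (gzero Z) = gzero W"
    by (rule addf_zero[OF Z.vsp_axioms W.vsp_axioms hmapD(1)[OF hchainD(1)[OF h(3)]]])
  have g0: "g (gzero W) = gzero Z"
    by (rule addf_zero[OF W.vsp_axioms Z.vsp_axioms hmapD(1)[OF hchainD(1)[OF h(4)]]])
  have lm: "lmap Z Z (\<lambda>z. g (q (f (p z))))"
    by (rule lmap_comp[OF lmap_comp[OF lmap_comp[OF p(1) f] q(1)] g])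
  have "M \<subseteq> ker Z Z (\<lambda>z. g (q (f (p z))))" unfolding p(2) ker_def using f0 q0 g0 by auto
  from Z.max_inessential_ker[OF M lm this] have Mk: "M = ker Z Z (\<lambda>z. g (q (f (p z))))" .
  have "ker Z L.Q F = M"
  proof (intro equalityI subsetI)
    fix z assume "z \<in> ker Z L.Q F"
    then have z: "z \<in> gcar Z" "L.\<pi> (f (p z)) = L.\<pi> (gzero W)" unfolding ker_def F_def L.quot_sel by simp_all
    have "f (p z) \<in> N" using L.coset_self[OF fpc[OF z(1)]] z(2) L.coset_zero by simp
    then have "q (f (p z)) = gzero W" unfolding q(2) ker_def by simp
    then show "z \<in> M" unfolding Mk ker_def using z(1) g0 by simp
  next
    fix z assume "z \<in> M"
    then have "z \<in> gcar Z" "p z = gzero Z" unfolding p(2) ker_def by simp_all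
    then show "z \<in> ker Z L.Q F" unfolding ker_def F_def L.quot_sel using f0 by simp
  qed
  then have Mk: "M = ker Z L.Q F" by simp
  then have "\<And>m. m \<in> M \<Longrightarrow> F m = gzero L.Q" unfolding ker_def by blast
  from K.hchain_ind[OF LQ.hcx_axioms F this] K.ind_inj[OF LQ.hcx_axioms F Mk]
  show ?thesis unfolding gchain_map_iff by blast
qed

lemma conn_giso:
  assumes Z: "swf Z t \<sigma> n c x e" and W: "swf W t' \<sigma>' n' c' x' e'"
    and M: "max_inessential Z M" and N: "max_inessential W N"
    and f: "lmap Z W f" and g: "lmap W Z g"
  shows "giso (quot Z M) (quot W N)"
proof -
  obtain \<Phi> where \<Phi>: "gchain_map (quot Z M) (quot W N) \<Phi>" "inj_on \<Phi> (gcar (quot Z M))"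
    using conn_inj[OF Z W M N f g] by blast
  obtain \<Psi> where \<Psi>: "gchain_map (quot W N) (quot Z M) \<Psi>" "inj_on \<Psi> (gcar (quot W N))"
    using conn_inj[OF W Z N M g f] by blast
  have fin: "finite (gcar (quot Z M))" "finite (gcar (quot W N))"
    using swf.finite_car[OF Z] swf.finite_car[OF W] by (simp_all add: quot_def)
  have i: "\<Phi> ` gcar (quot Z M) \<subseteq> gcar (quot W N)" "\<Psi> ` gcar (quot W N) \<subseteq> gcar (quot Z M)"
    using \<Phi>(1) \<Psi>(1) unfolding gchain_map_def by blast+
  have "\<Phi> ` gcar (quot Z M) = gcar (quot W N)"
    using card_inj_on_le[OF \<Psi>(2) i(2) fin(1)] card_image[OF \<Phi>(2)] by (intro card_seteq fin i) simp
  then show ?thesis unfolding giso_def bij_betw_def using \<Phi> by blast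
qed

text \<open>Since \<open>N\<close> is the kernel of \<open>q\<close>, the map induced by
  \<open>q\<close> embeds the quotient back into \<open>W\<close>. The last clause computes the
  composite on representatives, which \<open>conn_giso_sym\<close> needs.\<close>

lemma conn_map:
  assumes W: "swf W t' \<sigma>' n' c' x' e'" and q: "lmap W W q" "N = ker W W q"
    and Z: "is_gcx Z" "gsubcx Z M"
    and \<Phi>: "hchain (quot Z M) (quot W N) 0 \<Phi>" "inj_on \<Phi> (gcar (quot Z M))"
  shows "\<exists>F. hchain Z W 0 F \<and> ker Z W F = M \<and>
    (\<forall>z\<in>gcar Z. \<forall>w\<in>gcar W. \<Phi> (coset Z M z) = coset W N w \<longrightarrow> F z = q w)"
proof -
  interpret W: swf W t' \<sigma>' n' c' x' e' by fact
  interpret K: subcx Z M by unfold_locales (rule Z)+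
  note hq = lmapD(2)[OF q(1)]
  interpret L: subcx W N by unfold_locales (simp add: q(2) gsubcx_ker[OF W.gcx W.gcx hq])
  interpret KQ: hcx4 K.Q by (rule K.hcx4_quot)
  interpret LQ: hcx4 L.Q by (rule L.hcx4_quot)
  have qz: "\<And>m. m \<in> N \<Longrightarrow> q m = gzero W" unfolding q(2) ker_def by simp
  note iq = L.hchain_ind[OF W.hcx_axioms hq qz] and iqi = L.ind_inj[OF W.hcx_axioms hq q(2)]
  define F where "F = (\<lambda>z. L.ind q (\<Phi> (K.\<pi> z)))"
  have F: "hchain Z W 0 F"
    unfolding F_def using hchain_comp[OF hchain_comp[OF K.hchain_coset \<Phi>(1)] iq] by simp
  have i0: "L.ind q (gzero L.Q) = gzero W"
    by (rule addf_zero[OF LQ.vsp_axioms W.vsp_axioms hmapD(1)[OF hchainD(1)[OF iq]]])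
  have \<Phi>0: "\<Phi> (gzero K.Q) = gzero L.Q"
    by (rule addf_zero[OF KQ.vsp_axioms LQ.vsp_axioms hmapD(1)[OF hchainD(1)[OF \<Phi>(1)]]])
  have qc: "K.\<pi> z \<in> gcar K.Q" if "z \<in> gcar Z" for z using that by (simp add: K.quot_sel)
  have "z \<in> M \<longleftrightarrow> F z = gzero W" if z: "z \<in> gcar Z" for z
  proof -
    have "F z = gzero W \<longleftrightarrow> L.ind q (\<Phi> (K.\<pi> z)) = L.ind q (gzero L.Q)"
      unfolding F_def by (simp only: i0)
    also have "\<dots> \<longleftrightarrow> \<Phi> (K.\<pi> z) = gzero L.Q"
      by (rule inj_on_eq_iff[OF iqi hchain_simps(1)[OF \<Phi>(1) qc[OF z]] LQ.zero_closed])
    also have "\<dots> \<longleftrightarrow> \<Phi> (K.\<pi> z) = \<Phi> (gzero K.Q)"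
      by (simp only: \<Phi>0)
    also have "\<dots> \<longleftrightarrow> K.\<pi> z = gzero K.Q"
      by (rule inj_on_eq_iff[OF \<Phi>(2) qc[OF z] KQ.zero_closed])
    also have "\<dots> \<longleftrightarrow> z \<in> M"
      unfolding K.quot_sel(2) K.coset_eq[OF z K.zero_closed] K.add_0_right[OF z] ..
    finally show ?thesis by simp
  qed
  then have "ker Z W F = M" unfolding ker_def using K.M_car by blast
  moreover have "\<forall>z\<in>gcar Z. \<forall>w\<in>gcar W. \<Phi> (K.\<pi> z) = L.\<pi> w \<longrightarrow> F z = q w"
    unfolding F_def using L.ind_coset[OF W.hcx_axioms hq qz] by simp
  ultimately show ?thesis using F by blast
qed

text \<open>The point is that the inverse bijection preserves degrees: \<open>grade_lift\<close>,
  applied to the map of \<open>conn_map\<close>, replaces a representative in \<open>Z\<close> by a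
  homogeneous one in the same coset.\<close>

lemma conn_giso_sym:
  assumes W: "swf W t' \<sigma>' n' c' x' e'" and q: "lmap W W q" "N = ker W W q"
    and Z: "is_gcx Z" "gsubcx Z M"
    and \<Phi>: "gchain_map (quot Z M) (quot W N) \<Phi>" "bij_betw \<Phi> (gcar (quot Z M)) (gcar (quot W N))"
  shows "\<exists>\<Psi>. gchain_map (quot W N) (quot Z M) \<Psi> \<and> inj_on \<Psi> (gcar (quot W N))"
proof -
  interpret W: swf W t' \<sigma>' n' c' x' e' by fact
  interpret K: subcx Z M by unfold_locales (rule Z)+
  interpret KQ: hcx4 K.Q by (rule K.hcx4_quot)
  note hq = lmapD(2)[OF q(1)]
  interpret L: subcx W N by unfold_locales (simp add: q(2) gsubcx_ker[OF W.gcx W.gcx hq])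
  have h: "hchain K.Q L.Q 0 \<Phi>" using \<Phi>(1) by (simp add: gchain_map_iff)
  have inj: "inj_on \<Phi> (gcar K.Q)" using \<Phi>(2) by (simp add: bij_betw_def)
  obtain F where F: "hchain Z W 0 F" "ker Z W F = M"
    "\<And>z w. z \<in> gcar Z \<Longrightarrow> w \<in> gcar W \<Longrightarrow> \<Phi> (coset Z M z) = coset W N w \<Longrightarrow> F z = q w"
    using conn_map[OF W q Z h inj] by (elim exE conjE) (rule that, blast+)
  define \<Psi> where "\<Psi> = inv_into (gcar K.Q) \<Phi>"
  have \<Psi>: "\<And>y. y \<in> gcar L.Q \<Longrightarrow> \<Psi> y \<in> gcar K.Q" "\<And>y. y \<in> gcar L.Q \<Longrightarrow> \<Phi> (\<Psi> y) = y"
    using \<Phi>(2) unfolding \<Psi>_def bij_betw_def by (metis inv_into_into, metis f_inv_into_f)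
  have eq: "\<Psi> y = x" if "x \<in> gcar K.Q" "\<Phi> x = y" for x y
    unfolding \<Psi>_def that(2)[symmetric] by (rule inv_into_f_f[OF inj that(1)])
  note hh = hchain_simps[OF h]
  have gr: "\<Psi> Y \<in> ggrade K.Q m" if Y: "Y \<in> ggrade L.Q m" for Y m
  proof -
    obtain w where w: "w \<in> ggrade W m" "Y = L.\<pi> w" using Y unfolding L.quot_sel by blast
    have wc: "w \<in> gcar W" by (rule W.grade_car[OF w(1)])
    have Yc: "Y \<in> gcar L.Q" using wc w(2) by (simp add: L.quot_sel)
    obtain z where z: "z \<in> gcar Z" "\<Psi> Y = K.\<pi> z" using \<Psi>(1)[OF Yc] unfolding K.quot_sel by blast
    have Fz: "F z = q w" by (rule F(3)[OF z(1) wc]) (use \<Psi>(2)[OF Yc] z(2) w(2) in simp)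
    have "q w \<in> ggrade W m" using hmapD(3)[OF hchainD(1)[OF hq] w(1)] by simp
    then obtain z' where z': "z' \<in> ggrade Z m" "F z' = F z"
      using grade_lift[OF Z(1) W.gcx F(1) z(1)] Fz by metis
    have z'c: "z' \<in> gcar Z" by (rule K.grade_car[OF z'(1)])
    have "gadd Z z z' \<in> ker Z W F"
      unfolding ker_def using hchain_simps(1,4)[OF F(1)] z(1) z'c z'(2) by simp
    then have "K.\<pi> z = K.\<pi> z'" using K.coset_eq[OF z(1) z'c] F(2) by simp
    then show ?thesis using z(2) z'(1) unfolding K.quot_sel by blast
  qed
  have "gchain_map L.Q K.Q \<Psi>"
    unfolding gchain_map_def additive_on_def
  proof (intro conjI ballI allI)
    fix y y' assume y: "y \<in> gcar L.Q" "y' \<in> gcar L.Q"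
    show "\<Psi> (gadd L.Q y y') = gadd K.Q (\<Psi> y) (\<Psi> y')"
      by (rule eq) (simp_all add: \<Psi> hh y)
  qed (rule gr \<Psi>(1) eq; simp add: \<Psi> hh)+
  moreover have "inj_on \<Psi> (gcar L.Q)" by (rule inj_on_inverseI[of _ \<Phi>]) (rule \<Psi>(2))
  ultimately show ?thesis by blast
qed

text \<open>If the fixed-point set of \<open>Z\<close> reached higher, some \<open>c i\<close> could
  have degree \<open>\<sigma>' + t' + 1\<close>, where \<open>s\<close> is injective on
  \<open>W\<close>; as \<open>s\<close> kills \<open>c i\<close>, its image would be zero. Otherwise
  \<open>\<sigma>\<close> exceeds that degree, and \<open>G\<close> kills \<open>c' 0\<close> for
  degree reasons.\<close>

lemma conn_deg:
  assumes Z: "swf Z t \<sigma> n c x e" and W: "swf W t' \<sigma>' n' c' x' e'"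
    and F: "hchain Z W 0 F" "ker Z W F \<inter> gfix Z = {gzero Z}"
    and G: "hchain W Z 0 G" "ker W Z G \<inter> gfix W = {gzero W}"
  shows "\<sigma> + int t \<le> \<sigma>' + int t'"
proof (rule ccontr)
  interpret Z: swf Z t \<sigma> n c x e by fact
  interpret W: swf W t' \<sigma>' n' c' x' e' by fact
  assume lt: "\<not> \<sigma> + int t \<le> \<sigma>' + int t'"
  show False
  proof (cases "\<sigma> \<le> \<sigma>' + int t' + 1")
    case True
    define i where "i = nat (\<sigma>' + int t' + 1 - \<sigma>)"
    have i: "i \<le> t" "int i + \<sigma> = \<sigma>' + int t' + 1" using True lt unfolding i_def by auto
    have "F (c i) \<in> ggrade W (\<sigma>' + int t' + 1)"
      using hmapD(3)[OF hchainD(1)[OF F(1)] Z.c_grade[OF i(1)]] i(2) by simp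
    moreover have "gs W (F (c i)) = gzero W"
      using hchain_simps(2)[OF F(1) Z.c_car[OF i(1)]] Z.s_c[OF i(1)]
        addf_zero[OF Z.vsp_axioms W.vsp_axioms hmapD(1)[OF hchainD(1)[OF F(1)]]] by simp
    ultimately have "F (c i) = gzero W" by (rule W.s_inj)
    then have "c i \<in> ker Z W F \<inter> gfix Z" unfolding ker_def using Z.c_car[OF i(1)] Z.c_fix(1)[OF i(1)] by simp
    then have "c i = gzero Z" unfolding F(2) by simp
    then show False using Z.g_nonzero[of "Inl (i, 0)"] Z.c_in(1,2)[OF i(1)] by simp
  next
    case False
    have "G (c' 0) \<in> ggrade Z \<sigma>'"
      using hmapD(3)[OF hchainD(1)[OF G(1)] W.c_grade[of 0]] by simp
    moreover from this have "G (c' 0) \<in> gfix Z" using False by (intro Z.homog_low) auto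
    ultimately have "G (c' 0) = gzero Z"
      by (cases rule: Z.fix_cases[rotated]) (use False in auto)
    then have "c' 0 \<in> ker W Z G \<inter> gfix W" unfolding ker_def using W.c_car[of 0] W.c_fix(1)[of 0] by simp
    then show False unfolding G(2) using W.c0_nonzero by simp
  qed
qed

text \<open>Images of fixed basis elements have degree at most \<open>\<sigma>' + t'\<close>, and up
  to that degree all of \<open>W\<close> is fixed.\<close>

lemma conn_lmap:
  assumes Z: "swf Z t \<sigma> n c x e" and W: "swf W t' \<sigma>' n' c' x' e'"
    and F: "hchain Z W 0 F" "ker Z W F \<inter> gfix Z = {gzero Z}"
    and d: "\<sigma> + int t \<le> \<sigma>' + int t'"
  shows "lmap Z W F"
proof -
  interpret Z: swf Z t \<sigma> n c x e by fact
  interpret W: swf W t' \<sigma>' n' c' x' e' by fact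
  note FF = hchain_simps[OF F(1)]
  have "F z \<in> gfix W" if "z \<in> gfix Z" for z
    using that
  proof (induction rule: Z.fix_induct)
    case zero
    then show ?case
      using addf_zero[OF Z.vsp_axioms W.vsp_axioms hmapD(1)[OF hchainD(1)[OF F(1)]]] W.fix_zero by simp
  next
    case (g i)
    then have "F (Z.g i) \<in> ggrade W (Z.bdeg i)"
      using hmapD(3)[OF hchainD(1)[OF F(1)] Z.g_grade[of i]] by simp
    moreover have "Z.bdeg i \<le> \<sigma> + int t" using g by (cases i rule: Z.Ic_cases) auto
    ultimately show ?case using d W.homog_low[of "F (Z.g i)" "Z.bdeg i"] by simp
  next
    case (add y z)
    then have "y \<in> gcar Z" "z \<in> gcar Z" using Z.fix_sub by blast+
    then show ?case using add FF(4) W.fix_add by simp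
  qed
  moreover have "inj_on F (gfix Z)"
  proof (rule inj_onI)
    fix y z assume yz: "y \<in> gfix Z" "z \<in> gfix Z" "F y = F z"
    have c: "y \<in> gcar Z" "z \<in> gcar Z" using yz Z.fix_sub by blast+
    have "gadd Z y z \<in> ker Z W F \<inter> gfix Z" unfolding ker_def using c yz FF Z.fix_add by simp
    then have "gadd Z y z = gzero Z" unfolding F(2) by simp
    then show "y = z" using Z.add_eq_zero[OF c] by simp
  qed
  ultimately show ?thesis unfolding lmap_def gchain_map_iff using F(1) by blast
qed

lemma conn_lmaps:
  assumes Z: "swf Z t \<sigma> n c x e" and W: "swf W t' \<sigma>' n' c' x' e'"
    and M: "max_inessential Z M" and N: "max_inessential W N" and iso: "giso (quot Z M) (quot W N)"
  shows "\<exists>F G. lmap Z W F \<and> lmap W Z G"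
proof -
  interpret Z: swf Z t \<sigma> n c x e by fact
  interpret W: swf W t' \<sigma>' n' c' x' e' by fact
  obtain p where p: "lmap Z Z p" "M = ker Z Z p" using Z.max_inessential_ker_ex[OF M] .
  obtain q where q: "lmap W W q" "N = ker W W q" using W.max_inessential_ker_ex[OF N] .
  have sub: "gsubcx Z M" "gsubcx W N" and fx: "M \<inter> gfix Z = {gzero Z}" "N \<inter> gfix W = {gzero W}"
    using M N unfolding max_inessential_def inessential_def by simp_all
  obtain \<Phi> where \<Phi>: "gchain_map (quot Z M) (quot W N) \<Phi>"
    "bij_betw \<Phi> (gcar (quot Z M)) (gcar (quot W N))"
    using iso unfolding giso_def by blast
  obtain \<Psi> where \<Psi>: "gchain_map (quot W N) (quot Z M) \<Psi>" "inj_on \<Psi> (gcar (quot W N))"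
    using conn_giso_sym[OF W q Z.gcx sub(1) \<Phi>] by blast
  have inj: "inj_on \<Phi> (gcar (quot Z M))" using \<Phi>(2) by (simp add: bij_betw_def)
  obtain F where F: "hchain Z W 0 F" "ker Z W F = M"
    using conn_map[OF W q Z.gcx sub(1) \<Phi>(1)[unfolded gchain_map_iff] inj] by blast
  obtain G where G: "hchain W Z 0 G" "ker W Z G = N"
    using conn_map[OF Z p W.gcx sub(2) \<Psi>(1)[unfolded gchain_map_iff] \<Psi>(2)] by blast
  note F' = F(1) fx(1)[folded F(2)] and G' = G(1) fx(2)[folded G(2)]
  show ?thesis
    using conn_lmap[OF Z W F' conn_deg[OF Z W F' G']] conn_lmap[OF W Z G' conn_deg[OF W Z G' F']] by blast
qed

lemma lmap_gembed:
  assumes "lmap Z W f"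
  shows "lmap (gembed Z :: ('b list \<Rightarrow> 'v) gcx) (gembed W) (\<lambda>u. emb W (f (u [])))"
  using assms unfolding lmap_def gchain_map_def additive_on_def
  by (auto simp: gembed_sel inj_on_def)

text \<open>Mutual local maps are already equivalences on fixed-point sets, so the unsuspended case
  witnesses chain local equivalence.\<close>

lemma fix_he_susp_zero:
  assumes Z: "swf Z t \<sigma> n c x e" and W: "swf W t' \<sigma>' n' c' x' e'" and F: "lmap Z W F" and G: "lmap W Z G"
  shows "\<exists>f. gchain_map (susp_MN 0 0 Z) (susp_MN 0 0 W) f \<and> fix_he (susp_MN 0 0 Z) (susp_MN 0 0 W) f"
proof -
  interpret Z: swf Z t \<sigma> n c x e by fact
  interpret W: swf W t' \<sigma>' n' c' x' e' by fact
  let ?Z = "gembed Z :: (sbasis list \<Rightarrow> _) gcx" let ?W = "gembed W :: (sbasis list \<Rightarrow> _) gcx"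
  have h: "hcx ?Z" "hcx ?W" using hcx4_gembed Z.hcx4_axioms W.hcx4_axioms hcx4.axioms(1) by blast+
  have ok: "fixok ?Z" "fixok ?W"
    using fixok_Rn[OF Z.hcx4_axioms Z.fixok, of 0] fixok_Rn[OF W.hcx4_axioms W.fixok, of 0] by simp_all
  have fin: "finite (gfix ?Z)" "finite (gfix ?W)"
    using Z.finite_fix W.finite_fix by (simp_all add: gembed_sel)
  note l = lmap_gembed[OF F] lmap_gembed[OF G]
  have e: "susp_MN 0 0 Z = ?Z" "susp_MN 0 0 W = ?W" by (simp_all add: susp_MN_def)
  show ?thesis
    unfolding e using lmapD(1)[OF l(1)] fix_he_lmap[OF h(1) ok(1) fin(1) h(2) ok(2) fin(2) l] by blast
qed

theorem theorem2p29:
  fixes Z :: "'v gcx" and W :: "'w gcx"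
  assumes "is_swf Z" and "is_swf W" and "suspensionlike Z" and "suspensionlike W"
  shows "chain_loc_equiv Z W \<longleftrightarrow>
           (\<exists>M N. max_inessential Z M \<and> max_inessential W N \<and> giso (quot Z M) (quot W N))"
proof -
  obtain t \<sigma> n c x e where Z: "swf Z t \<sigma> n c x e" using is_swf_swf[OF assms(1,3)] by blast
  obtain t' \<sigma>' n' c' x' e' where W: "swf W t' \<sigma>' n' c' x' e'" using is_swf_swf[OF assms(2,4)] by blast
  show ?thesis
  proof
    assume "chain_loc_equiv Z W"
    then obtain M N F G where FG:
      "gchain_map (susp_MN M N Z) (susp_MN M N W) F" "fix_he (susp_MN M N Z) (susp_MN M N W) F"
      "gchain_map (susp_MN M N W) (susp_MN M N Z) G" "fix_he (susp_MN M N W) (susp_MN M N Z) G"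
      unfolding chain_loc_equiv_def by blast
    obtain f where f: "lmap Z W f" using desuspend[OF Z W FG] by blast
    obtain g where g: "lmap W Z g" using desuspend[OF W Z FG(3,4,1,2)] by blast
    obtain M' N' where "max_inessential Z M'" "max_inessential W N'"
      using swf.max_inessential_ex[OF Z] swf.max_inessential_ex[OF W] by blast
    with conn_giso[OF Z W _ _ f g]
    show "\<exists>M N. max_inessential Z M \<and> max_inessential W N \<and> giso (quot Z M) (quot W N)" by blast
  next
    assume "\<exists>M N. max_inessential Z M \<and> max_inessential W N \<and> giso (quot Z M) (quot W N)"
    then obtain F G where FG: "lmap Z W F" "lmap W Z G" using conn_lmaps[OF Z W] by blast
    show "chain_loc_equiv Z W"
      unfolding chain_loc_equiv_def
      using fix_he_susp_zero[OF Z W FG] fix_he_susp_zero[OF W Z FG(2,1)] by blast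
  qed
qed

end
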